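(* The fully discrete exponential fitting scheme and the nonlinear scheme (both defined in the context, the latter for any $\varepsilon\ge0$) preserve the thermal equilibrium, in the sense that their discrete equilibrium quasi-Fermi potentials are constant. More precisely: - the discrete equilibrium density $\underline{\mathfrak u}_{\mathcal D}^{\omega,\infty}$ of the fully discrete exponential fitting scheme is such that $\log(\underline{\mathfrak u}_{\mathcal D}^{\omega,\infty})+\underline\phi_{\mathcal D}$ is proportional to $\underline1_{\mathcal D}$ (the logarithm being taken component by component); - the discrete equilibrium logarithm potential $\underline\ell_{\mathcal D}^\infty$ of the nonlinear scheme is such that $\underline\ell_{\mathcal D}^\infty+\underline\phi_{\mathcal D}$ is proportional to $\underline1_{\mathcal D}$.
   Context: **Data.** $\Omega\subset\mathbb R^d$, $d\in\{2,3\}$, is an open, bounded, connected polytopal set with Lipschitz boundary. $\Lambda\in L^\infty(\Omega)^{d\times d}$ is uniformly elliptic: there is $\lambda_\flat>0$ with $\Lambda(x)\xi\cdot\xi\ge\lambda_\flat|\xi|^2$ for a.e. $x\in\Omega$ and all $\xi\in\mathbb R^d$. $\phi\in W^{1,\infty}(\Omega)$. $u^0\in L^1(\Omega)$ is non-negative with $\int_\Omega u^0\log(u^0)<\infty$ and $M=\int_\Omega u^0>0$. $\Delta t>0$ is the time step, $k\ge 0$ is an integer. **Mesh.** A discretisation is a couple $\mathcal D=(\mathcal M,\mathcal E)$. $\mathcal M$ is a finite collection of disjoint, open, Lipschitz polytopes $K\subset\Omega$ (cells) of positive measure with $\overline\Omega=\bigcup_{K\in\mathcal M}\overline K$. $\mathcal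 E$ is a finite collection of disjoint, connected, relatively open subsets $\sigma$ of $\overline\Omega$ (faces), with positive $(d-1)$-dimensional measure, each a Lipschitz polytopal subset of an affine hyperplane, with $\partial\mathcal M:=\bigcup_{K\in\mathcal M}\partial K=\bigcup_{\sigma\in\mathcal E}\overline\sigma$; for each $K$ there is $\mathcal E_K\subset\mathcal E$ with $\partial K=\bigcup_{\sigma\in\mathcal E_K}\overline\sigma$. $n_{K,\sigma}$ is the unit normal to $\sigma\in\mathcal E_K$ pointing out of $K$; $h_X$ is the diameter of $X$. It is assumed that $\Lambda_{|K}\in W^{1,\infty}(K)^{d\times d}$ for all $K\in\mathcal M$. **Discrete space and operators.** $\mathbb P^q(X)$ denotes polynomial functions on $X$ of total degree at most $q$, and $\Pi_X^q$ the $L^2(X)$-orthogonal projector onto it. $\underline V_{\mathcal D}^k$ is the space of $\underline v_{\mathcal D}=((v_K)_{K\in\mathcal M},(v_\sigma)_{\sigma\in\mathcal E})$ with $v_K\in\mathbb P^{k+1}(K)$ and $v_\sigma\in\mathbb P^k(\sigma)$; the restriction of $\underline v_{\mathcal D}$ to $K$ is $\underline v_K=(v_K,(v_\sigma)_{\sigma\in\mathcal E_K})$; $v_{\mathcal M}:\Omega\to\mathbb R$ is the function with $(v_{\mathcal M})_{|K}=v_K$; $\underline 1_{\mathcal D}$ is the element with all components equal to $1$. The discrete potential is $\underline\phi_{\mathcal D}\in\underline V_{\mathcal D}^k$ with $\phi_K=\Pi_K^{k+1}(\phi_{|K})$ and $\phi_\sigma=\Pi_\sigma^k(\phi_{|\sigma})$.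 The discrete gradient $G_K(\underline v_K)\in\mathbb P^k(K)^d$ is defined by $$\int_K G_K(\underline v_K)\cdot\tau=-\int_K v_K\,\nabla\cdot\tau+\sum_{\sigma\in\mathcal E_K}\int_\sigma v_\sigma\,\tau\cdot n_{K,\sigma}\qquad\forall\tau\in\mathbb P^k(K)^d,$$ and the jump by $J_{K,\sigma}(\underline v_K)=\Pi_\sigma^k(v_{K|\sigma})-v_\sigma$. **Fully discrete exponential fitting scheme.** Let $$\tilde a_{\mathcal D}(\underline\rho_{\mathcal D},\underline v_{\mathcal D})=\sum_{K\in\mathcal M}\Big(\int_K e^{-\phi_K}\Lambda G_K(\underline\rho_K)\cdot G_K(\underline v_K)+\sum_{\sigma\in\mathcal E_K}\frac{\|e^{-\phi_K}\Lambda_{|K}n_{K,\sigma}\cdot n_{K,\sigma}\|_{L^\infty(\sigma)}}{h_\sigma}\int_\sigma J_{K,\sigma}(\underline\rho_K)J_{K,\sigma}(\underline v_K)\Big).$$ The scheme seeks $(\underline\rho_{\mathcal D}^n)_{n\ge1}$ in $\underline V_{\mathcal D}^k$ with, for all $n\ge0$ and all $\underline v_{\mathcal D}\in\underline V_{\mathcal D}^k$, $\sum_{K}\int_K\frac{\mathfrak u_K^{\omega,n+1}-\mathfrak u_K^{\omega,n}}{\Delta t}v_K+\tilde a_{\mathcal D}(\underline\rho_{\mathcal D}^{n+1},\underline v_{\mathcal D})=0$, where $\mathfrak u_K^{\omega,n+1}=e^{-\phi_K}\rho_K^{n+1}$ and $\mathfrak u_K^{\omega,0}=u^0_{|K}$.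 To $\underline\rho_{\mathcal D}$ is associated the discrete density $\underline{\mathfrak u}_{\mathcal D}^\omega=((\mathfrak u^\omega_K)_K,(\mathfrak u^\omega_\sigma)_\sigma)$ with $\mathfrak u_K^\omega=e^{-\phi_K}\rho_K$, $\mathfrak u_\sigma^\omega=e^{-\phi_\sigma}\rho_\sigma$. Its discrete equilibrium is the unique steady solution $\underline\rho_{\mathcal D}^\infty\in\underline V_{\mathcal D}^k$ of mass $M$, i.e. $\tilde a_{\mathcal D}(\underline\rho_{\mathcal D}^\infty,\underline v_{\mathcal D})=0$ for all $\underline v_{\mathcal D}\in\underline V_{\mathcal D}^k$ and $\int_\Omega e^{-\phi_{\mathcal M}}\rho^\infty_{\mathcal M}=M$; the associated discrete density is the discrete equilibrium density $\underline{\mathfrak u}_{\mathcal D}^{\omega,\infty}$. **Nonlinear scheme.** Let $\Lambda_{K,\sigma}=\|\Lambda_{|K}n_{K,\sigma}\cdot n_{K,\sigma}\|_{L^\infty(\sigma)}$ and $a_K(\underline z_K,\underline v_K)=\int_K\Lambda G_K(\underline z_K)\cdot G_K(\underline v_K)+\sum_{\sigma\in\mathcal E_K}\frac{\Lambda_{K,\sigma}}{h_\sigma}\int_\sigma J_{K,\sigma}(\underline z_K)J_{K,\sigma}(\underline v_K)$. For $\varepsilon\ge0$, $\mathcal T_{\mathcal D}(\underline\ell_{\mathcal D};\underline w_{\mathcal D},\underline v_{\mathcal D})$ is the sum over $K\in\mathcal M$ of $$\int_K e^{\ell_K}\Lambda G_K(\underline w_K)\cdot G_K(\underline v_K)+\sum_{\sigma\in\mathcal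 E_K}\frac{\Lambda_{K,\sigma}}{h_\sigma}\int_\sigma\frac{e^{\Pi_\sigma^k(\ell_{K|\sigma})}+e^{\ell_\sigma}}{2}J_{K,\sigma}(\underline w_K)J_{K,\sigma}(\underline v_K)+\varepsilon\,h_K^{k+2}a_K(\underline w_K,\underline v_K).$$ The scheme seeks $(\underline\ell_{\mathcal D}^n)_{n\ge1}$ in $\underline V_{\mathcal D}^k$ with, for all $n\ge0$ and all $\underline v_{\mathcal D}\in\underline V_{\mathcal D}^k$, $\sum_K\int_K\frac{\mathfrak u_K^{n+1}-\mathfrak u_K^n}{\Delta t}v_K+\mathcal T_{\mathcal D}(\underline\ell_{\mathcal D}^{n+1};\underline\ell_{\mathcal D}^{n+1}+\underline\phi_{\mathcal D},\underline v_{\mathcal D})=0$, where $\mathfrak u_K^{n+1}=e^{\ell_K^{n+1}}$ and $\mathfrak u_K^0=u^0_{|K}$. Its discrete equilibrium logarithm potential is the unique steady solution $\underline\ell_{\mathcal D}^\infty\in\underline V_{\mathcal D}^k$ of mass $M$, i.e. $\mathcal T_{\mathcal D}(\underline\ell_{\mathcal D}^\infty;\underline\ell_{\mathcal D}^\infty+\underline\phi_{\mathcal D},\underline v_{\mathcal D})=0$ for all $\underline v_{\mathcal D}\in\underline V_{\mathcal D}^k$ and $\int_\Omega e^{\ell_{\mathcal M}^\infty}=M$. *)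

theory Defs
  imports "HOL-Analysis.Analysis" "HOL-Probability.Essential_Supremum"
begin

text \<open>
  A polytopal set of dimension \<open>n\<close> is the relative interior of a finite union of \<open>n\<close>-simplices
  lying in one \<open>n\<close>-dimensional affine subspace; it is relatively open in that subspace. Neither
  convexity nor connectedness is required.
\<close>

definition polytopal :: "int \<Rightarrow> 'a::euclidean_space set \<Rightarrow> bool" where
  "polytopal n X \<longleftrightarrow> (\<exists>T. finite T \<and> T \<noteq> {} \<and> (\<forall>S\<in>T. n simplex S) \<and>
     aff_dim (\<Union>T) = n \<and> X = rel_interior (\<Union>T))"

text \<open>
  Everything is relative to the affine hull of \<open>X\<close>, so that the same definition covers domains,
  cells and faces: near each boundary point, \<open>X\<close> is the strict epigraph, in some unit direction
  \<open>e\<close> of the affine hull, of a Lipschitz function of the component orthogonal to \<open>e\<close>.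
\<close>

definition lipschitz_boundary :: "'a::euclidean_space set \<Rightarrow> bool" where
  "lipschitz_boundary X \<longleftrightarrow> (\<forall>x\<in>rel_frontier X. \<exists>e g L U.
     norm e = 1 \<and> x + e \<in> affine hull X \<and>
     L-lipschitz_on {z. z \<bullet> e = 0} (g :: 'a \<Rightarrow> real) \<and> open U \<and> x \<in> U \<and>
     (\<forall>y \<in> U \<inter> affine hull X. y \<in> X \<longleftrightarrow> g (y - (y \<bullet> e) *\<^sub>R e) < y \<bullet> e))"

text \<open>
  The Lebesgue measure of dimension \<open>aff_dim S\<close> on the affine hull of \<open>S\<close>, transported by
  Cartesian coordinates in an orthonormal basis \<open>B\<close> of its direction space with origin \<open>a\<close>. The
  result does not depend on the choice of \<open>a\<close> and \<open>B\<close>.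
\<close>

definition orthonormal_frame :: "'a::euclidean_space set \<Rightarrow> 'a \<Rightarrow> 'a set \<Rightarrow> bool" where
  "orthonormal_frame S a B \<longleftrightarrow> a \<in> affine hull S \<and> pairwise orthogonal B \<and>
     (\<forall>b\<in>B. norm b = 1) \<and> span B = {x - y |x y. x \<in> affine hull S \<and> y \<in> affine hull S}"

definition surface_measure :: "'a::euclidean_space set \<Rightarrow> 'a measure" where
  "surface_measure S = (let (a, B) = (SOME (a, B). orthonormal_frame S a B) in
     distr (\<Pi>\<^sub>M b\<in>B. (lborel :: real measure)) borel (\<lambda>z. a + (\<Sum>b\<in>B. z b *\<^sub>R b)))"

definition outward_normal :: "'a::euclidean_space set \<Rightarrow> 'a set \<Rightarrow> 'a" where
  "outward_normal K \<sigma> = (THE n. norm n = 1 \<and> (\<forall>x\<in>\<sigma>. \<forall>y\<in>\<sigma>. n \<bullet> (x - y) = 0) \<and>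
     (\<forall>x\<in>\<sigma>. \<exists>\<delta>>0. \<forall>t. 0 < t \<and> t < \<delta> \<longrightarrow> x - t *\<^sub>R n \<in> K \<and> x + t *\<^sub>R n \<notin> closure K))"

definition partial :: "'n \<Rightarrow> (real^'n \<Rightarrow> real) \<Rightarrow> real^'n \<Rightarrow> real" where
  "partial i f x = frechet_derivative f (at x) (axis i 1)"

definition divergence :: "(real^'n \<Rightarrow> real^'n) \<Rightarrow> real^'n \<Rightarrow> real" where
  "divergence \<tau> x = (\<Sum>i\<in>UNIV. partial i (\<lambda>y. \<tau> y $ i) x)"

text \<open>Coinductively: partial derivatives of every order exist and are differentiable.\<close>

coinductive smooth :: "(real^'n \<Rightarrow> real) \<Rightarrow> bool" where
  "(\<And>x. f differentiable (at x)) \<Longrightarrow> (\<And>i. smooth (partial i f)) \<Longrightarrow> smooth f"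

definition test_function :: "(real^'n) set \<Rightarrow> (real^'n \<Rightarrow> real) \<Rightarrow> bool" where
  "test_function U \<psi> \<longleftrightarrow> smooth \<psi> \<and> compact (closure {x. \<psi> x \<noteq> 0}) \<and> closure {x. \<psi> x \<noteq> 0} \<subseteq> U"

definition linf_norm :: "'a measure \<Rightarrow> ('a \<Rightarrow> real) \<Rightarrow> real" where
  "linf_norm M f = real_of_ereal (esssup M (\<lambda>x. ereal \<bar>f x\<bar>))"

definition L_infty :: "(real^'n) set \<Rightarrow> (real^'n \<Rightarrow> real) \<Rightarrow> bool" where
  "L_infty U f \<longleftrightarrow> f \<in> borel_measurable (lebesgue_on U) \<and>
     esssup (lebesgue_on U) (\<lambda>x. ereal \<bar>f x\<bar>) < \<infinity>"

definition W1_infty :: "(real^'n) set \<Rightarrow> (real^'n \<Rightarrow> real) \<Rightarrow> bool" where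
  "W1_infty U f \<longleftrightarrow> L_infty U f \<and> (\<forall>i. \<exists>g. L_infty U g \<and> (\<forall>\<psi>. test_function U \<psi> \<longrightarrow>
     (LINT x:U|lebesgue. f x * partial i \<psi> x) = - (LINT x:U|lebesgue. g x * \<psi> x)))"

text \<open>
  Restricting a \<open>W\<^sup>1\<^sup>,\<^sup>\<infinity>\<close> function on a bounded Lipschitz set \<open>U\<close> to a part of the boundary refers
  to its continuous representative on \<open>closure U\<close>, whose values there are unique.
\<close>

definition boundary_trace ::
    "(real^'n) set \<Rightarrow> (real^'n \<Rightarrow> 'b::topological_space) \<Rightarrow> real^'n \<Rightarrow> 'b" where
  "boundary_trace U f =
     (SOME g. continuous_on (closure U) g \<and> (AE x in lebesgue_on U. g x = f x))"

definition polynomials :: "nat \<Rightarrow> (real^'n \<Rightarrow> real) set" where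
  "polynomials q = {p. \<exists>c :: ('n \<Rightarrow> nat) \<Rightarrow> real.
     p = (\<lambda>x. \<Sum>\<alpha> | (\<Sum>i\<in>UNIV. \<alpha> i) \<le> q. c \<alpha> * (\<Prod>i\<in>UNIV. (x $ i) ^ \<alpha> i))}"

text \<open>
  Polynomial functions on \<open>X\<close> are represented by total functions that vanish off \<open>closure X\<close>. This
  makes representatives unique (also for \<open>X\<close> inside a hyperplane), gives a linear space of functions,
  and makes the values of a cell polynomial on the faces of the cell directly available.
\<close>

definition poly_on :: "nat \<Rightarrow> (real^'n) set \<Rightarrow> (real^'n \<Rightarrow> real) set" where
  "poly_on q X = (\<lambda>p x. if x \<in> closure X then p x else 0) ` polynomials q"

definition vec_poly_on :: "nat \<Rightarrow> (real^'n) set \<Rightarrow> (real^'n \<Rightarrow> real^'n) set" where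
  "vec_poly_on q X = {\<tau>. \<forall>i. (\<lambda>x. \<tau> x $ i) \<in> poly_on q X}"

definition L2_proj ::
    "(real^'n) measure \<Rightarrow> nat \<Rightarrow> (real^'n) set \<Rightarrow> (real^'n \<Rightarrow> real) \<Rightarrow> real^'n \<Rightarrow> real" where
  "L2_proj \<mu> q X f = (THE p. p \<in> poly_on q X \<and>
     (\<forall>r\<in>poly_on q X. (LINT x:X|\<mu>. p x * r x) = (LINT x:X|\<mu>. f x * r x)))"

abbreviation cell_proj :: "nat \<Rightarrow> (real^'n) set \<Rightarrow> (real^'n \<Rightarrow> real) \<Rightarrow> real^'n \<Rightarrow> real" where
  "cell_proj q K \<equiv> L2_proj lebesgue q K"

abbreviation face_proj :: "nat \<Rightarrow> (real^'n) set \<Rightarrow> (real^'n \<Rightarrow> real) \<Rightarrow> real^'n \<Rightarrow> real" where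
  "face_proj q \<sigma> \<equiv> L2_proj (surface_measure \<sigma>) q \<sigma>"

record 'n mesh =
  cells :: "(real^'n) set set"
  faces :: "(real^'n) set set"
  cell_faces :: "(real^'n) set \<Rightarrow> (real^'n) set set"

definition polytopal_mesh :: "(real^'n) set \<Rightarrow> 'n::finite mesh \<Rightarrow> bool" where
  "polytopal_mesh \<Omega> D \<longleftrightarrow>
     finite (cells D) \<and> pairwise disjnt (cells D) \<and>
     (\<forall>K\<in>cells D. K \<subseteq> \<Omega> \<and> open K \<and> polytopal (int CARD('n)) K \<and> lipschitz_boundary K \<and>
        0 < emeasure lebesgue K) \<and>
     closure \<Omega> = (\<Union>K\<in>cells D. closure K) \<and>
     finite (faces D) \<and> pairwise disjnt (faces D) \<and>
     (\<forall>\<sigma>\<in>faces D. \<sigma> \<subseteq> closure \<Omega> \<and> connected \<sigma> \<and> openin (top_of_set (affine hull \<sigma>)) \<sigma> \<and>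
        polytopal (int CARD('n) - 1) \<sigma> \<and> lipschitz_boundary \<sigma> \<and>
        0 < emeasure (surface_measure \<sigma>) \<sigma>) \<and>
     (\<Union>K\<in>cells D. frontier K) = (\<Union>\<sigma>\<in>faces D. closure \<sigma>) \<and>
     (\<forall>K\<in>cells D. cell_faces D K \<subseteq> faces D \<and> frontier K = (\<Union>\<sigma>\<in>cell_faces D K. closure \<sigma>))"

record 'n hybrid =
  cell :: "(real^'n) set \<Rightarrow> real^'n \<Rightarrow> real"
  face :: "(real^'n) set \<Rightarrow> real^'n \<Rightarrow> real"

text \<open>
  Components at indices that are not cells (faces) of the mesh are fixed to zero, so that two
  elements are equal as records exactly when they agree on the mesh.
\<close>

definition hybrid_space :: "nat \<Rightarrow> 'n::finite mesh \<Rightarrow> 'n hybrid set" where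
  "hybrid_space k D = {v.
     (\<forall>K. if K \<in> cells D then cell v K \<in> poly_on (k + 1) K else cell v K = (\<lambda>_. 0)) \<and>
     (\<forall>\<sigma>. if \<sigma> \<in> faces D then face v \<sigma> \<in> poly_on k \<sigma> else face v \<sigma> = (\<lambda>_. 0))}"

definition hybrid_add :: "'n::finite hybrid \<Rightarrow> 'n hybrid \<Rightarrow> 'n hybrid" where
  "hybrid_add v w = \<lparr>cell = (\<lambda>K x. cell v K x + cell w K x),
                     face = (\<lambda>\<sigma> x. face v \<sigma> x + face w \<sigma> x)\<rparr>"

definition hybrid_ln :: "'n::finite hybrid \<Rightarrow> 'n hybrid" where
  "hybrid_ln u = \<lparr>cell = (\<lambda>K x. ln (cell u K x)), face = (\<lambda>\<sigma> x. ln (face u \<sigma> x))\<rparr>"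

text \<open>
  \<open>ln\<close> is total on the reals; a componentwise logarithm is only meaningful together with this
  positivity condition.
\<close>

definition hybrid_positive :: "'n::finite mesh \<Rightarrow> 'n hybrid \<Rightarrow> bool" where
  "hybrid_positive D u \<longleftrightarrow> (\<forall>K\<in>cells D. \<forall>x\<in>K. 0 < cell u K x) \<and> (\<forall>\<sigma>\<in>faces D. \<forall>x\<in>\<sigma>. 0 < face u \<sigma> x)"

definition proportional_to_one :: "'n::finite mesh \<Rightarrow> 'n hybrid \<Rightarrow> bool" where
  "proportional_to_one D w \<longleftrightarrow> (\<exists>c :: real.
     (\<forall>K\<in>cells D. \<forall>x\<in>K. cell w K x = c * 1) \<and> (\<forall>\<sigma>\<in>faces D. \<forall>x\<in>\<sigma>. face w \<sigma> x = c * 1))"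

definition cell_function :: "'n::finite mesh \<Rightarrow> 'n hybrid \<Rightarrow> real^'n \<Rightarrow> real" where
  "cell_function D v x = (\<Sum>K\<in>cells D. indicator K x * cell v K x)"

definition discrete_potential ::
    "nat \<Rightarrow> (real^'n) set \<Rightarrow> 'n::finite mesh \<Rightarrow> (real^'n \<Rightarrow> real) \<Rightarrow> 'n hybrid" where
  "discrete_potential k \<Omega> D \<phi> =
     \<lparr>cell = (\<lambda>K. if K \<in> cells D then cell_proj (k + 1) K \<phi> else (\<lambda>_. 0)),
      face = (\<lambda>\<sigma>. if \<sigma> \<in> faces D then face_proj k \<sigma> (boundary_trace \<Omega> \<phi>) else (\<lambda>_. 0))\<rparr>"

definition discrete_grad ::
    "nat \<Rightarrow> 'n::finite mesh \<Rightarrow> (real^'n) set \<Rightarrow> 'n hybrid \<Rightarrow> real^'n \<Rightarrow> real^'n" where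
  "discrete_grad k D K v = (THE G. G \<in> vec_poly_on k K \<and> (\<forall>\<tau>\<in>vec_poly_on k K.
     (LINT x:K|lebesgue. G x \<bullet> \<tau> x) =
       - (LINT x:K|lebesgue. cell v K x * divergence \<tau> x)
       + (\<Sum>\<sigma>\<in>cell_faces D K.
            LINT x:\<sigma>|surface_measure \<sigma>. face v \<sigma> x * (\<tau> x \<bullet> outward_normal K \<sigma>))))"

definition jump ::
    "nat \<Rightarrow> (real^'n) set \<Rightarrow> (real^'n) set \<Rightarrow> 'n::finite hybrid \<Rightarrow> real^'n \<Rightarrow> real" where
  "jump k K \<sigma> v x = face_proj k \<sigma> (cell v K) x - face v \<sigma> x"

definition normal_diffusion ::
    "(real^'n \<Rightarrow> real^'n^'n) \<Rightarrow> (real^'n) set \<Rightarrow> (real^'n) set \<Rightarrow> real^'n \<Rightarrow> real" where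
  "normal_diffusion \<Lambda> K \<sigma> x =
     (boundary_trace K \<Lambda> x *v outward_normal K \<sigma>) \<bullet> outward_normal K \<sigma>"

abbreviation face_linf_norm :: "(real^'n) set \<Rightarrow> (real^'n \<Rightarrow> real) \<Rightarrow> real" where
  "face_linf_norm \<sigma> f \<equiv> linf_norm (restrict_space (surface_measure \<sigma>) \<sigma>) f"

definition ef_form ::
    "nat \<Rightarrow> 'n::finite mesh \<Rightarrow> (real^'n \<Rightarrow> real^'n^'n) \<Rightarrow> 'n hybrid \<Rightarrow> 'n hybrid \<Rightarrow> 'n hybrid \<Rightarrow> real"
  where
  "ef_form k D \<Lambda> \<Phi> \<rho> v = (\<Sum>K\<in>cells D.
     (LINT x:K|lebesgue.
        exp (- cell \<Phi> K x) * ((\<Lambda> x *v discrete_grad k D K \<rho> x) \<bullet> discrete_grad k D K v x)) +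
     (\<Sum>\<sigma>\<in>cell_faces D K.
        face_linf_norm \<sigma> (\<lambda>x. exp (- cell \<Phi> K x) * normal_diffusion \<Lambda> K \<sigma> x) / diameter \<sigma> *
        (LINT x:\<sigma>|surface_measure \<sigma>. jump k K \<sigma> \<rho> x * jump k K \<sigma> v x)))"

definition ef_equilibrium ::
    "nat \<Rightarrow> (real^'n) set \<Rightarrow> 'n::finite mesh \<Rightarrow> (real^'n \<Rightarrow> real^'n^'n) \<Rightarrow> 'n hybrid \<Rightarrow> real \<Rightarrow>
     'n hybrid \<Rightarrow> bool" where
  "ef_equilibrium k \<Omega> D \<Lambda> \<Phi> m \<rho> \<longleftrightarrow> \<rho> \<in> hybrid_space k D \<and>
     (\<forall>v\<in>hybrid_space k D. ef_form k D \<Lambda> \<Phi> \<rho> v = 0) \<and>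
     (LINT x:\<Omega>|lebesgue. exp (- cell_function D \<Phi> x) * cell_function D \<rho> x) = m"

definition ef_density :: "'n::finite hybrid \<Rightarrow> 'n hybrid \<Rightarrow> 'n hybrid" where
  "ef_density \<Phi> \<rho> = \<lparr>cell = (\<lambda>K x. exp (- cell \<Phi> K x) * cell \<rho> K x),
                     face = (\<lambda>\<sigma> x. exp (- face \<Phi> \<sigma> x) * face \<rho> \<sigma> x)\<rparr>"

definition local_form ::
    "nat \<Rightarrow> 'n::finite mesh \<Rightarrow> (real^'n \<Rightarrow> real^'n^'n) \<Rightarrow> (real^'n) set \<Rightarrow> 'n hybrid \<Rightarrow> 'n hybrid \<Rightarrow> real"
  where
  "local_form k D \<Lambda> K z v =
     (LINT x:K|lebesgue. (\<Lambda> x *v discrete_grad k D K z x) \<bullet> discrete_grad k D K v x) +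
     (\<Sum>\<sigma>\<in>cell_faces D K. face_linf_norm \<sigma> (normal_diffusion \<Lambda> K \<sigma>) / diameter \<sigma> *
        (LINT x:\<sigma>|surface_measure \<sigma>. jump k K \<sigma> z x * jump k K \<sigma> v x))"

definition nl_form ::
    "nat \<Rightarrow> 'n::finite mesh \<Rightarrow> (real^'n \<Rightarrow> real^'n^'n) \<Rightarrow> real \<Rightarrow> 'n hybrid \<Rightarrow> 'n hybrid \<Rightarrow> 'n hybrid \<Rightarrow> real"
  where
  "nl_form k D \<Lambda> \<epsilon> l w v = (\<Sum>K\<in>cells D.
     (LINT x:K|lebesgue.
        exp (cell l K x) * ((\<Lambda> x *v discrete_grad k D K w x) \<bullet> discrete_grad k D K v x)) +
     (\<Sum>\<sigma>\<in>cell_faces D K. face_linf_norm \<sigma> (normal_diffusion \<Lambda> K \<sigma>) / diameter \<sigma> *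
        (LINT x:\<sigma>|surface_measure \<sigma>.
           (exp (face_proj k \<sigma> (cell l K) x) + exp (face l \<sigma> x)) / 2 *
           (jump k K \<sigma> w x * jump k K \<sigma> v x))) +
     \<epsilon> * diameter K ^ (k + 2) * local_form k D \<Lambda> K w v)"

definition nl_equilibrium ::
    "nat \<Rightarrow> (real^'n) set \<Rightarrow> 'n::finite mesh \<Rightarrow> (real^'n \<Rightarrow> real^'n^'n) \<Rightarrow> 'n hybrid \<Rightarrow> real \<Rightarrow> real \<Rightarrow>
     'n hybrid \<Rightarrow> bool" where
  "nl_equilibrium k \<Omega> D \<Lambda> \<Phi> \<epsilon> m l \<longleftrightarrow> l \<in> hybrid_space k D \<and>
     (\<forall>v\<in>hybrid_space k D. nl_form k D \<Lambda> \<epsilon> l (hybrid_add l \<Phi>) v = 0) \<and>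
     (LINT x:\<Omega>|lebesgue. exp (cell_function D l x)) = m"

end

theory Submission
  imports Defs
begin

text \<open>
  Tested with its own argument, each form is a sum of non-negative volume and face terms, so these
  all vanish at a steady state. Ellipticity, which the traces of \<open>\<Lambda>\<close> on the faces inherit, then
  makes every discrete gradient and every jump zero. Testing the definition of the gradient with
  \<open>\<nabla>v\<^sub>K\<close> and integrating by parts shows that the unknowns of a cell and of its faces equal one constant.
  The constants of all cells agree: the relative boundaries of the faces lie in finitely many affine
  subspaces of codimension 2, which do not disconnect \<open>\<Omega>\<close>, and away from these
  subspaces two cells only meet across a common face. Conversely constants have zero energy, and the mass determines the constant.

  Traces are meaningful because a \<open>W\<^sup>1\<^sup>,\<^sup>\<infinity>\<close> function on a bounded Lipschitz set has a continuous
  representative up to the boundary.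
\<close>

subsection \<open>Surface measures\<close>

text \<open>The unknowns pair degree \<open>k + 1\<close> in cells with degree \<open>k\<close> on
  faces, and this pairing is what closes the argument: the gradient of a cell unknown is an
  admissible test field, and its normal component on a face is a polynomial of degree at most
  \<open>k\<close>, against which a cell unknown and its projection cannot be told apart. Gradients,
  projections and normals are given by definite descriptions, so each needs existence and uniqueness
  before it can be used.

  The obstacle is the integration by parts. Cells need be neither convex nor connected, and
  \<open>surface_measure\<close> is the image of a product measure under an arbitrarily chosen
  frame. The divergence theorem is therefore proved by slicing along one direction transversal to
  all faces: almost every line avoids the ridges, on such a line only signed crossings have to be
  counted, and the surface measure is recovered as the image of volume under an oblique projection.
  All but a null set of directions are transversal, and linearity yields the others.\<close>

lemma nn_integral_lborel_translate:
  fixes f :: "'a::euclidean_space \<Rightarrow> ennreal"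
  assumes [measurable]: "f \<in> borel_measurable borel"
  shows "(\<integral>\<^sup>+x. f (a + x) \<partial>lborel) = (\<integral>\<^sup>+x. f x \<partial>lborel)"
proof -
  have "(\<integral>\<^sup>+x. f x \<partial>lborel) = (\<integral>\<^sup>+x. f x \<partial>distr lborel borel ((+) a))"
    by (simp add: lborel_distr_plus)
  then show ?thesis by (subst (asm) nn_integral_distr) auto
qed

lemma nn_integral_lborel_reflect:
  fixes f :: "'a::euclidean_space \<Rightarrow> ennreal"
  assumes [measurable]: "f \<in> borel_measurable borel"
  shows "(\<integral>\<^sup>+x. f (a - x) \<partial>lborel) = (\<integral>\<^sup>+x. f x \<partial>lborel)"
proof -
  have "(\<integral>\<^sup>+x. f x \<partial>lborel) = (\<integral>\<^sup>+x. f x \<partial>density (distr lborel borel (\<lambda>x. a + (-1) *\<^sub>R x)) (\<lambda>_. 1))"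
    using lborel_affine[of "-1" a] by simp
  also have "\<dots> = (\<integral>\<^sup>+x. f (a - x) \<partial>lborel)"
    by (simp add: nn_integral_density nn_integral_distr)
  finally show ?thesis by simp
qed

text \<open>
  Uniqueness of translation-invariant measures: both sides of
  \<open>\<mu> A * \<lambda> B = \<lambda> A * \<mu> B\<close>, with \<open>\<mu>\<close> the image measure and \<open>B\<close> a ball, are the
  same double integral.
\<close>

lemma distr_lborel_orthogonal:
  fixes f :: "'a::euclidean_space \<Rightarrow> 'a"
  assumes f: "orthogonal_transformation f"
  shows "distr lborel borel f = lborel"
proof (rule measure_eqI)
  let ?M = "distr lborel borel f"
  have lin: "linear f" and bij: "bij f"
    using f orthogonal_transformation_linear orthogonal_transformation_bij by blast+
  have meas[measurable]: "f \<in> borel_measurable borel"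
    using lin by (intro borel_measurable_continuous_onI linear_continuous_on) (simp add: linear_conv_bounded_linear)
  show "sets ?M = sets lborel" by simp
  fix A assume "A \<in> sets ?M"
  then have A[measurable]: "A \<in> sets borel" by simp
  define B where "B = ball (0::'a) 1"
  have B[measurable]: "B \<in> sets borel" by (simp add: B_def)
  have prem: "emeasure ?M S = (\<integral>\<^sup>+x. indicator S (f x) \<partial>lborel)" if [measurable]: "S \<in> sets borel" for S
  proof -
    have "emeasure ?M S = (\<integral>\<^sup>+x. indicator S x \<partial>?M)"
      by (rule nn_integral_indicator[symmetric]) simp
    also have "\<dots> = (\<integral>\<^sup>+x. indicator S (f x) \<partial>lborel)"
      by (rule nn_integral_distr) auto
    finally show ?thesis .
  qed
  have "emeasure ?M A * emeasure lborel B =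
      (\<integral>\<^sup>+x. (\<integral>\<^sup>+y. indicator A (f x) * indicator B (f x + y) \<partial>lborel) \<partial>lborel)"
    by (simp add: prem nn_integral_cmult nn_integral_lborel_translate nn_integral_multc)
  also have "\<dots> = (\<integral>\<^sup>+y. (\<integral>\<^sup>+x. indicator A (f x) * indicator B (f x + y) \<partial>lborel) \<partial>lborel)"
    by (rule lborel_pair.Fubini') measurable
  \<comment> \<open>Substituting \<open>z + x\<close> for \<open>x\<close>, with
    \<open>f z = y\<close>, moves the translation by \<open>y\<close> from the set \<open>B\<close>
    to the set \<open>A\<close>.\<close>
  also have "\<dots> = (\<integral>\<^sup>+y. (\<integral>\<^sup>+x. indicator A (f x - y) * indicator B (f x) \<partial>lborel) \<partial>lborel)"
  proof (rule nn_integral_cong)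
    fix y
    obtain z where z: "f z = y" using bij by (metis bij_pointE)
    have "(\<integral>\<^sup>+x. indicator A (f x - y) * indicator B (f x) \<partial>lborel)
      = (\<integral>\<^sup>+x. indicator A (f (z + x) - y) * indicator B (f (z + x)) \<partial>lborel)"
      by (rule nn_integral_lborel_translate[symmetric]) measurable
    also have "\<dots> = (\<integral>\<^sup>+x. indicator A (f x) * indicator B (f x + y) \<partial>lborel)"
      by (simp add: linear_add[OF lin] z add.commute)
    finally show "(\<integral>\<^sup>+x. indicator A (f x) * indicator B (f x + y) \<partial>lborel)
      = (\<integral>\<^sup>+x. indicator A (f x - y) * indicator B (f x) \<partial>lborel)" ..
  qed
  also have "\<dots> = (\<integral>\<^sup>+x. (\<integral>\<^sup>+y. indicator A (f x - y) * indicator B (f x) \<partial>lborel) \<partial>lborel)"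
    by (rule lborel_pair.Fubini') measurable
  also have "\<dots> = emeasure lborel A * emeasure ?M B"
    by (simp add: prem nn_integral_multc nn_integral_lborel_reflect nn_integral_cmult)
  \<comment> \<open>The preimage of the unit ball under an isometry fixing the origin is the ball
    itself; this makes the proportionality constant of the two measures equal to one.\<close>
  also have "emeasure ?M B = emeasure lborel B"
  proof -
    have "indicator B (f x) = (indicator B x :: ennreal)" for x
      by (simp add: B_def indicator_def f orthogonal_transformation_norm)
    then show ?thesis by (simp add: prem)
  qed
  finally have eq: "emeasure ?M A * emeasure lborel B = emeasure lborel A * emeasure lborel B" .
  moreover have "emeasure lborel B \<noteq> top"
    using emeasure_lborel_ball_finite[of "0::'a" 1] by (simp add: B_def)
  moreover have "emeasure lborel B \<noteq> 0"
  proof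
    assume "emeasure lborel B = 0"
    then have "measure lborel B = 0" by (simp add: measure_def)
    then show False using content_ball_pos[of 1 "0::'a"] by (simp add: B_def)
  qed
  ultimately have cancel: "c * emeasure lborel B / emeasure lborel B = c" for c
    by (intro ennreal_mult_divide_eq)
  show "emeasure ?M A = emeasure lborel A"
    using cancel[of "emeasure ?M A"] unfolding eq cancel by (rule sym)
qed

text \<open>\<open>lborel\<close> is a product measure in the coordinates of \<open>Basis\<close>.
  An orthogonal map carrying \<open>Basis\<close> onto \<open>B\<close> leaves it unchanged, so only
  the index set of the product has to be renamed.\<close>

lemma lborel_orthonormal_basis:
  fixes B :: "'a::euclidean_space set"
  assumes orth: "pairwise orthogonal B" and norm: "\<And>b. b \<in> B \<Longrightarrow> norm b = 1" and span: "span B = UNIV"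
  shows "lborel = distr (\<Pi>\<^sub>M b\<in>B. (lborel :: real measure)) borel (\<lambda>z. \<Sum>b\<in>B. z b *\<^sub>R b)"
proof -
  have "0 \<notin> B" using norm by force
  then have indep: "independent B" using pairwise_orthogonal_independent orth by blast
  then have finB[simp]: "finite B" by (rule independent_imp_finite)
  have "card B = DIM('a)"
    using dim_span_eq_card_independent[OF indep] by (simp add: span)
  then obtain \<pi> :: "'a \<Rightarrow> 'a" where \<pi>: "bij_betw \<pi> Basis B"
    using finite_same_card_bij[of "Basis :: 'a set" B] by auto
  obtain f :: "'a \<Rightarrow> 'a" where lin: "linear f" and f: "\<And>b. b \<in> Basis \<Longrightarrow> f b = \<pi> b"
    using linear_independent_extend[OF independent_Basis] by metis
  have sum: "f (\<Sum>b\<in>Basis. c b *\<^sub>R b) = (\<Sum>b\<in>Basis. c b *\<^sub>R \<pi> b)" for c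
    by (simp add: linear_sum[OF lin] linear_cmul[OF lin] f)
  have inner: "\<pi> b \<bullet> \<pi> b' = b \<bullet> b'" if "b \<in> Basis" "b' \<in> Basis" for b b'
  proof (cases "b = b'")
    case True
    have "\<pi> b \<in> B" using \<pi> that by (auto simp: bij_betw_def)
    then show ?thesis using True that norm by (simp add: norm_eq_1 inner_Basis)
  next
    case False
    then have "\<pi> b \<noteq> \<pi> b'" "\<pi> b \<in> B" "\<pi> b' \<in> B" using \<pi> that by (auto simp: bij_betw_def inj_on_def)
    then show ?thesis using orth False that by (auto simp: pairwise_def orthogonal_def inner_Basis)
  qed
  have "f x \<bullet> f y = x \<bullet> y" for x y
  proof -
    have "f x \<bullet> f y = f (\<Sum>b\<in>Basis. (x \<bullet> b) *\<^sub>R b) \<bullet> f (\<Sum>b\<in>Basis. (y \<bullet> b) *\<^sub>R b)"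
      by (simp add: euclidean_representation)
    also have "\<dots> = (\<Sum>b\<in>Basis. (x \<bullet> b) *\<^sub>R b) \<bullet> (\<Sum>b\<in>Basis. (y \<bullet> b) *\<^sub>R b)"
      unfolding sum by (simp add: inner_sum_left inner_sum_right inner cong: sum.cong)
    finally show ?thesis by (simp add: euclidean_representation)
  qed
  with lin have orthf: "orthogonal_transformation f" by (simp add: orthogonal_transformation_def)
  interpret product_sigma_finite "\<lambda>_::'a. lborel :: real measure" by standard
  \<comment> \<open>Reads a coordinate family indexed by \<open>B\<close> as one indexed by
    \<open>Basis\<close>; the restriction keeps it in the extensional function space underlying the
    product measure.\<close>
  define \<rho> :: "('a \<Rightarrow> real) \<Rightarrow> 'a \<Rightarrow> real" where "\<rho> = (\<lambda>\<omega>. \<lambda>b\<in>Basis. \<omega> (\<pi> b))"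
  have \<rho>[measurable]: "\<rho> \<in> measurable (\<Pi>\<^sub>M b\<in>B. lborel) (\<Pi>\<^sub>M b\<in>Basis. lborel)"
    unfolding \<rho>_def using \<pi>
    by (intro measurable_restrict measurable_component_singleton) (auto simp: bij_betw_def)
  have reindex: "(\<Pi>\<^sub>M b\<in>Basis. lborel) = distr (\<Pi>\<^sub>M b\<in>B. lborel) (\<Pi>\<^sub>M b\<in>Basis. lborel) \<rho>"
  proof (rule PiM_eqI[symmetric])
    fix A :: "'a \<Rightarrow> real set" assume A: "\<And>i. i \<in> Basis \<Longrightarrow> A i \<in> sets lborel"
    define \<pi>' where "\<pi>' = inv_into Basis \<pi>"
    have \<pi>': "\<pi>' b \<in> Basis" "\<pi> (\<pi>' b) = b" if "b \<in> B" for b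
      using that \<pi> by (auto simp: \<pi>'_def bij_betw_def inv_into_into f_inv_into_f)
    have \<pi>'': "\<pi>' (\<pi> b) = b" if "b \<in> Basis" for b
      using that \<pi> by (auto simp: \<pi>'_def bij_betw_def)
    have eq: "\<rho> -` Pi\<^sub>E Basis A \<inter> space (\<Pi>\<^sub>M b\<in>B. lborel) = Pi\<^sub>E B (\<lambda>b. A (\<pi>' b))"
    proof (intro set_eqI iffI)
      fix \<omega> assume "\<omega> \<in> \<rho> -` Pi\<^sub>E Basis A \<inter> space (\<Pi>\<^sub>M b\<in>B. lborel)"
      then have w: "\<And>b. b \<in> Basis \<Longrightarrow> \<omega> (\<pi> b) \<in> A b" "\<omega> \<in> extensional B"
        by (auto simp: \<rho>_def space_PiM PiE_def Pi_iff)
      show "\<omega> \<in> Pi\<^sub>E B (\<lambda>b. A (\<pi>' b))"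
        using w \<pi>' by (auto simp: PiE_def Pi_iff) metis
    next
      fix \<omega> assume "\<omega> \<in> Pi\<^sub>E B (\<lambda>b. A (\<pi>' b))"
      then show "\<omega> \<in> \<rho> -` Pi\<^sub>E Basis A \<inter> space (\<Pi>\<^sub>M b\<in>B. lborel)"
        using \<pi>'' \<pi> by (auto simp: \<rho>_def space_PiM PiE_def Pi_iff bij_betw_def)
    qed
    have "emeasure (distr (\<Pi>\<^sub>M b\<in>B. lborel) (\<Pi>\<^sub>M b\<in>Basis. lborel) \<rho>) (Pi\<^sub>E Basis A)
        = emeasure (\<Pi>\<^sub>M b\<in>B. lborel) (Pi\<^sub>E B (\<lambda>b. A (\<pi>' b)))"
      using A by (subst emeasure_distr) (auto simp: eq intro!: sets_PiM_I_finite)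
    also have "\<dots> = (\<Prod>b\<in>B. emeasure lborel (A (\<pi>' b)))"
      using A \<pi>' by (intro emeasure_PiM) auto
    also have "\<dots> = (\<Prod>b\<in>Basis. emeasure lborel (A b))"
      using \<pi>'' by (subst prod.reindex_bij_betw[OF \<pi>, symmetric]) simp
    finally show "emeasure (distr (\<Pi>\<^sub>M b\<in>B. lborel) (\<Pi>\<^sub>M b\<in>Basis. lborel) \<rho>) (Pi\<^sub>E Basis A)
        = (\<Prod>b\<in>Basis. emeasure lborel (A b))" .
  qed auto
  have contf: "f \<in> borel_measurable borel"
    using lin by (intro borel_measurable_continuous_onI linear_continuous_on) (simp add: linear_conv_bounded_linear)
  have meas: "(\<lambda>g. \<Sum>b\<in>Basis. g b *\<^sub>R b) \<in> borel_measurable (\<Pi>\<^sub>M b\<in>Basis. (lborel :: real measure))"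
    by (intro borel_measurable_sum borel_measurable_scaleR borel_measurable_const)
      (metis measurable_component_singleton measurable_lborel1 measurable_cong_sets sets_lborel)
  have "lborel = distr (distr (\<Pi>\<^sub>M b\<in>Basis. lborel) borel (\<lambda>g. \<Sum>b\<in>Basis. g b *\<^sub>R b)) borel f"
    by (simp only: lborel_eq[symmetric] distr_lborel_orthogonal[OF orthf])
  also have "\<dots> = distr (\<Pi>\<^sub>M b\<in>Basis. lborel) borel (\<lambda>g. \<Sum>b\<in>Basis. g b *\<^sub>R \<pi> b)"
    by (subst distr_distr[OF contf meas]) (simp add: comp_def sum)
  also have "\<dots> = distr (\<Pi>\<^sub>M b\<in>B. lborel) borel ((\<lambda>g. \<Sum>b\<in>Basis. g b *\<^sub>R \<pi> b) \<circ> \<rho>)"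
  proof (subst reindex, rule distr_distr)
    show "(\<lambda>g. \<Sum>b\<in>Basis. g b *\<^sub>R \<pi> b) \<in> borel_measurable (\<Pi>\<^sub>M b\<in>Basis. (lborel :: real measure))"
      using measurable_comp[OF meas contf] by (simp add: comp_def sum)
  qed simp
  also have "(\<lambda>g. \<Sum>b\<in>Basis. g b *\<^sub>R \<pi> b) \<circ> \<rho> = (\<lambda>z. \<Sum>b\<in>B. z b *\<^sub>R b)"
  proof
    fix z :: "'a \<Rightarrow> real"
    have "(\<Sum>b\<in>Basis. z (\<pi> b) *\<^sub>R \<pi> b) = (\<Sum>b\<in>B. z b *\<^sub>R b)"
      by (rule sum.reindex_bij_betw[OF \<pi>])
    then show "((\<lambda>g. \<Sum>b\<in>Basis. g b *\<^sub>R \<pi> b) \<circ> \<rho>) z = (\<Sum>b\<in>B. z b *\<^sub>R b)"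
      by (simp add: \<rho>_def)
  qed
  finally show ?thesis .
qed

lemma distr_PiM_lborel_translate:
  assumes [simp]: "finite B"
  shows "distr (\<Pi>\<^sub>M b\<in>B. (lborel :: real measure)) (\<Pi>\<^sub>M b\<in>B. lborel) (\<lambda>x. \<lambda>b\<in>B. c b + x b) = (\<Pi>\<^sub>M b\<in>B. lborel)"
proof -
  interpret product_sigma_finite "\<lambda>_. lborel :: real measure" by standard
  let ?t = "\<lambda>x. \<lambda>b\<in>B. c b + x b"
  have m: "?t \<in> measurable (\<Pi>\<^sub>M b\<in>B. (lborel :: real measure)) (\<Pi>\<^sub>M b\<in>B. lborel)"
    by measurable
  show ?thesis
  proof (rule PiM_eqI)
    fix A :: "'a \<Rightarrow> real set" assume A: "\<And>i. i \<in> B \<Longrightarrow> A i \<in> sets lborel"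
    have eq: "?t -` Pi\<^sub>E B A \<inter> space (\<Pi>\<^sub>M b\<in>B. lborel) = Pi\<^sub>E B (\<lambda>b. (+) (c b) -` A b)"
      by (auto simp: space_PiM PiE_def Pi_iff)
    have tr: "emeasure lborel ((+) (c b) -` A b) = emeasure lborel (A b)" if "b \<in> B" for b
    proof -
      have "emeasure lborel (A b) = emeasure (distr lborel borel ((+) (c b))) (A b)"
        by (simp add: lborel_distr_plus)
      then show ?thesis using A[OF that] by (simp add: emeasure_distr)
    qed
    have "emeasure (distr (\<Pi>\<^sub>M b\<in>B. lborel) (\<Pi>\<^sub>M b\<in>B. lborel) ?t) (Pi\<^sub>E B A)
        = emeasure (\<Pi>\<^sub>M b\<in>B. lborel) (Pi\<^sub>E B (\<lambda>b. (+) (c b) -` A b))"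
      using A m by (subst emeasure_distr) (auto simp: eq intro!: sets_PiM_I_finite)
    also have "\<dots> = (\<Prod>b\<in>B. emeasure lborel ((+) (c b) -` A b))"
      using A by (intro emeasure_PiM) (auto intro!: measurable_sets_borel[of "(+) _" borel])
    also have "\<dots> = (\<Prod>b\<in>B. emeasure lborel (A b))" by (simp add: tr)
    finally show "emeasure (distr (\<Pi>\<^sub>M b\<in>B. lborel) (\<Pi>\<^sub>M b\<in>B. lborel) ?t) (Pi\<^sub>E B A)
      = (\<Prod>b\<in>B. emeasure lborel (A b))" .
  qed auto
qed

section \<open>Orthonormal frames of affine hulls\<close>

lemma orthonormal_frame_exists:
  fixes S :: "'a::euclidean_space set"
  assumes "S \<noteq> {}"
  shows "\<exists>a B. orthonormal_frame S a B"
proof -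
  obtain a where a: "a \<in> affine hull S" using assms using affine_hull_eq_empty by blast
  define D where "D = {x - y |x y. x \<in> affine hull S \<and> y \<in> affine hull S}"
  have "D = (\<lambda>x. x - a) ` (affine hull S)"
  unfolding D_def
  proof (intro set_eqI iffI)
    fix d assume "d \<in> {x - y |x y. x \<in> affine hull S \<and> y \<in> affine hull S}"
    then obtain x y where d: "d = x - y" "x \<in> affine hull S" "y \<in> affine hull S" by auto
    have "a + 1 *\<^sub>R (x - y) \<in> affine hull S"
      by (rule mem_affine_3_minus) (use a d in auto)
    then show "d \<in> (\<lambda>x. x - a) ` (affine hull S)"
      by (intro image_eqI[where x = "a + (x - y)"]) (auto simp: d)
  qed (use a in auto)
  then have "subspace D" using affine_diffs_subspace_subtract[OF affine_affine_hull a] by simp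
  then obtain B where "B \<subseteq> D" "pairwise orthogonal B" "\<And>x. x \<in> B \<Longrightarrow> norm x = 1" "span B = D"
    using orthonormal_basis_subspace[of D] by (metis (no_types))
  then show ?thesis using a unfolding orthonormal_frame_def D_def by blast
qed

text \<open>The choice inside \<open>surface_measure\<close> is resolved here: a frame exists, so
  the chosen pair satisfies its specification, and later arguments hold for whichever frame was
  picked.\<close>

lemma surface_measure_frame:
  fixes S :: "'a::euclidean_space set"
  assumes "S \<noteq> {}"
  obtains a B where "orthonormal_frame S a B"
    "surface_measure S = distr (\<Pi>\<^sub>M b\<in>B. (lborel :: real measure)) borel (\<lambda>z. a + (\<Sum>b\<in>B. z b *\<^sub>R b))"
proof -
  define p where "p = (SOME (a, B). orthonormal_frame S a B)"
  have "\<exists>q. case q of (a, B) \<Rightarrow> orthonormal_frame S a B"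
    using orthonormal_frame_exists[OF assms] by simp
  then have "case p of (a, B) \<Rightarrow> orthonormal_frame S a B"
    unfolding p_def by (rule someI_ex)
  moreover obtain a B where "p = (a, B)" by (cases p)
  ultimately show thesis
    by (intro that[of a B]) (simp_all add: surface_measure_def p_def[symmetric])
qed

text \<open>Bridge from the surface measure of a hyperplane to volume: the directions of the
  hyperplane are exactly the vectors orthogonal to \<open>n\<close>, so \<open>n\<close> completes
  its frame to an orthonormal basis of the whole space.\<close>

lemma orthonormal_frame_hyperplane:
  fixes S :: "'a::euclidean_space set"
  assumes hyp: "affine hull S = {x. n \<bullet> x = c}" and n: "norm n = 1" and frame: "orthonormal_frame S a B"
  shows "n \<bullet> a = c" "finite B" "n \<notin> B" "\<And>b. b \<in> B \<Longrightarrow> n \<bullet> b = 0"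
    "pairwise orthogonal (insert n B)" "\<And>b. b \<in> insert n B \<Longrightarrow> norm b = 1" "span (insert n B) = UNIV"
proof -
  have norm: "\<And>b. b \<in> B \<Longrightarrow> norm b = 1" and orth: "pairwise orthogonal B"
    and "span B = {x - y |x y. x \<in> affine hull S \<and> y \<in> affine hull S}"
    and a: "a \<in> affine hull S"
    using frame by (auto simp: orthonormal_frame_def)
  moreover show na: "n \<bullet> a = c" using a hyp by simp
  ultimately have span: "span B = {x. n \<bullet> x = 0}"
    unfolding hyp
    by (auto simp: inner_diff_right) (metis (no_types, lifting) add_diff_cancel_left' inner_add_right add.right_neutral)
  have "0 \<notin> B" using norm by force
  then show "finite B" using orth pairwise_orthogonal_independent independent_imp_finite by blast
  show nb: "\<And>b. b \<in> B \<Longrightarrow> n \<bullet> b = 0" using span span_base by blast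
  have nn: "n \<bullet> n = 1" using n by (simp add: norm_eq_1)
  then show "n \<notin> B" using nb by force
  show "\<And>b. b \<in> insert n B \<Longrightarrow> norm b = 1" using n norm by auto
  show "pairwise orthogonal (insert n B)"
    using orth nb by (auto simp: pairwise_insert orthogonal_def inner_commute)
  show "span (insert n B) = UNIV"
  proof -
    have "x \<in> span (insert n B)" for x
    proof -
      have "x - (n \<bullet> x) *\<^sub>R n \<in> span B" by (simp add: span inner_diff_right nn)
      then show ?thesis by (auto simp: span_insert)
    qed
    then show ?thesis by auto
  qed
qed

lemma nn_integral_PiM_lborel_translate:
  assumes fin: "finite B" and f[measurable]: "f \<in> borel_measurable (\<Pi>\<^sub>M b\<in>B. (lborel :: real measure))"
  shows "(\<integral>\<^sup>+x. f (\<lambda>b\<in>B. c b + x b) \<partial>(\<Pi>\<^sub>M b\<in>B. lborel)) = (\<integral>\<^sup>+x. f x \<partial>(\<Pi>\<^sub>M b\<in>B. lborel))"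
proof -
  have "(\<integral>\<^sup>+x. f x \<partial>(\<Pi>\<^sub>M b\<in>B. lborel)) = (\<integral>\<^sup>+x. f x \<partial>distr (\<Pi>\<^sub>M b\<in>B. lborel) (\<Pi>\<^sub>M b\<in>B. lborel) (\<lambda>x. \<lambda>b\<in>B. c b + x b))"
    by (simp add: distr_PiM_lborel_translate[OF fin])
  also have "\<dots> = (\<integral>\<^sup>+x. f (\<lambda>b\<in>B. c b + x b) \<partial>(\<Pi>\<^sub>M b\<in>B. lborel))"
    by (rule nn_integral_distr) auto
  finally show ?thesis ..
qed

text \<open>Fubini in oblique coordinates, a point of the hyperplane and a parameter along
  \<open>v\<close>. Only the normal component of \<open>v\<close> changes volume, since its
  tangential part merely translates each parallel slice within itself; hence the Jacobian
  \<open>\<bar>n \<bullet> v\<bar>\<close>.\<close>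

lemma nn_integral_along_direction:
  fixes S :: "'a::euclidean_space set" and f :: "'a \<Rightarrow> ennreal"
  assumes hyp: "affine hull S = {x. n \<bullet> x = c}" and n: "norm n = 1" and ne: "S \<noteq> {}"
    and f[measurable]: "f \<in> borel_measurable borel" and v: "n \<bullet> v \<noteq> 0"
  shows "(\<integral>\<^sup>+y. f y \<partial>lborel) = ennreal \<bar>n \<bullet> v\<bar> * (\<integral>\<^sup>+x. (\<integral>\<^sup>+s. f (x + s *\<^sub>R v) \<partial>lborel) \<partial>surface_measure S)"
proof -
  obtain a B where frame: "orthonormal_frame S a B"
    and S: "surface_measure S = distr (\<Pi>\<^sub>M b\<in>B. (lborel :: real measure)) borel (\<lambda>z. a + (\<Sum>b\<in>B. z b *\<^sub>R b))"
    using surface_measure_frame[OF ne] .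
  note fr = orthonormal_frame_hyperplane[OF hyp n frame]
  note finB[simp] = fr(2)
  interpret product_sigma_finite "\<lambda>_::'a. lborel :: real measure" by standard
  interpret PB: sigma_finite_measure "\<Pi>\<^sub>M b\<in>B. (lborel :: real measure)"
    by (rule sigma_finite) simp
  interpret P: pair_sigma_finite "\<Pi>\<^sub>M b\<in>B. (lborel :: real measure)" "lborel :: real measure" ..
  let ?PB = "\<Pi>\<^sub>M b\<in>B. (lborel :: real measure)"
  define e where "e z = a + (\<Sum>b\<in>B. z b *\<^sub>R b)" for z :: "'a \<Rightarrow> real"
  have e[measurable]: "e \<in> borel_measurable ?PB" unfolding e_def by measurable
  have comp[measurable]: "(\<lambda>z. \<Sum>b\<in>insert n B. z b *\<^sub>R b) \<in> borel_measurable (\<Pi>\<^sub>M b\<in>insert n B. (lborel :: real measure))"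
    by measurable
  \<comment> \<open>The remainder \<open>w\<close> of the expansion of \<open>v\<close> is
    orthogonal to a spanning set, hence to itself.\<close>
  have dec: "v = (n \<bullet> v) *\<^sub>R n + (\<Sum>b\<in>B. (b \<bullet> v) *\<^sub>R b)"
  proof -
    define w where "w = v - (\<Sum>b\<in>insert n B. (b \<bullet> v) *\<^sub>R b)"
    have "orthogonal w d" if d: "d \<in> insert n B" for d
    proof -
      have "(\<Sum>b\<in>insert n B. (b \<bullet> v) * (b \<bullet> d)) = (\<Sum>b\<in>insert n B. if b = d then d \<bullet> v else 0)"
      proof (rule sum.cong)
        fix b assume b: "b \<in> insert n B"
        show "(b \<bullet> v) * (b \<bullet> d) = (if b = d then d \<bullet> v else 0)"
          using fr(5) fr(6)[OF d] b d by (auto simp: pairwise_def orthogonal_def norm_eq_1)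
      qed simp
      also have "\<dots> = d \<bullet> v" using d by simp
      finally show ?thesis
        by (simp add: orthogonal_def w_def inner_diff_left inner_sum_left inner_commute[of v d])
    qed
    then have "orthogonal w w" using orthogonal_to_span[of w "insert n B" w] fr(7) by simp
    then have "v = (\<Sum>b\<in>insert n B. (b \<bullet> v) *\<^sub>R b)" by (simp add: w_def orthogonal_self)
    then show ?thesis using fr by simp
  qed
  have "(\<integral>\<^sup>+y. f y \<partial>lborel) = (\<integral>\<^sup>+y. f (a + y) \<partial>lborel)"
    by (rule nn_integral_lborel_translate[symmetric]) simp
  also have "\<dots> = (\<integral>\<^sup>+z. f (a + (\<Sum>b\<in>insert n B. z b *\<^sub>R b)) \<partial>(\<Pi>\<^sub>M b\<in>insert n B. lborel))"
    by (subst lborel_orthonormal_basis[OF fr(5-7)], assumption, subst nn_integral_distr) simp_all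
  also have "\<dots> = (\<integral>\<^sup>+t. (\<integral>\<^sup>+z. f (a + (\<Sum>b\<in>insert n B. (z(n := t)) b *\<^sub>R b)) \<partial>?PB) \<partial>lborel)"
    using fr by (intro product_nn_integral_insert_rev) auto
  also have "\<dots> = (\<integral>\<^sup>+t. (\<integral>\<^sup>+z. f (e z + t *\<^sub>R n) \<partial>?PB) \<partial>lborel)"
  proof (intro nn_integral_cong)
    fix t :: real and z :: "'a \<Rightarrow> real"
    have "(\<Sum>b\<in>B. (z(n := t)) b *\<^sub>R b) = (\<Sum>b\<in>B. z b *\<^sub>R b)"
      using fr(3) by (intro sum.cong) auto
    then show "f (a + (\<Sum>b\<in>insert n B. (z(n := t)) b *\<^sub>R b)) = f (e z + t *\<^sub>R n)"
      using fr(3) by (simp add: e_def algebra_simps)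
  qed
  \<comment> \<open>The height over the hyperplane is rescaled to
    \<open>t = (n \<bullet> v) * s\<close>; this is the source of the Jacobian.\<close>
  also have "\<dots> = ennreal \<bar>n \<bullet> v\<bar> * (\<integral>\<^sup>+s. (\<integral>\<^sup>+z. f (e z + (0 + (n \<bullet> v) * s) *\<^sub>R n) \<partial>?PB) \<partial>lborel)"
    by (rule nn_integral_real_affine[OF _ v]) measurable
  \<comment> \<open>For fixed \<open>s\<close> the tangential part of \<open>s *\<^sub>R v\<close>
    is absorbed by translating the coordinates in the hyperplane, which turns a displacement along
    \<open>n\<close> into one along \<open>v\<close>.\<close>
  also have "(\<integral>\<^sup>+s. (\<integral>\<^sup>+z. f (e z + (0 + (n \<bullet> v) * s) *\<^sub>R n) \<partial>?PB) \<partial>lborel)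
      = (\<integral>\<^sup>+s. (\<integral>\<^sup>+z. f (e z + s *\<^sub>R v) \<partial>?PB) \<partial>lborel)"
  proof (rule nn_integral_cong)
    fix s :: real
    have "(\<integral>\<^sup>+z. f (e z + (0 + (n \<bullet> v) * s) *\<^sub>R n) \<partial>?PB)
      = (\<integral>\<^sup>+z. f (e (\<lambda>b\<in>B. s * (b \<bullet> v) + z b) + (0 + (n \<bullet> v) * s) *\<^sub>R n) \<partial>?PB)"
      by (rule nn_integral_PiM_lborel_translate[symmetric]) (simp, measurable)
    also have "\<dots> = (\<integral>\<^sup>+z. f (e z + s *\<^sub>R v) \<partial>?PB)"
    proof (rule nn_integral_cong)
      fix z
      have "e (\<lambda>b\<in>B. s * (b \<bullet> v) + z b) + (0 + (n \<bullet> v) * s) *\<^sub>R n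
        = e z + s *\<^sub>R ((n \<bullet> v) *\<^sub>R n + (\<Sum>b\<in>B. (b \<bullet> v) *\<^sub>R b))"
        by (simp add: e_def algebra_simps sum.distrib scaleR_sum_right)
      then show "f (e (\<lambda>b\<in>B. s * (b \<bullet> v) + z b) + (0 + (n \<bullet> v) * s) *\<^sub>R n) = f (e z + s *\<^sub>R v)"
        using dec by simp
    qed
    finally show "(\<integral>\<^sup>+z. f (e z + (0 + (n \<bullet> v) * s) *\<^sub>R n) \<partial>?PB) = (\<integral>\<^sup>+z. f (e z + s *\<^sub>R v) \<partial>?PB)" .
  qed
  also have "\<dots> = (\<integral>\<^sup>+z. (\<integral>\<^sup>+s. f (e z + s *\<^sub>R v) \<partial>lborel) \<partial>?PB)"
    by (rule P.Fubini') measurable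
  also have "\<dots> = (\<integral>\<^sup>+x. (\<integral>\<^sup>+s. f (x + s *\<^sub>R v) \<partial>lborel) \<partial>surface_measure S)"
    unfolding S e_def[symmetric] by (rule nn_integral_distr[symmetric]) measurable
  finally show ?thesis .
qed

section \<open>Surface measures as projections of volume\<close>

lemma sets_surface_measure[simp, measurable_cong]: "sets (surface_measure S) = sets borel"
  by (simp add: surface_measure_def split: prod.splits)

lemma space_surface_measure[simp]: "space (surface_measure S) = UNIV"
  by (simp add: surface_measure_def split: prod.splits)

lemma AE_surface_measure_affine_hull:
  fixes S :: "'a::euclidean_space set"
  assumes "S \<noteq> {}"
  shows "AE x in surface_measure S. x \<in> affine hull S"
proof -
  obtain a B where frame: "orthonormal_frame S a B"
    and S: "surface_measure S = distr (\<Pi>\<^sub>M b\<in>B. (lborel :: real measure)) borel (\<lambda>z. a + (\<Sum>b\<in>B. z b *\<^sub>R b))"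
    using surface_measure_frame[OF assms] .
  have "a + (\<Sum>b\<in>B. z b *\<^sub>R b) \<in> affine hull S" for z
  proof -
    have "(\<Sum>b\<in>B. z b *\<^sub>R b) \<in> span B" by (intro span_sum span_scale span_base)
    then obtain x y where xy: "(\<Sum>b\<in>B. z b *\<^sub>R b) = x - y" "x \<in> affine hull S" "y \<in> affine hull S"
      using frame by (auto simp: orthonormal_frame_def)
    have "a + 1 *\<^sub>R (x - y) \<in> affine hull S"
      by (rule mem_affine_3_minus) (use frame xy in \<open>auto simp: orthonormal_frame_def\<close>)
    then show ?thesis using xy by simp
  qed
  moreover have "affine hull S \<in> sets borel" by (simp add: closed_affine_hull borel_closed)
  moreover have "(\<lambda>z. a + (\<Sum>b\<in>B. z b *\<^sub>R b)) \<in> borel_measurable (\<Pi>\<^sub>M b\<in>B. (lborel :: real measure))"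
    by measurable
  ultimately show ?thesis unfolding S
    by (subst AE_distr_iff) auto
qed

text \<open>A line in direction \<open>v\<close> meets this slab in a segment of parameter length
  exactly one, if \<open>v \<noteq> 0\<close>. Integrating the indicator along \<open>v\<close>
  therefore inserts the factor one.\<close>

definition slab :: "'a::euclidean_space \<Rightarrow> 'a set" where
  "slab v = {y. 0 \<le> v \<bullet> y \<and> v \<bullet> y \<le> v \<bullet> v}"

text \<open>Oblique projection along \<open>v\<close> onto the hyperplane of the points
  \<open>x\<close> with \<open>n \<bullet> x = c\<close>, for \<open>v\<close> not parallel to
  it.\<close>

definition shear_proj :: "'a::euclidean_space \<Rightarrow> real \<Rightarrow> 'a \<Rightarrow> 'a \<Rightarrow> 'a" where
  "shear_proj n c v y = y - ((n \<bullet> y - c) / (n \<bullet> v)) *\<^sub>R v"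

lemma slab_borel[measurable]: "slab v \<in> sets borel"
  unfolding slab_def by measurable

lemma shear_proj_measurable[measurable]: "shear_proj n c v \<in> borel_measurable borel"
  unfolding shear_proj_def by measurable

lemma nn_integral_slab_line:
  assumes "v \<noteq> 0"
  shows "(\<integral>\<^sup>+s. indicator (slab v) (x + s *\<^sub>R v) \<partial>lborel) = 1"
proof -
  have vv: "v \<bullet> v > 0" using assms by simp
  have "indicator (slab v) (x + s *\<^sub>R v) = (indicator {- (v \<bullet> x) / (v \<bullet> v) .. 1 - (v \<bullet> x) / (v \<bullet> v)} s :: ennreal)" for s
    using vv by (auto simp: slab_def indicator_def inner_add_right field_simps)
  then show ?thesis by (simp add: diff_divide_distrib[symmetric] emeasure_lborel_Icc_eq)
qed

text \<open>In oblique coordinates the slab contributes length one over every point of the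
  hyperplane, so projecting its volume leaves the surface measure times the Jacobian. From here on
  surface integrals are handled as volume integrals, and the frame does not reappear.\<close>

lemma surface_measure_shear_proj:
  fixes S :: "'a::euclidean_space set"
  assumes hyp: "affine hull S = {x. n \<bullet> x = c}" and n: "norm n = 1" and ne: "S \<noteq> {}" and v: "n \<bullet> v \<noteq> 0"
  shows "distr (density lborel (indicator (slab v))) borel (shear_proj n c v)
    = density (surface_measure S) (\<lambda>_. ennreal \<bar>n \<bullet> v\<bar>)"
proof (rule measure_eqI)
  fix A assume "A \<in> sets (distr (density lborel (indicator (slab v))) borel (shear_proj n c v))"
  then have A[measurable]: "A \<in> sets borel" by simp
  have v0: "v \<noteq> 0" using v by auto
  have "emeasure (distr (density lborel (indicator (slab v))) borel (shear_proj n c v)) A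
    = (\<integral>\<^sup>+y. indicator (slab v) y * indicator A (shear_proj n c v y) \<partial>lborel)"
    by (simp add: nn_integral_indicator[symmetric] nn_integral_distr nn_integral_density del: nn_integral_indicator)
  also have "\<dots> = ennreal \<bar>n \<bullet> v\<bar> * (\<integral>\<^sup>+x. (\<integral>\<^sup>+s. indicator (slab v) (x + s *\<^sub>R v) *
      indicator A (shear_proj n c v (x + s *\<^sub>R v)) \<partial>lborel) \<partial>surface_measure S)"
    by (rule nn_integral_along_direction[OF hyp n ne _ v]) measurable
  also have "(\<integral>\<^sup>+x. (\<integral>\<^sup>+s. indicator (slab v) (x + s *\<^sub>R v) *
      indicator A (shear_proj n c v (x + s *\<^sub>R v)) \<partial>lborel) \<partial>surface_measure S) = (\<integral>\<^sup>+x. indicator A x \<partial>surface_measure S)"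
  proof (rule nn_integral_cong_AE, use AE_surface_measure_affine_hull[OF ne] in eventually_elim)
    case (elim x)
    then have "shear_proj n c v (x + s *\<^sub>R v) = x" for s
      using v by (simp add: hyp shear_proj_def inner_add_right)
    then show ?case by (simp add: nn_integral_multc nn_integral_slab_line[OF v0])
  qed
  finally show "emeasure (distr (density lborel (indicator (slab v))) borel (shear_proj n c v)) A
      = emeasure (density (surface_measure S) (\<lambda>_. ennreal \<bar>n \<bullet> v\<bar>)) A"
    by (simp add: emeasure_density nn_integral_cmult)
qed simp

lemma
  fixes S :: "'a::euclidean_space set" and g :: "'a \<Rightarrow> real"
  assumes hyp: "affine hull S = {x. n \<bullet> x = c}" and n: "norm n = 1" and ne: "S \<noteq> {}" and v: "n \<bullet> v \<noteq> 0"
    and g[measurable]: "g \<in> borel_measurable borel"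
  shows integral_surface_measure: "\<bar>n \<bullet> v\<bar> * (LINT x|surface_measure S. g x)
      = (LINT y|lborel. indicator (slab v) y * g (shear_proj n c v y))"
    and integrable_surface_measure: "integrable (surface_measure S) g \<longleftrightarrow>
      integrable lborel (\<lambda>y. indicator (slab v) y * g (shear_proj n c v y))"
proof -
  note eq = surface_measure_shear_proj[OF hyp n ne v]
  have ind: "(indicator (slab v) :: 'a \<Rightarrow> ennreal) = (\<lambda>x. ennreal (indicator (slab v) x))"
    by (auto simp: fun_eq_iff indicator_def)
  have "\<bar>n \<bullet> v\<bar> * (LINT x|surface_measure S. g x) = (LINT x|density (surface_measure S) (\<lambda>_. ennreal \<bar>n \<bullet> v\<bar>). g x)"
    by (subst integral_density) auto
  also have "\<dots> = (LINT y|density lborel (indicator (slab v)). g (shear_proj n c v y))"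
    unfolding eq[symmetric] by (rule integral_distr) auto
  also have "\<dots> = (LINT y|lborel. indicator (slab v) y * g (shear_proj n c v y))"
    unfolding ind by (subst integral_density) auto
  finally show "\<bar>n \<bullet> v\<bar> * (LINT x|surface_measure S. g x)
      = (LINT y|lborel. indicator (slab v) y * g (shear_proj n c v y))" .
  have "integrable (surface_measure S) g \<longleftrightarrow> integrable (density (surface_measure S) (\<lambda>_. ennreal \<bar>n \<bullet> v\<bar>)) g"
    using v by (subst integrable_density) auto
  also have "\<dots> \<longleftrightarrow> integrable (density lborel (indicator (slab v))) (\<lambda>y. g (shear_proj n c v y))"
    unfolding eq[symmetric] by (rule integrable_distr_eq) auto
  also have "\<dots> \<longleftrightarrow> integrable lborel (\<lambda>y. indicator (slab v) y * g (shear_proj n c v y))"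
    unfolding ind by (subst integrable_density) auto
  finally show "integrable (surface_measure S) g \<longleftrightarrow>
      integrable lborel (\<lambda>y. indicator (slab v) y * g (shear_proj n c v y))" .
qed

subsection \<open>Outward normals\<close>

text \<open>A Lipschitz graph leaves \<open>K\<close> on one side only, which excludes slits. Near a
  point of a flat piece the graph coincides with the hyperplane, so \<open>K\<close> fills exactly
  one of two half-balls.\<close>

lemma lipschitz_boundary_flat_side:
  fixes K :: "'a::euclidean_space set"
  assumes K: "open K" "lipschitz_boundary K" and \<sigma>: "\<sigma> \<subseteq> frontier K"
    and op: "openin (top_of_set {x. n \<bullet> x = c}) \<sigma>" and x: "x \<in> \<sigma>" and n: "norm n = 1"
  obtains r s where "r > 0" "s = 1 \<or> s = -1" "\<And>y. y \<in> ball x r \<Longrightarrow> y \<in> K \<longleftrightarrow> s * (n \<bullet> y - c) < 0"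
proof -
  have xfr: "x \<in> frontier K" using \<sigma> x by auto
  then have "K \<noteq> {}" by auto
  then have int: "interior K \<noteq> {}" and hull: "affine hull K = UNIV"
    using K by (auto simp: interior_open affine_hull_open)
  obtain e g L U where e: "norm e = 1"
    and g: "L-lipschitz_on {z. z \<bullet> e = 0} (g :: 'a \<Rightarrow> real)" and U: "open U" "x \<in> U"
    and graph: "\<And>y. y \<in> U \<Longrightarrow> y \<in> K \<longleftrightarrow> g (y - (y \<bullet> e) *\<^sub>R e) < y \<bullet> e"
    using K(2)[unfolded lipschitz_boundary_def] xfr
    unfolding rel_frontier_nonempty_interior[OF int] hull by (metis Int_UNIV_right)
  have ee: "e \<bullet> e = 1" using e by (simp add: norm_eq_1)
  \<comment> \<open>Height of the graph above \<open>y\<close>: within \<open>U\<close> it is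
    negative exactly on \<open>K\<close>, and it falls at unit rate in direction
    \<open>e\<close>.\<close>
  define h where "h y = g (y - (y \<bullet> e) *\<^sub>R e) - y \<bullet> e" for y
  have conth: "continuous_on UNIV h"
    unfolding h_def
    by (intro continuous_intros continuous_on_compose2[OF lipschitz_on_continuous_on[OF g]])
      (auto simp: inner_diff_left ee)
  have fr0: "h y = 0" if "y \<in> frontier K" "y \<in> U" for y
  proof (rule antisym)
    have "y \<notin> K" using that K by (auto simp: frontier_def interior_open)
    then show "0 \<le> h y" using graph that by (auto simp: h_def)
    show "h y \<le> 0"
    proof (rule ccontr)
      assume "\<not> h y \<le> 0"
      have "open (U \<inter> {z. h z > 0})"
        using U open_Collect_less[OF continuous_on_const conth] by auto
      moreover have "y \<in> U \<inter> {z. h z > 0}" using that \<open>\<not> h y \<le> 0\<close> by auto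
      moreover have "y \<in> closure K" using that by (auto simp: frontier_def)
      ultimately obtain z where "z \<in> K" "z \<in> U" "h z > 0"
        by (metis (no_types, lifting) IntD1 IntD2 disjoint_iff mem_Collect_eq open_Int_closure_eq_empty)
      then show False using graph by (auto simp: h_def)
    qed
  qed
  obtain V where V: "open V" "\<sigma> = {x. n \<bullet> x = c} \<inter> V"
    using op by (auto simp: openin_open)
  obtain r0 where r0: "r0 > 0" "ball x r0 \<subseteq> U \<inter> V"
    using U V x open_contains_ball_eq[of "U \<inter> V" x] by (metis IntD2 IntI open_Int)
  have flat: "h y = 0" if "n \<bullet> y = c" "y \<in> ball x r0" for y
    using that r0 V \<sigma> by (intro fr0) auto
  have nx: "n \<bullet> x = c" using x V by auto
  \<comment> \<open>If \<open>e\<close> were tangent to the face, a small step along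
    \<open>e\<close> would stay on the face, where \<open>h\<close> vanishes, although
    \<open>h\<close> falls at unit rate.\<close>
  have ne: "n \<bullet> e \<noteq> 0"
  proof
    assume 0: "n \<bullet> e = 0"
    let ?y = "x + (r0/2) *\<^sub>R e"
    have "?y - (?y \<bullet> e) *\<^sub>R e = x - (x \<bullet> e) *\<^sub>R e"
      by (simp add: inner_add_left ee algebra_simps)
    then have "g (?y - (?y \<bullet> e) *\<^sub>R e) = g (x - (x \<bullet> e) *\<^sub>R e)" by (rule arg_cong)
    moreover have "?y \<bullet> e = x \<bullet> e + r0/2" by (simp add: inner_add_left ee)
    ultimately have "h ?y = h x - r0/2" unfolding h_def by linarith
    moreover have "h ?y = 0" by (rule flat) (use 0 nx r0 e in \<open>auto simp: inner_add_right dist_norm\<close>)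
    moreover have "h x = 0" by (rule flat) (use nx r0 in auto)
    ultimately show False using r0 by simp
  qed
  define a where "a = \<bar>n \<bullet> e\<bar>"
  have a: "0 < a" "a \<le> 1" using ne Cauchy_Schwarz_ineq2[of n e] n e by (auto simp: a_def)
  \<comment> \<open>A point at distance less than \<open>r\<close> from \<open>x\<close> reaches the
    hyperplane by a shift along \<open>e\<close> shorter than \<open>r / a = r0 / 2\<close>, hence
    without leaving \<open>ball x r0\<close>.\<close>
  define r where "r = r0 * a / 2"
  have rr: "0 < r" "r \<le> r0 / 2" using a r0 mult_left_mono[of a 1 r0] by (auto simp: r_def)
  show thesis
  proof
    show "r > 0" by fact
    show "- sgn (n \<bullet> e) = 1 \<or> - sgn (n \<bullet> e) = -1" using ne by (auto simp: sgn_real_def)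
    fix y assume y: "y \<in> ball x r"
    define t where "t = (n \<bullet> y - c) / (n \<bullet> e)"
    define y' where "y' = y - t *\<^sub>R e"
    have "\<bar>n \<bullet> y - c\<bar> = \<bar>n \<bullet> (y - x)\<bar>" using nx by (simp add: inner_diff_right)
    also have "\<dots> \<le> norm (y - x)" using Cauchy_Schwarz_ineq2[of n "y - x"] n by simp
    also have "\<dots> < r" using y by (simp add: dist_norm norm_minus_commute)
    finally have "\<bar>t\<bar> < r / a" using a by (auto simp: t_def a_def divide_strict_right_mono)
    then have t: "\<bar>t\<bar> < r0 / 2" using a by (simp add: r_def)
    have "dist x y' \<le> dist x y + \<bar>t\<bar>"
      using norm_triangle_ineq[of "x - y" "t *\<^sub>R e"] by (simp add: y'_def dist_norm e algebra_simps)
    then have "y' \<in> ball x r0" using y t rr by simp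
    moreover have "n \<bullet> y' = c" using ne by (simp add: y'_def t_def inner_diff_right)
    ultimately have "h y' = 0" by (rule flat[rotated])
    have "y' - (y' \<bullet> e) *\<^sub>R e = y - (y \<bullet> e) *\<^sub>R e"
      by (simp add: y'_def inner_diff_left ee algebra_simps)
    then have "g (y' - (y' \<bullet> e) *\<^sub>R e) = g (y - (y \<bullet> e) *\<^sub>R e)" by (rule arg_cong)
    moreover have "y' \<bullet> e = y \<bullet> e - t" by (simp add: y'_def inner_diff_left ee)
    ultimately have "h y = - t" using \<open>h y' = 0\<close> unfolding h_def by linarith
    moreover have "y \<in> U" using y rr r0 by (auto simp: subset_iff)
    ultimately have "y \<in> K \<longleftrightarrow> t > 0" using graph by (auto simp: h_def)
    also have "\<dots> \<longleftrightarrow> - sgn (n \<bullet> e) * (n \<bullet> y - c) < 0"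
      using ne by (cases "n \<bullet> e > 0") (auto simp: t_def zero_less_divide_iff sgn_real_def mult_less_0_iff)
    finally show "y \<in> K \<longleftrightarrow> - sgn (n \<bullet> e) * (n \<bullet> y - c) < 0" .
  qed
qed

text \<open>The part \<open>w\<close> of \<open>m\<close> orthogonal to \<open>n\<close> is a
  direction of the first hyperplane, along which the inner product with \<open>m\<close> is
  constant; so \<open>w\<close> is orthogonal to \<open>m\<close> and therefore zero.\<close>

lemma unit_normal_unique:
  fixes n :: "'a::real_inner"
  assumes n: "norm n = 1" "norm m = 1" and sub: "{x. n \<bullet> x = c} \<subseteq> {x. m \<bullet> x = d}"
  shows "m = n \<or> m = - n"
proof -
  define w where "w = m - (m \<bullet> n) *\<^sub>R n"
  have nn: "n \<bullet> n = 1" using n by (simp add: norm_eq_1)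
  then have nw: "n \<bullet> w = 0" by (simp add: w_def inner_diff_right inner_commute)
  have "c *\<^sub>R n \<in> {x. n \<bullet> x = c}" "c *\<^sub>R n + w \<in> {x. n \<bullet> x = c}"
    using nn nw by (auto simp: inner_add_right)
  then have "m \<bullet> (c *\<^sub>R n) = d" "m \<bullet> (c *\<^sub>R n + w) = d" using sub by blast+
  then have "m \<bullet> w = 0" by (simp add: inner_add_right)
  then have "w \<bullet> w = 0" using nw by (simp add: w_def inner_diff_left inner_commute)
  then have m: "m = (m \<bullet> n) *\<^sub>R n" by (simp add: w_def)
  then have "\<bar>m \<bullet> n\<bar> = 1" using n by (metis mult.right_neutral norm_scaleR)
  then show ?thesis using m by (metis abs_eq_iff abs_one scaleR_minus_left scaleR_one)
qed

text \<open>The description defining \<open>outward_normal\<close> is met by a unit normal of the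
  hyperplane, and only one sign fits. A priori the sign could vary over the face; the sets of points
  with either sign are relatively open, disjoint and cover the face, so connectedness makes it
  constant.\<close>

lemma outward_normal:
  fixes K :: "'a::euclidean_space set"
  assumes K: "open K" "lipschitz_boundary K" and sub: "\<sigma> \<subseteq> frontier K"
    and \<sigma>: "connected \<sigma>" "\<sigma> \<noteq> {}" "openin (top_of_set (affine hull \<sigma>)) \<sigma>"
    and dim: "aff_dim \<sigma> = int DIM('a) - 1"
  shows "norm (outward_normal K \<sigma>) = 1"
    and "\<exists>c. affine hull \<sigma> = {x. outward_normal K \<sigma> \<bullet> x = c}"
    and "\<And>x. x \<in> \<sigma> \<Longrightarrow> \<exists>r>0. \<forall>y\<in>ball x r. y \<in> K \<longleftrightarrow> outward_normal K \<sigma> \<bullet> (y - x) < 0"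
proof -
  obtain a b where ab: "a \<noteq> 0" "affine hull \<sigma> = {x. a \<bullet> x = b}"
    using aff_dim_eq_hyperplane[of \<sigma>] dim by auto
  define n c where "n = a /\<^sub>R norm a" and "c = b / norm a"
  have n: "norm n = 1" using ab by (simp add: n_def)
  have hyp: "affine hull \<sigma> = {x. n \<bullet> x = c}"
    using ab by (auto simp: n_def c_def field_simps)
  have on: "n \<bullet> x = c" if "x \<in> \<sigma>" for x using that hull_inc[of x \<sigma> affine] hyp by auto
  define P where "P s = {x \<in> \<sigma>. \<exists>r>0. \<forall>y\<in>ball x r. y \<in> K \<longleftrightarrow> s * (n \<bullet> y - c) < 0}" for s
  have cover: "\<sigma> \<subseteq> P 1 \<union> P (-1)"
  proof
    fix x assume x: "x \<in> \<sigma>"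
    obtain r s where "r > 0" "s = 1 \<or> s = -1" "\<And>y. y \<in> ball x r \<Longrightarrow> y \<in> K \<longleftrightarrow> s * (n \<bullet> y - c) < 0"
      by (rule lipschitz_boundary_flat_side[OF K sub \<sigma>(3)[unfolded hyp] x n]) blast
    then show "x \<in> P 1 \<union> P (-1)" unfolding P_def using x by auto
  qed
  have opP: "openin (top_of_set \<sigma>) (P s)" for s
  proof (subst openin_euclidean_subtopology_iff, intro conjI ballI)
    show "P s \<subseteq> \<sigma>" by (auto simp: P_def)
    fix x assume "x \<in> P s"
    then obtain r where r: "r > 0" "\<And>y. y \<in> ball x r \<Longrightarrow> y \<in> K \<longleftrightarrow> s * (n \<bullet> y - c) < 0" "x \<in> \<sigma>"
      by (auto simp: P_def)
    have "x' \<in> P s" if "x' \<in> \<sigma>" "dist x' x < r/2" for x'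
    proof -
      have "ball x' (r/2) \<subseteq> ball x r" using that by (subst ball_subset_ball_iff) (auto simp: dist_commute)
      then show ?thesis using that r by (auto simp: P_def intro!: exI[of _ "r/2"])
    qed
    then show "\<exists>e>0. \<forall>x'\<in>\<sigma>. dist x' x < e \<longrightarrow> x' \<in> P s"
      using r by (intro exI[of _ "r/2"]) auto
  qed
  \<comment> \<open>The far half of the ball is open and free of \<open>K\<close>, so it misses the
    closure of \<open>K\<close> as well.\<close>
  have side: "x - t *\<^sub>R (s *\<^sub>R n) \<in> K \<and> x + t *\<^sub>R (s *\<^sub>R n) \<notin> closure K"
    if "x \<in> \<sigma>" and r: "r > 0" "\<And>y. y \<in> ball x r \<Longrightarrow> y \<in> K \<longleftrightarrow> s * (n \<bullet> y - c) < 0"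
      and s: "s = 1 \<or> s = -1" and t: "0 < t" "t < r" for x r s t
  proof
    have nn: "n \<bullet> n = 1" "s * s = 1" using n s by (auto simp: norm_eq_1)
    have inb: "x - t *\<^sub>R (s *\<^sub>R n) \<in> ball x r" "x + t *\<^sub>R (s *\<^sub>R n) \<in> ball x r"
      using t s n by (auto simp: dist_norm)
    show "x - t *\<^sub>R (s *\<^sub>R n) \<in> K"
      using r(2)[OF inb(1)] on[OF that(1)] s t nn by (auto simp: inner_diff_right)
    have "open (ball x r \<inter> {y. s * (n \<bullet> y - c) > 0})"
      by (intro open_Int open_ball open_Collect_less continuous_intros)
    moreover have "x + t *\<^sub>R (s *\<^sub>R n) \<in> ball x r \<inter> {y. s * (n \<bullet> y - c) > 0}"
      using inb on[OF that(1)] s t nn by (auto simp: inner_add_right)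
    moreover have "(ball x r \<inter> {y. s * (n \<bullet> y - c) > 0}) \<inter> K = {}" using r by force
    ultimately show "x + t *\<^sub>R (s *\<^sub>R n) \<notin> closure K"
      using open_Int_closure_eq_empty by blast
  qed
  have disj: "P 1 \<inter> P (-1) = {}"
  proof (rule ccontr)
    assume "P 1 \<inter> P (-1) \<noteq> {}"
    then obtain x r r' where x: "x \<in> \<sigma>" and r: "r > 0" "\<And>y. y \<in> ball x r \<Longrightarrow> y \<in> K \<longleftrightarrow> 1 * (n \<bullet> y - c) < 0"
      and r': "r' > 0" "\<And>y. y \<in> ball x r' \<Longrightarrow> y \<in> K \<longleftrightarrow> -1 * (n \<bullet> y - c) < 0"
      unfolding P_def by blast
    let ?t = "min r r' / 2"
    have t: "0 < ?t" "?t < r" "?t < r'" using r r' by auto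
    show False
      using side[OF x r _ t(1,2)] side[OF x r' _ t(1,3)] closure_subset[of K] by auto
  qed
  have "P 1 = \<sigma> \<or> P (-1) = \<sigma>"
  proof (rule ccontr)
    assume "\<not> ?thesis"
    then have "P 1 \<noteq> {}" "P (-1) \<noteq> {}" using cover by (auto simp: P_def)
    then show False using \<sigma>(1) opP[of 1] opP[of "-1"] cover disj unfolding connected_openin by blast
  qed
  then obtain s where s: "s = 1 \<or> s = -1" "P s = \<sigma>" by blast
  define m where "m = s *\<^sub>R n"
  have m1: "norm m = 1" using s n by (auto simp: m_def)
  let ?Q = "\<lambda>m. norm m = 1 \<and> (\<forall>x\<in>\<sigma>. \<forall>y\<in>\<sigma>. m \<bullet> (x - y) = 0) \<and>
     (\<forall>x\<in>\<sigma>. \<exists>\<delta>>0. \<forall>t. 0 < t \<and> t < \<delta> \<longrightarrow> x - t *\<^sub>R m \<in> K \<and> x + t *\<^sub>R m \<notin> closure K)"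
  have Qm: "?Q m"
  proof (intro conjI ballI m1)
    show "m \<bullet> (x - y) = 0" if "x \<in> \<sigma>" "y \<in> \<sigma>" for x y
      using on that by (simp add: m_def inner_diff_right)
    fix x assume x: "x \<in> \<sigma>"
    then obtain r where "r > 0" "\<And>y. y \<in> ball x r \<Longrightarrow> y \<in> K \<longleftrightarrow> s * (n \<bullet> y - c) < 0"
      using s(2) unfolding P_def by blast
    then show "\<exists>\<delta>>0. \<forall>t. 0 < t \<and> t < \<delta> \<longrightarrow> x - t *\<^sub>R m \<in> K \<and> x + t *\<^sub>R m \<notin> closure K"
      using side[OF x _ _ s(1)] unfolding m_def by blast
  qed
  have "outward_normal K \<sigma> = m"
    unfolding outward_normal_def
  proof (rule the_equality[of ?Q, OF Qm])
    fix m' assume Q: "?Q m'"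
    obtain x where x: "x \<in> \<sigma>" using \<sigma> by blast
    have "\<sigma> \<subseteq> {y. m' \<bullet> y = m' \<bullet> x}"
    proof
      fix y assume "y \<in> \<sigma>"
      then have "m' \<bullet> (y - x) = 0" using Q x by blast
      then show "y \<in> {y. m' \<bullet> y = m' \<bullet> x}" by (simp add: inner_diff_right)
    qed
    then have "affine hull \<sigma> \<subseteq> {y. m' \<bullet> y = m' \<bullet> x}" by (rule hull_minimal) (rule affine_hyperplane)
    then have "m' = n \<or> m' = - n" using Q unit_normal_unique[OF n] unfolding hyp by blast
    then have "m' = m \<or> m' = - m" using s by (auto simp: m_def)
    moreover have "m' \<noteq> - m"
    proof
      assume eq: "m' = - m"
      have "\<exists>\<delta>>0. \<forall>t. 0 < t \<and> t < \<delta> \<longrightarrow> x - t *\<^sub>R m \<in> K \<and> x + t *\<^sub>R m \<notin> closure K"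
        "\<exists>\<delta>>0. \<forall>t. 0 < t \<and> t < \<delta> \<longrightarrow> x - t *\<^sub>R m' \<in> K \<and> x + t *\<^sub>R m' \<notin> closure K"
        using Qm Q x by blast+
      then obtain d d' where d: "d > 0" "\<And>t. 0 < t \<Longrightarrow> t < d \<Longrightarrow> x + t *\<^sub>R m \<notin> closure K"
        and d': "d' > 0" "\<And>t. 0 < t \<Longrightarrow> t < d' \<Longrightarrow> x - t *\<^sub>R m' \<in> K" by blast
      have "x + (min d d' / 2) *\<^sub>R m \<notin> closure K" "x - (min d d' / 2) *\<^sub>R m' \<in> K"
        using d d' by auto
      then show False using closure_subset[of K] by (auto simp: eq)
    qed
    ultimately show "m' = m" by blast
  qed
  then have eq: "outward_normal K \<sigma> = s *\<^sub>R n" by (simp add: m_def)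
  show "norm (outward_normal K \<sigma>) = 1" using m1 eq m_def by simp
  show "\<exists>c. affine hull \<sigma> = {x. outward_normal K \<sigma> \<bullet> x = c}"
    unfolding eq hyp using s by (intro exI[of _ "s * c"]) auto
  fix x assume x: "x \<in> \<sigma>"
  then obtain r where "r > 0" "\<And>y. y \<in> ball x r \<Longrightarrow> y \<in> K \<longleftrightarrow> s * (n \<bullet> y - c) < 0"
    using s(2) unfolding P_def by blast
  then show "\<exists>r>0. \<forall>y\<in>ball x r. y \<in> K \<longleftrightarrow> outward_normal K \<sigma> \<bullet> (y - x) < 0"
    unfolding eq using on[OF x] by (intro exI[of _ r]) (auto simp: inner_diff_right right_diff_distrib)
qed

section \<open>Polytopal sets as finite unions of simplices\<close>

lemma polytopalE:
  assumes "polytopal n X" "n \<ge> 0"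
  obtains T where "finite T" "T \<noteq> {}" "\<And>S. S \<in> T \<Longrightarrow> n simplex S" "\<And>S. S \<in> T \<Longrightarrow> rel_interior S \<subseteq> X"
    "X \<subseteq> \<Union>T" "aff_dim (\<Union>T) = n"
proof -
  obtain T where T: "finite T" "T \<noteq> {}" "\<And>S. S \<in> T \<Longrightarrow> n simplex S" "aff_dim (\<Union>T) = n" "X = rel_interior (\<Union>T)"
    using assms by (auto simp: polytopal_def)
  \<comment> \<open>A simplex of full dimension has the same affine hull as the whole union, so
    relative interiors in the two sets refer to the same subspace.\<close>
  have "rel_interior S \<subseteq> X" if S: "S \<in> T" for S
  proof -
    have dim: "aff_dim S = n" using T(3)[OF S] by (simp add: aff_dim_simplex)
    then have "S \<noteq> {}" using assms(2) by auto
    then have "affine hull S = affine hull \<Union>T"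
      using dim T(4) S hull_mono[of S "\<Union>T" affine] by (intro affine_dim_equal) auto
    then show ?thesis using subset_rel_interior[of S "\<Union>T"] S T by auto
  qed
  then show thesis using T rel_interior_subset[of "\<Union>T"] by (intro that[of T]) auto
qed

lemma aff_dim_polytopal:
  assumes "polytopal n X" "n \<ge> 0"
  shows "aff_dim X = n"
proof -
  obtain T where T: "finite T" "T \<noteq> {}" "\<And>S. S \<in> T \<Longrightarrow> n simplex S" "\<And>S. S \<in> T \<Longrightarrow> rel_interior S \<subseteq> X"
    "X \<subseteq> \<Union>T" "aff_dim (\<Union>T) = n"
    using polytopalE[OF assms] by blast
  obtain S where S: "S \<in> T" using T by blast
  have "aff_dim (rel_interior S) = n"
    using T(3)[OF S] by (simp add: aff_dim_simplex rel_interior_aff_dim convex_simplex)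
  then show ?thesis using aff_dim_subset[OF T(4)[OF S]] aff_dim_subset[OF T(5)] T(6) by simp
qed

lemma bounded_polytopal:
  assumes "polytopal n X" "n \<ge> 0"
  shows "bounded X"
proof -
  obtain T where T: "finite T" "T \<noteq> {}" "\<And>S. S \<in> T \<Longrightarrow> n simplex S" "\<And>S. S \<in> T \<Longrightarrow> rel_interior S \<subseteq> X"
    "X \<subseteq> \<Union>T" "aff_dim (\<Union>T) = n"
    using polytopalE[OF assms] by blast
  have "bounded (\<Union>T)"
    using T(1,3) compact_simplex compact_imp_bounded by (intro bounded_Union) auto
  then show ?thesis using T(5) bounded_subset by blast
qed

text \<open>A point of the closure outside \<open>X\<close> still lies in one of the simplices but
  not in its relative interior, hence on a facet. For a face of a mesh, the affine hulls of these
  facets are the ridges.\<close>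

lemma closure_polytopal_diff:
  assumes "polytopal n X" "n \<ge> 0"
  obtains \<F> where "finite \<F>" "\<And>F. F \<in> \<F> \<Longrightarrow> affine F" "\<And>F. F \<in> \<F> \<Longrightarrow> aff_dim F = n - 1" "closure X - X \<subseteq> \<Union>\<F>"
proof -
  obtain T where T: "finite T" "T \<noteq> {}" "\<And>S. S \<in> T \<Longrightarrow> n simplex S" "\<And>S. S \<in> T \<Longrightarrow> rel_interior S \<subseteq> X"
    "X \<subseteq> \<Union>T" "aff_dim (\<Union>T) = n"
    using polytopalE[OF assms] by blast
  let ?F = "\<Union>S\<in>T. (hull) affine ` {F. F facet_of S}"
  show thesis
  proof
    show "finite ?F"
      using T(1,3) by (intro finite_UN_I finite_imageI finite_polytope_facets simplex_imp_polytope) auto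
    show "affine F" if "F \<in> ?F" for F using that by auto
    show "aff_dim F = n - 1" if "F \<in> ?F" for F
      using that T(3) by (auto simp: facet_of_def aff_dim_simplex)
    have "closed (\<Union>T)" using T(1,3) by (intro closed_Union) (auto intro: closed_simplex)
    then have clos: "closure X \<subseteq> \<Union>T" using T(5) by (simp add: closure_minimal)
    show "closure X - X \<subseteq> \<Union>?F"
    proof
      fix x assume x: "x \<in> closure X - X"
      then obtain S where S: "S \<in> T" "x \<in> S" using clos by auto
      then have "x \<in> rel_frontier S"
        using x T(4)[OF S(1)] closure_subset[of S] by (auto simp: rel_frontier_def)
      then obtain F where "F facet_of S" "x \<in> F"
        using rel_frontier_of_polyhedron[OF simplex_imp_polyhedron[OF T(3)[OF S(1)]]] by auto
      then show "x \<in> \<Union>?F" using S hull_inc[of x F affine] by auto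
    qed
  qed
qed

subsection \<open>The divergence theorem across flat faces\<close>

lemma integrable_bounded_support:
  fixes f :: "'a::euclidean_space \<Rightarrow> real"
  assumes f[measurable]: "f \<in> borel_measurable borel" and "bounded S" and supp: "\<And>x. x \<notin> S \<Longrightarrow> f x = 0"
    and bd: "\<And>x. x \<in> S \<Longrightarrow> \<bar>f x\<bar> \<le> M"
  shows "integrable lborel f"
proof -
  obtain R where "\<forall>x\<in>S. norm x \<le> R" using \<open>bounded S\<close> unfolding bounded_iff by auto
  then have R: "S \<subseteq> cball 0 R" by auto
  show ?thesis
  proof (rule Bochner_Integration.integrable_bound)
    show "integrable lborel (\<lambda>x. \<bar>M\<bar> * indicator (cball (0::'a) R) x)"
      using emeasure_bounded_finite[of "cball (0::'a) R"]
      by (intro integrable_mult_right integrable_real_indicator) auto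
    have "norm (f x) \<le> norm (\<bar>M\<bar> * indicator (cball (0::'a) R) x)" for x
      using R supp[of x] bd[of x] by (cases "x \<in> S") (auto simp: indicator_def)
    then show "AE x in lborel. norm (f x) \<le> norm (\<bar>M\<bar> * indicator (cball (0::'a) R) x)" by simp
  qed simp
qed

text \<open>\<open>\<epsilon> i\<close> is the outward sign at the end point \<open>z i\<close>.
  Passing a crossing changes the indicator and the sum by the same amount, so their difference is
  locally constant on the line; far to the right both vanish.\<close>

lemma indicator_eq_sum_crossings:
  fixes z :: "'i \<Rightarrow> real" and \<epsilon> :: "'i \<Rightarrow> real"
  assumes A: "open A" "bounded A" and I: "finite I" "inj_on z I"
    and fr: "frontier A \<subseteq> z ` I"
    and side: "\<And>i. i \<in> I \<Longrightarrow> (\<epsilon> i = 1 \<or> \<epsilon> i = -1) \<and> (\<exists>r>0. \<forall>t\<in>ball (z i) r. t \<in> A \<longleftrightarrow> \<epsilon> i * (t - z i) < 0)"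
    and t: "t \<notin> z ` I"
  shows "indicator A t = (\<Sum>i | i \<in> I \<and> t \<le> z i. \<epsilon> i)"
proof -
  \<comment> \<open>The sum still counts a crossing at \<open>t = z i\<close>, whereas the open set
    \<open>A\<close> omits its end points. Adding the right ends makes the difference
    \<open>d\<close> locally constant at the crossings too.\<close>
  define E where "E = A \<union> z ` {i \<in> I. \<epsilon> i = 1}"
  define d where "d t = indicator E t - (\<Sum>i | i \<in> I \<and> t \<le> z i. \<epsilon> i)" for t
  have loc: "\<forall>\<^sub>F s in nhds t. d t = d s" for t
  proof -
    obtain r0 where r0: "r0 > 0" "\<And>i. i \<in> I \<Longrightarrow> z i \<noteq> t \<Longrightarrow> r0 \<le> dist t (z i)"
      using finite_set_avoid[of "z ` I" t] I by auto
    show ?thesis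
    proof (cases "t \<in> z ` I")
      case False
      have "\<forall>\<^sub>F s in nhds t. s \<in> A \<longleftrightarrow> t \<in> A"
      proof (cases "t \<in> A")
        case True
        then show ?thesis using A eventually_nhds_in_open[of A t] by (auto elim: eventually_mono)
      next
        case False
        then have "t \<in> - closure A" using fr A \<open>t \<notin> z ` I\<close> by (auto simp: frontier_def interior_open)
        then have "\<forall>\<^sub>F s in nhds t. s \<in> - closure A" by (intro eventually_nhds_in_open) auto
        then show ?thesis using False closure_subset[of A] by (auto elim!: eventually_mono)
      qed
      moreover have "\<forall>\<^sub>F s in nhds t. dist s t < r0" using r0 eventually_nhds_metric by blast
      ultimately show ?thesis
      proof eventually_elim
        case (elim s)
        have *: "t \<noteq> z i \<and> s \<noteq> z i \<and> (t \<le> z i \<longleftrightarrow> s \<le> z i)" if "i \<in> I" for i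
        proof -
          have "z i \<noteq> t" using False that by auto
          then have "r0 \<le> \<bar>t - z i\<bar>" using r0(2)[OF that] by (simp add: dist_real_def)
          then show ?thesis using elim(2) by (auto simp: dist_real_def abs_if split: if_splits)
        qed
        then have "{i \<in> I. t \<le> z i} = {i \<in> I. s \<le> z i}" "t \<in> E \<longleftrightarrow> s \<in> E"
          using elim(1) by (auto simp: E_def)
        then show ?case by (simp add: d_def indicator_def)
      qed
    next
      case True
      then obtain i where i: "i \<in> I" "z i = t" by auto
      obtain r where r: "r > 0" "\<And>s. s \<in> ball t r \<Longrightarrow> s \<in> A \<longleftrightarrow> \<epsilon> i * (s - t) < 0" and ei: "\<epsilon> i = 1 \<or> \<epsilon> i = -1"
        using side[OF i(1)] i by auto
      have "\<forall>\<^sub>F s in nhds t. dist s t < min r r0" using r0 r eventually_nhds_metric[of _ t] by (metis min_less_iff_conj)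
      then show ?thesis
      proof eventually_elim
        case (elim s)
        have other: "z j \<noteq> t \<and> s \<noteq> z j \<and> (t \<le> z j \<longleftrightarrow> s \<le> z j)" if "j \<in> I" "j \<noteq> i" for j
        proof -
          have "z j \<noteq> t" using that i I(2) by (auto simp: inj_on_def)
          moreover from this have "r0 \<le> \<bar>t - z j\<bar>" using r0(2)[OF that(1)] by (simp add: dist_real_def)
          ultimately show ?thesis using elim by (auto simp: dist_real_def abs_if split: if_splits)
        qed
        have mem: "s \<in> A \<longleftrightarrow> \<epsilon> i * (s - t) < 0" using r(2)[of s] elim by (simp add: dist_commute)
        have memt: "t \<notin> A" using r(2)[of t] r(1) by simp
        have E: "t \<in> E \<longleftrightarrow> \<epsilon> i = 1" "s \<in> E \<longleftrightarrow> s \<in> A \<or> (s = t \<and> \<epsilon> i = 1)"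
        proof -
          have uniq: "j = i" if "j \<in> I" "z j = t \<or> z j = s" for j
            using other[OF that(1)] that(2) by metis
          have "t \<in> z ` {j \<in> I. \<epsilon> j = 1} \<longleftrightarrow> \<epsilon> i = 1"
          proof
            assume "t \<in> z ` {j \<in> I. \<epsilon> j = 1}"
            then obtain j where "j \<in> I" "\<epsilon> j = 1" "z j = t" by blast
            then show "\<epsilon> i = 1" using uniq[of j] by simp
          qed (use i in blast)
          then show "t \<in> E \<longleftrightarrow> \<epsilon> i = 1" using memt by (simp add: E_def)
          have "s \<in> z ` {j \<in> I. \<epsilon> j = 1} \<longleftrightarrow> s = t \<and> \<epsilon> i = 1"
          proof
            assume "s \<in> z ` {j \<in> I. \<epsilon> j = 1}"
            then obtain j where "j \<in> I" "\<epsilon> j = 1" "z j = s" by blast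
            then show "s = t \<and> \<epsilon> i = 1" using uniq[of j] i by simp
          qed (use i in blast)
          then show "s \<in> E \<longleftrightarrow> s \<in> A \<or> (s = t \<and> \<epsilon> i = 1)" by (simp add: E_def)
        qed
        let ?J = "{j \<in> I. j \<noteq> i \<and> t \<le> z j}"
        have S: "{j \<in> I. t \<le> z j} = insert i ?J" "{j \<in> I. s \<le> z j} = (if s \<le> t then insert i ?J else ?J)"
          using i other by auto
        have sum: "(\<Sum>j | j \<in> I \<and> t \<le> z j. \<epsilon> j) = \<epsilon> i + sum \<epsilon> ?J"
          "(\<Sum>j | j \<in> I \<and> s \<le> z j. \<epsilon> j) = (if s \<le> t then \<epsilon> i + sum \<epsilon> ?J else sum \<epsilon> ?J)"
          unfolding S using I by auto
        consider "s = t" | "s < t" | "s > t" by linarith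
        then show ?case
          using ei E mem unfolding d_def sum by cases (auto simp: indicator_def)
      qed
    qed
  qed
  have const: "d s = d t" for s t
    by (rule connected_local_const[OF connected_UNIV]) (auto intro: eventually_at_filter[THEN iffD2] eventually_mono[OF loc])
  have "bounded (A \<union> z ` I)" using A I by (auto intro: finite_imp_bounded)
  then obtain B where B: "\<And>s. s \<in> A \<union> z ` I \<Longrightarrow> \<bar>s\<bar> \<le> B" using bounded_iff[of "A \<union> z ` I"] by auto
  \<comment> \<open>A point to the right of \<open>A\<close> and of every crossing.\<close>
  define T where "T = max 0 B + 1"
  have "T \<notin> A" "\<And>i. i \<in> I \<Longrightarrow> \<not> T \<le> z i" using B by (auto simp: T_def) (smt (verit) UnCI imageI)+
  then have "d T = 0" by (auto simp: d_def E_def indicator_def intro!: sum.neutral)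
  then have "d t = 0" using const by metis
  moreover have "t \<in> E \<longleftrightarrow> t \<in> A" using t by (auto simp: E_def)
  ultimately show ?thesis by (simp add: d_def indicator_def)
qed

text \<open>Off the crossings the indicator of \<open>A\<close> is a signed sum of indicators of
  left half-lines, so the fundamental theorem of calculus applies to one half-line at a time. The
  values of \<open>q\<close> at the common left end cancel because the signs add up to zero.\<close>

lemma integral_crossings:
  fixes z :: "'i \<Rightarrow> real" and \<epsilon> :: "'i \<Rightarrow> real" and q :: "real \<Rightarrow> real"
  assumes A: "open A" "bounded A" and I: "finite I" "inj_on z I"
    and fr: "frontier A \<subseteq> z ` I"
    and side: "\<And>i. i \<in> I \<Longrightarrow> (\<epsilon> i = 1 \<or> \<epsilon> i = -1) \<and> (\<exists>r>0. \<forall>t\<in>ball (z i) r. t \<in> A \<longleftrightarrow> \<epsilon> i * (t - z i) < 0)"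
    and q: "\<And>t. (q has_real_derivative q' t) (at t)" "continuous_on UNIV q'"
  shows "(LINT t|lborel. indicator A t * q' t) = (\<Sum>i\<in>I. \<epsilon> i * q (z i))"
proof -
  have "bounded (A \<union> z ` I)" using A I by (auto intro: finite_imp_bounded)
  then obtain B where B: "\<And>s. s \<in> A \<union> z ` I \<Longrightarrow> \<bar>s\<bar> \<le> B" using bounded_iff[of "A \<union> z ` I"] by auto
  define T where "T = max 0 B + 1"
  have T: "A \<subseteq> {-T<..<T}" "\<And>i. i \<in> I \<Longrightarrow> z i \<in> {-T<..<T}" "T > 0"
    using B by (auto simp: T_def) (smt (verit) UnCI imageI)+
  have piece: "((\<lambda>t. (if t \<le> z i then \<epsilon> i * q' t else 0)) has_integral \<epsilon> i * (q (z i) - q (-T))) {-T..T}" if i: "i \<in> I" for i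
  proof -
    have "(q' has_integral (q (z i) - q (-T))) {-T..z i}"
      using T(2)[OF i] q(1)
      by (intro fundamental_theorem_of_calculus)
        (auto simp: has_real_derivative_iff_has_vector_derivative[symmetric] intro: has_field_derivative_at_within)
    then have "((\<lambda>t. if t \<in> {-T..z i} then q' t else 0) has_integral (q (z i) - q (-T))) {-T..T}"
      using T(2)[OF i] by (subst has_integral_restrict) auto
    then have "((\<lambda>t. \<epsilon> i * (if t \<in> {-T..z i} then q' t else 0)) has_integral \<epsilon> i * (q (z i) - q (-T))) {-T..T}"
      by (rule has_integral_mult_right)
    then show ?thesis by (rule has_integral_eq[rotated]) auto
  qed
  have ind: "indicator A t = (\<Sum>i | i \<in> I \<and> t \<le> z i. \<epsilon> i)" if "t \<notin> z ` I" for t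
    by (rule indicator_eq_sum_crossings[OF A I fr side that])
  \<comment> \<open>The crossing formula is evaluated left of everything, where all crossings are
    counted and the indicator is zero.\<close>
  have zero: "(\<Sum>i\<in>I. \<epsilon> i) = 0"
  proof -
    have "{i \<in> I. -T \<le> z i} = I" using T(2) by force
    moreover have "-T \<notin> z ` I" "-T \<notin> A" using T by force+
    ultimately show ?thesis using ind[of "-T"] by simp
  qed
  have "((\<lambda>t. \<Sum>i\<in>I. (if t \<le> z i then \<epsilon> i * q' t else 0)) has_integral (\<Sum>i\<in>I. \<epsilon> i * (q (z i) - q (-T)))) {-T..T}"
    by (rule has_integral_sum[OF I(1) piece])
  also have "(\<Sum>i\<in>I. \<epsilon> i * (q (z i) - q (-T))) = (\<Sum>i\<in>I. \<epsilon> i * q (z i))"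
    using zero by (simp add: right_diff_distrib sum_subtractf sum_distrib_right[symmetric])
  finally have "((\<lambda>t. indicator A t * q' t) has_integral (\<Sum>i\<in>I. \<epsilon> i * q (z i))) {-T..T}"
  proof (rule has_integral_spike_finite[rotated 2])
    show "finite (z ` I)" using I by simp
    fix t assume "t \<in> {-T..T} - z ` I"
    then have "indicator A t * q' t = (\<Sum>i | i \<in> I \<and> t \<le> z i. \<epsilon> i * q' t)" using ind[of t] by (simp add: sum_distrib_right)
    also have "\<dots> = (\<Sum>i\<in>I. (if t \<le> z i then \<epsilon> i * q' t else 0))"
      using I(1) by (rule sum.inter_filter)
    finally show "indicator A t * q' t = (\<Sum>i\<in>I. (if t \<le> z i then \<epsilon> i * q' t else 0))" .
  qed
  then have 1: "((\<lambda>t. indicator A t * q' t) has_integral (\<Sum>i\<in>I. \<epsilon> i * q (z i))) UNIV"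
    by (rule has_integral_on_superset) (use T in \<open>auto simp: indicator_def\<close>)
  have "compact (q' ` {-T..T})" using q(2) by (intro compact_continuous_image) (auto intro: continuous_on_subset)
  then have "bounded (q' ` {-T..T})" by (rule compact_imp_bounded)
  then obtain M where "\<forall>y\<in>q' ` {-T..T}. norm y \<le> M" unfolding bounded_iff by blast
  then have M: "\<bar>q' t\<bar> \<le> M" if "t \<in> {-T..T}" for t using that by simp
  have [measurable]: "q' \<in> borel_measurable borel" "A \<in> sets borel"
    using q(2) A(1) by (auto intro: borel_measurable_continuous_onI)
  have "integrable lborel (\<lambda>t. indicator A t * q' t)"
    by (rule integrable_bounded_support[OF _ A(2), where M = M])
      (use T M in \<open>auto simp: indicator_def subset_iff intro!: M\<close>)
  then have "((\<lambda>t. indicator A t * q' t) has_integral (LINT t|lborel. indicator A t * q' t)) UNIV"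
    by (rule has_integral_integral_lborel)
  with 1 show ?thesis by (rule has_integral_unique[rotated])
qed

section \<open>Slicing along a transversal direction\<close>

lemma integral_lborel_translate:
  fixes f :: "'a::euclidean_space \<Rightarrow> real"
  assumes [measurable]: "f \<in> borel_measurable borel"
  shows "(LINT x|lborel. f (a + x)) = (LINT x|lborel. f x)"
proof -
  have "(LINT x|lborel. f x) = (LINT x|distr lborel borel ((+) a). f x)"
    by (simp add: lborel_distr_plus)
  then show ?thesis by (subst (asm) integral_distr) auto
qed

text \<open>Codimension two leaves room for one further point: the hull still fits into a
  hyperplane.\<close>

lemma negligible_affine_hull_insert:
  fixes F :: "'a::euclidean_space set"
  assumes "aff_dim F \<le> int DIM('a) - 2"
  shows "negligible (affine hull (insert x F))"
proof -
  have "aff_dim (insert x F) < int DIM('a)"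
    using assms aff_dim_insert[of x F] by (simp split: if_splits)
  then obtain a b where "a \<noteq> 0" "insert x F \<subseteq> {x. a \<bullet> x = b}"
    using aff_lowdim_subset_hyperplane[of "insert x F"] by metis
  then have "affine hull (insert x F) \<subseteq> {x. a \<bullet> x = b}" "negligible {x. a \<bullet> x = b}"
    using hull_minimal[of "insert x F" "{x. a \<bullet> x = b}" affine] affine_hyperplane[of a b]
      negligible_hyperplane[of a b] by simp_all
  then show ?thesis by (rule negligible_subset[rotated])
qed

text \<open>Sweeping \<open>F\<close> along \<open>v\<close> stays in the affine hull of
  \<open>F\<close> and one translated point of it. The case \<open>v = 0\<close> says that
  \<open>F\<close> itself is negligible.\<close>

lemma negligible_lines_through:
  fixes F :: "'a::euclidean_space set"
  assumes "aff_dim F \<le> int DIM('a) - 2"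
  shows "negligible {y. \<exists>s. y + s *\<^sub>R v \<in> F}"
proof (cases "F = {}")
  case False
  then obtain x where x: "x \<in> F" by blast
  have "{y. \<exists>s. y + s *\<^sub>R v \<in> F} \<subseteq> affine hull (insert (x + v) F)"
  proof
    fix y assume "y \<in> {y. \<exists>s. y + s *\<^sub>R v \<in> F}"
    then obtain s where s: "y + s *\<^sub>R v \<in> F" by blast
    have "(y + s *\<^sub>R v) + (-s) *\<^sub>R ((x + v) - x) \<in> affine hull (insert (x + v) F)"
      by (rule mem_affine_3_minus) (use s x in \<open>auto intro: hull_inc\<close>)
    then show "y \<in> affine hull (insert (x + v) F)" by simp
  qed
  then show ?thesis using negligible_affine_hull_insert[OF assms] negligible_subset by blast
qed simp

text \<open>Isolates what slicing uses of a cell: \<open>\<nu>\<close> gives the outward normals of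
  its flat faces, and the ridges in \<open>\<F>\<close> cover the closure points outside the faces,
  where the local shape of \<open>K\<close> is not described.\<close>

locale flat_boundary =
  fixes K :: "'a::euclidean_space set" and \<S> :: "'a set set" and \<nu> :: "'a set \<Rightarrow> 'a" and \<F> :: "'a set set"
  assumes open_K: "open K" and bounded_K: "bounded K"
    and finite_faces: "finite \<S>" and disjoint_faces: "pairwise disjnt \<S>"
    and frontier_faces: "frontier K = (\<Union>\<sigma>\<in>\<S>. closure \<sigma>)"
    and face_nonempty: "\<sigma> \<in> \<S> \<Longrightarrow> \<sigma> \<noteq> {}"
    and face_borel: "\<sigma> \<in> \<S> \<Longrightarrow> \<sigma> \<in> sets borel"
    and face_hull: "\<sigma> \<in> \<S> \<Longrightarrow> \<exists>c. affine hull \<sigma> = {x. \<nu> \<sigma> \<bullet> x = c}"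
    and norm_normal: "\<sigma> \<in> \<S> \<Longrightarrow> norm (\<nu> \<sigma>) = 1"
    and side: "\<sigma> \<in> \<S> \<Longrightarrow> x \<in> \<sigma> \<Longrightarrow> \<exists>r>0. \<forall>y\<in>ball x r. y \<in> K \<longleftrightarrow> \<nu> \<sigma> \<bullet> (y - x) < 0"
    and finite_ridges: "finite \<F>"
    and ridge_dim: "F \<in> \<F> \<Longrightarrow> aff_dim F \<le> int DIM('a) - 2"
    and ridges: "\<sigma> \<in> \<S> \<Longrightarrow> closure \<sigma> - \<sigma> \<subseteq> \<Union>\<F>"
begin

text \<open>On a line that misses the ridges, this is the one-dimensional divergence theorem.\<close>

lemma line_integral:
  fixes p :: "'a \<Rightarrow> real" and Gp :: "'a \<Rightarrow> 'a"
  assumes c: "\<And>\<sigma>. \<sigma> \<in> \<S> \<Longrightarrow> affine hull \<sigma> = {x. \<nu> \<sigma> \<bullet> x = c \<sigma>}"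
    and p: "\<And>x. (p has_derivative (\<lambda>h. Gp x \<bullet> h)) (at x)" "continuous_on UNIV Gp"
    and v: "v \<noteq> 0" "\<And>\<sigma>. \<sigma> \<in> \<S> \<Longrightarrow> \<nu> \<sigma> \<bullet> v \<noteq> 0"
    and good: "\<And>s. y + s *\<^sub>R v \<notin> \<Union>\<F>"
  shows "(LINT s|lborel. indicator K (y + s *\<^sub>R v) * (Gp (y + s *\<^sub>R v) \<bullet> v))
    = (\<Sum>\<sigma>\<in>\<S>. sgn (\<nu> \<sigma> \<bullet> v) * (indicator \<sigma> (shear_proj (\<nu> \<sigma>) (c \<sigma>) v y) * p (shear_proj (\<nu> \<sigma>) (c \<sigma>) v y)))"
proof -
  define \<gamma> where "\<gamma> s = y + s *\<^sub>R v" for s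
  \<comment> \<open>Parameter at which the line crosses the hyperplane of \<open>\<sigma>\<close>;
    it is unique because \<open>v\<close> is transversal.\<close>
  define z where "z \<sigma> = - ((\<nu> \<sigma> \<bullet> y - c \<sigma>) / (\<nu> \<sigma> \<bullet> v))" for \<sigma>
  have proj: "shear_proj (\<nu> \<sigma>) (c \<sigma>) v y = \<gamma> (z \<sigma>)" for \<sigma>
    by (simp add: shear_proj_def \<gamma>_def z_def)
  have zz: "s = z \<sigma>" if "\<sigma> \<in> \<S>" "\<gamma> s \<in> \<sigma>" for s \<sigma>
  proof -
    have "\<nu> \<sigma> \<bullet> \<gamma> s = c \<sigma>" using c[OF that(1)] hull_inc[OF that(2)] by auto
    then show ?thesis using v(2)[OF that(1)] by (simp add: \<gamma>_def z_def inner_add_right field_simps)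
  qed
  \<comment> \<open>Only faces hit in the face itself, not merely in its hyperplane, contribute
    crossings.\<close>
  define I where "I = {\<sigma> \<in> \<S>. \<gamma> (z \<sigma>) \<in> \<sigma>}"
  define A where "A = {s. \<gamma> s \<in> K}"
  have cont: "continuous_on UNIV \<gamma>" unfolding \<gamma>_def by (intro continuous_intros)
  have A_open: "open A"
    using open_vimage[OF open_K cont] by (simp add: A_def vimage_def)
  have A_bdd: "bounded A"
  proof -
    obtain R where R: "\<forall>x\<in>K. norm x \<le> R" using bounded_K unfolding bounded_iff by auto
    have "\<bar>s\<bar> \<le> (R + norm y) / norm v" if "s \<in> A" for s
    proof -
      have "\<bar>s\<bar> * norm v \<le> norm (\<gamma> s) + norm y"
        using norm_triangle_ineq4[of "\<gamma> s" y] by (simp add: \<gamma>_def)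
      also have "\<dots> \<le> R + norm y" using R that by (auto simp: A_def)
      finally show ?thesis using v(1) by (simp add: field_simps)
    qed
    then show ?thesis unfolding bounded_iff by auto
  qed
  have fin: "finite I" using finite_faces by (simp add: I_def)
  have inj: "inj_on z I"
  proof (rule inj_onI, rule ccontr)
    fix \<sigma> \<tau> assume *: "\<sigma> \<in> I" "\<tau> \<in> I" "z \<sigma> = z \<tau>" "\<sigma> \<noteq> \<tau>"
    then have "\<gamma> (z \<sigma>) \<in> \<sigma> \<inter> \<tau>" "disjnt \<sigma> \<tau>" using disjoint_faces by (auto simp: I_def pairwise_def)
    then show False by (auto simp: disjnt_def)
  qed
  have fr: "frontier A \<subseteq> z ` I"
  proof
    fix s assume s: "s \<in> frontier A"
    have "s \<notin> A" using s A_open by (auto simp: frontier_def interior_open)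
    then have nK: "\<gamma> s \<notin> K" by (simp add: A_def)
    have "\<gamma> ` closure A \<subseteq> closure (\<gamma> ` A)"
      by (rule image_closure_subset) (auto intro: continuous_on_subset[OF cont] simp: closure_subset)
    also have "\<dots> \<subseteq> closure K" by (intro closure_mono) (auto simp: A_def)
    finally have "\<gamma> s \<in> closure K" using s by (auto simp: frontier_def)
    then have "\<gamma> s \<in> frontier K" using nK open_K by (simp add: frontier_def interior_open)
    then obtain \<sigma> where \<sigma>: "\<sigma> \<in> \<S>" "\<gamma> s \<in> closure \<sigma>" using frontier_faces by auto
    \<comment> \<open>This is where avoiding the ridges matters: a point of a face closure off the
      ridges belongs to the face.\<close>
    then have "\<gamma> s \<in> \<sigma>" using ridges[OF \<sigma>(1)] good[of s] by (auto simp: \<gamma>_def)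
    then show "s \<in> z ` I" using zz[OF \<sigma>(1)] \<sigma>(1) by (auto simp: I_def)
  qed
  have "(LINT s|lborel. indicator A s * (Gp (\<gamma> s) \<bullet> v)) = (\<Sum>\<sigma>\<in>I. sgn (\<nu> \<sigma> \<bullet> v) * p (\<gamma> (z \<sigma>)))"
  proof (rule integral_crossings[OF A_open A_bdd fin inj fr, where q = "\<lambda>s. p (\<gamma> s)"])
    fix \<sigma> assume \<sigma>: "\<sigma> \<in> I"
    then have \<sigma>': "\<sigma> \<in> \<S>" "\<gamma> (z \<sigma>) \<in> \<sigma>" by (auto simp: I_def)
    note vn = v(2)[OF \<sigma>'(1)]
    obtain r where r: "r > 0" "\<forall>x\<in>ball (\<gamma> (z \<sigma>)) r. x \<in> K \<longleftrightarrow> \<nu> \<sigma> \<bullet> (x - \<gamma> (z \<sigma>)) < 0"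
      using side[OF \<sigma>'] by blast
    have "t \<in> A \<longleftrightarrow> sgn (\<nu> \<sigma> \<bullet> v) * (t - z \<sigma>) < 0" if "t \<in> ball (z \<sigma>) (r / norm v)" for t
    proof -
      have eq: "\<gamma> t - \<gamma> (z \<sigma>) = (t - z \<sigma>) *\<^sub>R v" by (simp add: \<gamma>_def algebra_simps)
      have "\<bar>t - z \<sigma>\<bar> * norm v < r" using that v(1) by (simp add: dist_real_def field_simps abs_minus_commute)
      then have "\<gamma> t \<in> ball (\<gamma> (z \<sigma>)) r"
        using eq by (simp add: dist_norm norm_minus_commute[of "\<gamma> (z \<sigma>)"])
      then have "t \<in> A \<longleftrightarrow> (t - z \<sigma>) * (\<nu> \<sigma> \<bullet> v) < 0" using r(2) eq by (simp add: A_def)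
      also have "\<dots> \<longleftrightarrow> sgn (\<nu> \<sigma> \<bullet> v) * (t - z \<sigma>) < 0"
        using vn by (auto simp: sgn_real_def mult_less_0_iff)
      finally show ?thesis .
    qed
    then show "(sgn (\<nu> \<sigma> \<bullet> v) = 1 \<or> sgn (\<nu> \<sigma> \<bullet> v) = -1) \<and>
        (\<exists>r>0. \<forall>t\<in>ball (z \<sigma>) r. t \<in> A \<longleftrightarrow> sgn (\<nu> \<sigma> \<bullet> v) * (t - z \<sigma>) < 0)"
      using vn r(1) v(1) by (intro conjI exI[of _ "r / norm v"]) (auto simp: sgn_real_def)
  next
    fix t
    have "(\<gamma> has_derivative (\<lambda>h. h *\<^sub>R v)) (at t)"
      unfolding \<gamma>_def by (auto intro!: derivative_eq_intros)
    from has_derivative_compose[OF this p(1)]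
    have "((\<lambda>s. p (\<gamma> s)) has_derivative (\<lambda>h. (Gp (\<gamma> t) \<bullet> v) * h)) (at t)" by (simp add: mult.commute)
    then show "((\<lambda>s. p (\<gamma> s)) has_real_derivative Gp (\<gamma> t) \<bullet> v) (at t)"
      by (simp add: has_field_derivative_def)
  next
    show "continuous_on UNIV (\<lambda>t. Gp (\<gamma> t) \<bullet> v)"
      by (intro continuous_intros continuous_on_compose2[OF p(2) cont]) auto
  qed
  also have "\<dots> = (\<Sum>\<sigma>\<in>\<S>. if \<gamma> (z \<sigma>) \<in> \<sigma> then sgn (\<nu> \<sigma> \<bullet> v) * p (\<gamma> (z \<sigma>)) else 0)"
    unfolding I_def using finite_faces by (rule sum.inter_filter)
  also have "\<dots> = (\<Sum>\<sigma>\<in>\<S>. sgn (\<nu> \<sigma> \<bullet> v) * (indicator \<sigma> (\<gamma> (z \<sigma>)) * p (\<gamma> (z \<sigma>))))"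
    by (intro sum.cong) auto
  finally show ?thesis
    unfolding proj by (simp add: \<gamma>_def A_def indicator_def)
qed

text \<open>The factor one, written as the integral of the slab indicator along \<open>v\<close>, is
  inserted, and Fubini turns the volume integral into integrals over lines. Almost every line obeys
  the one-dimensional theorem, and integrating the crossing points over the slab gives surface
  integrals through the oblique projection.\<close>

lemma divergence_transversal:
  fixes p :: "'a \<Rightarrow> real" and Gp :: "'a \<Rightarrow> 'a"
  assumes p: "\<And>x. (p has_derivative (\<lambda>h. Gp x \<bullet> h)) (at x)" "continuous_on UNIV Gp"
    and v: "v \<noteq> 0" "\<And>\<sigma>. \<sigma> \<in> \<S> \<Longrightarrow> \<nu> \<sigma> \<bullet> v \<noteq> 0"
  shows "(LINT x|lborel. indicator K x * (Gp x \<bullet> v))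
    = (\<Sum>\<sigma>\<in>\<S>. (\<nu> \<sigma> \<bullet> v) * (LINT x|surface_measure \<sigma>. indicator \<sigma> x * p x))"
proof -
  obtain c where c: "\<And>\<sigma>. \<sigma> \<in> \<S> \<Longrightarrow> affine hull \<sigma> = {x. \<nu> \<sigma> \<bullet> x = c \<sigma>}"
    using face_hull by metis
  define g where "g x = indicator K x * (Gp x \<bullet> v)" for x
  have [measurable]: "K \<in> sets borel" using open_K by auto
  have [measurable]: "Gp \<in> borel_measurable borel" using p(2) by (rule borel_measurable_continuous_onI)
  have [measurable]: "g \<in> borel_measurable borel" unfolding g_def by measurable
  have contp: "continuous_on UNIV p"
    using p(1) by (metis continuous_at_imp_continuous_on has_derivative_continuous)
  have [measurable]: "p \<in> borel_measurable borel" using contp by (rule borel_measurable_continuous_onI)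
  obtain R where R: "\<forall>x\<in>closure K. norm x \<le> R" using bounded_closure[OF bounded_K] unfolding bounded_iff by auto
  have compK: "compact (closure K)" using bounded_K by simp
  have "bounded ((\<lambda>x. Gp x \<bullet> v) ` closure K)"
    using p(2) by (intro compact_imp_bounded compact_continuous_image compK continuous_intros)
      (auto intro: continuous_on_subset)
  then obtain M where "\<forall>y\<in>(\<lambda>x. Gp x \<bullet> v) ` closure K. norm y \<le> M" unfolding bounded_iff by blast
  then have M: "\<bar>g x\<bar> \<le> \<bar>M\<bar>" for x using closure_subset[of K] by (force simp: g_def indicator_def)
  have "bounded (p ` closure K)"
    using contp by (intro compact_imp_bounded compact_continuous_image compK) (auto intro: continuous_on_subset)
  then obtain M' where "\<forall>y\<in>p ` closure K. norm y \<le> M'" unfolding bounded_iff by blast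
  then have M': "\<bar>p x\<bar> \<le> M'" if "x \<in> closure K" for x using that by simp
  \<comment> \<open>If \<open>x\<close> has norm at most \<open>R\<close> and
    \<open>x - s *\<^sub>R v\<close> lies in the slab, then \<open>R1\<close> bounds
    \<open>s\<close> in absolute value. This gives bounded supports, hence integrability, for both
    uses of Fubini.\<close>
  define R1 where "R1 = norm v * R / (v \<bullet> v) + 1"
  have vv: "v \<bullet> v > 0" using v by simp
  have slab_bound: "\<bar>s\<bar> \<le> R1" if "x - s *\<^sub>R v \<in> slab v" "norm x \<le> R" for x s
  proof -
    have vx: "\<bar>v \<bullet> x\<bar> \<le> norm v * R"
      using Cauchy_Schwarz_ineq2[of v x] that(2) mult_left_mono[of "norm x" R "norm v"] by simp
    have "0 \<le> v \<bullet> x - s * (v \<bullet> v)" "v \<bullet> x - s * (v \<bullet> v) \<le> v \<bullet> v"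
      using that(1) by (auto simp: slab_def inner_diff_right)
    then have "\<bar>s\<bar> * (v \<bullet> v) \<le> norm v * R + v \<bullet> v" using vx vv by (auto simp: abs_if split: if_splits)
    then show ?thesis using vv by (simp add: R1_def field_simps)
  qed
  have slab1: "(LINT s|lborel. indicator (slab v) (x - s *\<^sub>R v)) = (1 :: real)" for x
  proof -
    have "indicator (slab v) (x - s *\<^sub>R v) = (indicator {(v \<bullet> x) / (v \<bullet> v) - 1 .. (v \<bullet> x) / (v \<bullet> v)} s :: real)" for s
      using vv by (auto simp: slab_def indicator_def inner_diff_right field_simps)
    then show ?thesis by simp
  qed
  have int1: "integrable (lborel \<Otimes>\<^sub>M lborel) (\<lambda>(x, s). indicator (slab v) (x - s *\<^sub>R v) * g x)"
    unfolding lborel_prod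
  proof (rule integrable_bounded_support)
    show "bounded (closure K \<times> cball (0::real) R1)" by (intro bounded_Times) (auto simp: bounded_K)
    show "(\<lambda>(x, s). indicator (slab v) (x - s *\<^sub>R v) * g x) \<in> borel_measurable borel"
      unfolding borel_prod[symmetric] by measurable
    show "(case z of (x, s) \<Rightarrow> indicator (slab v) (x - s *\<^sub>R v) * g x) = 0" if "z \<notin> closure K \<times> cball (0::real) R1" for z
    proof (cases z)
      case (Pair x s)
      then show ?thesis using that slab_bound[of x s] R closure_subset[of K]
        by (auto simp: g_def indicator_def)
    qed
    show "\<bar>case z of (x, s) \<Rightarrow> indicator (slab v) (x - s *\<^sub>R v) * g x\<bar> \<le> \<bar>M\<bar>" for z
      using M by (cases z) (auto simp: indicator_def)
  qed
  have int2: "integrable (lborel \<Otimes>\<^sub>M lborel) (\<lambda>(x, s). indicator (slab v) x * g (x + s *\<^sub>R v))"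
    unfolding lborel_prod
  proof (rule integrable_bounded_support)
    show "bounded (cball (0::'a) (R + R1 * norm v) \<times> cball (0::real) R1)" by (intro bounded_Times) auto
    show "(\<lambda>(x, s). indicator (slab v) x * g (x + s *\<^sub>R v)) \<in> borel_measurable borel"
      unfolding borel_prod[symmetric] by measurable
    show "(case z of (x, s) \<Rightarrow> indicator (slab v) x * g (x + s *\<^sub>R v)) = 0"
      if "z \<notin> cball (0::'a) (R + R1 * norm v) \<times> cball (0::real) R1" for z
    proof (cases z)
      case (Pair x s)
      have "z \<in> cball (0::'a) (R + R1 * norm v) \<times> cball (0::real) R1" if "x \<in> slab v" "x + s *\<^sub>R v \<in> K"
      proof -
        have n: "norm (x + s *\<^sub>R v) \<le> R" using that R closure_subset[of K] by auto
        then have s: "\<bar>s\<bar> \<le> R1" using slab_bound[of "x + s *\<^sub>R v" s] that by simp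
        have "norm x \<le> norm (x + s *\<^sub>R v) + \<bar>s\<bar> * norm v"
          using norm_triangle_ineq4[of "x + s *\<^sub>R v" "s *\<^sub>R v"] by simp
        also have "\<dots> \<le> R + R1 * norm v" using n s by (intro add_mono mult_right_mono) auto
        finally show ?thesis using s Pair by simp
      qed
      then show ?thesis using that Pair by (auto simp: g_def indicator_def)
    qed
    show "\<bar>case z of (x, s) \<Rightarrow> indicator (slab v) x * g (x + s *\<^sub>R v)\<bar> \<le> \<bar>M\<bar>" for z
      using M by (cases z) (auto simp: indicator_def)
  qed
  have "(LINT x|lborel. g x) = (LINT x|lborel. (LINT s|lborel. indicator (slab v) (x - s *\<^sub>R v) * g x))"
    by (simp add: slab1)
  also have "\<dots> = (LINT s|lborel. (LINT x|lborel. indicator (slab v) (x - s *\<^sub>R v) * g x))"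
    by (rule lborel_pair.Fubini_integral[OF int1, symmetric])
  also have "\<dots> = (LINT s|lborel. (LINT x|lborel. indicator (slab v) x * g (x + s *\<^sub>R v)))"
  proof (rule Bochner_Integration.integral_cong[OF refl])
    fix s :: real
    have "(LINT x|lborel. indicator (slab v) (x - s *\<^sub>R v) * g x)
      = (LINT x|lborel. indicator (slab v) ((s *\<^sub>R v + x) - s *\<^sub>R v) * g (s *\<^sub>R v + x))"
      by (rule integral_lborel_translate[symmetric]) measurable
    then show "(LINT x|lborel. indicator (slab v) (x - s *\<^sub>R v) * g x) = (LINT x|lborel. indicator (slab v) x * g (x + s *\<^sub>R v))"
      by (simp add: add.commute)
  qed
  also have "\<dots> = (LINT x|lborel. (LINT s|lborel. indicator (slab v) x * g (x + s *\<^sub>R v)))"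
    by (rule lborel_pair.Fubini_integral[OF int2])
  also have "\<dots> = (LINT x|lborel. (\<Sum>\<sigma>\<in>\<S>. sgn (\<nu> \<sigma> \<bullet> v) * (indicator (slab v) x *
      (indicator \<sigma> (shear_proj (\<nu> \<sigma>) (c \<sigma>) v x) * p (shear_proj (\<nu> \<sigma>) (c \<sigma>) v x)))))"
  proof (rule integral_cong_AE)
    \<comment> \<open>The exceptional starting points are those whose line meets a ridge, and they
      form a null set.\<close>
    have "negligible (\<Union>F\<in>\<F>. {y. \<exists>s. y + s *\<^sub>R v \<in> F})"
      using finite_ridges ridge_dim by (intro negligible_Union) (auto intro!: negligible_lines_through)
    then have "AE x in lebesgue. x \<notin> (\<Union>F\<in>\<F>. {y. \<exists>s. y + s *\<^sub>R v \<in> F})"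
      unfolding negligible_iff_null_sets by (rule AE_not_in)
    then have "AE x in lborel. x \<notin> (\<Union>F\<in>\<F>. {y. \<exists>s. y + s *\<^sub>R v \<in> F})" by (simp add: AE_completion_iff)
    then show "AE x in lborel. (LINT s|lborel. indicator (slab v) x * g (x + s *\<^sub>R v)) =
      (\<Sum>\<sigma>\<in>\<S>. sgn (\<nu> \<sigma> \<bullet> v) * (indicator (slab v) x *
      (indicator \<sigma> (shear_proj (\<nu> \<sigma>) (c \<sigma>) v x) * p (shear_proj (\<nu> \<sigma>) (c \<sigma>) v x))))"
    proof eventually_elim
      case (elim x)
      then have "(LINT s|lborel. g (x + s *\<^sub>R v)) = (\<Sum>\<sigma>\<in>\<S>. sgn (\<nu> \<sigma> \<bullet> v) *
        (indicator \<sigma> (shear_proj (\<nu> \<sigma>) (c \<sigma>) v x) * p (shear_proj (\<nu> \<sigma>) (c \<sigma>) v x)))"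
        unfolding g_def by (intro line_integral[OF c p v]) auto
      then show ?case by (simp add: sum_distrib_left mult.left_commute)
    qed
    show "(\<lambda>x. \<Sum>\<sigma>\<in>\<S>. sgn (\<nu> \<sigma> \<bullet> v) * (indicator (slab v) x *
      (indicator \<sigma> (shear_proj (\<nu> \<sigma>) (c \<sigma>) v x) * p (shear_proj (\<nu> \<sigma>) (c \<sigma>) v x)))) \<in> borel_measurable lborel"
      using face_borel by measurable
  qed measurable
  also have "\<dots> = (\<Sum>\<sigma>\<in>\<S>. sgn (\<nu> \<sigma> \<bullet> v) * (LINT x|lborel. indicator (slab v) x *
      (indicator \<sigma> (shear_proj (\<nu> \<sigma>) (c \<sigma>) v x) * p (shear_proj (\<nu> \<sigma>) (c \<sigma>) v x))))"
  proof (subst Bochner_Integration.integral_sum)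
    fix \<sigma> assume \<sigma>: "\<sigma> \<in> \<S>"
    have [measurable]: "\<sigma> \<in> sets borel" using face_borel \<sigma> .
    let ?P = "shear_proj (\<nu> \<sigma>) (c \<sigma>) v"
    have sub: "\<sigma> \<subseteq> closure K" using \<sigma> frontier_faces closure_subset[of \<sigma>] by (auto simp: frontier_def)
    have "integrable lborel (\<lambda>x. indicator (slab v) x * (indicator \<sigma> (?P x) * p (?P x)))"
    proof (rule integrable_bounded_support)
      show "bounded (cball (0::'a) (R + R1 * norm v))" by simp
      show "indicator (slab v) x * (indicator \<sigma> (?P x) * p (?P x)) = 0" if out: "x \<notin> cball (0::'a) (R + R1 * norm v)" for x
      proof -
        have "x \<in> cball (0::'a) (R + R1 * norm v)" if "x \<in> slab v" "?P x \<in> \<sigma>"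
        proof -
          define s where "s = - ((\<nu> \<sigma> \<bullet> x - c \<sigma>) / (\<nu> \<sigma> \<bullet> v))"
          have P: "?P x = x + s *\<^sub>R v" by (simp add: shear_proj_def s_def)
          have n: "norm (x + s *\<^sub>R v) \<le> R" using that R sub unfolding P by auto
          then have s: "\<bar>s\<bar> \<le> R1" using slab_bound[of "x + s *\<^sub>R v" s] that by simp
          have "norm x \<le> norm (x + s *\<^sub>R v) + \<bar>s\<bar> * norm v"
            using norm_triangle_ineq4[of "x + s *\<^sub>R v" "s *\<^sub>R v"] by simp
          also have "\<dots> \<le> R + R1 * norm v" using n s by (intro add_mono mult_right_mono) auto
          finally show ?thesis by simp
        qed
        then show ?thesis using out by (auto simp: indicator_def)
      qed
      show "\<bar>indicator (slab v) x * (indicator \<sigma> (?P x) * p (?P x))\<bar> \<le> \<bar>M'\<bar>" for x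
        using M'[of "?P x"] sub by (auto simp: indicator_def)
    qed measurable
    then show "integrable lborel (\<lambda>x. sgn (\<nu> \<sigma> \<bullet> v) * (indicator (slab v) x * (indicator \<sigma> (?P x) * p (?P x))))"
      by (rule integrable_mult_right)
  qed simp
  \<comment> \<open>The sign from the crossing count and the Jacobian
    \<open>\<bar>\<nu> \<sigma> \<bullet> v\<bar>\<close> recombine to the signed normal component
    of \<open>v\<close>.\<close>
  also have "\<dots> = (\<Sum>\<sigma>\<in>\<S>. (\<nu> \<sigma> \<bullet> v) * (LINT x|surface_measure \<sigma>. indicator \<sigma> x * p x))"
  proof (rule sum.cong[OF refl])
    fix \<sigma> assume \<sigma>: "\<sigma> \<in> \<S>"
    have [measurable]: "\<sigma> \<in> sets borel" using face_borel \<sigma> .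
    show "sgn (\<nu> \<sigma> \<bullet> v) * (LINT x|lborel. indicator (slab v) x *
      (indicator \<sigma> (shear_proj (\<nu> \<sigma>) (c \<sigma>) v x) * p (shear_proj (\<nu> \<sigma>) (c \<sigma>) v x)))
      = (\<nu> \<sigma> \<bullet> v) * (LINT x|surface_measure \<sigma>. indicator \<sigma> x * p x)"
      using integral_surface_measure[OF c[OF \<sigma>] norm_normal[OF \<sigma>] face_nonempty[OF \<sigma>] v(2)[OF \<sigma>], of "\<lambda>x. indicator \<sigma> x * p x", symmetric]
      by (simp add: mult.assoc[symmetric] sgn_mult_abs[symmetric] abs_sgn)
  qed
  finally show ?thesis by (simp add: g_def)
qed

end

subsection \<open>Polynomials and projections\<close>

definition multi_indices :: "nat \<Rightarrow> ('n::finite \<Rightarrow> nat) set" where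
  "multi_indices q = {\<alpha>. (\<Sum>i\<in>UNIV. \<alpha> i) \<le> q}"

definition monomial :: "('n::finite \<Rightarrow> nat) \<Rightarrow> real^'n \<Rightarrow> real" where
  "monomial \<alpha> x = (\<Prod>i\<in>UNIV. (x $ i) ^ \<alpha> i)"

lemma finite_multi_indices: "finite (multi_indices q :: ('n::finite \<Rightarrow> nat) set)"
proof (rule finite_subset)
  show "(multi_indices q :: ('n \<Rightarrow> nat) set) \<subseteq> Pi\<^sub>E UNIV (\<lambda>_. {..q})"
  proof
    fix \<alpha> :: "'n \<Rightarrow> nat" assume "\<alpha> \<in> multi_indices q"
    then have "\<alpha> i \<le> q" for i
      using member_le_sum[of i UNIV \<alpha>] by (simp add: multi_indices_def)
    then show "\<alpha> \<in> Pi\<^sub>E UNIV (\<lambda>_. {..q})" by (auto simp: PiE_def)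
  qed
  show "finite (Pi\<^sub>E (UNIV :: 'n set) (\<lambda>_. {..q}))" by (intro finite_PiE) auto
qed

lemma polynomials_iff:
  "p \<in> polynomials q \<longleftrightarrow> (\<exists>c. p = (\<lambda>x. \<Sum>\<alpha>\<in>multi_indices q. c \<alpha> * monomial \<alpha> x))"
  by (simp add: polynomials_def multi_indices_def monomial_def)

lemma polynomials_add: "p \<in> polynomials q \<Longrightarrow> r \<in> polynomials q \<Longrightarrow> (\<lambda>x. p x + r x) \<in> polynomials q"
  unfolding polynomials_iff
  by (elim exE, rule_tac x = "\<lambda>\<alpha>. c \<alpha> + ca \<alpha>" in exI) (simp add: sum.distrib distrib_right)

lemma polynomials_cmult: "p \<in> polynomials q \<Longrightarrow> (\<lambda>x. a * p x) \<in> polynomials q"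
  unfolding polynomials_iff
  by (elim exE, rule_tac x = "\<lambda>\<alpha>. a * c \<alpha>" in exI) (simp add: sum_distrib_left mult.assoc)

lemma polynomials_zero: "(\<lambda>x. 0) \<in> polynomials q"
  unfolding polynomials_iff by (intro exI[of _ "\<lambda>_. 0"]) simp

lemma polynomials_sum:
  "finite A \<Longrightarrow> (\<And>a. a \<in> A \<Longrightarrow> f a \<in> polynomials q) \<Longrightarrow> (\<lambda>x. \<Sum>a\<in>A. f a x) \<in> polynomials q"
  by (induction A rule: finite_induct) (auto intro: polynomials_zero polynomials_add)

lemma monomial_in_polynomials:
  assumes "\<alpha> \<in> multi_indices q"
  shows "monomial \<alpha> \<in> polynomials q"
  unfolding polynomials_iff
proof (intro exI[of _ "\<lambda>\<beta>. if \<beta> = \<alpha> then 1 else 0"] ext)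
  fix x
  have "(\<Sum>\<beta>\<in>multi_indices q. (if \<beta> = \<alpha> then 1 else 0) * monomial \<beta> x) = (\<Sum>\<beta>\<in>multi_indices q. if \<beta> = \<alpha> then monomial \<alpha> x else 0)"
    by (intro sum.cong) auto
  then show "monomial \<alpha> x = (\<Sum>\<beta>\<in>multi_indices q. (if \<beta> = \<alpha> then 1 else 0) * monomial \<beta> x)"
    using assms by (simp add: sum.delta[OF finite_multi_indices])
qed

lemma polynomials_const: "(\<lambda>x. a) \<in> polynomials q"
proof -
  have "monomial (\<lambda>_. 0) \<in> polynomials q" by (rule monomial_in_polynomials) (simp add: multi_indices_def)
  from polynomials_cmult[OF this, of a] show ?thesis by (simp add: monomial_def[abs_def])
qed

lemma polynomials_mono: "q \<le> q' \<Longrightarrow> polynomials q \<subseteq> polynomials q'"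
proof
  fix p assume "q \<le> q'" "p \<in> polynomials q"
  then obtain c where p: "p = (\<lambda>x. \<Sum>\<alpha>\<in>multi_indices q. c \<alpha> * monomial \<alpha> x)" by (auto simp: polynomials_iff)
  show "p \<in> polynomials q'" unfolding p
    using \<open>q \<le> q'\<close> by (intro polynomials_sum finite_multi_indices polynomials_cmult monomial_in_polynomials)
      (auto simp: multi_indices_def)
qed

lemma polynomials_gradient:
  assumes "p \<in> polynomials (Suc q)"
  obtains G where "\<And>x. (p has_derivative (\<lambda>h. G x \<bullet> h)) (at x)" "\<And>i. (\<lambda>x. G x $ i) \<in> polynomials q"
proof -
  obtain c where p: "p = (\<lambda>x. \<Sum>\<alpha>\<in>multi_indices (Suc q). c \<alpha> * monomial \<alpha> x)"
    using assms by (auto simp: polynomials_iff)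
  \<comment> \<open>For \<open>\<alpha> i = 0\<close> the truncated exponent
    \<open>\<alpha> i - 1\<close> is harmless, since the factor \<open>real (\<alpha> i)\<close>
    vanishes.\<close>
  define d where "d \<alpha> i x = real (\<alpha> i) * monomial (\<alpha>(i := \<alpha> i - 1)) x" for \<alpha> :: "'a \<Rightarrow> nat" and i x
  define G where "G x = (\<chi> i. \<Sum>\<alpha>\<in>multi_indices (Suc q). c \<alpha> * d \<alpha> i x)" for x
  have mono: "(monomial \<alpha> has_derivative (\<lambda>h. \<Sum>i\<in>UNIV. d \<alpha> i x * h $ i)) (at x)" for \<alpha> x
  proof -
    have "((\<lambda>y. \<Prod>i\<in>UNIV. (y $ i) ^ \<alpha> i) has_derivative
        (\<lambda>h. \<Sum>i\<in>UNIV. (real (\<alpha> i) * (h $ i) * (x $ i) ^ (\<alpha> i - 1)) * (\<Prod>j\<in>UNIV - {i}. (x $ j) ^ \<alpha> j))) (at x)"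
    proof (rule has_derivative_prod)
      fix i
      have "((\<lambda>y. y $ i) has_derivative (\<lambda>h. h $ i)) (at x)"
        by (rule bounded_linear_imp_has_derivative) (rule bounded_linear_vec_nth)
      from has_derivative_power[OF this, of "\<alpha> i"]
      show "((\<lambda>y. (y $ i) ^ \<alpha> i) has_derivative (\<lambda>h. real (\<alpha> i) * (h $ i) * (x $ i) ^ (\<alpha> i - 1))) (at x)" .
    qed
    moreover have "(real (\<alpha> i) * (h $ i) * (x $ i) ^ (\<alpha> i - 1)) * (\<Prod>j\<in>UNIV - {i}. (x $ j) ^ \<alpha> j) = d \<alpha> i x * h $ i" for i h
    proof -
      have "monomial (\<alpha>(i := \<alpha> i - 1)) x = (x $ i) ^ (\<alpha> i - 1) * (\<Prod>j\<in>UNIV - {i}. (x $ j) ^ \<alpha> j)"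
        unfolding monomial_def by (subst prod.remove[of UNIV i]) (auto intro!: prod.cong)
      then show ?thesis by (simp add: d_def)
    qed
    ultimately show ?thesis unfolding monomial_def[abs_def] by (simp only:)
  qed
  have "(p has_derivative (\<lambda>h. \<Sum>\<alpha>\<in>multi_indices (Suc q). c \<alpha> * (\<Sum>i\<in>UNIV. d \<alpha> i x * h $ i))) (at x)" for x
    unfolding p by (intro has_derivative_sum has_derivative_mult_right mono)
  moreover have "(\<Sum>\<alpha>\<in>multi_indices (Suc q). c \<alpha> * (\<Sum>i\<in>UNIV. d \<alpha> i x * h $ i)) = G x \<bullet> h" for x h
    by (simp add: G_def inner_vec_def sum_distrib_left sum_distrib_right sum.swap[of _ UNIV] mult.assoc)
  ultimately have 1: "(p has_derivative (\<lambda>h. G x \<bullet> h)) (at x)" for x by simp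
  have dpoly: "d \<alpha> i \<in> polynomials q" if "\<alpha> \<in> multi_indices (Suc q)" for \<alpha> i
  proof (cases "\<alpha> i = 0")
    case True
    then show ?thesis using polynomials_zero by (simp add: d_def[abs_def])
  next
    case False
    have "(\<Sum>j\<in>UNIV. (\<alpha>(i := \<alpha> i - 1)) j) = (\<alpha> i - 1) + (\<Sum>j\<in>UNIV - {i}. \<alpha> j)"
      by (subst sum.remove[of UNIV i]) (auto intro!: sum.cong)
    moreover have "(\<Sum>j\<in>UNIV. \<alpha> j) = \<alpha> i + (\<Sum>j\<in>UNIV - {i}. \<alpha> j)" by (subst sum.remove[of UNIV i]) auto
    ultimately have "\<alpha>(i := \<alpha> i - 1) \<in> multi_indices q" using that False by (simp add: multi_indices_def)
    then show ?thesis unfolding d_def[abs_def] by (intro polynomials_cmult monomial_in_polynomials)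
  qed
  have 2: "(\<lambda>x. G x $ i) \<in> polynomials q" for i
    unfolding G_def using dpoly by (simp, intro polynomials_sum finite_multi_indices polynomials_cmult) auto
  show thesis using that 1 2 by blast
qed

lemma polynomials_continuous: "p \<in> polynomials q \<Longrightarrow> continuous_on S p"
  unfolding polynomials_iff monomial_def by (auto intro!: continuous_intros)

lemma polynomials_gradient_continuous:
  fixes G :: "real^'n::finite \<Rightarrow> real^'n"
  assumes "\<And>i. (\<lambda>x. G x $ i) \<in> polynomials q"
  shows "continuous_on S G"
  unfolding continuous_on_componentwise[of S G]
proof
  fix b :: "real^'n" assume "b \<in> Basis"
  then obtain i where "b = axis i 1" by (auto simp: Basis_vec_def)
  then show "continuous_on S (\<lambda>x. G x \<bullet> b)"
    using polynomials_continuous[OF assms, of S i] by (simp add: inner_axis)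
qed

text \<open>By restriction to lines, where a polynomial has finitely many zeros.\<close>

lemma polynomials_eq_zero:
  assumes p: "p \<in> polynomials q" and V: "open V" "V \<noteq> {}" "\<And>x. x \<in> V \<Longrightarrow> p x = 0"
  shows "p y = 0"
proof -
  obtain x where x: "x \<in> V" using V by blast
  obtain c where c: "p = (\<lambda>x. \<Sum>\<alpha>\<in>multi_indices q. c \<alpha> * monomial \<alpha> x)" using p by (auto simp: polynomials_iff)
  \<comment> \<open>The restriction of \<open>p\<close> to the line through \<open>x\<close> and
    \<open>y\<close> as a univariate polynomial, with \<open>y\<close> at parameter one.\<close>
  define R where "R = (\<Sum>\<alpha>\<in>multi_indices q. smult (c \<alpha>) (\<Prod>i\<in>UNIV. [:x $ i, y $ i - x $ i:] ^ \<alpha> i))"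
  have R: "poly R t = p (x + t *\<^sub>R (y - x))" for t
    by (simp add: R_def c poly_sum monomial_def poly_prod)
  have "open ((\<lambda>t. x + t *\<^sub>R (y - x)) -` V)"
    using V(1) by (intro open_vimage) (auto intro!: continuous_intros)
  moreover have "0 \<in> (\<lambda>t. x + t *\<^sub>R (y - x)) -` V" using x by simp
  ultimately obtain r where r: "r > 0" "ball 0 r \<subseteq> (\<lambda>t. x + t *\<^sub>R (y - x)) -` V"
    using open_contains_ball by blast
  have "{0<..<r} \<subseteq> {t. poly R t = 0}"
    using r(2) V(3) by (auto simp: R subset_iff dist_real_def)
  moreover have "infinite {0<..<r}" using r(1) by simp
  ultimately have "R = 0" using poly_roots_finite[of R] finite_subset by blast
  then show ?thesis using R[of 1] by simp
qed

text \<open>A vanishing gradient near one point makes \<open>p\<close> constant on a ball, and the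
  difference to that constant is a polynomial vanishing on an open set.\<close>

lemma polynomials_constant:
  assumes p: "p \<in> polynomials q" and G: "\<And>x. (p has_derivative (\<lambda>h. G x \<bullet> h)) (at x)"
    and V: "open V" "x \<in> V" "\<And>y. y \<in> V \<Longrightarrow> G y = 0"
  shows "p y = p x"
proof -
  obtain r where r: "r > 0" "ball x r \<subseteq> V" using V open_contains_ball by blast
  have const: "p z = p x" if z: "z \<in> ball x r" for z
  proof (rule has_derivative_zero_unique[of "ball x r" p])
    show "(p has_derivative (\<lambda>h. 0)) (at y within ball x r)" if "y \<in> ball x r" for y
    proof -
      have "G y = 0" using V(3) r(2) that by blast
      then have "(p has_derivative (\<lambda>h. 0)) (at y)" using G[of y] by simp
      then show ?thesis by (rule has_derivative_at_withinI)
    qed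
  qed (use z r in auto)
  have a: "(\<lambda>z. p z + (- p x)) \<in> polynomials q" by (intro polynomials_add p polynomials_const)
  have b: "p z + (- p x) = 0" if "z \<in> ball x r" for z using const[OF that] by linarith
  have "p y + (- p x) = 0"
    by (rule polynomials_eq_zero[OF a open_ball _ b]) (use r(1) in auto)
  then show ?thesis by simp
qed

section \<open>Polynomials restricted to cells and faces\<close>

lemma poly_on_iff: "r \<in> poly_on q X \<longleftrightarrow> (\<exists>p\<in>polynomials q. r = (\<lambda>x. if x \<in> closure X then p x else 0))"
  by (auto simp: poly_on_def)

lemma poly_on_add: "p \<in> poly_on q X \<Longrightarrow> r \<in> poly_on q X \<Longrightarrow> (\<lambda>x. p x + r x) \<in> poly_on q X"
  unfolding poly_on_iff by (elim bexE, rule_tac x = "\<lambda>x. pa x + paa x" in bexI) (auto intro: polynomials_add)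

lemma poly_on_cmult: "p \<in> poly_on q X \<Longrightarrow> (\<lambda>x. a * p x) \<in> poly_on q X"
  unfolding poly_on_iff by (elim bexE, rule_tac x = "\<lambda>x. a * pa x" in bexI) (auto intro: polynomials_cmult)

lemma poly_on_const: "(\<lambda>x. if x \<in> closure X then a else 0) \<in> poly_on q X"
  unfolding poly_on_iff by (intro bexI[of _ "\<lambda>_. a"] polynomials_const) auto

lemma poly_on_continuous:
  assumes "p \<in> poly_on q X"
  shows "continuous_on (closure X) p"
proof -
  obtain p' where p': "p' \<in> polynomials q" "p = (\<lambda>x. if x \<in> closure X then p' x else 0)"
    using assms by (auto simp: poly_on_iff)
  have "continuous_on (closure X) p'" using p'(1) by (rule polynomials_continuous)
  then show ?thesis by (rule continuous_on_eq) (simp add: p'(2))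
qed

lemma poly_on_outside: "p \<in> poly_on q X \<Longrightarrow> x \<notin> closure X \<Longrightarrow> p x = 0"
  by (auto simp: poly_on_iff)

text \<open>Agreement passes from \<open>X\<close> to its closure by continuity, and off the closure
  both representatives are zero by convention.\<close>

lemma poly_on_eqI:
  assumes "p \<in> poly_on q X" "r \<in> poly_on q' X" "\<And>x. x \<in> X \<Longrightarrow> p x = r x"
  shows "p = r"
proof
  fix x
  show "p x = r x"
  proof (cases "x \<in> closure X")
    case True
    have "continuous_on (closure X) (\<lambda>x. p x - r x)"
      using assms(1,2) by (intro continuous_intros poly_on_continuous)
    then have "p x - r x = 0"
      by (rule continuous_constant_on_closure) (use assms(3) True in auto)
    then show ?thesis by simp
  qed (use assms poly_on_outside in metis)
qed

text \<open>The only properties of the measures on cells and faces that projections and energies need.\<close>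

definition faithful :: "'a::euclidean_space measure \<Rightarrow> 'a set \<Rightarrow> bool" where
  "faithful \<mu> X \<longleftrightarrow> (\<forall>h :: 'a \<Rightarrow> real. continuous_on (closure X) h \<longrightarrow> set_integrable \<mu> X h \<and>
    ((\<forall>x\<in>X. 0 \<le> h x) \<longrightarrow> (LINT x:X|\<mu>. h x) = 0 \<longrightarrow> (\<forall>x\<in>X. h x = 0)))"

lemma faithful_integrable: "faithful \<mu> X \<Longrightarrow> continuous_on (closure X) h \<Longrightarrow> set_integrable \<mu> X (h :: _ \<Rightarrow> real)"
  by (simp add: faithful_def)

lemma faithful_zero:
  "faithful \<mu> X \<Longrightarrow> continuous_on (closure X) h \<Longrightarrow> (\<And>x. x \<in> X \<Longrightarrow> 0 \<le> h x) \<Longrightarrow>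
    (LINT x:X|\<mu>. h x) = 0 \<Longrightarrow> x \<in> X \<Longrightarrow> (h x :: real) = 0"
  by (simp add: faithful_def)

section \<open>Measures that detect continuous functions\<close>

lemma negligible_AE:
  assumes "AE x in lebesgue. P x"
  shows "negligible {x. \<not> P x}"
proof -
  obtain N where "\<And>x. x \<in> space lebesgue - N \<Longrightarrow> P x" "N \<in> null_sets lebesgue"
    by (rule AE_E3[OF assms]) blast
  then have "{x. \<not> P x} \<subseteq> N" "negligible N" by (auto simp: negligible_iff_null_sets)
  then show ?thesis by (rule negligible_subset[rotated])
qed

lemma faithful_lebesgue:
  fixes X :: "'a::euclidean_space set"
  assumes X: "open X" "bounded X"
  shows "faithful lebesgue X"
  unfolding faithful_def
proof (intro allI impI conjI ballI)
  fix h :: "'a \<Rightarrow> real" assume h: "continuous_on (closure X) h"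
  have "integrable lborel (\<lambda>x. indicator (closure X) x *\<^sub>R h x)"
    using X h by (intro borel_integrable_compact) auto
  then have "set_integrable lebesgue (closure X) h"
    unfolding set_integrable_def by (simp add: integrable_completion)
  then show int: "set_integrable lebesgue X h"
    by (rule set_integrable_subset) (use X closure_subset in auto)
  fix x assume nn: "\<forall>x\<in>X. 0 \<le> h x" and zero: "(LINT x:X|lebesgue. h x) = 0" and x: "x \<in> X"
  have "AE y in lebesgue. indicator X y * h y = 0"
    using zero int nn unfolding set_lebesgue_integral_def set_integrable_def
    by (subst (asm) integral_nonneg_eq_0_iff_AE) (auto simp: indicator_def)
  then have N: "negligible {y. indicator X y * h y \<noteq> 0}" by (rule negligible_AE)
  show "h x = 0"
  proof (rule ccontr)
    assume "h x \<noteq> 0"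
    have "open (X \<inter> h -` (- {0}))"
      using X(1) continuous_on_subset[OF h closure_subset] by (intro continuous_open_preimage) auto
    then have "\<not> negligible (X \<inter> h -` (- {0}))" using x \<open>h x \<noteq> 0\<close> open_not_negligible by blast
    then show False using N negligible_subset[OF N, of "X \<inter> h -` (- {0})"] by (auto simp: indicator_def subset_iff)
  qed
qed

text \<open>The orthogonal projection along \<open>n\<close> pulls a relatively open part of the
  face back to an open cylinder in the slab, and a non-empty open set is not negligible. Strict
  positivity is thus inherited from Lebesgue measure.\<close>

lemma faithful_surface_measure:
  fixes S :: "'a::euclidean_space set"
  assumes hyp: "affine hull S = {x. n \<bullet> x = c}" and n: "norm n = 1" and ne: "S \<noteq> {}"
    and bdd: "bounded S" and op: "openin (top_of_set (affine hull S)) S"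
  shows "faithful (surface_measure S) S"
  unfolding faithful_def
proof (intro allI impI conjI ballI)
  fix h :: "'a \<Rightarrow> real" assume h: "continuous_on (closure S) h"
  obtain V where V: "open V" "S = {x. n \<bullet> x = c} \<inter> V" using op unfolding hyp by (auto simp: openin_open)
  have [measurable]: "S \<in> sets borel"
    unfolding V(2) using V(1) by (intro sets.Int) (auto intro: borel_closed closed_hyperplane)
  have nn1: "n \<bullet> n = 1" using n by (simp add: norm_eq_1)
  define g where "g x = indicator S x * h x" for x
  have "(\<lambda>x. indicator (closure S) x *\<^sub>R h x) \<in> borel_measurable borel"
    using h by (intro borel_measurable_continuous_on_indicator) auto
  then have "(\<lambda>x. indicator S x * (indicator (closure S) x *\<^sub>R h x)) \<in> borel_measurable borel" by measurable
  moreover have "(\<lambda>x. indicator S x * (indicator (closure S) x *\<^sub>R h x)) = g"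
    using closure_subset[of S] by (auto simp: g_def fun_eq_iff indicator_def)
  ultimately have [measurable]: "g \<in> borel_measurable borel" by simp
  have "compact (closure S)" using bdd by simp
  then have "bounded (h ` closure S)" using h compact_continuous_image compact_imp_bounded by blast
  then obtain M where M: "\<forall>y\<in>h ` closure S. norm y \<le> M" unfolding bounded_iff by blast
  obtain R where R: "\<forall>x\<in>S. norm x \<le> R" using bdd unfolding bounded_iff by blast
  let ?P = "shear_proj n c n"
  have P: "?P y = y - (n \<bullet> y - c) *\<^sub>R n" for y by (simp add: shear_proj_def nn1)
  have intP: "integrable lborel (\<lambda>y. indicator (slab n) y * g (?P y))"
  proof (rule integrable_bounded_support)
    show "bounded (cball (0::'a) (R + 1 + \<bar>c\<bar>))" by simp
    show "indicator (slab n) y * g (?P y) = 0" if out: "y \<notin> cball (0::'a) (R + 1 + \<bar>c\<bar>)" for y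
    proof (rule ccontr)
      assume "indicator (slab n) y * g (?P y) \<noteq> 0"
      then have y: "y \<in> slab n" "?P y \<in> S" by (auto simp: g_def indicator_def split: if_splits)
      have "norm y \<le> norm (?P y) + \<bar>n \<bullet> y - c\<bar>"
        using norm_triangle_ineq[of "?P y" "(n \<bullet> y - c) *\<^sub>R n"] n by (simp add: P)
      also have "\<dots> \<le> R + (1 + \<bar>c\<bar>)"
        using R y nn1 by (intro add_mono) (auto simp: slab_def)
      finally show False using out by simp
    qed
    show "\<bar>indicator (slab n) y * g (?P y)\<bar> \<le> \<bar>M\<bar>" for y
      using M closure_subset[of S] by (force simp: g_def indicator_def)
  qed measurable
  have nv: "n \<bullet> n \<noteq> 0" using nn1 by simp
  have int: "integrable (surface_measure S) g"
    using intP integrable_surface_measure[OF hyp n ne nv, of g] by simp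
  then show "set_integrable (surface_measure S) S h" by (simp add: set_integrable_def g_def[abs_def])
  fix x assume nn: "\<forall>x\<in>S. 0 \<le> h x" and zero: "(LINT x:S|surface_measure S. h x) = 0" and x: "x \<in> S"
  have g0: "0 \<le> g y" for y using nn by (auto simp: g_def indicator_def)
  have "(LINT y|lborel. indicator (slab n) y * g (?P y)) = 0"
    using integral_surface_measure[OF hyp n ne nv, of g] zero
    by (simp add: set_lebesgue_integral_def g_def)
  then have "AE y in lborel. indicator (slab n) y * g (?P y) = 0"
    using intP g0 by (subst (asm) integral_nonneg_eq_0_iff_AE) (auto simp: indicator_def)
  then have "AE y in lebesgue. indicator (slab n) y * g (?P y) = 0" by (rule AE_completion)
  then have N: "negligible {y. indicator (slab n) y * g (?P y) \<noteq> 0}" by (rule negligible_AE)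
  show "h x = 0"
  proof (rule ccontr)
    assume hx: "h x \<noteq> 0"
    have "openin (top_of_set S) (S \<inter> h -` (- {0}))"
      by (intro continuous_openin_preimage_gen continuous_on_subset[OF h] closure_subset) auto
    then obtain V' where V': "open V'" "S \<inter> h -` (- {0}) = S \<inter> V'" by (auto simp: openin_open)
    \<comment> \<open>The open part of the slab over the points of the face where \<open>h\<close>
      does not vanish.\<close>
    define W where "W = {y. 0 < n \<bullet> y} \<inter> {y. n \<bullet> y < 1} \<inter> ?P -` (V \<inter> V')"
    have "open W"
      unfolding W_def P using V(1) V'(1)
      by (intro open_Int open_vimage open_Collect_less continuous_intros) auto
    \<comment> \<open>The shift places the point over \<open>x\<close> at height \<open>1/2\<close>,
      in the middle of the slab.\<close>
    moreover have "x + (1/2 - c) *\<^sub>R n \<in> W"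
      using x V V'(2) hx nn1 by (auto simp: W_def P inner_add_right)
    ultimately have "\<not> negligible W" using open_not_negligible by blast
    moreover have "W \<subseteq> {y. indicator (slab n) y * g (?P y) \<noteq> 0}"
    proof
      fix y assume y: "y \<in> W"
      have "?P y \<in> S" using y by (auto simp: W_def V(2) P inner_diff_right nn1)
      moreover from this have "h (?P y) \<noteq> 0" using y V'(2) by (auto simp: W_def)
      ultimately show "y \<in> {y. indicator (slab n) y * g (?P y) \<noteq> 0}"
        using y nn1 by (simp add: W_def slab_def g_def)
    qed
    ultimately show False using N negligible_subset by blast
  qed
qed

text \<open>By induction on a spanning set, one Gram--Schmidt step each.\<close>

lemma riesz_finite_span:
  fixes B :: "('a \<Rightarrow> real) \<Rightarrow> ('a \<Rightarrow> real) \<Rightarrow> real" and e :: "'i \<Rightarrow> 'a \<Rightarrow> real"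
  assumes W_add: "\<And>f g. f \<in> W \<Longrightarrow> g \<in> W \<Longrightarrow> (\<lambda>x. f x + g x) \<in> W"
    and W_cmult: "\<And>f a. f \<in> W \<Longrightarrow> (\<lambda>x. a * f x) \<in> W"
    and B_add: "\<And>f g h. f \<in> W \<Longrightarrow> g \<in> W \<Longrightarrow> h \<in> W \<Longrightarrow> B (\<lambda>x. f x + g x) h = B f h + B g h"
    and B_cmult: "\<And>f h a. f \<in> W \<Longrightarrow> h \<in> W \<Longrightarrow> B (\<lambda>x. a * f x) h = a * B f h"
    and B_sym: "\<And>f g. f \<in> W \<Longrightarrow> g \<in> W \<Longrightarrow> B f g = B g f"
    and B_pos: "\<And>f. f \<in> W \<Longrightarrow> B f f = 0 \<Longrightarrow> f = (\<lambda>x. 0)"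
    and fin: "finite J" and e: "\<And>i. e i \<in> W" and zero: "(\<lambda>x. 0) \<in> W"
    and l_add: "\<And>f g. f \<in> W \<Longrightarrow> g \<in> W \<Longrightarrow> l (\<lambda>x. f x + g x) = l f + l g"
    and l_cmult: "\<And>f a. f \<in> W \<Longrightarrow> l (\<lambda>x. a * f x) = a * l f"
  shows "\<exists>p. (\<exists>c. p = (\<lambda>x. \<Sum>i\<in>J. c i * e i x)) \<and> (\<forall>c. B p (\<lambda>x. \<Sum>i\<in>J. c i * e i x) = l (\<lambda>x. \<Sum>i\<in>J. c i * e i x))"
  using fin l_add l_cmult
proof (induction J arbitrary: l rule: finite_induct)
  case empty
  have "l (\<lambda>x. 0) = 0" using empty(2)[OF zero, of 0] by simp
  moreover have "B (\<lambda>x. 0) (\<lambda>x. 0) = 0" using B_cmult[OF zero zero, of 0] by simp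
  ultimately show ?case by (intro exI[of _ "\<lambda>x. 0"]) simp
next
  case (insert k J)
  define V where "V c = (\<lambda>x. \<Sum>i\<in>J. c i * e i x)" for c
  have VW: "V c \<in> W" for c
    unfolding V_def using insert.hyps(1)
  proof (induction J rule: finite_induct)
    case empty
    then show ?case using zero by simp
  next
    case (insert i F)
    then show ?case using W_add[OF W_cmult[OF e, of "c i" i] insert.IH] by simp
  qed
  have V_add: "V (\<lambda>i. a i + b i) = (\<lambda>x. V a x + V b x)" for a b
    by (simp add: V_def distrib_right sum.distrib)
  have V_cmult: "V (\<lambda>i. s * a i) = (\<lambda>x. s * V a x)" for a s
    by (simp add: V_def sum_distrib_left mult.assoc)
  have V_insert: "(\<lambda>x. \<Sum>i\<in>insert k J. c i * e i x) = (\<lambda>x. c k * e k x + V c x)" for c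
    using insert.hyps by (simp add: V_def)
  obtain a where a: "\<And>c. B (V a) (V c) = l (V c)"
    using insert.IH[of l, OF insert.prems] unfolding V_def[symmetric] by blast
  obtain b where b: "\<And>c. B (V b) (V c) = B (e k) (V c)"
  proof -
    have "\<exists>p. (\<exists>c. p = (\<lambda>x. \<Sum>i\<in>J. c i * e i x)) \<and> (\<forall>c. B p (\<lambda>x. \<Sum>i\<in>J. c i * e i x) = B (e k) (\<lambda>x. \<Sum>i\<in>J. c i * e i x))"
    proof (rule insert.IH)
      fix f g assume "f \<in> W" "g \<in> W"
      then show "B (e k) (\<lambda>x. f x + g x) = B (e k) f + B (e k) g"
        using B_add[of f g "e k"] B_sym e W_add by metis
    next
      fix f and s :: real assume "f \<in> W"
      then show "B (e k) (\<lambda>x. s * f x) = s * B (e k) f"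
        using B_cmult[of f "e k" s] B_sym e W_cmult by metis
    qed
    then show thesis using that unfolding V_def[symmetric] by blast
  qed
  \<comment> \<open>The component of \<open>e k\<close> orthogonal to the span of the earlier
    vectors. It may vanish, since the vectors can be dependent.\<close>
  define r where "r = (\<lambda>x. e k x + V (\<lambda>i. - 1 * b i) x)"
  have rW: "r \<in> W" unfolding r_def by (intro W_add e VW)
  have rV: "B r (V c) = 0" for c
  proof -
    have "B r (V c) = B (e k) (V c) + B (V (\<lambda>i. - 1 * b i)) (V c)"
      unfolding r_def by (rule B_add[OF e VW VW])
    also have "B (V (\<lambda>i. - 1 * b i)) (V c) = - 1 * B (V b) (V c)"
      unfolding V_cmult by (rule B_cmult[OF VW VW])
    finally show ?thesis using b by simp
  qed
  have ek: "e k = (\<lambda>x. r x + V b x)" unfolding r_def by (simp only: V_cmult) simp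
  have rek: "B r (e k) = B r r"
  proof -
    have "B r (e k) = B (e k) r" by (rule B_sym[OF rW e])
    also have "\<dots> = B r r + B (V b) r" unfolding ek by (rule B_add[OF rW VW rW])
    also have "B (V b) r = 0" using B_sym[OF VW rW] rV by simp
    finally show ?thesis by simp
  qed
  have expand: "B p (\<lambda>x. c k * e k x + V c x) = c k * B p (e k) + B p (V c)" if "p \<in> W" for p c
  proof -
    have "B p (\<lambda>x. c k * e k x + V c x) = B (\<lambda>x. c k * e k x + V c x) p"
      by (intro B_sym that W_add W_cmult e VW)
    also have "\<dots> = c k * B (e k) p + B (V c) p"
      using B_add[OF W_cmult[OF e] VW that] B_cmult[OF e that] by simp
    finally show ?thesis using B_sym[OF that e] B_sym[OF that VW] by simp
  qed
  have l_expand: "l (\<lambda>x. c k * e k x + V c x) = c k * l (e k) + l (V c)" for c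
    using insert.prems(1)[OF W_cmult[OF e] VW] insert.prems(2)[OF e] by simp
  \<comment> \<open>If \<open>e k\<close> already lies in the earlier span, the value of
    \<open>l\<close> at \<open>e k\<close> is forced by linearity and no correction is made;
    otherwise \<open>t\<close> solves the one remaining equation.\<close>
  define t where "t = (if r = (\<lambda>x. 0) then 0 else (l (e k) - B (V a) (e k)) / B r r)"
  define p where "p = (\<lambda>x. V a x + t * r x)"
  have pW: "p \<in> W" unfolding p_def by (intro W_add W_cmult VW rW)
  have pB: "B p f = B (V a) f + t * B r f" if "f \<in> W" for f
    unfolding p_def using B_add[OF VW W_cmult[OF rW] that] B_cmult[OF rW that] by simp
  have pek: "B p (e k) = l (e k)"
  proof (cases "r = (\<lambda>x. 0)")
    case True
    then have "e k = V b" using ek by simp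
    then show ?thesis using pB[OF e, of k] a[of b] True by (simp add: t_def)
  next
    case False
    then have "B r r \<noteq> 0" using B_pos[OF rW] by blast
    then show ?thesis using pB[OF e, of k] rek False by (simp add: t_def)
  qed
  have "B p (\<lambda>x. c k * e k x + V c x) = l (\<lambda>x. c k * e k x + V c x)" for c
    unfolding expand[OF pW] l_expand pek using pB[OF VW] rV a by simp
  moreover have "\<exists>c. p = (\<lambda>x. \<Sum>i\<in>insert k J. c i * e i x)"
  proof -
    define c where "c = (\<lambda>i. a i + t * (- 1 * b i))(k := t)"
    have "V c = V (\<lambda>i. a i + t * (- 1 * b i))"
      unfolding V_def c_def using insert.hyps by (intro ext sum.cong) auto
    also have "\<dots> = (\<lambda>x. V a x + t * V (\<lambda>i. - 1 * b i) x)" by (simp only: V_add V_cmult)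
    finally have "(\<lambda>x. c k * e k x + V c x) = p"
      by (simp add: p_def r_def c_def fun_eq_iff algebra_simps)
    then show ?thesis unfolding V_insert by (intro exI[of _ c]) simp
  qed
  ultimately show ?case unfolding V_insert by blast
qed

text \<open>Common source of the projections and of the components of the discrete gradient:
  \<open>faithful\<close> makes the integral of a product a definite form on polynomials, and the
  monomials give a finite spanning set.\<close>

lemma poly_on_riesz:
  fixes X :: "(real^'n::finite) set"
  assumes \<mu>: "faithful \<mu> X"
    and l_add: "\<And>f g. f \<in> poly_on q X \<Longrightarrow> g \<in> poly_on q X \<Longrightarrow> l (\<lambda>x. f x + g x) = l f + l g"
    and l_cmult: "\<And>f a. f \<in> poly_on q X \<Longrightarrow> l (\<lambda>x. a * f x) = a * l f"
  shows "\<exists>!p. p \<in> poly_on q X \<and> (\<forall>r\<in>poly_on q X. (LINT x:X|\<mu>. p x * r x) = l r)"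
proof -
  define B where "B f g = (LINT x:X|\<mu>. f x * g x)" for f g :: "real^'n \<Rightarrow> real"
  \<comment> \<open>Indices outside \<open>multi_indices q\<close> are sent to the zero function
    because \<open>riesz_finite_span\<close> asks every \<open>e \<alpha>\<close> to lie in the
    space.\<close>
  define e where "e \<alpha> = (\<lambda>x :: real^'n. if x \<in> closure X then (if \<alpha> \<in> multi_indices q then monomial \<alpha> x else 0) else 0)" for \<alpha>
  let ?W = "poly_on q X"
  have int: "set_integrable \<mu> X (\<lambda>x. f x * g x)" if "f \<in> ?W" "g \<in> ?W" for f g
    using that by (intro faithful_integrable[OF \<mu>] continuous_intros poly_on_continuous)
  have B_add: "B (\<lambda>x. f x + g x) h = B f h + B g h" if "f \<in> ?W" "g \<in> ?W" "h \<in> ?W" for f g h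
    unfolding B_def using set_integral_add(2)[OF int[OF that(1,3)] int[OF that(2,3)]] by (simp add: distrib_right)
  have B_cmult: "B (\<lambda>x. a * f x) h = a * B f h" if "f \<in> ?W" "h \<in> ?W" for f h a
    unfolding B_def by (simp add: mult.assoc)
  have B_pos: "f = (\<lambda>x. 0)" if f: "f \<in> ?W" and "B f f = 0" for f
  proof -
    have "f x * f x = 0" if "x \<in> X" for x
      using f \<open>B f f = 0\<close> that unfolding B_def
      by (intro faithful_zero[OF \<mu>, of "\<lambda>x. f x * f x"] continuous_intros poly_on_continuous) auto
    then show ?thesis
      using poly_on_const[of X 0 q] by (intro poly_on_eqI[OF f, of _ q]) auto
  qed
  have eW: "e \<alpha> \<in> ?W" for \<alpha>
  proof (cases "\<alpha> \<in> multi_indices q")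
    case True
    then show ?thesis unfolding poly_on_iff e_def
      by (intro bexI[of _ "monomial \<alpha>"] monomial_in_polynomials) auto
  next
    case False
    then show ?thesis unfolding poly_on_iff e_def
      by (intro bexI[of _ "\<lambda>_. 0"] polynomials_zero) auto
  qed
  have span: "f \<in> ?W \<longleftrightarrow> (\<exists>c. f = (\<lambda>x. \<Sum>\<alpha>\<in>multi_indices q. c \<alpha> * e \<alpha> x))" for f
  proof -
    have eq: "(\<lambda>x. \<Sum>\<alpha>\<in>multi_indices q. c \<alpha> * e \<alpha> x) =
        (\<lambda>x. if x \<in> closure X then (\<Sum>\<alpha>\<in>multi_indices q. c \<alpha> * monomial \<alpha> x) else 0)" for c
      by (auto simp: e_def fun_eq_iff intro!: sum.cong)
    show ?thesis
    proof
      assume "f \<in> ?W"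
      then obtain p where "p \<in> polynomials q" and f: "f = (\<lambda>x. if x \<in> closure X then p x else 0)"
        by (auto simp: poly_on_iff)
      then obtain c where "p = (\<lambda>x. \<Sum>\<alpha>\<in>multi_indices q. c \<alpha> * monomial \<alpha> x)"
        by (auto simp: polynomials_iff)
      with f have "f = (\<lambda>x. \<Sum>\<alpha>\<in>multi_indices q. c \<alpha> * e \<alpha> x)" by (simp only: eq)
      then show "\<exists>c. f = (\<lambda>x. \<Sum>\<alpha>\<in>multi_indices q. c \<alpha> * e \<alpha> x)" by (rule exI[of _ c])
    next
      assume "\<exists>c. f = (\<lambda>x. \<Sum>\<alpha>\<in>multi_indices q. c \<alpha> * e \<alpha> x)"
      then obtain c where c: "f = (\<lambda>x. \<Sum>\<alpha>\<in>multi_indices q. c \<alpha> * e \<alpha> x)" by (elim exE)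
      show "f \<in> ?W" unfolding poly_on_iff
      proof (rule bexI)
        show "f = (\<lambda>x. if x \<in> closure X then (\<Sum>\<alpha>\<in>multi_indices q. c \<alpha> * monomial \<alpha> x) else 0)"
          unfolding c by (rule eq)
        show "(\<lambda>x. \<Sum>\<alpha>\<in>multi_indices q. c \<alpha> * monomial \<alpha> x) \<in> polynomials q"
          unfolding polynomials_iff by (rule exI) (rule refl)
      qed
    qed
  qed
  have "\<exists>p. (\<exists>c. p = (\<lambda>x. \<Sum>\<alpha>\<in>multi_indices q. c \<alpha> * e \<alpha> x)) \<and>
      (\<forall>c. B p (\<lambda>x. \<Sum>\<alpha>\<in>multi_indices q. c \<alpha> * e \<alpha> x) = l (\<lambda>x. \<Sum>\<alpha>\<in>multi_indices q. c \<alpha> * e \<alpha> x))"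
  proof (rule riesz_finite_span[where W = ?W])
    show "B f g = B g f" for f g by (simp add: B_def mult.commute)
    show "(\<lambda>x. 0) \<in> ?W" using poly_on_const[of X 0 q] by simp
  qed (assumption | rule poly_on_add poly_on_cmult B_add B_cmult B_pos finite_multi_indices eW l_add l_cmult)+
  then obtain p where p: "p \<in> ?W" "\<And>r. r \<in> ?W \<Longrightarrow> B p r = l r" unfolding span by blast
  show ?thesis
  proof (rule ex1I[of _ p])
    show "p \<in> ?W \<and> (\<forall>r\<in>?W. (LINT x:X|\<mu>. p x * r x) = l r)" using p by (simp add: B_def)
    fix p' assume p': "p' \<in> ?W \<and> (\<forall>r\<in>?W. (LINT x:X|\<mu>. p' x * r x) = l r)"
    define d where "d = (\<lambda>x. p' x + (-1) * p x)"
    have d: "d \<in> ?W" unfolding d_def using p' p by (intro poly_on_add poly_on_cmult) auto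
    have "B d d = B p' d + (-1) * B p d"
      using B_add[of p' "\<lambda>x. (-1) * p x" d] B_cmult[of p d "-1"] p(1) p' d poly_on_cmult[OF p(1), of "-1"]
      unfolding d_def[symmetric] by simp
    also have "\<dots> = 0" using p(2)[OF d] p' d by (simp add: B_def)
    finally have "d = (\<lambda>x. 0)" by (rule B_pos[OF d])
    then show "p' = p" by (auto simp: d_def fun_eq_iff)
  qed
qed

lemma L2_proj:
  fixes X :: "(real^'n::finite) set"
  assumes \<mu>: "faithful \<mu> X" and f: "\<And>r. r \<in> poly_on q X \<Longrightarrow> set_integrable \<mu> X (\<lambda>x. f x * r x)"
  shows "L2_proj \<mu> q X f \<in> poly_on q X"
    and "\<And>r. r \<in> poly_on q X \<Longrightarrow> (LINT x:X|\<mu>. L2_proj \<mu> q X f x * r x) = (LINT x:X|\<mu>. f x * r x)"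
    and "\<And>p. p \<in> poly_on q X \<Longrightarrow> (\<And>r. r \<in> poly_on q X \<Longrightarrow> (LINT x:X|\<mu>. p x * r x) = (LINT x:X|\<mu>. f x * r x)) \<Longrightarrow>
      L2_proj \<mu> q X f = p"
proof -
  have ex: "\<exists>!p. p \<in> poly_on q X \<and> (\<forall>r\<in>poly_on q X. (LINT x:X|\<mu>. p x * r x) = (LINT x:X|\<mu>. f x * r x))"
  proof (rule poly_on_riesz[OF \<mu>])
    show "(LINT x:X|\<mu>. f x * (g x + h x)) = (LINT x:X|\<mu>. f x * g x) + (LINT x:X|\<mu>. f x * h x)"
      if "g \<in> poly_on q X" "h \<in> poly_on q X" for g h
      using set_integral_add(2)[OF f[OF that(1)] f[OF that(2)]] by (simp add: distrib_left)
    show "(LINT x:X|\<mu>. f x * (a * g x)) = a * (LINT x:X|\<mu>. f x * g x)" for g a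
      by (simp add: mult.left_commute)
  qed
  from theI'[OF ex] show "L2_proj \<mu> q X f \<in> poly_on q X"
    "\<And>r. r \<in> poly_on q X \<Longrightarrow> (LINT x:X|\<mu>. L2_proj \<mu> q X f x * r x) = (LINT x:X|\<mu>. f x * r x)"
    unfolding L2_proj_def by blast+
  show "L2_proj \<mu> q X f = p"
    if "p \<in> poly_on q X" "\<And>r. r \<in> poly_on q X \<Longrightarrow> (LINT x:X|\<mu>. p x * r x) = (LINT x:X|\<mu>. f x * r x)" for p
    unfolding L2_proj_def using ex that by (intro the1_equality) auto
qed

lemma L2_proj_continuous_integrable:
  assumes "faithful \<mu> X" "continuous_on (closure X) f" "r \<in> poly_on q X"
  shows "set_integrable \<mu> X (\<lambda>x. f x * r x)"
  by (intro faithful_integrable[OF assms(1)] continuous_on_mult assms(2) poly_on_continuous[OF assms(3)])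

text \<open>Only values on \<open>X\<close> enter the integrals, so \<open>f\<close> may be
  arbitrary elsewhere; a constant is its own projection because constants are polynomials of every
  degree.\<close>

lemma L2_proj_constant:
  fixes X :: "(real^'n::finite) set"
  assumes \<mu>: "faithful \<mu> X" and f: "\<And>x. x \<in> X \<Longrightarrow> f x = a"
  shows "L2_proj \<mu> q X f = (\<lambda>x. if x \<in> closure X then a else 0)"
proof -
  have eq: "indicator X x *\<^sub>R (f x * r x) = indicator X x *\<^sub>R (a * r x)"
    "indicator X x *\<^sub>R ((if x \<in> closure X then a else 0) * r x) = indicator X x *\<^sub>R (a * r x)" for x and r :: "real^'n \<Rightarrow> real"
    using f closure_subset[of X] by (auto simp: indicator_def)
  show ?thesis
  proof (rule L2_proj(3)[OF \<mu>])
    fix r :: "real^'n \<Rightarrow> real" assume r: "r \<in> poly_on q X"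
    have "set_integrable \<mu> X (\<lambda>x. a * r x)"
      using L2_proj_continuous_integrable[OF \<mu> _ r, of "\<lambda>_. a"] by simp
    then show "set_integrable \<mu> X (\<lambda>x. f x * r x)" unfolding set_integrable_def eq .
    show "(LINT x:X|\<mu>. (if x \<in> closure X then a else 0) * r x) = (LINT x:X|\<mu>. f x * r x)"
      unfolding set_lebesgue_integral_def eq ..
  qed (rule poly_on_const)
qed

context flat_boundary
begin

text \<open>Both sides are linear in \<open>w\<close>, and the transversal directions fill all but
  finitely many hyperplanes. A non-zero defect vector \<open>z\<close> would fail to be orthogonal
  to one of them.\<close>

theorem divergence_theorem:
  fixes p :: "'a \<Rightarrow> real" and Gp :: "'a \<Rightarrow> 'a"
  assumes p: "\<And>x. (p has_derivative (\<lambda>h. Gp x \<bullet> h)) (at x)" "continuous_on UNIV Gp"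
  shows "(LINT x|lborel. indicator K x * (Gp x \<bullet> w))
    = (\<Sum>\<sigma>\<in>\<S>. (\<nu> \<sigma> \<bullet> w) * (LINT x|surface_measure \<sigma>. indicator \<sigma> x * p x))"
proof -
  have "integrable lborel (\<lambda>x. indicator (closure K) x *\<^sub>R Gp x)"
    using p(2) bounded_K by (intro borel_integrable_compact) (auto intro: continuous_on_subset)
  then have "set_integrable lborel (closure K) Gp" by (simp add: set_integrable_def)
  then have "set_integrable lborel K Gp"
    by (rule set_integrable_subset) (use open_K closure_subset in auto)
  then have int: "integrable lborel (\<lambda>x. indicator K x *\<^sub>R Gp x)" by (simp add: set_integrable_def)
  define z where "z = (LINT x|lborel. indicator K x *\<^sub>R Gp x) -
    (\<Sum>\<sigma>\<in>\<S>. (LINT x|surface_measure \<sigma>. indicator \<sigma> x * p x) *\<^sub>R \<nu> \<sigma>)"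
  have z: "z \<bullet> v = (LINT x|lborel. indicator K x * (Gp x \<bullet> v)) -
      (\<Sum>\<sigma>\<in>\<S>. (\<nu> \<sigma> \<bullet> v) * (LINT x|surface_measure \<sigma>. indicator \<sigma> x * p x))" for v
    using integral_inner_left[OF int, of v]
    by (simp add: z_def inner_diff_left inner_sum_left mult.commute)
  have "z = 0"
  proof (rule ccontr)
    assume "z \<noteq> 0"
    have nz: "\<nu> \<sigma> \<noteq> 0" if "\<sigma> \<in> \<S>" for \<sigma> using norm_normal[OF that] by auto
    have "negligible ({v. z \<bullet> v = 0} \<union> (\<Union>\<sigma>\<in>\<S>. {v. \<nu> \<sigma> \<bullet> v = 0}))"
      using \<open>z \<noteq> 0\<close> finite_faces nz
      by (intro negligible_Un negligible_Union negligible_hyperplane) (auto intro!: negligible_hyperplane)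
    then have "{v. z \<bullet> v = 0} \<union> (\<Union>\<sigma>\<in>\<S>. {v. \<nu> \<sigma> \<bullet> v = 0}) \<noteq> UNIV"
      using open_not_negligible[OF open_UNIV UNIV_not_empty] by metis
    then obtain v where v: "z \<bullet> v \<noteq> 0" "\<And>\<sigma>. \<sigma> \<in> \<S> \<Longrightarrow> \<nu> \<sigma> \<bullet> v \<noteq> 0" by blast
    moreover have "v \<noteq> 0" using v(1) by auto
    ultimately have "z \<bullet> v = 0" using divergence_transversal[OF p, of v] z by simp
    then show False using v(1) by simp
  qed
  then show ?thesis using z[of w] by simp
qed

end

subsection \<open>Meshes and the discrete gradient\<close>

text \<open>\<open>dim\<close> makes every face at least one-dimensional; hence faces are non-empty
  and have positive diameter.\<close>

locale mesh_on =
  fixes \<Omega> :: "(real^'n::finite) set" and D :: "'n mesh"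
  assumes dim: "CARD('n) \<ge> 2" and mesh: "polytopal_mesh \<Omega> D"
begin

lemma finite_cells: "finite (cells D)" and finite_faces: "finite (faces D)"
  and closure_domain: "closure \<Omega> = (\<Union>K\<in>cells D. closure K)"
  and cells_disjoint: "pairwise disjnt (cells D)" and faces_disjoint: "pairwise disjnt (faces D)"
  and frontier_cells: "(\<Union>K\<in>cells D. frontier K) = (\<Union>\<sigma>\<in>faces D. closure \<sigma>)"
  and mesh_cells: "\<forall>K\<in>cells D. K \<subseteq> \<Omega> \<and> open K \<and> polytopal (int CARD('n)) K \<and> lipschitz_boundary K \<and>
        0 < emeasure lebesgue K"
  and mesh_faces: "\<forall>\<sigma>\<in>faces D. \<sigma> \<subseteq> closure \<Omega> \<and> connected \<sigma> \<and> openin (top_of_set (affine hull \<sigma>)) \<sigma> \<and>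
        polytopal (int CARD('n) - 1) \<sigma> \<and> lipschitz_boundary \<sigma> \<and>
        0 < emeasure (surface_measure \<sigma>) \<sigma>"
  and mesh_cell_faces: "\<forall>K\<in>cells D. cell_faces D K \<subseteq> faces D \<and> frontier K = (\<Union>\<sigma>\<in>cell_faces D K. closure \<sigma>)"
  using mesh unfolding polytopal_mesh_def by - (elim conjE, assumption)+

lemma cell_props:
  assumes "K \<in> cells D"
  shows "open K" "lipschitz_boundary K" "bounded K" "K \<noteq> {}" "K \<subseteq> \<Omega>"
    "cell_faces D K \<subseteq> faces D" "frontier K = (\<Union>\<sigma>\<in>cell_faces D K. closure \<sigma>)"
  using bspec[OF mesh_cells assms] bspec[OF mesh_cell_faces assms] bounded_polytopal[of "int CARD('n)" K]
  by auto

lemma face_props: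
  assumes "\<sigma> \<in> faces D"
  shows "\<sigma> \<subseteq> closure \<Omega>" "connected \<sigma>" "openin (top_of_set (affine hull \<sigma>)) \<sigma>" "bounded \<sigma>" "\<sigma> \<noteq> {}"
    "polytopal (int CARD('n) - 1) \<sigma>" "aff_dim \<sigma> = int CARD('n) - 1"
proof -
  show pt: "polytopal (int CARD('n) - 1) \<sigma>" and "\<sigma> \<subseteq> closure \<Omega>" "connected \<sigma>" "openin (top_of_set (affine hull \<sigma>)) \<sigma>"
    using bspec[OF mesh_faces assms] by - (elim conjE, assumption)+
  show "bounded \<sigma>" using bounded_polytopal[OF pt] dim by simp
  show ad: "aff_dim \<sigma> = int CARD('n) - 1" using aff_dim_polytopal[OF pt] dim by simp
  show "\<sigma> \<noteq> {}" using ad dim by auto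
qed

lemma cell_face:
  assumes "K \<in> cells D" "\<sigma> \<in> cell_faces D K"
  shows "\<sigma> \<in> faces D" "\<sigma> \<subseteq> frontier K" "closure \<sigma> \<subseteq> closure K"
    "norm (outward_normal K \<sigma>) = 1"
    "\<exists>c. affine hull \<sigma> = {x. outward_normal K \<sigma> \<bullet> x = c}"
    "\<And>x. x \<in> \<sigma> \<Longrightarrow> \<exists>r>0. \<forall>y\<in>ball x r. y \<in> K \<longleftrightarrow> outward_normal K \<sigma> \<bullet> (y - x) < 0"
proof -
  show \<sigma>: "\<sigma> \<in> faces D" using assms cell_props(6) by blast
  have "closure \<sigma> \<subseteq> frontier K" using assms cell_props(7) by blast
  then show fr: "\<sigma> \<subseteq> frontier K" "closure \<sigma> \<subseteq> closure K"
    using closure_subset[of \<sigma>] by (auto simp: frontier_def)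
  have dim': "aff_dim \<sigma> = int DIM(real^'n) - 1" using face_props(7)[OF \<sigma>] by simp
  note on = outward_normal[OF cell_props(1,2)[OF assms(1)] fr(1) face_props(2,5,3)[OF \<sigma>] dim']
  show "norm (outward_normal K \<sigma>) = 1"
    "\<exists>c. affine hull \<sigma> = {x. outward_normal K \<sigma> \<bullet> x = c}"
    "\<And>x. x \<in> \<sigma> \<Longrightarrow> \<exists>r>0. \<forall>y\<in>ball x r. y \<in> K \<longleftrightarrow> outward_normal K \<sigma> \<bullet> (y - x) < 0"
    using on by blast+
qed

lemma face_hyperplane:
  assumes "\<sigma> \<in> faces D"
  obtains n c where "norm n = 1" "affine hull \<sigma> = {x. n \<bullet> x = c}"
proof -
  obtain a b where ab: "a \<noteq> 0" "affine hull \<sigma> = {x. a \<bullet> x = b}"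
    using aff_dim_eq_hyperplane[of \<sigma>] face_props(7)[OF assms] by auto
  then have "norm (a /\<^sub>R norm a) = 1" "affine hull \<sigma> = {x. (a /\<^sub>R norm a) \<bullet> x = b / norm a}"
    by (auto simp: field_simps)
  then show thesis by (rule that)
qed

lemma faithful_cell: "K \<in> cells D \<Longrightarrow> faithful lebesgue K"
  by (rule faithful_lebesgue) (rule cell_props, assumption)+

lemma faithful_face:
  assumes "\<sigma> \<in> faces D"
  shows "faithful (surface_measure \<sigma>) \<sigma>"
proof -
  obtain n c where "norm n = 1" "affine hull \<sigma> = {x. n \<bullet> x = c}" using face_hyperplane[OF assms] .
  then show ?thesis using face_props(3,4,5)[OF assms] by (intro faithful_surface_measure)
qed

lemma ridges_exist:
  obtains \<F> where "finite \<F>" "\<And>F. F \<in> \<F> \<Longrightarrow> affine F" "\<And>F. F \<in> \<F> \<Longrightarrow> aff_dim F = int CARD('n) - 2"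
    "\<And>\<sigma>. \<sigma> \<in> faces D \<Longrightarrow> closure \<sigma> - \<sigma> \<subseteq> \<Union>\<F>"
proof -
  define Q where "Q \<sigma> \<F> \<longleftrightarrow> finite \<F> \<and> (\<forall>F\<in>\<F>. affine F \<and> aff_dim F = int CARD('n) - 2) \<and> closure \<sigma> - \<sigma> \<subseteq> \<Union>\<F>"
    for \<sigma> and \<F> :: "(real^'n) set set"
  have "\<exists>\<F>. Q \<sigma> \<F>" if \<sigma>: "\<sigma> \<in> faces D" for \<sigma>
  proof -
    have "int CARD('n) - 1 \<ge> 0" using dim by simp
    then obtain \<F> where "finite \<F>" "\<And>F. F \<in> \<F> \<Longrightarrow> affine F" "\<And>F. F \<in> \<F> \<Longrightarrow> aff_dim F = int CARD('n) - 1 - 1" "closure \<sigma> - \<sigma> \<subseteq> \<Union>\<F>"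
      by (rule closure_polytopal_diff[OF face_props(6)[OF \<sigma>]]) (rule that)
    then show ?thesis by (intro exI[of _ \<F>]) (auto simp: Q_def)
  qed
  then obtain f where f: "\<And>\<sigma>. \<sigma> \<in> faces D \<Longrightarrow> Q \<sigma> (f \<sigma>)" using bchoice[of "faces D" Q] by blast
  show thesis
  proof
    show "finite (\<Union>(f ` faces D))" using f finite_faces by (auto simp: Q_def)
    show "affine F" "aff_dim F = int CARD('n) - 2" if "F \<in> \<Union>(f ` faces D)" for F
      using f that by (auto simp: Q_def)
    show "closure \<sigma> - \<sigma> \<subseteq> \<Union>(\<Union>(f ` faces D))" if "\<sigma> \<in> faces D" for \<sigma>
      using f[OF that] that unfolding Q_def by blast
  qed
qed

lemma cell_divergence:
  fixes p :: "real^'n \<Rightarrow> real" and Gp :: "real^'n \<Rightarrow> real^'n"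
  assumes K: "K \<in> cells D"
    and p: "\<And>x. (p has_derivative (\<lambda>h. Gp x \<bullet> h)) (at x)" "continuous_on UNIV Gp"
  shows "(LINT x:K|lebesgue. Gp x \<bullet> w)
    = (\<Sum>\<sigma>\<in>cell_faces D K. (outward_normal K \<sigma> \<bullet> w) * (LINT x:\<sigma>|surface_measure \<sigma>. p x))"
proof -
  obtain \<F> where \<F>: "finite \<F>" "\<And>F. F \<in> \<F> \<Longrightarrow> affine F" "\<And>F. F \<in> \<F> \<Longrightarrow> aff_dim F = int CARD('n) - 2"
    "\<And>\<sigma>. \<sigma> \<in> faces D \<Longrightarrow> closure \<sigma> - \<sigma> \<subseteq> \<Union>\<F>"
    by (rule ridges_exist) (rule that)
  interpret flat_boundary K "cell_faces D K" "outward_normal K" \<F>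
  proof
    show "finite (cell_faces D K)" using cell_props(6)[OF K] finite_faces finite_subset by blast
    show "pairwise disjnt (cell_faces D K)" using cell_props(6)[OF K] faces_disjoint pairwise_subset by blast
    show "\<sigma> \<in> sets borel" if \<sigma>: "\<sigma> \<in> cell_faces D K" for \<sigma>
    proof -
      obtain V where "open V" "\<sigma> = affine hull \<sigma> \<inter> V"
        using face_props(3)[OF cell_face(1)[OF K \<sigma>]] by (auto simp: openin_open)
      then show ?thesis using closed_affine_hull[of \<sigma>] by (metis borel_closed borel_open sets.Int)
    qed
    show "aff_dim F \<le> int DIM(real^'n) - 2" if "F \<in> \<F>" for F using \<F>(3)[OF that] by simp
    show "closure \<sigma> - \<sigma> \<subseteq> \<Union>\<F>" if "\<sigma> \<in> cell_faces D K" for \<sigma> using \<F>(4)[OF cell_face(1)[OF K that]] .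
    show "\<sigma> \<noteq> {}" if "\<sigma> \<in> cell_faces D K" for \<sigma> using face_props(5)[OF cell_face(1)[OF K that]] .
    show "open K" "bounded K" "frontier K = (\<Union>\<sigma>\<in>cell_faces D K. closure \<sigma>)" using cell_props[OF K] by blast+
    show "\<exists>c. affine hull \<sigma> = {x. outward_normal K \<sigma> \<bullet> x = c}" "norm (outward_normal K \<sigma>) = 1"
      if "\<sigma> \<in> cell_faces D K" for \<sigma>
      using cell_face(4,5)[OF K that] by blast+
    show "\<exists>r>0. \<forall>y\<in>ball x r. y \<in> K \<longleftrightarrow> outward_normal K \<sigma> \<bullet> (y - x) < 0"
      if "\<sigma> \<in> cell_faces D K" "x \<in> \<sigma>" for \<sigma> x
      by (rule cell_face(6)[OF K that])
    show "finite \<F>" by (rule \<F>(1))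
  qed
  have [measurable]: "K \<in> sets borel" using cell_props(1)[OF K] by auto
  have [measurable]: "Gp \<in> borel_measurable borel" using p(2) by (rule borel_measurable_continuous_onI)
  have "(LINT x:K|lebesgue. Gp x \<bullet> w) = (LINT x|lborel. indicator K x * (Gp x \<bullet> w))"
    unfolding set_lebesgue_integral_def by (subst integral_completion) auto
  then show ?thesis using divergence_theorem[OF p, of w] by (simp add: set_lebesgue_integral_def)
qed

end

section \<open>The discrete gradient of a cell\<close>

lemma partial_eq_gradient:
  fixes r :: "real^'n::finite \<Rightarrow> real"
  assumes "open K" "x \<in> K" and eq: "\<And>y. y \<in> K \<Longrightarrow> r y = p y" and p: "(p has_derivative (\<lambda>h. G \<bullet> h)) (at x)"
  shows "partial i r x = G $ i"
proof -
  have "(r has_derivative (\<lambda>h. G \<bullet> h)) (at x)"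
    using p by (rule has_derivative_transform_within_open[OF _ assms(1,2)]) (simp add: eq)
  then show ?thesis
    by (simp add: partial_def frechet_derivative_at[symmetric] inner_axis)
qed

text \<open>\<open>partial\<close> differentiates the total function, which may jump where the zero
  extension begins. Derivatives are therefore controlled only on the open cell, while the values of
  \<open>r\<close> are controlled up to its boundary.\<close>

lemma poly_on_gradient:
  fixes r :: "real^'n::finite \<Rightarrow> real"
  assumes "r \<in> poly_on q K" "open K"
  obtains p G where "p \<in> polynomials q" "\<And>x. x \<in> closure K \<Longrightarrow> r x = p x"
    "\<And>x. (p has_derivative (\<lambda>h. G x \<bullet> h)) (at x)" "\<And>i. (\<lambda>x. G x $ i) \<in> polynomials q"
    "\<And>i x. x \<in> K \<Longrightarrow> partial i r x = G x $ i"
proof -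
  obtain p where p: "p \<in> polynomials q" "r = (\<lambda>x. if x \<in> closure K then p x else 0)"
    using assms(1) by (auto simp: poly_on_iff)
  have "p \<in> polynomials (Suc q)" using p(1) polynomials_mono[of q "Suc q"] by auto
  then obtain G where G: "\<And>x. (p has_derivative (\<lambda>h. G x \<bullet> h)) (at x)" "\<And>i. (\<lambda>x. G x $ i) \<in> polynomials q"
    by (rule polynomials_gradient) (rule that)
  have "partial i r x = G x $ i" if "x \<in> K" for i x
    using closure_subset[of K] by (intro partial_eq_gradient[OF assms(2) that _ G(1)]) (auto simp: p(2))
  then show thesis using p G by (intro that[of p G]) auto
qed

lemma LINT_set_cong:
  fixes f g :: "'a \<Rightarrow> real"
  assumes "\<And>x. x \<in> A \<Longrightarrow> f x = g x"
  shows "(LINT x:A|M. f x) = (LINT x:A|M. g x)"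
proof -
  have "indicator A x *\<^sub>R f x = indicator A x *\<^sub>R g x" for x using assms by (auto simp: indicator_def)
  then show ?thesis unfolding set_lebesgue_integral_def by presburger
qed

lemma set_integrable_eq:
  fixes f g :: "'a \<Rightarrow> real"
  assumes "\<And>x. x \<in> A \<Longrightarrow> f x = g x" "set_integrable M A g"
  shows "set_integrable M A f"
proof -
  have "(\<lambda>x. indicator A x *\<^sub>R f x) = (\<lambda>x. indicator A x *\<^sub>R g x)" using assms by (auto simp: indicator_def)
  then show ?thesis using assms(2) by (simp only: set_integrable_def)
qed

lemma LINT_set_sum:
  fixes f :: "'i \<Rightarrow> 'a \<Rightarrow> real"
  assumes "\<And>i. i \<in> I \<Longrightarrow> set_integrable M A (f i)"
  shows "(LINT x:A|M. (\<Sum>i\<in>I. f i x)) = (\<Sum>i\<in>I. LINT x:A|M. f i x)"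
  using assms unfolding set_lebesgue_integral_def set_integrable_def
  by (simp only: scaleR_sum_right) (rule Bochner_Integration.integral_sum)

context mesh_on
begin

lemma cell_face_integrable:
  assumes "K \<in> cells D" "\<sigma> \<in> cell_faces D K" "continuous_on (closure K) (h :: real^'n \<Rightarrow> real)"
  shows "set_integrable (surface_measure \<sigma>) \<sigma> h"
  using faithful_integrable[OF faithful_face[OF cell_face(1)[OF assms(1,2)]]]
    continuous_on_subset[OF assms(3) cell_face(3)[OF assms(1,2)]] .

text \<open>Divergence and normal component are sums over coordinates, so the defining functional
  splits into functionals of the single components of the test field, and each component of the
  gradient is a Riesz representative.\<close>

lemma discrete_grad:
  assumes K: "K \<in> cells D"
    and vc: "continuous_on (closure K) (cell v K)"
    and vf: "\<And>\<sigma>. \<sigma> \<in> cell_faces D K \<Longrightarrow> continuous_on (closure \<sigma>) (face v \<sigma>)"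
  defines "E \<tau> \<equiv> - (LINT x:K|lebesgue. cell v K x * divergence \<tau> x)
       + (\<Sum>\<sigma>\<in>cell_faces D K. LINT x:\<sigma>|surface_measure \<sigma>. face v \<sigma> x * (\<tau> x \<bullet> outward_normal K \<sigma>))"
  shows "discrete_grad k D K v \<in> vec_poly_on k K"
    and "\<And>\<tau>. \<tau> \<in> vec_poly_on k K \<Longrightarrow> (LINT x:K|lebesgue. discrete_grad k D K v x \<bullet> \<tau> x) = E \<tau>"
    and "\<And>G. G \<in> vec_poly_on k K \<Longrightarrow> (\<And>\<tau>. \<tau> \<in> vec_poly_on k K \<Longrightarrow> (LINT x:K|lebesgue. G x \<bullet> \<tau> x) = E \<tau>) \<Longrightarrow>
      discrete_grad k D K v = G"
proof -
  let ?W = "poly_on k K"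
  have oK: "open K" using cell_props(1)[OF K] .
  \<comment> \<open>The part of the defining functional that sees only the \<open>i\<close>-th
    component of the test field.\<close>
  define l where "l i r = - (LINT x:K|lebesgue. cell v K x * partial i r x)
       + (\<Sum>\<sigma>\<in>cell_faces D K. LINT x:\<sigma>|surface_measure \<sigma>. face v \<sigma> x * (r x * outward_normal K \<sigma> $ i))"
    for i and r :: "real^'n \<Rightarrow> real"
  have icell: "set_integrable lebesgue K (\<lambda>x. cell v K x * partial i r x)" if r: "r \<in> ?W" for i r
  proof -
    obtain p G where G: "\<And>i. (\<lambda>x. G x $ i) \<in> polynomials k" "\<And>i x. x \<in> K \<Longrightarrow> partial i r x = G x $ i"
      by (rule poly_on_gradient[OF r oK]) (rule that)
    have "set_integrable lebesgue K (\<lambda>x. cell v K x * G x $ i)"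
      by (intro faithful_integrable[OF faithful_cell[OF K]] continuous_on_mult vc polynomials_continuous[OF G(1)])
    then show ?thesis by (rule set_integrable_eq[rotated]) (simp add: G(2))
  qed
  have iface: "set_integrable (surface_measure \<sigma>) \<sigma> (\<lambda>x. face v \<sigma> x * (r x * c))"
    if "r \<in> ?W" "\<sigma> \<in> cell_faces D K" for \<sigma> r c
    by (intro faithful_integrable[OF faithful_face[OF cell_face(1)[OF K that(2)]]] continuous_on_mult vf that
        continuous_on_const continuous_on_subset[OF poly_on_continuous[OF that(1)] cell_face(3)[OF K that(2)]])
  have padd: "partial i (\<lambda>x. f x + g x) x = partial i f x + partial i g x" if fW: "f \<in> ?W" and gW: "g \<in> ?W" and x: "x \<in> K" for f g i x
  proof -
    obtain p F where F: "\<And>x. x \<in> closure K \<Longrightarrow> f x = p x" "\<And>x. (p has_derivative (\<lambda>h. F x \<bullet> h)) (at x)"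
      "\<And>i x. x \<in> K \<Longrightarrow> partial i f x = F x $ i" by (rule poly_on_gradient[OF fW oK]) (rule that)
    obtain q G where G: "\<And>x. x \<in> closure K \<Longrightarrow> g x = q x" "\<And>x. (q has_derivative (\<lambda>h. G x \<bullet> h)) (at x)"
      "\<And>i x. x \<in> K \<Longrightarrow> partial i g x = G x $ i" by (rule poly_on_gradient[OF gW oK]) (rule that)
    have "((\<lambda>x. p x + q x) has_derivative (\<lambda>h. (F x + G x) \<bullet> h)) (at x)"
      using has_derivative_add[OF F(2) G(2)] by (simp add: inner_add_left)
    then have "partial i (\<lambda>x. f x + g x) x = (F x + G x) $ i"
      using closure_subset[of K] by (intro partial_eq_gradient[OF oK x]) (auto simp: F(1) G(1))
    then show ?thesis using F(3) G(3) x by simp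
  qed
  have pcmult: "partial i (\<lambda>x. a * f x) x = a * partial i f x" if fW: "f \<in> ?W" and x: "x \<in> K" for f a i x
  proof -
    obtain p F where F: "\<And>x. x \<in> closure K \<Longrightarrow> f x = p x" "\<And>x. (p has_derivative (\<lambda>h. F x \<bullet> h)) (at x)"
      "\<And>i x. x \<in> K \<Longrightarrow> partial i f x = F x $ i" by (rule poly_on_gradient[OF fW oK]) (rule that)
    have "((\<lambda>x. a * p x) has_derivative (\<lambda>h. (a *\<^sub>R F x) \<bullet> h)) (at x)"
      using has_derivative_mult_right[OF F(2), of a] by simp
    then have "partial i (\<lambda>x. a * f x) x = (a *\<^sub>R F x) $ i"
      using closure_subset[of K] by (intro partial_eq_gradient[OF oK x]) (auto simp: F(1))
    then show ?thesis using F(3) x by simp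
  qed
  have l_add: "l i (\<lambda>x. f x + g x) = l i f + l i g" if "f \<in> ?W" "g \<in> ?W" for f g i
  proof -
    have "(LINT x:K|lebesgue. cell v K x * partial i (\<lambda>x. f x + g x) x)
        = (LINT x:K|lebesgue. cell v K x * partial i f x + cell v K x * partial i g x)"
      using that by (intro LINT_set_cong) (simp add: padd distrib_left)
    also have "\<dots> = (LINT x:K|lebesgue. cell v K x * partial i f x) + (LINT x:K|lebesgue. cell v K x * partial i g x)"
      by (intro set_integral_add icell that)
    finally have 1: "(LINT x:K|lebesgue. cell v K x * partial i (\<lambda>x. f x + g x) x) = \<dots>" .
    have 2: "(LINT x:\<sigma>|surface_measure \<sigma>. face v \<sigma> x * ((f x + g x) * outward_normal K \<sigma> $ i))
      = (LINT x:\<sigma>|surface_measure \<sigma>. face v \<sigma> x * (f x * outward_normal K \<sigma> $ i))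
      + (LINT x:\<sigma>|surface_measure \<sigma>. face v \<sigma> x * (g x * outward_normal K \<sigma> $ i))" if \<sigma>: "\<sigma> \<in> cell_faces D K" for \<sigma>
      using set_integral_add(2)[OF iface[OF \<open>f \<in> ?W\<close> \<sigma>] iface[OF \<open>g \<in> ?W\<close> \<sigma>]]
      by (simp add: distrib_left distrib_right)
    show ?thesis unfolding l_def 1 by (simp add: 2 sum.distrib)
  qed
  have l_cmult: "l i (\<lambda>x. a * f x) = a * l i f" if "f \<in> ?W" for f a i
  proof -
    have 1: "(LINT x:K|lebesgue. cell v K x * partial i (\<lambda>x. a * f x) x)
        = (LINT x:K|lebesgue. a * (cell v K x * partial i f x))"
      using that by (intro LINT_set_cong) (simp add: pcmult)
    have 2: "face v \<sigma> x * (a * f x * c) = a * (face v \<sigma> x * (f x * c))" for \<sigma> x c by simp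
    show ?thesis unfolding l_def 1 2 by (simp add: sum_distrib_left right_diff_distrib)
  qed
  have E: "E \<tau> = (\<Sum>i\<in>UNIV. l i (\<lambda>x. \<tau> x $ i))" if \<tau>: "\<tau> \<in> vec_poly_on k K" for \<tau>
  proof -
    have \<tau>i: "(\<lambda>x. \<tau> x $ i) \<in> ?W" for i using \<tau> by (simp add: vec_poly_on_def)
    have 1: "(LINT x:K|lebesgue. cell v K x * divergence \<tau> x)
        = (\<Sum>i\<in>UNIV. LINT x:K|lebesgue. cell v K x * partial i (\<lambda>x. \<tau> x $ i) x)"
      unfolding divergence_def sum_distrib_left by (intro LINT_set_sum icell \<tau>i)
    have 2: "(LINT x:\<sigma>|surface_measure \<sigma>. face v \<sigma> x * (\<tau> x \<bullet> outward_normal K \<sigma>))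
        = (\<Sum>i\<in>UNIV. LINT x:\<sigma>|surface_measure \<sigma>. face v \<sigma> x * (\<tau> x $ i * outward_normal K \<sigma> $ i))"
      if "\<sigma> \<in> cell_faces D K" for \<sigma>
      unfolding inner_vec_def sum_distrib_left inner_real_def by (intro LINT_set_sum iface \<tau>i that)
    show ?thesis
      unfolding E_def l_def 1 by (simp add: 2 sum_subtractf sum.swap[of _ UNIV])
  qed
  have G: "(LINT x:K|lebesgue. G x \<bullet> \<tau> x) = (\<Sum>i\<in>UNIV. LINT x:K|lebesgue. G x $ i * \<tau> x $ i)"
    if "G \<in> vec_poly_on k K" "\<tau> \<in> vec_poly_on k K" for G \<tau>
    unfolding inner_vec_def inner_real_def using that
    by (intro LINT_set_sum faithful_integrable[OF faithful_cell[OF K]] continuous_on_mult poly_on_continuous)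
      (auto simp: vec_poly_on_def)
  have ex: "\<exists>!p. p \<in> ?W \<and> (\<forall>r\<in>?W. (LINT x:K|lebesgue. p x * r x) = l i r)" for i
    by (rule poly_on_riesz[OF faithful_cell[OF K]]) (rule l_add l_cmult, assumption+)+
  define P where "P i = (THE p. p \<in> ?W \<and> (\<forall>r\<in>?W. (LINT x:K|lebesgue. p x * r x) = l i r))" for i
  have "P i \<in> ?W \<and> (\<forall>r\<in>?W. (LINT x:K|lebesgue. P i x * r x) = l i r)" for i
    unfolding P_def by (rule theI'[OF ex])
  then have P: "\<And>i. P i \<in> ?W" "\<And>i r. r \<in> ?W \<Longrightarrow> (LINT x:K|lebesgue. P i x * r x) = l i r"
    by auto
  have Pu: "p = P i" if "p \<in> ?W" "\<And>r. r \<in> ?W \<Longrightarrow> (LINT x:K|lebesgue. p x * r x) = l i r" for i p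
    unfolding P_def using that by (intro the1_equality[OF ex, symmetric]) auto
  define G0 where "G0 x = (\<chi> i. P i x)" for x
  have G0: "G0 \<in> vec_poly_on k K" using P(1) by (simp add: vec_poly_on_def G0_def)
  let ?Q = "\<lambda>G. G \<in> vec_poly_on k K \<and> (\<forall>\<tau>\<in>vec_poly_on k K. (LINT x:K|lebesgue. G x \<bullet> \<tau> x) = E \<tau>)"
  have QG0: "?Q G0"
  proof (intro conjI ballI G0)
    fix \<tau> assume \<tau>: "\<tau> \<in> vec_poly_on k K"
    show "(LINT x:K|lebesgue. G0 x \<bullet> \<tau> x) = E \<tau>"
      unfolding G[OF G0 \<tau>] E[OF \<tau>] using \<tau> by (intro sum.cong refl) (simp add: G0_def P(2) vec_poly_on_def)
  qed
  have uniq: "G' = G0" if Q: "?Q G'" for G'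
  proof -
    have "(\<lambda>x. G' x $ i) = P i" for i
    proof (rule Pu)
      show "(\<lambda>x. G' x $ i) \<in> ?W" using Q by (simp add: vec_poly_on_def)
      fix r assume r: "r \<in> ?W"
      \<comment> \<open>A test field with \<open>r\<close> as its only component, in direction
        \<open>i\<close>, singles out the \<open>i\<close>-th component of
        \<open>G'\<close>.\<close>
      define \<tau> where "\<tau> x = (r x *\<^sub>R axis i 1 :: real^'n)" for x
      have \<tau>j: "(\<lambda>x. \<tau> x $ j) = (if j = i then r else (\<lambda>x. 0))" for j by (auto simp: \<tau>_def axis_def)
      have zero: "(\<lambda>x. 0) \<in> ?W" using poly_on_const[of K 0 k] by simp
      have \<tau>: "\<tau> \<in> vec_poly_on k K" using r zero by (simp add: vec_poly_on_def \<tau>j)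
      have l0: "l j (\<lambda>x. 0) = 0" for j using l_cmult[OF zero, of j 0] by simp
      have "(LINT x:K|lebesgue. G' x $ i * r x) = (LINT x:K|lebesgue. G' x \<bullet> \<tau> x)"
        by (simp add: \<tau>_def inner_axis mult.commute)
      also have "\<dots> = E \<tau>" using Q \<tau> by simp
      also have "E \<tau> = (\<Sum>j\<in>UNIV. if j = i then l i r else 0)"
        unfolding E[OF \<tau>] \<tau>j by (intro sum.cong) (auto simp: l0)
      also have "\<dots> = l i r" by simp
      finally show "(LINT x:K|lebesgue. G' x $ i * r x) = l i r" .
    qed
    then show "G' = G0" by (auto simp: G0_def fun_eq_iff vec_eq_iff)
  qed
  have "discrete_grad k D K v = (THE G. ?Q G)" unfolding discrete_grad_def E_def ..
  also have "\<dots> = G0" using QG0 uniq by (rule the_equality)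
  finally have eq: "discrete_grad k D K v = G0" .
  show "discrete_grad k D K v \<in> vec_poly_on k K" unfolding eq by (rule G0)
  show "(LINT x:K|lebesgue. discrete_grad k D K v x \<bullet> \<tau> x) = E \<tau>" if "\<tau> \<in> vec_poly_on k K" for \<tau>
    unfolding eq using conjunct2[OF QG0] that by (rule bspec)
  show "discrete_grad k D K v = G"
    if "G \<in> vec_poly_on k K" "\<And>\<tau>. \<tau> \<in> vec_poly_on k K \<Longrightarrow> (LINT x:K|lebesgue. G x \<bullet> \<tau> x) = E \<tau>" for G
    unfolding eq by (rule uniq[symmetric]) (intro conjI ballI that)
qed

text \<open>Consistency identity behind the discrete gradient: the divergence theorem is applied to
  each coordinate of the test field along the corresponding axis.\<close>

lemma vec_poly_on_divergence:
  assumes K: "K \<in> cells D" and \<tau>: "\<tau> \<in> vec_poly_on k K"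
  shows "(LINT x:K|lebesgue. divergence \<tau> x)
    = (\<Sum>\<sigma>\<in>cell_faces D K. LINT x:\<sigma>|surface_measure \<sigma>. \<tau> x \<bullet> outward_normal K \<sigma>)"
proof -
  have oK: "open K" using cell_props(1)[OF K] .
  have \<tau>i: "(\<lambda>x. \<tau> x $ i) \<in> poly_on k K" for i using \<tau> by (simp add: vec_poly_on_def)
  have comp: "set_integrable lebesgue K (partial i (\<lambda>x. \<tau> x $ i)) \<and>
      (LINT x:K|lebesgue. partial i (\<lambda>x. \<tau> x $ i) x)
      = (\<Sum>\<sigma>\<in>cell_faces D K. LINT x:\<sigma>|surface_measure \<sigma>. \<tau> x $ i * outward_normal K \<sigma> $ i)" for i
  proof -
    obtain p G where p: "\<And>x. x \<in> closure K \<Longrightarrow> \<tau> x $ i = p x" "\<And>x. (p has_derivative (\<lambda>h. G x \<bullet> h)) (at x)"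
      "\<And>j. (\<lambda>x. G x $ j) \<in> polynomials k" "\<And>j x. x \<in> K \<Longrightarrow> partial j (\<lambda>x. \<tau> x $ i) x = G x $ j"
      by (rule poly_on_gradient[OF \<tau>i oK]) (rule that)
    have int: "set_integrable lebesgue K (partial i (\<lambda>x. \<tau> x $ i))"
      by (rule set_integrable_eq[OF p(4)])
        (auto intro: faithful_integrable[OF faithful_cell[OF K]] polynomials_continuous[OF p(3)])
    have "(LINT x:K|lebesgue. partial i (\<lambda>x. \<tau> x $ i) x) = (LINT x:K|lebesgue. G x \<bullet> axis i 1)"
      by (intro LINT_set_cong) (simp add: p(4) inner_axis)
    also have "\<dots> = (\<Sum>\<sigma>\<in>cell_faces D K. (outward_normal K \<sigma> \<bullet> axis i 1) * (LINT x:\<sigma>|surface_measure \<sigma>. p x))"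
      by (rule cell_divergence[OF K p(2) polynomials_gradient_continuous[OF p(3)]])
    also have "\<dots> = (\<Sum>\<sigma>\<in>cell_faces D K. LINT x:\<sigma>|surface_measure \<sigma>. \<tau> x $ i * outward_normal K \<sigma> $ i)"
    proof (rule sum.cong[OF refl])
      fix \<sigma> assume \<sigma>: "\<sigma> \<in> cell_faces D K"
      have "(LINT x:\<sigma>|surface_measure \<sigma>. \<tau> x $ i * outward_normal K \<sigma> $ i)
        = (LINT x:\<sigma>|surface_measure \<sigma>. p x * outward_normal K \<sigma> $ i)"
        using cell_face(3)[OF K \<sigma>] closure_subset[of \<sigma>] by (intro LINT_set_cong) (auto simp: p(1))
      then show "(outward_normal K \<sigma> \<bullet> axis i 1) * (LINT x:\<sigma>|surface_measure \<sigma>. p x)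
        = (LINT x:\<sigma>|surface_measure \<sigma>. \<tau> x $ i * outward_normal K \<sigma> $ i)"
        by (auto simp: inner_axis mult.commute)
    qed
    finally show ?thesis using int by simp
  qed
  have "(LINT x:K|lebesgue. divergence \<tau> x) = (\<Sum>i\<in>UNIV. LINT x:K|lebesgue. partial i (\<lambda>x. \<tau> x $ i) x)"
    unfolding divergence_def using comp by (intro LINT_set_sum) auto
  also have "\<dots> = (\<Sum>i\<in>UNIV. \<Sum>\<sigma>\<in>cell_faces D K. LINT x:\<sigma>|surface_measure \<sigma>. \<tau> x $ i * outward_normal K \<sigma> $ i)"
    using comp by simp
  also have "\<dots> = (\<Sum>\<sigma>\<in>cell_faces D K. \<Sum>i\<in>UNIV. LINT x:\<sigma>|surface_measure \<sigma>. \<tau> x $ i * outward_normal K \<sigma> $ i)"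
    by (rule sum.swap)
  also have "\<dots> = (\<Sum>\<sigma>\<in>cell_faces D K. LINT x:\<sigma>|surface_measure \<sigma>. \<tau> x \<bullet> outward_normal K \<sigma>)"
  proof (rule sum.cong[OF refl])
    fix \<sigma> assume \<sigma>: "\<sigma> \<in> cell_faces D K"
    show "(\<Sum>i\<in>UNIV. LINT x:\<sigma>|surface_measure \<sigma>. \<tau> x $ i * outward_normal K \<sigma> $ i)
      = (LINT x:\<sigma>|surface_measure \<sigma>. \<tau> x \<bullet> outward_normal K \<sigma>)"
      unfolding inner_vec_def inner_real_def
      by (intro LINT_set_sum[symmetric] cell_face_integrable[OF K \<sigma>] continuous_on_mult continuous_on_const
          poly_on_continuous[OF \<tau>i])
  qed
  finally show ?thesis .
qed

text \<open>For a constant state the defining functional is \<open>c\<close> times the defect in the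
  divergence theorem for \<open>\<tau>\<close>, so the zero field satisfies the definition.\<close>

lemma discrete_grad_constant:
  assumes K: "K \<in> cells D" and c: "\<And>x. x \<in> closure K \<Longrightarrow> cell v K x = c"
    "\<And>\<sigma> x. \<sigma> \<in> cell_faces D K \<Longrightarrow> x \<in> closure \<sigma> \<Longrightarrow> face v \<sigma> x = c"
  shows "discrete_grad k D K v = (\<lambda>x. 0)"
proof (rule discrete_grad(3)[OF K])
  show "continuous_on (closure K) (cell v K)"
    by (rule continuous_on_eq[of _ "\<lambda>_. c"]) (simp_all add: c(1))
  show "continuous_on (closure \<sigma>) (face v \<sigma>)" if "\<sigma> \<in> cell_faces D K" for \<sigma>
    by (rule continuous_on_eq[of _ "\<lambda>_. c"]) (simp_all add: c(2)[OF that])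
  show "(\<lambda>x. 0) \<in> vec_poly_on k K" using poly_on_const[of K 0 k] by (simp add: vec_poly_on_def)
  fix \<tau> assume \<tau>: "\<tau> \<in> vec_poly_on k K"
  have 1: "(LINT x:K|lebesgue. cell v K x * divergence \<tau> x) = (LINT x:K|lebesgue. c * divergence \<tau> x)"
    using closure_subset[of K] by (intro LINT_set_cong) (auto simp: c(1))
  have 2: "(LINT x:\<sigma>|surface_measure \<sigma>. face v \<sigma> x * (\<tau> x \<bullet> outward_normal K \<sigma>))
      = (LINT x:\<sigma>|surface_measure \<sigma>. c * (\<tau> x \<bullet> outward_normal K \<sigma>))" if "\<sigma> \<in> cell_faces D K" for \<sigma>
    using closure_subset[of \<sigma>] by (intro LINT_set_cong) (auto simp: c(2)[OF that])
  have 3: "(\<Sum>\<sigma>\<in>cell_faces D K. LINT x:\<sigma>|surface_measure \<sigma>. face v \<sigma> x * (\<tau> x \<bullet> outward_normal K \<sigma>))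
      = (\<Sum>\<sigma>\<in>cell_faces D K. c * (LINT x:\<sigma>|surface_measure \<sigma>. \<tau> x \<bullet> outward_normal K \<sigma>))"
    by (intro sum.cong refl) (simp add: 2)
  show "(LINT x:K|lebesgue. 0 \<bullet> \<tau> x) = - (LINT x:K|lebesgue. cell v K x * divergence \<tau> x)
      + (\<Sum>\<sigma>\<in>cell_faces D K. LINT x:\<sigma>|surface_measure \<sigma>. face v \<sigma> x * (\<tau> x \<bullet> outward_normal K \<sigma>))"
    unfolding 1 3 sum_distrib_left[symmetric] vec_poly_on_divergence[OF K \<tau>, symmetric] by simp
qed

text \<open>With zero jumps the face terms can be written in cell values; integration by parts then
  cancels the second derivatives and leaves the integral of the squared gradient of the cell
  unknown.\<close>

lemma constant_of_discrete_grad_zero: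
  assumes K: "K \<in> cells D" and vK: "cell v K \<in> poly_on (k + 1) K"
    and vf: "\<And>\<sigma>. \<sigma> \<in> cell_faces D K \<Longrightarrow> face v \<sigma> \<in> poly_on k \<sigma>"
    and grad: "discrete_grad k D K v = (\<lambda>x. 0)"
    and jump: "\<And>\<sigma>. \<sigma> \<in> cell_faces D K \<Longrightarrow> face_proj k \<sigma> (cell v K) = face v \<sigma>"
  obtains c where "\<And>x. x \<in> closure K \<Longrightarrow> cell v K x = c"
    "\<And>\<sigma> x. \<sigma> \<in> cell_faces D K \<Longrightarrow> x \<in> closure \<sigma> \<Longrightarrow> face v \<sigma> x = c"
proof -
  have oK: "open K" and neK: "K \<noteq> {}" using cell_props[OF K] by auto
  obtain p where p: "p \<in> polynomials (Suc k)" "cell v K = (\<lambda>x. if x \<in> closure K then p x else 0)"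
    using vK by (auto simp: poly_on_iff)
  obtain G where G: "\<And>x. (p has_derivative (\<lambda>h. G x \<bullet> h)) (at x)" "\<And>i. (\<lambda>x. G x $ i) \<in> polynomials k"
    by (rule polynomials_gradient[OF p(1)]) (rule that)
  \<comment> \<open>The gradient of the cell polynomial, cut off outside the closed cell as
    \<open>poly_on\<close> requires.\<close>
  define \<tau> where "\<tau> x = (if x \<in> closure K then G x else 0)" for x
  have \<tau>i: "(\<lambda>x. \<tau> x $ i) \<in> poly_on k K" for i
    unfolding poly_on_iff by (intro bexI[OF _ G(2)[of i]]) (auto simp: \<tau>_def)
  then have \<tau>: "\<tau> \<in> vec_poly_on k K" by (simp add: vec_poly_on_def)
  have "\<exists>H. (\<forall>x. ((\<lambda>x. G x $ i) has_derivative (\<lambda>h. H x \<bullet> h)) (at x)) \<and> (\<forall>j. (\<lambda>x. H x $ j) \<in> polynomials k)" for i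
  proof -
    have "(\<lambda>x. G x $ i) \<in> polynomials (Suc k)" using G(2)[of i] polynomials_mono[of k "Suc k"] by auto
    then obtain H where "\<And>x. ((\<lambda>x. G x $ i) has_derivative (\<lambda>h. H x \<bullet> h)) (at x)" "\<And>j. (\<lambda>x. H x $ j) \<in> polynomials k"
      by (rule polynomials_gradient) (rule that)
    then show ?thesis by (intro exI[of _ H]) simp
  qed
  then obtain H where H': "\<forall>i. (\<forall>x. ((\<lambda>x. G x $ i) has_derivative (\<lambda>h. H i x \<bullet> h)) (at x)) \<and> (\<forall>j. (\<lambda>x. H i x $ j) \<in> polynomials k)"
    using choice[of "\<lambda>i H. (\<forall>x. ((\<lambda>x. G x $ i) has_derivative (\<lambda>h. H x \<bullet> h)) (at x)) \<and> (\<forall>j. (\<lambda>x. H x $ j) \<in> polynomials k)"] by blast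
  then have H: "((\<lambda>x. G x $ i) has_derivative (\<lambda>h. H i x \<bullet> h)) (at x)" "(\<lambda>x. H i x $ j) \<in> polynomials k" for i x j
    by simp_all
  have part: "partial i (\<lambda>x. \<tau> x $ i) x = H i x $ i" if "x \<in> K" for i x
    using closure_subset[of K] by (intro partial_eq_gradient[OF oK that _ H(1)]) (auto simp: \<tau>_def)
  have contp: "continuous_on S p" for S by (rule polynomials_continuous[OF p(1)])
  have contG: "continuous_on S (\<lambda>x. G x $ i)" for S i by (rule polynomials_continuous[OF G(2)])
  have contH: "continuous_on S (\<lambda>x. H i x $ j)" for S i j by (rule polynomials_continuous[OF H(2)])
  have contGv: "continuous_on S G" for S by (rule polynomials_gradient_continuous[OF G(2)])
  have contHv: "continuous_on S (H i)" for S i by (rule polynomials_gradient_continuous[OF H(2)])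
  have icell: "set_integrable lebesgue K h" if "continuous_on (closure K) h" for h :: "real^'n \<Rightarrow> real"
    by (rule faithful_integrable[OF faithful_cell[OF K] that])
  have "0 = (LINT x:K|lebesgue. discrete_grad k D K v x \<bullet> \<tau> x)" by (simp add: grad)
  also have "\<dots> = - (LINT x:K|lebesgue. cell v K x * divergence \<tau> x)
       + (\<Sum>\<sigma>\<in>cell_faces D K. LINT x:\<sigma>|surface_measure \<sigma>. face v \<sigma> x * (\<tau> x \<bullet> outward_normal K \<sigma>))"
    by (rule discrete_grad(2)[OF K poly_on_continuous[OF vK] poly_on_continuous[OF vf] \<tau>])
  also have "(LINT x:K|lebesgue. cell v K x * divergence \<tau> x) = (LINT x:K|lebesgue. p x * (\<Sum>i\<in>UNIV. H i x $ i))"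
    using closure_subset[of K] by (intro LINT_set_cong) (auto simp: p(2) divergence_def part)
  also have "(\<Sum>\<sigma>\<in>cell_faces D K. LINT x:\<sigma>|surface_measure \<sigma>. face v \<sigma> x * (\<tau> x \<bullet> outward_normal K \<sigma>))
    = (\<Sum>\<sigma>\<in>cell_faces D K. \<Sum>i\<in>UNIV. outward_normal K \<sigma> $ i * (LINT x:\<sigma>|surface_measure \<sigma>. p x * G x $ i))"
  proof (rule sum.cong[OF refl])
    fix \<sigma> assume \<sigma>: "\<sigma> \<in> cell_faces D K"
    have sub: "closure \<sigma> \<subseteq> closure K" "\<sigma> \<subseteq> closure \<sigma>" using cell_face(3)[OF K \<sigma>] closure_subset by blast+
    let ?n = "outward_normal K \<sigma>"
    \<comment> \<open>Having degree at most \<open>k\<close>, the normal component of the gradient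
      cannot distinguish the cell values from their projection.\<close>
    define r where "r x = (if x \<in> closure \<sigma> then G x \<bullet> ?n else 0)" for x
    have "(\<lambda>x. G x \<bullet> ?n) \<in> polynomials k"
      unfolding inner_vec_def inner_real_def using G(2)
      by (subst mult.commute) (intro polynomials_sum polynomials_cmult finite)
    then have r: "r \<in> poly_on k \<sigma>"
      unfolding poly_on_iff by (intro bexI[of _ "\<lambda>x. G x \<bullet> ?n"]) (auto simp: r_def)
    have "(LINT x:\<sigma>|surface_measure \<sigma>. face v \<sigma> x * (\<tau> x \<bullet> ?n)) = (LINT x:\<sigma>|surface_measure \<sigma>. face_proj k \<sigma> (cell v K) x * r x)"
      unfolding jump[OF \<sigma>] using sub by (intro LINT_set_cong) (auto simp: \<tau>_def r_def)
    also have "\<dots> = (LINT x:\<sigma>|surface_measure \<sigma>. cell v K x * r x)"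
      using L2_proj_continuous_integrable[OF faithful_face[OF cell_face(1)[OF K \<sigma>]] continuous_on_subset[OF poly_on_continuous[OF vK] sub(1)]]
      by (intro L2_proj(2)[OF faithful_face[OF cell_face(1)[OF K \<sigma>]] _ r])
    also have "\<dots> = (LINT x:\<sigma>|surface_measure \<sigma>. (\<Sum>i\<in>UNIV. ?n $ i * (p x * G x $ i)))"
      using sub by (intro LINT_set_cong) (auto simp: p(2) r_def inner_vec_def sum_distrib_left mult_ac)
    also have "\<dots> = (\<Sum>i\<in>UNIV. LINT x:\<sigma>|surface_measure \<sigma>. ?n $ i * (p x * G x $ i))"
      by (intro LINT_set_sum cell_face_integrable[OF K \<sigma>] continuous_on_mult continuous_on_const contp contG)
    finally show "(LINT x:\<sigma>|surface_measure \<sigma>. face v \<sigma> x * (\<tau> x \<bullet> ?n))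
      = (\<Sum>i\<in>UNIV. ?n $ i * (LINT x:\<sigma>|surface_measure \<sigma>. p x * G x $ i))" by simp
  qed
  also have "\<dots> = (\<Sum>i\<in>UNIV. \<Sum>\<sigma>\<in>cell_faces D K. outward_normal K \<sigma> $ i * (LINT x:\<sigma>|surface_measure \<sigma>. p x * G x $ i))"
    by (rule sum.swap)
  \<comment> \<open>The divergence theorem for \<open>p\<close> times the \<open>i\<close>-th
    component of its gradient. \<open>H i\<close> is the gradient of that component, so the
    \<open>H i x $ i\<close> add up to the Laplacian of \<open>p\<close>.\<close>
  also have "\<dots> = (\<Sum>i\<in>UNIV. LINT x:K|lebesgue. G x $ i * G x $ i + p x * H i x $ i)"
  proof (rule sum.cong[OF refl])
    fix i :: 'n
    have "((\<lambda>x. p x * G x $ i) has_derivative (\<lambda>h. (G x $ i *\<^sub>R G x + p x *\<^sub>R H i x) \<bullet> h)) (at x)" for x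
      using has_derivative_mult[OF G(1) H(1)[of i]] by (simp add: inner_add_left algebra_simps)
    moreover have "continuous_on UNIV (\<lambda>x. G x $ i *\<^sub>R G x + p x *\<^sub>R H i x)"
      by (intro continuous_on_add continuous_on_scaleR contp contG contGv contHv)
    ultimately have "(LINT x:K|lebesgue. (G x $ i *\<^sub>R G x + p x *\<^sub>R H i x) \<bullet> axis i 1)
      = (\<Sum>\<sigma>\<in>cell_faces D K. (outward_normal K \<sigma> \<bullet> axis i 1) * (LINT x:\<sigma>|surface_measure \<sigma>. p x * G x $ i))"
      by (rule cell_divergence[OF K])
    then show "(\<Sum>\<sigma>\<in>cell_faces D K. outward_normal K \<sigma> $ i * (LINT x:\<sigma>|surface_measure \<sigma>. p x * G x $ i))
      = (LINT x:K|lebesgue. G x $ i * G x $ i + p x * H i x $ i)"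
      by (simp add: inner_add_left inner_axis)
  qed
  also have "\<dots> = (LINT x:K|lebesgue. (\<Sum>i\<in>UNIV. G x $ i * G x $ i + p x * H i x $ i))"
    by (intro LINT_set_sum[symmetric] icell continuous_on_add continuous_on_mult contp contG contH)
  also have "(\<lambda>x. \<Sum>i\<in>UNIV. G x $ i * G x $ i + p x * H i x $ i) = (\<lambda>x. G x \<bullet> G x + p x * (\<Sum>i\<in>UNIV. H i x $ i))"
    by (simp add: sum.distrib inner_vec_def sum_distrib_left)
  also have "(LINT x:K|lebesgue. G x \<bullet> G x + p x * (\<Sum>i\<in>UNIV. H i x $ i))
    = (LINT x:K|lebesgue. G x \<bullet> G x) + (LINT x:K|lebesgue. p x * (\<Sum>i\<in>UNIV. H i x $ i))"
    by (intro set_integral_add icell continuous_on_inner contGv continuous_on_mult contp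
        continuous_on_sum contH)
  \<comment> \<open>The two terms with the Laplacian cancel.\<close>
  finally have zero: "(LINT x:K|lebesgue. G x \<bullet> G x) = 0" by simp
  have G0: "G x = 0" if "x \<in> K" for x
  proof -
    have "G x \<bullet> G x = 0"
      by (rule faithful_zero[OF faithful_cell[OF K] _ _ zero that])
        (auto intro!: continuous_on_inner contGv)
    then show ?thesis by simp
  qed
  obtain x0 where x0: "x0 \<in> K" using neK by blast
  have pc: "p y = p x0" for y by (rule polynomials_constant[OF p(1) G(1) oK x0 G0])
  show thesis
  proof
    show vc: "cell v K x = p x0" if "x \<in> closure K" for x using that pc[of x] by (simp add: p(2))
    show "face v \<sigma> x = p x0" if \<sigma>: "\<sigma> \<in> cell_faces D K" and x: "x \<in> closure \<sigma>" for \<sigma> x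
    proof -
      have "\<sigma> \<subseteq> closure K" using cell_face(3)[OF K \<sigma>] closure_subset by blast
      then have "face_proj k \<sigma> (cell v K) = (\<lambda>x. if x \<in> closure \<sigma> then p x0 else 0)"
        by (intro L2_proj_constant[OF faithful_face[OF cell_face(1)[OF K \<sigma>]]]) (auto intro: vc)
      then show ?thesis using jump[OF \<sigma>] x by simp
    qed
  qed
qed

end

subsection \<open>Connectedness away from the ridges\<close>

text \<open>
  Within a ball, almost every segment from a given point misses the low-dimensional set; so a
  locally constant function on its complement extends to a locally constant function everywhere.
\<close>

lemma locally_constant_off_ridges:
  fixes \<Omega> :: "'a::euclidean_space set"
  assumes \<Omega>: "open \<Omega>" "connected \<Omega>" and fin: "finite \<F>"
    and \<F>: "\<And>F. F \<in> \<F> \<Longrightarrow> affine F" "\<And>F. F \<in> \<F> \<Longrightarrow> aff_dim F \<le> int DIM('a) - 2"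
    and loc: "\<And>x. x \<in> \<Omega> - \<Union>\<F> \<Longrightarrow> \<exists>\<delta>>0. \<forall>y\<in>ball x \<delta> \<inter> (\<Omega> - \<Union>\<F>). g y = g x"
    and yz: "y \<in> \<Omega> - \<Union>\<F>" "z \<in> \<Omega> - \<Union>\<F>"
  shows "g y = g z"
proof -
  \<comment> \<open>Contains every end point of a segment that starts at \<open>y\<close>, off the
    ridges, and meets a ridge.\<close>
  define N where "N y = (\<Union>F\<in>\<F>. affine hull (insert y F))" for y
  have negN: "negligible (N y)" for y
    unfolding N_def using fin \<F>(2) by (intro negligible_Union) (auto intro: negligible_affine_hull_insert)
  have subN: "\<Union>\<F> \<subseteq> N y" for y unfolding N_def by (auto intro: hull_inc)
  have pick: "\<exists>w. w \<in> V \<and> w \<notin> N y" if "open V" "V \<noteq> {}" for V y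
    using open_not_negligible[OF that] negN[of y] negligible_subset by blast
  have ball: "g y = g z" if B: "ball x r \<subseteq> \<Omega>" and y: "y \<in> ball x r" "y \<notin> \<Union>\<F>" and z: "z \<in> ball x r" "z \<notin> \<Union>\<F>" for x r y z
  proof -
    \<comment> \<open>The target \<open>z\<close> may itself lie in \<open>N y\<close>; a nearby
      point \<open>w\<close> outside that set has the same value of \<open>g\<close>.\<close>
    obtain \<delta> where \<delta>: "\<delta> > 0" "\<forall>w\<in>ball z \<delta> \<inter> (\<Omega> - \<Union>\<F>). g w = g z" using loc[of z] B z by blast
    have "open (ball z \<delta> \<inter> ball x r)" by (intro open_Int open_ball)
    moreover have "ball z \<delta> \<inter> ball x r \<noteq> {}" using \<delta>(1) z by (metis IntI centre_in_ball empty_iff)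
    ultimately obtain w where w: "w \<in> ball z \<delta>" "w \<in> ball x r" "w \<notin> N y" using pick by blast
    have "g w = g z" using \<delta>(2) w B subN[of y] by blast
    moreover have "g y = g w"
    proof (rule connected_local_const[of "closed_segment y w" y w g])
      have seg: "p \<in> \<Omega> - \<Union>\<F>" if p: "p \<in> closed_segment y w" for p
      proof
        show "p \<in> \<Omega>" using B p closed_segment_subset[OF y(1) w(2) convex_ball] by blast
        show "p \<notin> \<Union>\<F>"
        proof
          assume "p \<in> \<Union>\<F>"
          then obtain F where F: "F \<in> \<F>" "p \<in> F" by blast
          obtain t where t: "0 \<le> t" "t \<le> 1" "p = (1 - t) *\<^sub>R y + t *\<^sub>R w" using p by (auto simp: closed_segment_def)
          have "t \<noteq> 0" using t F y by auto
          have "y + (1 / t) *\<^sub>R (p - y) \<in> affine hull (insert y F)"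
            by (rule mem_affine_3_minus) (use F in \<open>auto intro: hull_inc\<close>)
          moreover have "p - y = t *\<^sub>R (w - y)" using t(3) by (simp add: algebra_simps)
          then have "y + (1 / t) *\<^sub>R (p - y) = w" using \<open>t \<noteq> 0\<close> by simp
          ultimately show False using w(3) F(1) by (auto simp: N_def)
        qed
      qed
      show "\<forall>p\<in>closed_segment y w. \<forall>\<^sub>F q in at p within closed_segment y w. g p = g q"
      proof
        fix p assume p: "p \<in> closed_segment y w"
        obtain \<delta> where "\<delta> > 0" "\<forall>q\<in>ball p \<delta> \<inter> (\<Omega> - \<Union>\<F>). g q = g p" using loc[OF seg[OF p]] by blast
        then show "\<forall>\<^sub>F q in at p within closed_segment y w. g p = g q"
          unfolding eventually_at using seg by (intro exI[of _ \<delta>]) (auto simp: dist_commute)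
      qed
    qed auto
    ultimately show ?thesis by simp
  qed
  have "\<exists>r. r > 0 \<and> ball x r \<subseteq> \<Omega>" if "x \<in> \<Omega>" for x using \<Omega>(1) that open_contains_ball by blast
  then obtain r where r: "\<And>x. x \<in> \<Omega> \<Longrightarrow> r x > 0" "\<And>x. x \<in> \<Omega> \<Longrightarrow> ball x (r x) \<subseteq> \<Omega>" by metis
  have "\<exists>s. s \<in> ball x (r x) \<and> s \<notin> \<Union>\<F>" if "x \<in> \<Omega>" for x
    using pick[of "ball x (r x)" x] subN[of x] r(1)[OF that] by auto
  \<comment> \<open>\<open>s x\<close> is a sample point off the ridges in a ball around
    \<open>x\<close>. Composing \<open>g\<close> with \<open>s\<close> gives a locally constant
    function on all of \<open>\<Omega>\<close>, to which connectedness applies.\<close>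
  then obtain s where s: "\<And>x. x \<in> \<Omega> \<Longrightarrow> s x \<in> ball x (r x)" "\<And>x. x \<in> \<Omega> \<Longrightarrow> s x \<notin> \<Union>\<F>" by metis
  have "g (s y) = g (s z)"
  proof (rule connected_local_const[of \<Omega> y z "\<lambda>x. g (s x)"])
    show "\<forall>x\<in>\<Omega>. \<forall>\<^sub>F x' in at x within \<Omega>. g (s x) = g (s x')"
    proof
      fix x assume x: "x \<in> \<Omega>"
      have "g (s x) = g (s x')" if x': "x' \<in> \<Omega>" "x' \<in> ball x (r x)" for x'
      proof -
        have "open (ball x (r x) \<inter> ball x' (r x'))" by (intro open_Int open_ball)
        moreover have "ball x (r x) \<inter> ball x' (r x') \<noteq> {}" using x' r(1)[OF x'(1)] by (metis IntI centre_in_ball empty_iff)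
        ultimately obtain w where w: "w \<in> ball x (r x)" "w \<in> ball x' (r x')" "w \<notin> N x" using pick by blast
        then have "w \<notin> \<Union>\<F>" using subN by blast
        then have "g (s x) = g w" "g (s x') = g w"
          using ball[OF r(2)[OF x] s(1)[OF x] s(2)[OF x] w(1)] ball[OF r(2)[OF x'(1)] s(1)[OF x'(1)] s(2)[OF x'(1)] w(2)] by auto
        then show ?thesis by simp
      qed
      then show "\<forall>\<^sub>F x' in at x within \<Omega>. g (s x) = g (s x')"
        unfolding eventually_at using r(1)[OF x] by (intro exI[of _ "r x"]) (auto simp: dist_commute)
    qed
  qed (use yz \<Omega>(2) in auto)
  moreover have "g x = g (s x)" if "x \<in> \<Omega> - \<Union>\<F>" for x
    using that r s by (intro ball[of x "r x"]) auto
  ultimately show ?thesis using yz by metis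
qed

context mesh_on
begin

text \<open>The mesh definition does not assign a face to a cell outright. A face of no cell would,
  by disjointness of faces, be covered by the relative boundaries of other faces, that is by ridges,
  which are too thin for it. Otherwise the energies would leave the unknown of such a face
  undetermined.\<close>

lemma face_has_cell:
  assumes \<sigma>: "\<sigma> \<in> faces D"
  shows "\<exists>K\<in>cells D. \<sigma> \<in> cell_faces D K"
proof (rule ccontr)
  assume none: "\<not> (\<exists>K\<in>cells D. \<sigma> \<in> cell_faces D K)"
  obtain \<F> where \<F>: "finite \<F>" "\<And>F. F \<in> \<F> \<Longrightarrow> affine F" "\<And>F. F \<in> \<F> \<Longrightarrow> aff_dim F = int CARD('n) - 2"
    "\<And>\<sigma>. \<sigma> \<in> faces D \<Longrightarrow> closure \<sigma> - \<sigma> \<subseteq> \<Union>\<F>"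
    by (rule ridges_exist) (rule that)
  have sub: "\<sigma> \<subseteq> \<Union>\<F>"
  proof
    fix x assume x: "x \<in> \<sigma>"
    then have "x \<in> (\<Union>K\<in>cells D. frontier K)" unfolding frontier_cells using \<sigma> closure_subset by blast
    then obtain K where K: "K \<in> cells D" "x \<in> frontier K" by blast
    then obtain \<sigma>' where \<sigma>': "\<sigma>' \<in> cell_faces D K" "x \<in> closure \<sigma>'" using cell_props(7)[OF K(1)] by blast
    have f: "\<sigma>' \<in> faces D" using cell_face(1)[OF K(1) \<sigma>'(1)] .
    have "\<sigma>' \<noteq> \<sigma>" using none K \<sigma>' by blast
    then have "x \<notin> \<sigma>'" using x f \<sigma> faces_disjoint by (auto simp: pairwise_def disjnt_iff)
    then show "x \<in> \<Union>\<F>" using \<sigma>'(2) \<F>(4)[OF f] by blast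
  qed
  obtain n c where n: "norm n = 1" "affine hull \<sigma> = {x. n \<bullet> x = c}" by (rule face_hyperplane[OF \<sigma>]) (rule that)
  have nn: "n \<bullet> n = 1" using n by (simp add: norm_eq_1)
  obtain V where V: "open V" "\<sigma> = {x. n \<bullet> x = c} \<inter> V"
    using face_props(3)[OF \<sigma>] unfolding n(2) by (auto simp: openin_open)
  \<comment> \<open>The open set of points whose orthogonal projection lies in
    \<open>\<sigma>\<close>; the normal line through each of them would meet a ridge.\<close>
  define W where "W = (\<lambda>y. y + (c - n \<bullet> y) *\<^sub>R n) -` V"
  have "open W" unfolding W_def using V(1) by (intro open_vimage continuous_intros)
  moreover obtain x where "x \<in> \<sigma>" using face_props(5)[OF \<sigma>] by blast
  then have "x \<in> W" using V by (simp add: W_def)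
  ultimately have "\<not> negligible W" using open_not_negligible by blast
  moreover have "W \<subseteq> (\<Union>F\<in>\<F>. {y. \<exists>s. y + s *\<^sub>R n \<in> F})"
  proof
    fix y assume "y \<in> W"
    then have "y + (c - n \<bullet> y) *\<^sub>R n \<in> \<sigma>" using V(2) nn by (simp add: W_def inner_add_right)
    then show "y \<in> (\<Union>F\<in>\<F>. {y. \<exists>s. y + s *\<^sub>R n \<in> F})" using sub by blast
  qed
  moreover have "negligible (\<Union>F\<in>\<F>. {y. \<exists>s. y + s *\<^sub>R n \<in> F})"
    using \<F>(1,3) by (intro negligible_Union) (auto intro!: negligible_lines_through)
  ultimately show False using negligible_subset by blast
qed

text \<open>The hypothesis on \<open>c'\<close> says that cells sharing a face carry equal
  constants. Since a point of \<open>\<Omega>\<close> may lie in several closed cells, the constants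
  are spread to points by an arbitrary choice \<open>\<kappa>\<close>, and \<open>agree\<close>
  shows that off the ridges the value does not depend on it.\<close>

lemma cell_constants_agree:
  assumes \<Omega>: "open \<Omega>" "connected \<Omega>"
    and c: "\<And>K \<sigma>. K \<in> cells D \<Longrightarrow> \<sigma> \<in> cell_faces D K \<Longrightarrow> c K = c' \<sigma>"
    and K: "K1 \<in> cells D" "K2 \<in> cells D"
  shows "(c K1 :: real) = c K2"
proof -
  obtain \<F> where \<F>: "finite \<F>" "\<And>F. F \<in> \<F> \<Longrightarrow> affine F" "\<And>F. F \<in> \<F> \<Longrightarrow> aff_dim F = int CARD('n) - 2"
    "\<And>\<sigma>. \<sigma> \<in> faces D \<Longrightarrow> closure \<sigma> - \<sigma> \<subseteq> \<Union>\<F>"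
    by (rule ridges_exist) (rule that)
  have interior: "K = K'" if "K \<in> cells D" "K' \<in> cells D" "z \<in> K" "z \<in> closure K'" for z K K'
  proof (rule ccontr)
    assume "K \<noteq> K'"
    then have "K \<inter> K' = {}" using that cells_disjoint by (auto simp: pairwise_def disjnt_def)
    then have "K \<inter> closure K' = {}" using open_Int_closure_eq_empty[OF cell_props(1)[OF that(1)]] by blast
    then show False using that by blast
  qed
  have agree: "c K = c K'" if K: "K \<in> cells D" "K' \<in> cells D" and z: "z \<in> closure K" "z \<in> closure K'" "z \<notin> \<Union>\<F>" for z K K'
  proof (cases "z \<in> K \<or> z \<in> K'")
    case True
    then have "K = K'"
    proof
      assume "z \<in> K"
      then show ?thesis by (rule interior[OF K _ z(2)])
    next
      assume "z \<in> K'"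
      then show ?thesis by (rule interior[OF K(2,1) _ z(1), symmetric])
    qed
    then show ?thesis by simp
  next
    case False
    then have "z \<in> frontier K" "z \<in> frontier K'" using z K cell_props(1) by (auto simp: frontier_def interior_open)
    then obtain \<sigma> \<sigma>' where \<sigma>: "\<sigma> \<in> cell_faces D K" "z \<in> closure \<sigma>" and \<sigma>': "\<sigma>' \<in> cell_faces D K'" "z \<in> closure \<sigma>'"
      using cell_props(7)[OF K(1)] cell_props(7)[OF K(2)] by blast
    have f: "\<sigma> \<in> faces D" "\<sigma>' \<in> faces D" using cell_face(1) K \<sigma>(1) \<sigma>'(1) by blast+
    \<comment> \<open>Off the ridges a point of a face closure lies in the face itself, and
      disjointness identifies the two faces.\<close>
    have "z \<in> \<sigma>" "z \<in> \<sigma>'" using \<F>(4)[OF f(1)] \<F>(4)[OF f(2)] \<sigma>(2) \<sigma>'(2) z(3) by blast+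
    then have "\<sigma> = \<sigma>'" using f faces_disjoint by (auto simp: pairwise_def disjnt_iff)
    then show ?thesis using c[OF K(1) \<sigma>(1)] c[OF K(2) \<sigma>'(1)] by simp
  qed
  have touch: "\<exists>K. K \<in> cells D \<and> z \<in> closure K" if "z \<in> \<Omega>" for z
    using closure_domain closure_subset[of \<Omega>] that by blast
  define \<kappa> where "\<kappa> z = (SOME K. K \<in> cells D \<and> z \<in> closure K)" for z
  have \<kappa>: "\<kappa> z \<in> cells D" "z \<in> closure (\<kappa> z)" if "z \<in> \<Omega>" for z
    using someI_ex[OF touch[OF that]] unfolding \<kappa>_def by blast+
  define g where "g z = c (\<kappa> z)" for z
  have loc: "\<exists>\<delta>>0. \<forall>y\<in>ball x \<delta> \<inter> (\<Omega> - \<Union>\<F>). g y = g x" if x: "x \<in> \<Omega> - \<Union>\<F>" for x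
  proof -
    \<comment> \<open>The closed cells avoiding \<open>x\<close> form a closed set, so every cell
      whose closure contains a point near \<open>x\<close> also has \<open>x\<close> in its
      closure.\<close>
    define C where "C = (\<Union>K\<in>{K \<in> cells D. x \<notin> closure K}. closure K)"
    have "closed C" unfolding C_def using finite_cells by (intro closed_UN) auto
    then have "open (- C)" by (simp add: open_Compl)
    moreover have "x \<in> - C" by (auto simp: C_def)
    ultimately obtain \<delta> where \<delta>: "\<delta> > 0" "ball x \<delta> \<subseteq> - C"
      using open_contains_ball[of "- C"] by blast
    have "g y = g x" if y: "y \<in> ball x \<delta> \<inter> (\<Omega> - \<Union>\<F>)" for y
    proof -
      have "y \<in> \<Omega>" "x \<in> \<Omega>" using x y by auto
      have "y \<notin> C" using \<delta>(2) y by blast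
      then have "x \<in> closure (\<kappa> y)" using \<kappa>[OF \<open>y \<in> \<Omega>\<close>] by (auto simp: C_def)
      then show ?thesis unfolding g_def
        using \<kappa>[OF \<open>y \<in> \<Omega>\<close>] \<kappa>[OF \<open>x \<in> \<Omega>\<close>] x by (intro agree[of _ _ x]) auto
    qed
    then show ?thesis using \<delta>(1) by blast
  qed
  have ex: "\<exists>y. y \<in> \<Omega> - \<Union>\<F> \<and> g y = c K" if K: "K \<in> cells D" for K
  proof -
    have "negligible F" if "F \<in> \<F>" for F
      using negligible_lines_through[of F 0] \<F>(3)[OF that] by simp
    then have "negligible (\<Union>\<F>)" by (intro negligible_Union \<F>(1))
    moreover have "\<not> negligible K" using cell_props(1,4)[OF K] open_not_negligible by blast
    ultimately obtain y where y: "y \<in> K" "y \<notin> \<Union>\<F>" using negligible_subset by blast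
    then have "y \<in> \<Omega>" using cell_props(5)[OF K] by blast
    moreover have "y \<in> closure K" using y(1) closure_subset by blast
    ultimately have "c (\<kappa> y) = c K" using \<kappa>[of y] K y(2) by (intro agree[of _ _ y]) auto
    then show ?thesis using \<open>y \<in> \<Omega>\<close> y(2) by (intro exI[of _ y]) (simp add: g_def)
  qed
  obtain y z where "y \<in> \<Omega> - \<Union>\<F>" "g y = c K1" "z \<in> \<Omega> - \<Union>\<F>" "g z = c K2" using ex[OF K(1)] ex[OF K(2)] by blast
  moreover have "g y = g z" if "y \<in> \<Omega> - \<Union>\<F>" "z \<in> \<Omega> - \<Union>\<F>" for y z
    using \<F>(3) by (intro locally_constant_off_ridges[OF \<Omega> \<F>(1,2) _ loc that]) auto
  ultimately show ?thesis by metis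
qed

text \<open>Points of \<open>\<Omega>\<close> in no cell lie on cell boundaries, hence in the
  hyperplanes of the faces. This lets total masses be computed cell by cell.\<close>

lemma negligible_outside_cells: "negligible (\<Omega> - \<Union>(cells D))"
proof -
  have "negligible (\<Union>\<sigma>\<in>faces D. affine hull \<sigma>)"
  proof (intro negligible_Union finite_imageI finite_faces)
    fix A assume "A \<in> (hull) affine ` faces D"
    then obtain \<sigma> where \<sigma>: "\<sigma> \<in> faces D" "A = affine hull \<sigma>" by blast
    obtain n c where "norm n = 1" "affine hull \<sigma> = {x. n \<bullet> x = c}" by (rule face_hyperplane[OF \<sigma>(1)]) (rule that)
    moreover from this have "n \<noteq> 0" by auto
    ultimately show "negligible A" using negligible_hyperplane[of n c] \<sigma>(2) by simp
  qed
  moreover have "\<Omega> - \<Union>(cells D) \<subseteq> (\<Union>\<sigma>\<in>faces D. affine hull \<sigma>)"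
  proof
    fix x assume x: "x \<in> \<Omega> - \<Union>(cells D)"
    then have "x \<in> (\<Union>K\<in>cells D. closure K)" using closure_domain closure_subset[of \<Omega>] by blast
    then obtain K where K: "K \<in> cells D" "x \<in> closure K" by blast
    then have "x \<in> frontier K" using x cell_props(1)[OF K(1)] by (auto simp: frontier_def interior_open)
    then have "x \<in> (\<Union>\<sigma>\<in>faces D. closure \<sigma>)" using frontier_cells K(1) by blast
    then show "x \<in> (\<Union>\<sigma>\<in>faces D. affine hull \<sigma>)"
      using closure_minimal[OF hull_subset[of _ affine] closed_affine_hull] by blast
  qed
  ultimately show ?thesis using negligible_subset by blast
qed

end

subsection \<open>Continuous representatives\<close>

text \<open>One-variable counterpart of \<open>smooth\<close>. The test functions will be products
  of one-variable factors, and carrying the derivative as a witness makes coinduction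
  direct.\<close>

coinductive smooth_real :: "(real \<Rightarrow> real) \<Rightarrow> bool" where
  "(\<And>x. (h has_real_derivative h' x) (at x)) \<Longrightarrow> smooth_real h' \<Longrightarrow> smooth_real h"

lemma smooth_real_deriv:
  assumes "smooth_real h"
  obtains h' where "\<And>x. (h has_real_derivative h' x) (at x)" "smooth_real h'"
  using assms by (cases rule: smooth_real.cases) blast

text \<open>Functions of this form, with \<open>t\<close> fixed, are closed under differentiation,
  which is the coinduction invariant.\<close>

lemma smooth_real_diff_shift:
  assumes "smooth_real f" "smooth_real g"
  shows "smooth_real (\<lambda>x. f x - g (x - t))"
proof -
  have "\<exists>f g. h = (\<lambda>x. f x - g (x - t)) \<and> smooth_real f \<and> smooth_real g \<Longrightarrow> smooth_real h" for h
  proof (coinduction arbitrary: h rule: smooth_real.coinduct)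
    case (smooth_real h)
    then obtain f g where h: "h = (\<lambda>x. f x - g (x - t))" and f: "smooth_real f" and g: "smooth_real g" by blast
    obtain f' where f': "\<And>x. (f has_real_derivative f' x) (at x)" "smooth_real f'" using smooth_real_deriv[OF f] by blast
    obtain g' where g': "\<And>x. (g has_real_derivative g' x) (at x)" "smooth_real g'" using smooth_real_deriv[OF g] by blast
    have "(h has_real_derivative f' x - g' (x - t)) (at x)" for x
      unfolding h by (auto intro!: derivative_eq_intros DERIV_chain'[of "\<lambda>x. x - t" 1 x UNIV g, simplified] f' g')
    then show ?case using f'(2) g'(2)
      by (intro exI[of _ h] exI[of _ "\<lambda>x. f' x - g' (x - t)"]) blast
  qed
  then show ?thesis using assms by blast
qed

text \<open>The standard smooth function that is flat at the origin, divided by \<open>u ^ k\<close>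
  so that differentiation leads back into the family up to a linear factor. The parameter
  \<open>m\<close> serves a limit: for \<open>k = 0\<close> and growing \<open>m\<close> the values
  at positive \<open>u\<close> tend to one.\<close>

definition flat_exp :: "real \<Rightarrow> nat \<Rightarrow> real \<Rightarrow> real" where
  "flat_exp m k u = (if u > 0 then exp (- 1 / (m * u)) / u ^ k else 0)"

lemma flat_exp_Suc: "u * flat_exp m (Suc k) u = flat_exp m k u"
  by (simp add: flat_exp_def)

lemma power_le_fact_exp:
  assumes "x \<ge> 0"
  shows "x ^ N / fact N \<le> exp (x :: real)"
proof -
  have "sum (\<lambda>n. inverse (fact n) * x ^ n) {N} \<le> (\<Sum>n. inverse (fact n) * x ^ n)"
    using assms by (intro sum_le_suminf summable_exp) auto
  then show ?thesis by (simp add: exp_def field_simps)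
qed

text \<open>The exponential is bounded below by the term of order \<open>k + 2\<close> of its
  series, two more powers than the denominator \<open>u ^ k\<close> consumes. The remaining factor
  \<open>u\<^sup>2\<close> is what makes the derivative at the origin zero.\<close>

lemma flat_exp_bound:
  assumes "m > 0"
  shows "\<bar>flat_exp m k u\<bar> \<le> m ^ (k + 2) * fact (k + 2) * u\<^sup>2"
proof (cases "u > 0")
  case True
  define x where "x = 1 / (m * u)"
  have x: "x > 0" using True assms by (simp add: x_def)
  have "x ^ (k + 2) / fact (k + 2) \<le> exp x" using x by (intro power_le_fact_exp) simp
  then have "exp (- x) \<le> fact (k + 2) / x ^ (k + 2)"
  proof -
    have gen: "1 / e \<le> F / a" if "a / F \<le> e" "a > 0" "F > 0" "e > 0" for a F e :: real
      using that by (simp add: field_simps)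
    show ?thesis
      using gen[OF \<open>x ^ (k + 2) / fact (k + 2) \<le> exp x\<close>] x by (simp add: exp_minus inverse_eq_divide)
  qed
  also have "\<dots> = m ^ (k + 2) * fact (k + 2) * u ^ (k + 2)"
    by (simp add: x_def power_mult_distrib power_divide)
  finally have "exp (- x) / u ^ k \<le> m ^ (k + 2) * fact (k + 2) * u ^ (k + 2) / u ^ k"
    using True by (intro divide_right_mono) auto
  also have "\<dots> = m ^ (k + 2) * fact (k + 2) * u\<^sup>2"
    using True by (simp add: power_add power2_eq_square)
  finally show ?thesis using True by (simp add: flat_exp_def x_def)
next
  case False
  then show ?thesis using assms by (simp add: flat_exp_def)
qed

text \<open>Differentiating the exponential lowers the power of \<open>u\<close> by two and
  differentiating the denominator lowers it by one; factoring out \<open>flat_exp m (k + 2)\<close>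
  leaves a linear polynomial. At the origin the quadratic bound is used.\<close>

lemma flat_exp_deriv:
  assumes m: "m > 0"
  shows "(flat_exp m k has_real_derivative (- real k * u + 1 / m) * flat_exp m (k + 2) u) (at u)"
proof -
  consider "u > 0" | "u < 0" | "u = 0" by linarith
  then show ?thesis
  proof cases
    case 1
    have "((\<lambda>u. exp (- 1 / (m * u)) / u ^ k) has_real_derivative (- real k * u + 1 / m) * flat_exp m (k + 2) u) (at u)"
      using 1 m
      by (auto intro!: derivative_eq_intros simp: flat_exp_def field_simps power2_eq_square)
        (cases k; simp add: field_simps power2_eq_square)
    then show ?thesis
      by (rule has_field_derivative_transform_within_open[of _ _ _ "{0<..}"]) (use 1 in \<open>auto simp: flat_exp_def\<close>)
  next
    case 2
    have "((\<lambda>u. 0) has_real_derivative 0) (at u)" by simp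
    then have "(flat_exp m k has_real_derivative 0) (at u)"
      by (rule has_field_derivative_transform_within_open[of _ _ _ "{..<0}"]) (use 2 in \<open>auto simp: flat_exp_def\<close>)
    then show ?thesis using 2 by (simp add: flat_exp_def)
  next
    case 3
    let ?C = "m ^ (k + 2) * fact (k + 2)"
    have "((\<lambda>y. (flat_exp m k y - flat_exp m k 0) / (y - 0)) \<longlongrightarrow> 0) (at 0)"
    proof (rule Lim_null_comparison)
      show "\<forall>\<^sub>F y in at 0. norm ((flat_exp m k y - flat_exp m k 0) / (y - 0)) \<le> ?C * \<bar>y\<bar>"
      proof (rule eventually_at_filter[THEN iffD2], rule always_eventually, intro allI impI)
        fix y :: real assume y: "y \<noteq> 0"
        have "norm ((flat_exp m k y - flat_exp m k 0) / (y - 0)) = \<bar>flat_exp m k y\<bar> / \<bar>y\<bar>"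
          by (simp add: flat_exp_def)
        also have "\<dots> \<le> ?C * y\<^sup>2 / \<bar>y\<bar>" by (intro divide_right_mono flat_exp_bound m) simp
        also have "\<dots> = ?C * \<bar>y\<bar>" using y by (cases "y > 0") (simp_all add: power2_eq_square)
        finally show "norm ((flat_exp m k y - flat_exp m k 0) / (y - 0)) \<le> ?C * \<bar>y\<bar>" .
      qed
      show "((\<lambda>y. ?C * \<bar>y\<bar>) \<longlongrightarrow> 0) (at 0)" by (auto intro!: tendsto_eq_intros)
    qed
    then show ?thesis using 3 by (simp add: has_field_derivative_iff flat_exp_def)
  qed
qed

lemma smooth_real_poly_flat_exp:
  assumes m: "m > 0"
  shows "smooth_real (\<lambda>x. poly P x * flat_exp m k (poly Q x))"
proof -
  have "\<exists>P k. h = (\<lambda>x. poly P x * flat_exp m k (poly Q x)) \<Longrightarrow> smooth_real h" for h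
  proof (coinduction arbitrary: h rule: smooth_real.coinduct)
    case (smooth_real h)
    then obtain P k where h: "h = (\<lambda>x. poly P x * flat_exp m k (poly Q x))" by blast
    \<comment> \<open>Terms from differentiating \<open>flat_exp\<close> carry order
      \<open>k + 2\<close>; the term with \<open>pderiv P\<close> is raised to that order by the
      factor \<open>Q ^ 2\<close>.\<close>
    define P' where "P' = pderiv P * Q ^ 2 + smult (- real k) (P * pderiv Q * Q) + smult (1 / m) (P * pderiv Q)"
    have "(h has_real_derivative poly P' x * flat_exp m (k + 2) (poly Q x)) (at x)" for x
    proof -
      have "((\<lambda>x. flat_exp m k (poly Q x)) has_real_derivative
          (- real k * poly Q x + 1 / m) * flat_exp m (k + 2) (poly Q x) * poly (pderiv Q) x) (at x)"
        by (rule DERIV_chain'[OF poly_DERIV flat_exp_deriv[OF m]])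
      from DERIV_mult[OF poly_DERIV this, of P]
      have "(h has_real_derivative poly (pderiv P) x * flat_exp m k (poly Q x) +
          (- real k * poly Q x + 1 / m) * flat_exp m (k + 2) (poly Q x) * poly (pderiv Q) x * poly P x) (at x)"
        unfolding h .
      moreover have "flat_exp m k (poly Q x) = (poly Q x)\<^sup>2 * flat_exp m (k + 2) (poly Q x)"
        using flat_exp_Suc[of "poly Q x" m k] flat_exp_Suc[of "poly Q x" m "Suc k"]
        by (simp add: power2_eq_square mult.assoc)
      ultimately show ?thesis by (simp add: P'_def algebra_simps)
    qed
    then show ?case
      by (intro exI[of _ h] exI[of _ "\<lambda>x. poly P' x * flat_exp m (k + 2) (poly Q x)"]) blast
  qed
  then show ?thesis by blast
qed

text \<open>For \<open>a < b\<close> and \<open>x\<close> between them the argument is positive, and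
  elsewhere it is not, so this vanishes off the open interval; increasing \<open>m\<close> sharpens
  it towards the indicator.\<close>

definition bump :: "real \<Rightarrow> real \<Rightarrow> real \<Rightarrow> real \<Rightarrow> real" where
  "bump m a b x = flat_exp m 0 ((x - a) * (b - x))"

lemma smooth_real_bump: "m > 0 \<Longrightarrow> smooth_real (bump m a b)"
  using smooth_real_poly_flat_exp[of m 1 0 "[:- a, 1:] * [:b, -1:]"]
  by (simp add: bump_def[abs_def] algebra_simps)

lemma bump_bounds: "m > 0 \<Longrightarrow> 0 \<le> bump m a b x" "m > 0 \<Longrightarrow> bump m a b x \<le> 1"
  by (auto simp: bump_def flat_exp_def)

lemma bump_outside: "a < b \<Longrightarrow> x \<notin> {a<..<b} \<Longrightarrow> bump m a b x = 0"
  by (auto simp: bump_def flat_exp_def zero_less_mult_iff)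

lemma bump_limit:
  assumes "a < b"
  shows "(\<lambda>n. bump (real (Suc n)) a b x) \<longlonglongrightarrow> indicator {a<..<b} x"
proof (cases "x \<in> {a<..<b}")
  case True
  define u where "u = (x - a) * (b - x)"
  have u: "u > 0" using True by (simp add: u_def)
  have "(\<lambda>n. - (1 / u) * inverse (real (Suc n))) \<longlonglongrightarrow> - (1 / u) * 0"
    by (intro tendsto_intros LIMSEQ_inverse_real_of_nat)
  then have "(\<lambda>n. exp (- (1 / u) * inverse (real (Suc n)))) \<longlonglongrightarrow> exp 0"
    by (intro tendsto_exp) simp
  moreover have "bump (real (Suc n)) a b x = exp (- (1 / u) * inverse (real (Suc n)))" for n
  proof -
    have "- 1 / (real (Suc n) * u) = - (1 / u) * inverse (real (Suc n))"
      using u by (simp add: field_simps)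
    then show ?thesis unfolding bump_def flat_exp_def u_def[symmetric] using u by simp
  qed
  ultimately show ?thesis using True by simp
next
  case False
  then show ?thesis using bump_outside[OF assms False] by simp
qed

text \<open>A partial derivative changes a single factor, so tensor products of smooth factors are
  closed under differentiation; this is the invariant for coinduction.\<close>

lemma smooth_tensor:
  fixes h :: "'n::finite \<Rightarrow> real \<Rightarrow> real"
  assumes "\<And>j. smooth_real (h j)"
  shows "smooth (\<lambda>y::real^'n. \<Prod>j\<in>UNIV. h j (y $ j))"
    and "(\<And>x. (h i has_real_derivative h' x) (at x)) \<Longrightarrow>
      partial i (\<lambda>y::real^'n. \<Prod>j\<in>UNIV. h j (y $ j)) = (\<lambda>y. h' (y $ i) * (\<Prod>j\<in>UNIV - {i}. h j (y $ j)))"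
proof -
  have der: "((\<lambda>y::real^'n. \<Prod>j\<in>UNIV. h j (y $ j)) has_derivative
      (\<lambda>v. \<Sum>j\<in>UNIV. d j (y $ j) * v $ j * (\<Prod>k\<in>UNIV - {j}. h k (y $ k)))) (at y)"
    if "\<And>j x. (h j has_real_derivative d j x) (at x)" for h d :: "'n \<Rightarrow> real \<Rightarrow> real" and y
  proof (rule has_derivative_prod)
    fix j
    have "((\<lambda>y::real^'n. y $ j) has_derivative (\<lambda>v. v $ j)) (at y)"
      by (rule bounded_linear_imp_has_derivative) (rule bounded_linear_vec_nth)
    from has_derivative_compose[OF this that[of j, unfolded has_field_derivative_def]]
    show "((\<lambda>y::real^'n. h j (y $ j)) has_derivative (\<lambda>v. d j (y $ j) * v $ j)) (at y)" by simp
  qed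
  have part: "partial i (\<lambda>y::real^'n. \<Prod>j\<in>UNIV. h j (y $ j)) = (\<lambda>y. d i (y $ i) * (\<Prod>j\<in>UNIV - {i}. h j (y $ j)))"
    if "\<And>j x. (h j has_real_derivative d j x) (at x)" for h d :: "'n \<Rightarrow> real \<Rightarrow> real" and i
  proof
    fix y :: "real^'n"
    have "partial i (\<lambda>y::real^'n. \<Prod>j\<in>UNIV. h j (y $ j)) y
      = (\<Sum>j\<in>UNIV. d j (y $ j) * (axis i 1 :: real^'n) $ j * (\<Prod>k\<in>UNIV - {j}. h k (y $ k)))"
      unfolding partial_def frechet_derivative_at[OF der[OF that], symmetric] ..
    also have "\<dots> = (\<Sum>j\<in>UNIV. if j = i then d i (y $ i) * (\<Prod>k\<in>UNIV - {i}. h k (y $ k)) else 0)"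
      by (intro sum.cong) (auto simp: axis_def)
    also have "\<dots> = d i (y $ i) * (\<Prod>k\<in>UNIV - {i}. h k (y $ k))" by simp
    finally show "partial i (\<lambda>y::real^'n. \<Prod>j\<in>UNIV. h j (y $ j)) y = d i (y $ i) * (\<Prod>k\<in>UNIV - {i}. h k (y $ k))" .
  qed
  have ex: "\<exists>d. (\<forall>j x. (h j has_real_derivative d j x) (at x)) \<and> (\<forall>j. smooth_real (d j))"
    if sm: "\<And>j. smooth_real (h j)" for h :: "'n \<Rightarrow> real \<Rightarrow> real"
  proof -
    have "\<forall>j. \<exists>d. (\<forall>x. (h j has_real_derivative d x) (at x)) \<and> smooth_real d"
    proof
      fix j
      obtain d where "\<And>x. (h j has_real_derivative d x) (at x)" "smooth_real d"
        using smooth_real_deriv[OF sm[of j]] by blast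
      then show "\<exists>d. (\<forall>x. (h j has_real_derivative d x) (at x)) \<and> smooth_real d" by blast
    qed
    then obtain d where "\<forall>j. (\<forall>x. (h j has_real_derivative d j x) (at x)) \<and> smooth_real (d j)"
      using choice[of "\<lambda>j d. (\<forall>x. (h j has_real_derivative d x) (at x)) \<and> smooth_real d"] by blast
    then show ?thesis by (intro exI[of _ d]) blast
  qed
  have "\<exists>h. (\<forall>j. smooth_real (h j)) \<and> f = (\<lambda>y::real^'n. \<Prod>j\<in>UNIV. h j (y $ j)) \<Longrightarrow> smooth f" for f
  proof (coinduction arbitrary: f rule: smooth.coinduct)
    case (smooth f)
    then obtain h where h: "\<And>j. smooth_real (h j)" and f: "f = (\<lambda>y::real^'n. \<Prod>j\<in>UNIV. h j (y $ j))" by blast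
    obtain d where d: "\<And>j x. (h j has_real_derivative d j x) (at x)" "\<And>j. smooth_real (d j)" using ex[of h, OF h] by blast
    have diff: "f differentiable (at x)" for x
      unfolding f differentiable_def using der[of h d x, OF d(1)] by blast
    have "\<exists>h. (\<forall>j. smooth_real (h j)) \<and> partial i f = (\<lambda>y::real^'n. \<Prod>j\<in>UNIV. h j (y $ j))" for i
    proof (intro exI conjI allI)
      show "smooth_real ((h(i := d i)) j)" for j using h d(2) by simp
      have "(\<Prod>j\<in>UNIV. (h(i := d i)) j (y $ j)) = d i (y $ i) * (\<Prod>j\<in>UNIV - {i}. h j (y $ j))" for y :: "real^'n"
        by (subst prod.remove[of UNIV i]) (auto intro!: prod.cong)
      then show "partial i f = (\<lambda>y. \<Prod>j\<in>UNIV. (h(i := d i)) j (y $ j))"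
        unfolding f part[of h d i, OF d(1)] by simp
    qed
    then show ?case using diff by (intro exI[of _ f]) blast
  qed
  then show "smooth (\<lambda>y::real^'n. \<Prod>j\<in>UNIV. h j (y $ j))" using assms by blast
  assume h': "\<And>x. (h i has_real_derivative h' x) (at x)"
  obtain d where d: "\<And>j x. (h j has_real_derivative d j x) (at x)" using ex[of h, OF assms] by blast
  have "(h j has_real_derivative (d(i := h')) j x) (at x)" for j x using d h' by auto
  from part[of h "d(i := h')" i, OF this]
  show "partial i (\<lambda>y::real^'n. \<Prod>j\<in>UNIV. h j (y $ j)) = (\<lambda>y. h' (y $ i) * (\<Prod>j\<in>UNIV - {i}. h j (y $ j)))"
    by simp
qed

text \<open>\<open>H\<close> is the increment over length \<open>t\<close> of a primitive of the
  bump. The primitive is constant on either side of the interval, which makes \<open>H\<close>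
  compactly supported, and it grows by at most \<open>b - a\<close> in total.\<close>

lemma bump_difference_antiderivative:
  fixes a b t m :: real
  assumes ab: "a < b" and t: "t > 0" and m: "m > 0"
  obtains H where "smooth_real H" "\<And>x. (H has_real_derivative bump m a b x - bump m a b (x - t)) (at x)"
    "\<And>x. 0 \<le> H x" "\<And>x. H x \<le> b - a" "\<And>x. x \<notin> {a..b + t} \<Longrightarrow> H x = 0"
proof -
  let ?h = "bump m a b"
  obtain d where d: "\<And>x. (?h has_real_derivative d x) (at x)"
    using smooth_real_deriv[OF smooth_real_bump[OF m, of a b]] by blast
  then have cont: "continuous_on S ?h" for S
    by (meson DERIV_isCont continuous_at_imp_continuous_on)
  define A where "A u = (LBINT y=ereal 0..ereal u. ?h y)" for u
  have A: "(A has_real_derivative ?h x) (at x)" for x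
  proof -
    let ?l = "min 0 x - 1" and ?r = "max 0 x + 1"
    have "(A has_vector_derivative ?h x) (at x within {?l..?r})"
      unfolding A_def by (rule interval_integral_FTC2) (auto intro: cont)
    then have "(A has_vector_derivative ?h x) (at x)"
      using at_within_Icc_at[of ?l x ?r] by (simp add: min_less_iff_disj less_max_iff_disj min_def max_def split: if_splits)
    then show ?thesis by (simp add: has_real_derivative_iff_has_vector_derivative)
  qed
  have mono: "A x \<le> A y" if "x \<le> y" for x y
    by (rule DERIV_nonneg_imp_nondecreasing[OF that]) (rule exI, rule conjI, rule A, rule bump_bounds(1)[OF m])
  have const: "A x = A y" if "x \<le> y" "\<And>u. x < u \<Longrightarrow> u < y \<Longrightarrow> u \<notin> {a<..<b}" for x y
  proof (cases "x = y")
    case False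
    then have "x < y" using that by simp
    then have "A y = A x"
    proof (rule DERIV_isconst_end)
      show "continuous_on {x..y} A" using A by (meson DERIV_isCont continuous_at_imp_continuous_on)
      show "(A has_real_derivative 0) (at u)" if "x < u" "u < y" for u
        using A[of u] bump_outside[OF ab, of u m] \<open>\<And>u. x < u \<Longrightarrow> u < y \<Longrightarrow> u \<notin> {a<..<b}\<close>[OF that] by simp
    qed
    then show ?thesis ..
  qed simp
  have lip: "A b - A a \<le> b - a"
  proof -
    obtain u where "A b - A a = (b - a) * ?h u" using MVT2[OF ab, of A ?h] A by auto
    then show ?thesis using bump_bounds(2)[OF m, of a b u] ab by (simp add: mult_left_le)
  qed
  have lo: "A x = A a" if "x \<le> a" for x using that by (intro const) auto
  have hi: "A b = A x" if "b \<le> x" for x using that by (intro const) auto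
  define H where "H x = A x - A (x - t)" for x
  show thesis
  proof
    have "smooth_real A" using smooth_real.intros[of A ?h] A smooth_real_bump[OF m] by simp
    then show "smooth_real H" unfolding H_def[abs_def] by (intro smooth_real_diff_shift)
    show "(H has_real_derivative ?h x - ?h (x - t)) (at x)" for x
      unfolding H_def by (auto intro!: derivative_eq_intros DERIV_chain'[of "\<lambda>x. x - t" 1 x UNIV A, simplified] A)
    show "0 \<le> H x" for x using mono[of "x - t" x] t by (simp add: H_def)
    show "H x \<le> b - a" for x
    proof -
      have "A x \<le> A b" using mono[of x b] hi[of x] by (cases "x \<le> b") auto
      moreover have "A a \<le> A (x - t)" using mono[of a "x - t"] lo[of "x - t"] by (cases "a \<le> x - t") auto
      ultimately show ?thesis using lip by (simp add: H_def)
    qed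
    show "H x = 0" if "x \<notin> {a..b + t}" for x
    proof (cases "x < a")
      case True
      then show ?thesis using lo[of x] lo[of "x - t"] t by (simp add: H_def)
    next
      case False
      then show ?thesis using that hi[of x] hi[of "x - t"] t by (simp add: H_def)
    qed
  qed
qed

section \<open>Lipschitz continuity from bounded weak derivatives\<close>

lemma L_infty_AE_bounded:
  assumes "L_infty U f"
  obtains M where "M \<ge> 0" "AE x in lebesgue_on U. \<bar>f x\<bar> \<le> M"
proof -
  let ?e = "esssup (lebesgue_on U) (\<lambda>x. ereal \<bar>f x\<bar>)"
  have e: "?e < \<infinity>" "AE x in lebesgue_on U. ereal \<bar>f x\<bar> \<le> ?e"
    using assms esssup_AE by (auto simp: L_infty_def)
  show thesis
  proof (rule that)
    show "max 0 (real_of_ereal ?e) \<ge> 0" by simp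
    show "AE x in lebesgue_on U. \<bar>f x\<bar> \<le> max 0 (real_of_ereal ?e)"
      using e(2)
    proof eventually_elim
      case (elim x)
      then show ?case using e(1) by (cases ?e) auto
    qed
  qed
qed

lemma AE_lebesgue_on_iff:
  assumes "U \<in> sets lebesgue"
  shows "(AE x in lebesgue_on U. P x) \<longleftrightarrow> (AE x in lebesgue. x \<in> U \<longrightarrow> P x)"
  using assms by (subst AE_restrict_space_iff) auto

lemma integrable_lebesgue_bounded_support:
  fixes f :: "'a::euclidean_space \<Rightarrow> real"
  assumes f[measurable]: "f \<in> borel_measurable lebesgue" and "bounded S"
    and bd: "AE x in lebesgue. \<bar>f x\<bar> \<le> M * indicator S x"
  shows "integrable lebesgue f"
proof -
  obtain R where "\<forall>x\<in>S. norm x \<le> R" using \<open>bounded S\<close> unfolding bounded_iff by auto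
  then have R: "S \<subseteq> cball 0 R" by auto
  show ?thesis
  proof (rule Bochner_Integration.integrable_bound)
    have "cball (0::'a) R \<in> lmeasurable" by simp
    then show "integrable lebesgue (\<lambda>x. \<bar>M\<bar> * indicator (cball (0::'a) R) x)"
      by (intro integrable_mult_right integrable_real_indicator) (auto simp: fmeasurable_def)
    show "AE x in lebesgue. norm (f x) \<le> norm (\<bar>M\<bar> * indicator (cball 0 R) x)"
      using bd
    proof eventually_elim
      case (elim x)
      then show ?case using R by (cases "x \<in> S") (auto simp: subset_iff)
    qed
  qed simp
qed

lemma integral_box_eq_cbox:
  fixes f :: "'a::euclidean_space \<Rightarrow> real"
  assumes [measurable]: "f \<in> borel_measurable lebesgue"
  shows "(LINT x|lebesgue. f x * indicator (box a b) x) = (LINT x|lebesgue. f x * indicator (cbox a b) x)"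
proof (rule integral_cong_AE)
  have "AE x in lebesgue. x \<notin> cbox a b - box a b"
    by (rule AE_not_in) (simp add: negligible_iff_null_sets[symmetric] negligible_frontier_interval)
  then show "AE x in lebesgue. f x * indicator (box a b) x = f x * indicator (cbox a b) x"
    using box_subset_cbox[of a b] by (auto elim!: eventually_mono simp: indicator_def)
  have [measurable]: "cbox a b \<in> sets lebesgue" "box a b \<in> sets lebesgue" by auto
  show "(\<lambda>x. f x * indicator (box a b) x) \<in> borel_measurable lebesgue"
    "(\<lambda>x. f x * indicator (cbox a b) x) \<in> borel_measurable lebesgue" by measurable
qed

text \<open>
  Test with a product of bumps in which the factor of direction \<open>i\<close> is replaced by an antiderivative
  of the difference of two translated bumps.
\<close>

lemma box_integral_shift:
  fixes f g :: "real^'n::finite \<Rightarrow> real"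
  assumes meas[measurable]: "f \<in> borel_measurable lebesgue" "g \<in> borel_measurable lebesgue"
    and fM: "AE x in lebesgue. \<bar>f x\<bar> \<le> M" and gC: "AE x in lebesgue. \<bar>g x\<bar> \<le> C" and C: "C \<ge> 0"
    and weak: "\<And>\<psi>. test_function U \<psi> \<Longrightarrow>
      (LINT x|lebesgue. f x * partial i \<psi> x) = - (LINT x|lebesgue. g x * \<psi> x)"
    and ab: "\<And>j. a $ j < b $ j" and t: "t > 0" and sub: "cbox a (b + t *\<^sub>R axis i 1) \<subseteq> U"
  shows "\<bar>(LINT x|lebesgue. f x * indicator (cbox a b) x) -
      (LINT x|lebesgue. f x * indicator (cbox (a + t *\<^sub>R axis i 1) (b + t *\<^sub>R axis i 1)) x)\<bar>
    \<le> C * (b $ i - a $ i) * measure lebesgue (cbox a (b + t *\<^sub>R axis i 1))"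
proof -
  define e where "e = t *\<^sub>R (axis i 1 :: real^'n)"
  have e: "e $ j = (if j = i then t else 0)" for j by (simp add: e_def axis_def)
  \<comment> \<open>Smallest closed box containing the original box and its translate; all test
    functions and their derivatives vanish outside it.\<close>
  define B where "B = cbox a (b + e)"
  define h where "h m j = bump (real (Suc m)) (a $ j) (b $ j)" for m j
  have h01: "0 \<le> h m j x" "h m j x \<le> 1" for m j x
    using bump_bounds[of "real (Suc m)"] by (auto simp: h_def)
  have h0: "h m j x = 0" if "x \<notin> {a $ j<..<b $ j}" for m j x
    using bump_outside[OF ab that] by (simp add: h_def)
  have "\<exists>H. smooth_real H \<and> (\<forall>x. (H has_real_derivative h m i x - h m i (x - t)) (at x)) \<and>
      (\<forall>x. 0 \<le> H x) \<and> (\<forall>x. H x \<le> b $ i - a $ i) \<and> (\<forall>x. x \<notin> {a $ i..b $ i + t} \<longrightarrow> H x = 0)" for m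
    unfolding h_def
    by (rule bump_difference_antiderivative[OF ab[of i] t, of "real (Suc m)"]) (simp, blast)
  then obtain H where H: "\<And>m. smooth_real (H m)"
      "\<And>m x. (H m has_real_derivative h m i x - h m i (x - t)) (at x)"
      "\<And>m x. 0 \<le> H m x" "\<And>m x. H m x \<le> b $ i - a $ i"
      "\<And>m x. x \<notin> {a $ i..b $ i + t} \<Longrightarrow> H m x = 0"
    by metis
  define \<psi> where "\<psi> m y = (\<Prod>j\<in>UNIV. ((h m)(i := H m)) j (y $ j))" for m and y :: "real^'n"
  define D where "D m y = (h m i (y $ i) - h m i (y $ i - t)) * (\<Prod>j\<in>UNIV - {i}. h m j (y $ j))"
    for m and y :: "real^'n"
  have sm: "smooth_real (((h m)(i := H m)) j)" for m j
    using H(1) smooth_real_bump by (simp add: h_def)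
  have \<psi>_eq: "\<psi> m y = H m (y $ i) * (\<Prod>j\<in>UNIV - {i}. h m j (y $ j))" for m y
    unfolding \<psi>_def by (subst prod.remove[of UNIV i]) (auto intro!: prod.cong)
  have part: "partial i (\<psi> m) = D m" for m
    using smooth_tensor(2)[of "(h m)(i := H m)", OF sm, of i "\<lambda>x. h m i x - h m i (x - t)"] H(2)
    unfolding \<psi>_def[abs_def] D_def[abs_def] by (auto simp: fun_eq_iff intro!: prod.cong)
  have prod01: "0 \<le> (\<Prod>j\<in>UNIV - {i}. h m j (y $ j))" "(\<Prod>j\<in>UNIV - {i}. h m j (y $ j)) \<le> 1" for m y
    using h01 by (auto intro!: prod_nonneg prod_le_1)
  have prod0: "(\<Prod>j\<in>UNIV - {i}. h m j (y $ j)) = 0" if "j \<noteq> i" "y $ j \<notin> {a $ j..b $ j}" for m y j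
    using that h0[of "y $ j" j m] by (intro prod_zero) (auto intro!: bexI[of _ j])
  have inB: "y \<in> B \<longleftrightarrow> y $ i \<in> {a $ i..b $ i + t} \<and> (\<forall>j. j \<noteq> i \<longrightarrow> y $ j \<in> {a $ j..b $ j})" for y
    unfolding B_def mem_box_cart by (auto simp: e split: if_splits)
  have \<psi>0: "\<psi> m y = 0" if "y \<notin> B" for m y
    using that H(5)[of "y $ i" m] prod0[of _ y m] unfolding inB \<psi>_eq by auto
  have D0: "D m y = 0" if "y \<notin> B" for m y
  proof (cases "y $ i \<in> {a $ i..b $ i + t}")
    case True
    then show ?thesis using that prod0[of _ y m] unfolding inB D_def by auto
  next
    case False
    then show ?thesis using h0[of "y $ i" i m] h0[of "y $ i - t" i m] t unfolding D_def by auto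
  qed
  have \<psi>bound: "\<bar>\<psi> m y\<bar> \<le> (b $ i - a $ i) * indicator B y" for m y
  proof (cases "y \<in> B")
    case True
    have "\<bar>\<psi> m y\<bar> = H m (y $ i) * (\<Prod>j\<in>UNIV - {i}. h m j (y $ j))"
      unfolding \<psi>_eq using H(3) prod01(1) by (simp add: abs_mult)
    also have "\<dots> \<le> (b $ i - a $ i) * 1"
      using H(3,4) prod01 ab[of i] by (intro mult_mono) auto
    finally show ?thesis using True by simp
  qed (simp add: \<psi>0)
  have Dbound: "\<bar>D m y\<bar> \<le> indicator B y" for m y
  proof (cases "y \<in> B")
    case True
    have "\<bar>D m y\<bar> = \<bar>h m i (y $ i) - h m i (y $ i - t)\<bar> * (\<Prod>j\<in>UNIV - {i}. h m j (y $ j))"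
      unfolding D_def using prod01(1) by (simp add: abs_mult)
    also have "\<dots> \<le> 1 * 1"
      using prod01 h01[of m i "y $ i"] h01[of m i "y $ i - t"] by (intro mult_mono) (auto simp: abs_le_iff)
    finally show ?thesis using True by simp
  qed (simp add: D0)
  have test: "test_function U (\<psi> m)" for m
  proof -
    have "closure {x. \<psi> m x \<noteq> 0} \<subseteq> B"
      by (rule closure_minimal) (use \<psi>0 in \<open>auto simp: B_def\<close>)
    moreover have "bounded {x. \<psi> m x \<noteq> 0}"
      by (rule bounded_subset[of B]) (use \<psi>0 in \<open>auto simp: B_def\<close>)
    moreover have "smooth (\<psi> m)" unfolding \<psi>_def[abs_def] using sm by (rule smooth_tensor(1))
    ultimately show ?thesis using sub unfolding test_function_def B_def e_def by auto
  qed
  have conth: "continuous_on UNIV (h m j)" for m j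
  proof -
    obtain d where "\<And>x. (h m j has_real_derivative d x) (at x)"
      using smooth_real_deriv[OF smooth_real_bump, of "real (Suc m)" "a $ j" "b $ j"] unfolding h_def by auto
    then show ?thesis by (meson DERIV_isCont continuous_at_imp_continuous_on)
  qed
  have contH: "continuous_on UNIV (H m)" for m
    using H(2) by (meson DERIV_isCont continuous_at_imp_continuous_on)
  have "continuous_on UNIV (D m)" for m
    unfolding D_def[abs_def] by (intro continuous_intros continuous_on_compose2[OF conth]) auto
  then have [measurable]: "D m \<in> borel_measurable lebesgue" for m
    by (intro measurable_completion) (simp add: borel_measurable_continuous_onI)
  have "continuous_on UNIV (\<psi> m)" for m
    unfolding \<psi>_eq[abs_def] by (intro continuous_intros continuous_on_compose2[OF conth] continuous_on_compose2[OF contH]) auto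
  then have [measurable]: "\<psi> m \<in> borel_measurable lebesgue" for m
    by (intro measurable_completion) (simp add: borel_measurable_continuous_onI)
  have [measurable]: "B \<in> sets lebesgue" "cbox c d \<in> sets lebesgue" "box c d \<in> sets lebesgue" for c d
    by (auto simp: B_def)
  have Bint: "integrable lebesgue (\<lambda>x. c * indicator B x)" for c :: real
    by (rule integrable_lebesgue_bounded_support[where S = B and M = "\<bar>c\<bar>"]) (auto simp: B_def indicator_def)
  \<comment> \<open>The weak derivative trades the derivative of the test function for the test
    function itself, whose bound \<open>b $ i - a $ i\<close> is uniform in
    \<open>m\<close>.\<close>
  have ineq: "\<bar>LINT x|lebesgue. f x * D m x\<bar> \<le> C * (b $ i - a $ i) * measure lebesgue B" for m
  proof -
    have gb: "AE x in lebesgue. \<bar>g x * \<psi> m x\<bar> \<le> C * (b $ i - a $ i) * indicator B x"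
      using gC
    proof eventually_elim
      case (elim x)
      then have "\<bar>g x\<bar> * \<bar>\<psi> m x\<bar> \<le> C * ((b $ i - a $ i) * indicator B x)"
        using \<psi>bound[of m x] C by (intro mult_mono) auto
      then show ?case by (simp add: abs_mult mult.assoc)
    qed
    have gi: "integrable lebesgue (\<lambda>x. g x * \<psi> m x)"
      by (rule integrable_lebesgue_bounded_support[OF _ _ gb]) (auto simp: B_def)
    have "\<bar>LINT x|lebesgue. f x * D m x\<bar> = \<bar>LINT x|lebesgue. g x * \<psi> m x\<bar>"
      using weak[OF test[of m]] unfolding part by simp
    also have "\<dots> \<le> (LINT x|lebesgue. \<bar>g x * \<psi> m x\<bar>)" by (rule integral_abs_bound)
    also have "\<dots> \<le> (LINT x|lebesgue. C * (b $ i - a $ i) * indicator B x)"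
      using gb by (intro integral_mono_AE integrable_abs gi Bint) auto
    also have "\<dots> = C * (b $ i - a $ i) * measure lebesgue B" by simp
    finally show ?thesis .
  qed
  \<comment> \<open>As \<open>m\<close> grows, the derivative of the test function tends to the
    difference of the indicators of the open box and of its translate.\<close>
  have lim: "(\<lambda>m. LINT x|lebesgue. f x * D m x) \<longlonglongrightarrow>
    (LINT x|lebesgue. f x * indicator (box a b) x - f x * indicator (box (a + e) (b + e)) x)"
  proof (rule integral_dominated_convergence[where w = "\<lambda>x. M * indicator B x"])
    show "integrable lebesgue (\<lambda>x. M * indicator B x)" by (rule Bint)
    show "AE x in lebesgue. (\<lambda>m. f x * D m x) \<longlonglongrightarrow> f x * indicator (box a b) x - f x * indicator (box (a + e) (b + e)) x"
    proof (rule AE_I2)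
      fix y
      have hl: "(\<lambda>m. h m j x) \<longlonglongrightarrow> indicator {a $ j<..<b $ j} x" for j x
        unfolding h_def by (rule bump_limit[OF ab])
      let ?P = "\<Prod>j\<in>UNIV - {i}. indicator {a $ j<..<b $ j} (y $ j) :: real"
      have 1: "(\<lambda>m. D m y) \<longlonglongrightarrow> (indicator {a $ i<..<b $ i} (y $ i) - indicator {a $ i<..<b $ i} (y $ i - t)) * ?P"
        unfolding D_def by (intro tendsto_intros hl)
      have P: "?P = (if \<forall>j. j \<noteq> i \<longrightarrow> y $ j \<in> {a $ j<..<b $ j} then 1 else 0)"
      proof (cases "\<forall>j. j \<noteq> i \<longrightarrow> y $ j \<in> {a $ j<..<b $ j}")
        case True
        then have "?P = 1" by (intro prod.neutral) auto
        then show ?thesis using True by simp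
      next
        case False
        then obtain j where "j \<noteq> i" "y $ j \<notin> {a $ j<..<b $ j}" by blast
        then have "?P = 0" by (intro prod_zero) (auto intro!: bexI[of _ j])
        then show ?thesis using False by simp
      qed
      have box1: "y \<in> box a b \<longleftrightarrow> y $ i \<in> {a $ i<..<b $ i} \<and> (\<forall>j. j \<noteq> i \<longrightarrow> y $ j \<in> {a $ j<..<b $ j})"
        unfolding mem_box_cart by auto
      have box2: "y \<in> box (a + e) (b + e) \<longleftrightarrow> y $ i - t \<in> {a $ i<..<b $ i} \<and> (\<forall>j. j \<noteq> i \<longrightarrow> y $ j \<in> {a $ j<..<b $ j})"
        unfolding mem_box_cart by (auto simp: e less_diff_eq diff_less_eq split: if_splits)
      have 2: "(indicator {a $ i<..<b $ i} (y $ i) - indicator {a $ i<..<b $ i} (y $ i - t)) * ?P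
        = indicator (box a b) y - indicator (box (a + e) (b + e)) y"
      proof -
        define Q where "Q \<longleftrightarrow> (\<forall>j. j \<noteq> i \<longrightarrow> y $ j \<in> {a $ j<..<b $ j})"
        show ?thesis
          unfolding P unfolding indicator_def box1 box2 unfolding Q_def[symmetric] by simp
      qed
      show "(\<lambda>m. f y * D m y) \<longlonglongrightarrow> f y * indicator (box a b) y - f y * indicator (box (a + e) (b + e)) y"
        using tendsto_mult_left[OF 1, of "f y"] unfolding 2 by (simp add: right_diff_distrib)
    qed
    show "AE x in lebesgue. norm (f x * D m x) \<le> M * indicator B x" for m
      using fM
    proof eventually_elim
      case (elim x)
      then have "\<bar>f x\<bar> * \<bar>D m x\<bar> \<le> M * indicator B x"
        using Dbound[of m x] by (intro mult_mono) auto
      then show ?case by (simp add: abs_mult)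
    qed
  qed measurable
  have fi: "integrable lebesgue (\<lambda>x. f x * indicator (cbox c d) x)" for c d
    by (rule integrable_lebesgue_bounded_support[of _ "cbox c d" M])
      (use fM in \<open>auto elim!: eventually_mono simp: indicator_def\<close>)
  have fi': "integrable lebesgue (\<lambda>x. f x * indicator (box c d) x)" for c d
    by (rule integrable_lebesgue_bounded_support[of _ "box c d" M])
      (use fM in \<open>auto elim!: eventually_mono simp: indicator_def\<close>)
  have "\<bar>LINT x|lebesgue. f x * indicator (box a b) x - f x * indicator (box (a + e) (b + e)) x\<bar>
    \<le> C * (b $ i - a $ i) * measure lebesgue B"
    using ineq by (intro LIMSEQ_le_const2[OF tendsto_rabs[OF lim]]) auto
  then show ?thesis
    by (simp add: Bochner_Integration.integral_diff fi fi' integral_box_eq_cbox B_def[symmetric] e_def[symmetric])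
qed

text \<open>Averages over cubes with lower corner \<open>x\<close> replace point values: shifting
  such an average in one coordinate is controlled by the weak derivative, up to an error of the
  order of the edge \<open>r\<close>. Outside the null set \<open>N\<close> the averages converge to
  the function as \<open>r\<close> tends to zero.\<close>

lemma W1_infty_AE_local_lipschitz:
  fixes f :: "real^'n::finite \<Rightarrow> real"
  assumes U: "open U" and W: "W1_infty U f"
  obtains N L where "negligible N" "L \<ge> 0"
    "\<And>z. z \<in> U \<Longrightarrow> \<exists>\<delta>>0. ball z \<delta> \<subseteq> U \<and> (\<forall>x\<in>ball z \<delta> - N. \<forall>y\<in>ball z \<delta> - N. \<bar>f x - f y\<bar> \<le> L * dist x y)"
proof -
  have Us[measurable]: "U \<in> sets lebesgue" using U by auto
  \<comment> \<open>Extension by zero, so that integrals over arbitrary boxes make sense.\<close>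
  define F where "F x = indicator U x * f x" for x
  have "L_infty U f" using W by (simp add: W1_infty_def)
  then obtain M where M: "M \<ge> 0" "AE x in lebesgue_on U. \<bar>f x\<bar> \<le> M" by (rule L_infty_AE_bounded)
  have Fmeas[measurable]: "F \<in> borel_measurable lebesgue"
    using \<open>L_infty U f\<close> unfolding F_def[abs_def] L_infty_def by (simp add: borel_measurable_restrict_space_iff)
  have FM: "AE x in lebesgue. \<bar>F x\<bar> \<le> M"
    using M unfolding AE_lebesgue_on_iff[OF Us] by (auto elim!: eventually_mono simp: F_def indicator_def)
  define Q where "Q i G C \<longleftrightarrow> G \<in> borel_measurable lebesgue \<and> C \<ge> 0 \<and> (AE x in lebesgue. \<bar>G x\<bar> \<le> C) \<and>
      (\<forall>\<psi>. test_function U \<psi> \<longrightarrow> (LINT x|lebesgue. F x * partial i \<psi> x) = - (LINT x|lebesgue. G x * \<psi> x))"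
    for i G and C :: real
  have "\<exists>p. Q i (fst p) (snd p)" for i
  proof -
    obtain g where g: "L_infty U g" "\<And>\<psi>. test_function U \<psi> \<Longrightarrow>
        (LINT x:U|lebesgue. f x * partial i \<psi> x) = - (LINT x:U|lebesgue. g x * \<psi> x)"
      using W unfolding W1_infty_def by metis
    obtain C where C: "C \<ge> 0" "AE x in lebesgue_on U. \<bar>g x\<bar> \<le> C" using g(1) by (rule L_infty_AE_bounded)
    have "(\<lambda>x. indicator U x * g x) \<in> borel_measurable lebesgue"
      using g(1) unfolding L_infty_def by (simp add: borel_measurable_restrict_space_iff)
    moreover have "AE x in lebesgue. \<bar>indicator U x * g x\<bar> \<le> C"
      using C unfolding AE_lebesgue_on_iff[OF Us] by (auto elim!: eventually_mono simp: indicator_def)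
    ultimately show ?thesis using C(1) g(2)
      by (intro exI[of _ "(\<lambda>x. indicator U x * g x, C)"])
        (simp add: Q_def F_def set_lebesgue_integral_def mult.assoc)
  qed
  then obtain p where p: "\<And>i. Q i (fst (p i)) (snd (p i))"
    using choice[of "\<lambda>i p. Q i (fst p) (snd p)"] by blast
  define G C where "G i = fst (p i)" and "C i = snd (p i)" for i
  have "Q i (G i) (C i)" for i using p by (simp add: G_def C_def)
  then have G: "\<And>i. G i \<in> borel_measurable lebesgue" "\<And>i. C i \<ge> 0" "\<And>i. AE x in lebesgue. \<bar>G i x\<bar> \<le> C i"
    and weak: "\<And>i \<psi>. test_function U \<psi> \<Longrightarrow> (LINT x|lebesgue. F x * partial i \<psi> x) = - (LINT x|lebesgue. G i x * \<psi> x)"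
    unfolding Q_def by blast+
  have Fint: "integrable lebesgue (\<lambda>x. F x * indicator (cbox a b) x)" for a b
  proof (rule integrable_lebesgue_bounded_support[of _ "cbox a b" M])
    have [measurable]: "cbox a b \<in> sets lebesgue" by auto
    show "(\<lambda>x. F x * indicator (cbox a b) x) \<in> borel_measurable lebesgue" by measurable
    show "AE x in lebesgue. \<bar>F x * indicator (cbox a b) x\<bar> \<le> M * indicator (cbox a b) x"
      using FM by eventually_elim (simp add: indicator_def)
  qed simp
  have Fset: "set_integrable lebesgue (cbox a b) F" for a b
    using Fint[of a b] by (simp add: set_integrable_def mult.commute)
  have HK: "integral (cbox a b) F = (LINT x|lebesgue. F x * indicator (cbox a b) x)" for a b
    using set_lebesgue_integral_eq_integral(2)[OF Fset[of a b]]
    by (simp add: set_lebesgue_integral_def mult.commute)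
  obtain N where N: "negligible N"
    "\<And>x e. \<lbrakk>x \<notin> N; 0 < e\<rbrakk> \<Longrightarrow> \<exists>d>0. \<forall>h. 0 < h \<and> h < d \<longrightarrow>
        norm (integral (cbox x (x + h *\<^sub>R One)) F /\<^sub>R h ^ DIM(real^'n) - F x) < e"
    using integrable_ccontinuous_explicit[of F, OF set_lebesgue_integral_eq_integral(1)[OF Fset]] by blast
  define one where "one = (One :: real^'n)"
  define A where "A r x = (LINT y|lebesgue. F y * indicator (cbox x (x + r *\<^sub>R one)) y) / r ^ CARD('n)" for r x
  have lim: "\<exists>d>0. \<forall>h. 0 < h \<and> h < d \<longrightarrow> \<bar>A h x - F x\<bar> < e" if "x \<notin> N" "0 < e" for x e
    using N(2)[OF that] unfolding HK A_def one_def by (simp add: divide_inverse mult.commute)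
  have one: "one $ j = 1" for j
    unfolding one_def cart_eq_inner_axis by (simp add: inner_sum_left_Basis)
  have shift: "\<bar>A r x - A r (x + t *\<^sub>R axis i 1)\<bar> \<le> C i * (r + t)"
    if r: "r > 0" and t: "t > 0" and sub: "cbox x (x + r *\<^sub>R one + t *\<^sub>R axis i 1) \<subseteq> U" for r x t i
  proof -
    have "\<bar>(LINT y|lebesgue. F y * indicator (cbox x (x + r *\<^sub>R one)) y) -
        (LINT y|lebesgue. F y * indicator (cbox (x + t *\<^sub>R axis i 1) (x + r *\<^sub>R one + t *\<^sub>R axis i 1)) y)\<bar>
      \<le> C i * ((x + r *\<^sub>R one) $ i - x $ i) * measure lebesgue (cbox x (x + r *\<^sub>R one + t *\<^sub>R axis i 1))"
      using r t sub G weak by (intro box_integral_shift[where M = M and U = U and g = "G i"] FM) (auto simp: one)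
    \<comment> \<open>Together with the edge factor \<open>r\<close> this volume cancels the
      normalisation \<open>r ^ CARD('n)\<close> and leaves \<open>r + t\<close>.\<close>
    also have "measure lebesgue (cbox x (x + r *\<^sub>R one + t *\<^sub>R axis i 1)) = (r + t) * r ^ (CARD('n) - 1)"
    proof -
      have ne: "cbox x (x + r *\<^sub>R one + t *\<^sub>R axis i 1) \<noteq> {}"
      proof -
        have "x \<in> cbox x (x + r *\<^sub>R one + t *\<^sub>R axis i 1)" using r t by (simp add: mem_box_cart one axis_def)
        then show ?thesis by blast
      qed
      have "measure lebesgue (cbox x (x + r *\<^sub>R one + t *\<^sub>R axis i 1))
          = (\<Prod>j\<in>UNIV. (x + r *\<^sub>R one + t *\<^sub>R axis i 1) $ j - x $ j)"
        using content_cbox_cart[OF ne] by simp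
      also have "\<dots> = (\<Prod>j\<in>UNIV. if j = i then r + t else r)"
        by (intro prod.cong) (auto simp: one axis_def)
      also have "\<dots> = (r + t) * (\<Prod>j\<in>UNIV - {i}. r)"
        by (subst prod.remove[of UNIV i]) auto
      finally show ?thesis by (simp add: card_Diff_singleton)
    qed
    finally have 1: "\<bar>(LINT y|lebesgue. F y * indicator (cbox x (x + r *\<^sub>R one)) y) -
        (LINT y|lebesgue. F y * indicator (cbox (x + t *\<^sub>R axis i 1) (x + r *\<^sub>R one + t *\<^sub>R axis i 1)) y)\<bar>
      \<le> C i * r * ((r + t) * r ^ (CARD('n) - 1))"
      by (simp add: one)
    have comm: "x + t *\<^sub>R axis i 1 + r *\<^sub>R one = x + r *\<^sub>R one + t *\<^sub>R axis i 1" by simp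
    have "A r x - A r (x + t *\<^sub>R axis i 1) = ((LINT y|lebesgue. F y * indicator (cbox x (x + r *\<^sub>R one)) y) -
        (LINT y|lebesgue. F y * indicator (cbox (x + t *\<^sub>R axis i 1) (x + r *\<^sub>R one + t *\<^sub>R axis i 1)) y)) / r ^ CARD('n)"
      unfolding A_def diff_divide_distrib comm ..
    then have "\<bar>A r x - A r (x + t *\<^sub>R axis i 1)\<bar> * r ^ CARD('n) \<le> C i * r * ((r + t) * r ^ (CARD('n) - 1))"
      using 1 r by simp
    also have "\<dots> = C i * (r + t) * r ^ CARD('n)"
    proof -
      have "r ^ CARD('n) = r * r ^ (CARD('n) - 1)" by (metis Suc_diff_1 power_Suc zero_less_card_finite)
      then show ?thesis by simp
    qed
    finally show ?thesis using r by simp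
  qed
  define S where "S = (\<Sum>i\<in>UNIV. C i)"
  have S: "S \<ge> 0" "C i \<le> S" for i
    using G(2) by (auto simp: S_def intro!: sum_nonneg member_le_sum)
  \<comment> \<open>Boxes are used because changing coordinates one at a time does not leave a box.
    The margin \<open>\<delta>\<close> at the upper corner leaves room for the averaging
    cubes.\<close>
  have cube: "\<bar>f x - f y\<bar> \<le> (S * CARD('n)) * dist x y"
    if \<delta>: "\<delta> > 0" and sub: "cbox l (u + \<delta> *\<^sub>R one) \<subseteq> U" and x: "x \<in> cbox l u - N" and y: "y \<in> cbox l u - N" for l u \<delta> x y
  proof -
    have step: "\<bar>A r x - A r y\<bar> \<le> S * (r + \<bar>x $ i - y $ i\<bar>)"
      if r: "0 < r" "r < \<delta>" and xy: "x \<in> cbox l u" "y \<in> cbox l u" "\<And>j. j \<noteq> i \<Longrightarrow> x $ j = y $ j" for r x y i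
    proof -
      have *: "\<bar>A r x - A r y\<bar> \<le> S * (r + \<bar>x $ i - y $ i\<bar>)"
        if lt: "x $ i < y $ i" and xy: "x \<in> cbox l u" "y \<in> cbox l u" "\<And>j. j \<noteq> i \<Longrightarrow> x $ j = y $ j" for x y
      proof -
        define t where "t = y $ i - x $ i"
        have t: "t > 0" using lt by (simp add: t_def)
        have y: "y = x + t *\<^sub>R axis i 1" using xy(3) by (auto simp: vec_eq_iff t_def axis_def)
        have "cbox x (x + r *\<^sub>R one + t *\<^sub>R axis i 1) \<subseteq> cbox l (u + \<delta> *\<^sub>R one)"
        proof
          fix w assume w: "w \<in> cbox x (x + r *\<^sub>R one + t *\<^sub>R axis i 1)"
          have "l $ j \<le> w $ j \<and> w $ j \<le> u $ j + \<delta>" for j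
          proof -
            have "x $ j \<le> w $ j" "w $ j \<le> y $ j + r" "l $ j \<le> x $ j" "y $ j \<le> u $ j"
              using w xy(1,2) unfolding mem_box_cart y by (auto simp: one algebra_simps)
            then show ?thesis using r by linarith
          qed
          then show "w \<in> cbox l (u + \<delta> *\<^sub>R one)" unfolding mem_box_cart by (simp add: one)
        qed
        then have "\<bar>A r x - A r y\<bar> \<le> C i * (r + t)"
          unfolding y using sub r t by (intro shift) auto
        also have "\<dots> \<le> S * (r + t)" using S(2)[of i] r t by (intro mult_right_mono) auto
        finally show ?thesis using lt by (simp add: t_def)
      qed
      consider "x $ i < y $ i" | "y $ i < x $ i" | "x $ i = y $ i" by linarith
      then show ?thesis
      proof cases
        case 1
        then show ?thesis using *[OF _ xy] by simp
      next
        case 2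
        then show ?thesis using *[of y x] xy by (simp add: abs_minus_commute)
      next
        case 3
        then have "x = y" using xy(3) by (metis vec_eq_iff)
        then show ?thesis using S r by simp
      qed
    qed
    have chain: "\<bar>A r x - A r y\<bar> \<le> (\<Sum>i\<in>J. S * (r + \<bar>x $ i - y $ i\<bar>))"
      if r: "0 < r" "r < \<delta>" and fin: "finite J" and xy: "x \<in> cbox l u" "y \<in> cbox l u" "\<And>j. j \<notin> J \<Longrightarrow> x $ j = y $ j" for r x y J
      using fin xy
    proof (induction J arbitrary: x)
      case empty
      then have "x = y" by (auto simp: vec_eq_iff)
      then show ?case by simp
    next
      case (insert i J)
      define z where "z = (\<chi> j. if j = i then y $ i else x $ j)"
      have z: "z $ j = (if j = i then y $ i else x $ j)" for j by (simp add: z_def)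
      have zb: "z \<in> cbox l u" using insert.prems unfolding mem_box_cart z by auto
      have 1: "\<bar>A r x - A r z\<bar> \<le> S * (r + \<bar>x $ i - z $ i\<bar>)"
        using insert.prems zb by (intro step r) (auto simp: z)
      have 2: "\<bar>A r z - A r y\<bar> \<le> (\<Sum>j\<in>J. S * (r + \<bar>z $ j - y $ j\<bar>))"
        using insert.prems zb by (intro insert.IH) (auto simp: z)
      have "(\<Sum>j\<in>J. S * (r + \<bar>z $ j - y $ j\<bar>)) = (\<Sum>j\<in>J. S * (r + \<bar>x $ j - y $ j\<bar>))"
        using insert.hyps by (intro sum.cong) (auto simp: z)
      then show ?case using 1 2 insert.hyps by (simp add: z)
    qed
    have "\<bar>F x - F y\<bar> \<le> (S * CARD('n)) * dist x y + e" if e: "e > 0" for e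
    proof -
      obtain d1 where d1: "d1 > 0" "\<And>h. 0 < h \<Longrightarrow> h < d1 \<Longrightarrow> \<bar>A h x - F x\<bar> < e / 3" using lim[of x "e/3"] x e by auto
      obtain d2 where d2: "d2 > 0" "\<And>h. 0 < h \<Longrightarrow> h < d2 \<Longrightarrow> \<bar>A h y - F y\<bar> < e / 3" using lim[of y "e/3"] y e by auto
      \<comment> \<open>Chosen so that the accumulated error \<open>S * CARD('n) * r\<close> is at
        most \<open>e / 3\<close>; the added one avoids division by zero when
        \<open>S = 0\<close>.\<close>
      define d3 where "d3 = e / (3 * (S * CARD('n) + 1))"
      have d3: "d3 > 0" using e S by (simp add: d3_def add_nonneg_pos)
      define r where "r = min (min d1 d2) (min d3 \<delta>) / 2"
      have r: "0 < r" "r < d1" "r < d2" "r < d3" "r < \<delta>" using d1 d2 d3 \<delta> by (auto simp: r_def)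
      have "\<bar>A r x - A r y\<bar> \<le> (\<Sum>i\<in>UNIV. S * (r + \<bar>x $ i - y $ i\<bar>))"
        using x y r by (intro chain) auto
      also have "\<dots> \<le> (\<Sum>i::'n\<in>UNIV. S * (r + dist x y))"
        using S(1) component_le_norm_cart[of "x - y"] by (intro sum_mono mult_left_mono) (auto simp: dist_norm)
      also have "\<dots> = S * CARD('n) * r + S * CARD('n) * dist x y" by (simp add: algebra_simps)
      also have "S * CARD('n) * r \<le> e / 3"
      proof -
        have "S * CARD('n) * r \<le> (S * CARD('n) + 1) * d3" using r S by (intro mult_mono) auto
        also have "\<dots> = e / 3"
        proof -
          have "S * CARD('n) + 1 > 0" using S by (simp add: add_nonneg_pos)
          then show ?thesis by (simp add: d3_def field_simps)
        qed
        finally show ?thesis .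
      qed
      finally have "\<bar>A r x - A r y\<bar> \<le> e / 3 + S * CARD('n) * dist x y" by simp
      then show ?thesis using d1(2)[of r] d2(2)[of r] r by linarith
    qed
    then have "\<bar>F x - F y\<bar> \<le> (S * CARD('n)) * dist x y" by (rule field_le_epsilon)
    moreover have "cbox l u \<subseteq> cbox l (u + \<delta> *\<^sub>R one)" using \<delta> by (auto simp: mem_box_cart one) (smt (verit))
    then have "x \<in> U" "y \<in> U" using x y sub by auto
    ultimately show ?thesis by (simp add: F_def)
  qed
  show thesis
  proof
    show "negligible N" by (rule N)
    show "S * CARD('n) \<ge> 0" using S by simp
    fix z assume "z \<in> U"
    then obtain \<rho> where \<rho>: "\<rho> > 0" "cball z \<rho> \<subseteq> U" using U open_contains_cball by blast
    \<comment> \<open>In the enlarged box every coordinate deviates from \<open>z\<close> by at most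
      \<open>2 * \<delta>\<close>, so the deviations add up to at most
      \<open>\<rho>\<close>.\<close>
    define \<delta> where "\<delta> = \<rho> / (2 * CARD('n))"
    have n1: "1 \<le> 2 * real CARD('n)" using zero_less_card_finite[where 'a = 'n] by linarith
    have "\<rho> / (2 * real CARD('n)) \<le> \<rho> / 1"
      by (rule divide_left_mono[OF n1]) (use \<rho>(1) in auto)
    then have \<delta>: "\<delta> > 0" "\<delta> \<le> \<rho>"
      using \<rho>(1) by (auto simp: \<delta>_def)
    have sub: "cbox (z - \<delta> *\<^sub>R one) (z + \<delta> *\<^sub>R one + \<delta> *\<^sub>R one) \<subseteq> U"
    proof
      fix w assume w0: "w \<in> cbox (z - \<delta> *\<^sub>R one) (z + \<delta> *\<^sub>R one + \<delta> *\<^sub>R one)"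
      have w: "z $ j - \<delta> \<le> w $ j \<and> w $ j \<le> z $ j + \<delta> + \<delta>" for j
        using w0[unfolded mem_box_cart, rule_format, of j] by (simp add: one)
      have "norm (w - z) \<le> (\<Sum>j\<in>UNIV. \<bar>(w - z) $ j\<bar>)" by (rule norm_le_l1_cart)
      also have "\<dots> \<le> (\<Sum>j::'n\<in>UNIV. 2 * \<delta>)"
      proof (rule sum_mono)
        fix j show "\<bar>(w - z) $ j\<bar> \<le> 2 * \<delta>"
          unfolding vector_minus_component using w[of j] \<delta>(1) by linarith
      qed
      also have "\<dots> = \<rho>" by (simp add: \<delta>_def)
      finally show "w \<in> U" using \<rho>(2) by (auto simp: subset_iff dist_norm norm_minus_commute)
    qed
    have inb: "w \<in> cbox (z - \<delta> *\<^sub>R one) (z + \<delta> *\<^sub>R one)" if "w \<in> ball z \<delta>" for w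
    proof -
      have "\<bar>(w - z) $ j\<bar> \<le> \<delta>" for j
        using component_le_norm_cart[of "w - z" j] that by (simp add: dist_norm norm_minus_commute)
      then have "z $ j - \<delta> \<le> w $ j \<and> w $ j \<le> z $ j + \<delta>" for j
        unfolding vector_minus_component by (metis abs_le_iff add.commute diff_le_eq minus_diff_eq)
      then show ?thesis by (simp add: mem_box_cart one)
    qed
    have "ball z \<delta> \<subseteq> U" using \<rho>(2) \<delta>(2) by (auto simp: subset_iff)
    moreover have "\<forall>x\<in>ball z \<delta> - N. \<forall>y\<in>ball z \<delta> - N. \<bar>f x - f y\<bar> \<le> S * CARD('n) * dist x y"
      using cube[OF \<delta>(1) sub] inb by blast
    ultimately show "\<exists>\<delta>>0. ball z \<delta> \<subseteq> U \<and> (\<forall>x\<in>ball z \<delta> - N. \<forall>y\<in>ball z \<delta> - N. \<bar>f x - f y\<bar> \<le> S * CARD('n) * dist x y)"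
      using \<delta>(1) by blast
  qed
qed

text \<open>The constant \<open>L\<close> is the same in all local estimates, so estimates on
  adjacent pieces of the segment add up without loss; compactness enters through the bisection
  principle \<open>Bolzano\<close>.\<close>

lemma lipschitz_along_segment:
  fixes F :: "'a::real_normed_vector \<Rightarrow> real"
  assumes loc: "\<And>z. z \<in> closed_segment a b \<Longrightarrow> \<exists>\<delta>>0. \<forall>x\<in>ball z \<delta>. \<forall>y\<in>ball z \<delta>. \<bar>F x - F y\<bar> \<le> L * dist x y"
    and L: "L \<ge> 0"
  shows "\<bar>F a - F b\<bar> \<le> L * dist a b"
proof -
  define \<gamma> where "\<gamma> t = a + t *\<^sub>R (b - a)" for t
  define P where "P s t \<longleftrightarrow> (0 \<le> s \<longrightarrow> t \<le> 1 \<longrightarrow> \<bar>F (\<gamma> s) - F (\<gamma> t)\<bar> \<le> L * ((t - s) * dist a b))" for s t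
  have "P 0 1"
  proof (rule Bolzano)
    show "P s u" if "P s t" "P t u" "s \<le> t" "t \<le> u" for s t u
      using that unfolding P_def by (auto simp: algebra_simps)
    show "\<exists>d>0. \<forall>s t. s \<le> x \<and> x \<le> t \<and> t - s < d \<longrightarrow> P s t" if x: "0 \<le> x" "x \<le> 1" for x
    proof -
      have "\<gamma> x \<in> closed_segment a b"
        unfolding closed_segment_def \<gamma>_def using x by (auto intro!: exI[of _ x] simp: algebra_simps)
      then obtain \<delta> where \<delta>: "\<delta> > 0" "\<And>y z. y \<in> ball (\<gamma> x) \<delta> \<Longrightarrow> z \<in> ball (\<gamma> x) \<delta> \<Longrightarrow> \<bar>F y - F z\<bar> \<le> L * dist y z"
        using loc by blast
      have dist: "dist (\<gamma> s) (\<gamma> t) = \<bar>t - s\<bar> * dist a b" for s t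
      proof -
        have "\<gamma> s - \<gamma> t = (s - t) *\<^sub>R (b - a)" by (simp add: \<gamma>_def algebra_simps)
        then show ?thesis by (simp add: dist_norm norm_minus_commute abs_minus_commute)
      qed
      define d where "d = \<delta> / (dist a b + 1)"
      have d: "d > 0" using \<delta>(1) by (simp add: d_def add_nonneg_pos)
      have inb: "\<gamma> s \<in> ball (\<gamma> x) \<delta>" if "\<bar>s - x\<bar> < d" for s
      proof -
        have "\<bar>s - x\<bar> * dist a b \<le> \<bar>s - x\<bar> * (dist a b + 1)" by (intro mult_left_mono) auto
        also have "\<dots> < d * (dist a b + 1)" using that by (intro mult_strict_right_mono) (auto simp: add_nonneg_pos)
        also have "\<dots> = \<delta>" by (simp add: d_def add_nonneg_eq_0_iff)
        finally show ?thesis by (simp add: dist)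
      qed
      show ?thesis
      proof (intro exI[of _ d] conjI d allI impI)
        fix s t assume st: "s \<le> x \<and> x \<le> t \<and> t - s < d"
        then have "\<bar>F (\<gamma> s) - F (\<gamma> t)\<bar> \<le> L * dist (\<gamma> s) (\<gamma> t)" by (intro \<delta>(2) inb) auto
        then show "P s t" using st by (simp add: P_def dist)
      qed
    qed
  qed simp
  then show ?thesis by (simp add: P_def \<gamma>_def)
qed

text \<open>Off the null set the function is Lipschitz on small balls and extends to each ball by
  density. Extensions agree on overlaps, being continuous and equal off a null set, so evaluating at
  each point the extension centred there gives one function.\<close>

lemma W1_infty_local_lipschitz:
  fixes f :: "real^'n::finite \<Rightarrow> real"
  assumes U: "open U" and W: "W1_infty U f"
  obtains F L where "L \<ge> 0" "AE x in lebesgue_on U. F x = f x"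
    "\<And>z. z \<in> U \<Longrightarrow> \<exists>\<delta>>0. \<forall>x\<in>ball z \<delta>. \<forall>y\<in>ball z \<delta>. \<bar>F x - F y\<bar> \<le> L * dist x y"
proof -
  obtain N L where N: "negligible N" and L: "L \<ge> 0" and loc: "\<And>z. z \<in> U \<Longrightarrow> \<exists>\<delta>>0. ball z \<delta> \<subseteq> U \<and>
      (\<forall>x\<in>ball z \<delta> - N. \<forall>y\<in>ball z \<delta> - N. \<bar>f x - f y\<bar> \<le> L * dist x y)"
    using W1_infty_AE_local_lipschitz[OF U W] by blast
  have dense: "ball z \<delta> \<subseteq> closure (ball z \<delta> - N)" for z \<delta>
  proof
    fix x assume x: "x \<in> ball z \<delta>"
    show "x \<in> closure (ball z \<delta> - N)"
      unfolding closure_iff_nhds_not_empty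
    proof (intro allI impI)
      fix A V assume V: "V \<subseteq> A" "open V" "x \<in> V"
      have "\<not> negligible (ball z \<delta> \<inter> V)"
        using x V by (intro open_not_negligible) auto
      then have "\<not> ball z \<delta> \<inter> V \<subseteq> N" using N negligible_subset by blast
      then show "(ball z \<delta> - N) \<inter> A \<noteq> {}" using V by blast
    qed
  qed
  have "\<exists>\<delta> g. \<delta> > 0 \<and> ball z \<delta> \<subseteq> U \<and> L-lipschitz_on (ball z \<delta>) g \<and> (\<forall>x\<in>ball z \<delta> - N. g x = f x)" if z: "z \<in> U" for z
  proof -
    obtain \<delta> where \<delta>: "\<delta> > 0" "ball z \<delta> \<subseteq> U"
      "\<forall>x\<in>ball z \<delta> - N. \<forall>y\<in>ball z \<delta> - N. \<bar>f x - f y\<bar> \<le> L * dist x y"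
      using loc[OF z] by blast
    have "L-lipschitz_on (ball z \<delta> - N) f"
      using \<delta>(3) L by (intro lipschitz_onI) (auto simp: dist_real_def)
    then obtain g where "L-lipschitz_on (closure (ball z \<delta> - N)) g" "\<And>x. x \<in> ball z \<delta> - N \<Longrightarrow> g x = f x"
      using lipschitz_extend_closure by metis
    then show ?thesis using \<delta> lipschitz_on_subset[OF _ dense] by blast
  qed
  then obtain \<delta> g where *: "\<And>z. z \<in> U \<Longrightarrow> \<delta> z > 0 \<and> ball z (\<delta> z) \<subseteq> U \<and> L-lipschitz_on (ball z (\<delta> z)) (g z) \<and>
      (\<forall>x\<in>ball z (\<delta> z) - N. g z x = f x)"
    by metis
  define F where "F x = g x x" for x
  have Fg: "F w = g z w" if z: "z \<in> U" and w: "w \<in> ball z (\<delta> z)" for z w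
  proof (rule ccontr)
    assume ne: "F w \<noteq> g z w"
    have wU: "w \<in> U" using * z w by blast
    define B where "B = ball z (\<delta> z) \<inter> ball w (\<delta> w)"
    have "continuous_on B (\<lambda>x. g w x - g z x)"
      using * z wU unfolding B_def
      by (intro continuous_intros; meson Int_lower1 Int_lower2 continuous_on_subset lipschitz_on_continuous_on)
    then have "open (B \<inter> (\<lambda>x. g w x - g z x) -` (- {0}))"
      by (intro continuous_open_preimage) (auto simp: B_def)
    moreover have "w \<in> B \<inter> (\<lambda>x. g w x - g z x) -` (- {0})"
      using ne w * wU by (auto simp: B_def F_def)
    ultimately have "\<not> negligible (B \<inter> (\<lambda>x. g w x - g z x) -` (- {0}))" using open_not_negligible by blast
    moreover have "B \<inter> (\<lambda>x. g w x - g z x) -` (- {0}) \<subseteq> N"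
      using * z wU by (fastforce simp: B_def)
    ultimately show False using N negligible_subset by blast
  qed
  show thesis
  proof
    show "L \<ge> 0" by fact
    have "F x = f x" if "x \<in> U" "x \<notin> N" for x
      using * that by (auto simp: F_def)
    moreover have "AE x in lebesgue. x \<notin> N" using N by (simp add: AE_not_in negligible_iff_null_sets)
    ultimately show "AE x in lebesgue_on U. F x = f x"
      using U by (subst AE_lebesgue_on_iff) (auto elim!: eventually_mono)
    fix z assume z: "z \<in> U"
    have "\<bar>F x - F y\<bar> \<le> L * dist x y" if "x \<in> ball z (\<delta> z)" "y \<in> ball z (\<delta> z)" for x y
    proof -
      have "L-lipschitz_on (ball z (\<delta> z)) (g z)" using * z by blast
      from lipschitz_onD[OF this that] show ?thesis unfolding Fg[OF z that(1)] Fg[OF z that(2)] dist_real_def .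
    qed
    then show "\<exists>\<delta>>0. \<forall>x\<in>ball z \<delta>. \<forall>y\<in>ball z \<delta>. \<bar>F x - F y\<bar> \<le> L * dist x y" using * z by blast
  qed
qed

section \<open>Uniform continuity up to a Lipschitz boundary\<close>

lemma norm_orthogonal_part_le:
  fixes a d :: "'a::real_inner"
  assumes "norm d = 1"
  shows "norm (a - (a \<bullet> d) *\<^sub>R d) \<le> norm a"
proof (rule power2_le_imp_le)
  have "d \<bullet> d = 1" using assms by (simp add: norm_eq_1)
  then have "(norm (a - (a \<bullet> d) *\<^sub>R d))\<^sup>2 = (norm a)\<^sup>2 - (a \<bullet> d)\<^sup>2"
    unfolding power2_norm_eq_inner
    by (simp add: inner_diff_left inner_diff_right inner_commute[of d a] power2_eq_square)
  then show "(norm (a - (a \<bullet> d) *\<^sub>R d))\<^sup>2 \<le> (norm a)\<^sup>2" by simp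
qed simp

text \<open>
  Near a boundary point, two points at height \<open>\<eta>\<close> or more above the graph are joined by a segment
  in the domain, so a Lipschitz function oscillates little: climb, cross, descend.
\<close>

lemma W1_infty_continuous_representative:
  fixes f :: "real^'n::finite \<Rightarrow> real"
  assumes U: "open U" "bounded U" "lipschitz_boundary U" and W: "W1_infty U f"
  shows "\<exists>g. continuous_on (closure U) g \<and> (AE x in lebesgue_on U. g x = f x)"
proof (cases "U = {}")
  case True
  then show ?thesis by (simp add: AE_lebesgue_on_iff)
next
  case False
  then have int: "interior U \<noteq> {}" and hull: "affine hull U = UNIV"
    using U by (auto simp: interior_open affine_hull_open)
  obtain L F where L: "L \<ge> 0" and AE: "AE x in lebesgue_on U. F x = f x"
    and loc: "\<And>z. z \<in> U \<Longrightarrow> \<exists>\<delta>>0. \<forall>x\<in>ball z \<delta>. \<forall>y\<in>ball z \<delta>. \<bar>F x - F y\<bar> \<le> L * dist x y"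
    by (rule W1_infty_local_lipschitz[OF U(1) W]) (rule that)
  have seg: "\<bar>F x - F y\<bar> \<le> L * dist x y" if "closed_segment x y \<subseteq> U" for x y
    using that by (intro lipschitz_along_segment loc L) auto
  have cancel: "c * (2 * (e / (2 * c))) = e" "4 * (c * (e / (4 * c))) = e" if "c > 0" for c e :: real
    using that by simp_all
  have osc: "\<exists>\<rho>>0. \<forall>y\<in>ball x \<rho> \<inter> U. \<forall>z\<in>ball x \<rho> \<inter> U. \<bar>F y - F z\<bar> < e" if x: "x \<in> closure U" and e: "e > 0" for x e
  proof (cases "x \<in> U")
    case True
    obtain r where r: "r > 0" "ball x r \<subseteq> U" using U(1) True open_contains_ball by blast
    define \<rho> where "\<rho> = min r (e / (2 * (L + 1)))"
    have \<rho>: "\<rho> > 0" "\<rho> \<le> r" "\<rho> \<le> e / (2 * (L + 1))" using r e L by (auto simp: \<rho>_def)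
    have "\<bar>F y - F z\<bar> < e" if "y \<in> ball x \<rho>" "z \<in> ball x \<rho>" for y z
    proof -
      have "closed_segment y z \<subseteq> ball x \<rho>" using that by (intro closed_segment_subset) auto
      also have "ball x \<rho> \<subseteq> U" using r(2) subset_ball[OF \<rho>(2), of x] by blast
      finally have "\<bar>F y - F z\<bar> \<le> L * dist y z" by (rule seg)
      also have "\<dots> \<le> (L + 1) * dist y z" by (intro mult_right_mono) auto
      also have "(L + 1) * dist y z < (L + 1) * (2 * \<rho>)"
      proof (rule mult_strict_left_mono)
        show "dist y z < 2 * \<rho>" using that dist_triangle3[of y z x] by simp
      qed (use L in simp)
      also have "\<dots> \<le> (L + 1) * (2 * (e / (2 * (L + 1))))" using L \<rho> by (intro mult_left_mono) auto
      also have "\<dots> = e" using cancel(1)[of "L + 1" e] L by linarith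
      finally show ?thesis .
    qed
    then show ?thesis using \<rho>(1) by blast
  next
    case False
    then have xfr: "x \<in> frontier U" using x U(1) by (simp add: frontier_def interior_open)
    obtain d h M V where d: "norm d = 1" and h: "M-lipschitz_on {z. z \<bullet> d = 0} (h :: real^'n \<Rightarrow> real)"
      and V: "open V" "x \<in> V" and graph: "\<And>y. y \<in> V \<Longrightarrow> y \<in> U \<longleftrightarrow> h (y - (y \<bullet> d) *\<^sub>R d) < y \<bullet> d"
      using U(3)[unfolded lipschitz_boundary_def] xfr
      unfolding rel_frontier_nonempty_interior[OF int] hull by (metis Int_UNIV_right)
    have dd: "d \<bullet> d = 1" using d by (simp add: norm_eq_1)
    have M: "M \<ge> 0" using h by (rule lipschitz_on_nonneg)
    obtain r where r: "r > 0" "ball x r \<subseteq> V" using V open_contains_ball by blast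
    \<comment> \<open>The bound \<open>r / 4\<close> keeps the three legs of the path inside
      \<open>ball x r\<close>, where the graph describes \<open>U\<close>, and
      \<open>e / (4 * (L + 1))\<close> makes their total cost less than \<open>e\<close>.\<close>
    define \<eta> where "\<eta> = min (r / 4) (e / (4 * (L + 1)))"
    have \<eta>: "\<eta> > 0" "\<eta> \<le> r / 4" "\<eta> \<le> e / (4 * (L + 1))"
      unfolding \<eta>_def using r(1) e L by (simp, intro min.cobounded1, intro min.cobounded2)
    \<comment> \<open>Points of \<open>ball x \<rho>\<close> are less than \<open>2 * \<rho>\<close>
      apart, so the graph varies by at most \<open>M * (2 * \<rho>)\<close> between them, and
      lifting by \<open>\<eta>\<close> clears it.\<close>
    define \<rho> where "\<rho> = \<eta> / (2 * (M + 1))"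
    have \<rho>: "\<rho> > 0" "2 * \<rho> * (M + 1) = \<eta>" using \<eta> M by (auto simp: \<rho>_def field_simps)
    have \<rho>\<eta>: "2 * \<rho> \<le> \<eta>" using \<rho> M mult_left_mono[of 1 "M + 1" "2 * \<rho>"] by simp
    have up: "w + s *\<^sub>R d \<in> U" if "w \<in> U" "w \<in> ball x (2 * \<eta>)" "0 \<le> s" "s \<le> \<eta>" for w s
    proof -
      have "dist x (w + s *\<^sub>R d) \<le> dist x w + s"
        using norm_triangle_ineq4[of "x - w" "s *\<^sub>R d"] that d by (simp add: dist_norm diff_diff_eq)
      then have "w + s *\<^sub>R d \<in> ball x r" "w \<in> ball x r" using that \<eta> r by auto
      then have inV: "w + s *\<^sub>R d \<in> V" "w \<in> V" using r by auto
      have "w + s *\<^sub>R d - ((w + s *\<^sub>R d) \<bullet> d) *\<^sub>R d = w - (w \<bullet> d) *\<^sub>R d"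
        by (simp add: inner_add_left dd algebra_simps)
      then have "h (w + s *\<^sub>R d - ((w + s *\<^sub>R d) \<bullet> d) *\<^sub>R d) = h (w - (w \<bullet> d) *\<^sub>R d)" by (rule arg_cong)
      moreover have "(w + s *\<^sub>R d) \<bullet> d = w \<bullet> d + s" by (simp add: inner_add_left dd)
      ultimately show ?thesis using graph[OF inV(1)] graph[OF inV(2)] that by simp
    qed
    have vert: "closed_segment w (w + \<eta> *\<^sub>R d) \<subseteq> U" if "w \<in> U" "w \<in> ball x (2 * \<eta>)" for w
    proof
      fix p assume "p \<in> closed_segment w (w + \<eta> *\<^sub>R d)"
      then obtain u where u: "0 \<le> u" "u \<le> 1" "p = (1 - u) *\<^sub>R w + u *\<^sub>R (w + \<eta> *\<^sub>R d)"
        by (auto simp: closed_segment_def)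
      then have "p = w + (u * \<eta>) *\<^sub>R d" by (simp add: algebra_simps)
      then show "p \<in> U" using up[OF that, of "u * \<eta>"] u \<eta> by (simp add: mult_left_le_one_le)
    qed
    have "\<bar>F y - F z\<bar> < e" if y: "y \<in> ball x \<rho> \<inter> U" and z: "z \<in> ball x \<rho> \<inter> U" for y z
    proof -
      have yz: "dist y z < 2 * \<rho>" using y z dist_triangle3[of y z x] by simp
      have ball: "w \<in> ball x (2 * \<eta>)" if "w \<in> ball x \<rho>" for w using that \<rho>\<eta> \<rho> by simp
      have horiz: "closed_segment (y + \<eta> *\<^sub>R d) (z + \<eta> *\<^sub>R d) \<subseteq> U"
      proof
        fix p assume "p \<in> closed_segment (y + \<eta> *\<^sub>R d) (z + \<eta> *\<^sub>R d)"
        then obtain u where u: "0 \<le> u" "u \<le> 1" "p = (1 - u) *\<^sub>R (y + \<eta> *\<^sub>R d) + u *\<^sub>R (z + \<eta> *\<^sub>R d)"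
          by (auto simp: closed_segment_def)
        define q where "q = (1 - u) *\<^sub>R y + u *\<^sub>R z"
        have p: "p = q + \<eta> *\<^sub>R d" using u(3) by (simp add: q_def algebra_simps)
        have "q \<in> closed_segment y z" using u by (auto simp: closed_segment_def q_def)
        moreover have "closed_segment y z \<subseteq> ball x \<rho>" using y z by (intro closed_segment_subset) auto
        ultimately have q: "q \<in> ball x \<rho>" by blast
        define \<pi> where "\<pi> w = w - (w \<bullet> d) *\<^sub>R d" for w
        have \<pi>0: "\<pi> w \<in> {z. z \<bullet> d = 0}" for w by (simp add: \<pi>_def inner_diff_left dd)
        have hl: "h (\<pi> q) \<le> h (\<pi> w) + M * dist q w" for w
        proof -
          have "dist (h (\<pi> q)) (h (\<pi> w)) \<le> M * dist (\<pi> q) (\<pi> w)"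
            by (rule lipschitz_onD[OF h \<pi>0 \<pi>0])
          moreover have "dist (\<pi> q) (\<pi> w) \<le> dist q w"
          proof -
            have "\<pi> q - \<pi> w = (q - w) - ((q - w) \<bullet> d) *\<^sub>R d"
              by (simp add: \<pi>_def inner_diff_left algebra_simps)
            then show ?thesis unfolding dist_norm using norm_orthogonal_part_le[OF d] by metis
          qed
          then have "M * dist (\<pi> q) (\<pi> w) \<le> M * dist q w" using M by (rule mult_left_mono)
          ultimately show ?thesis by (auto simp: dist_real_def)
        qed
        have dq: "dist q y \<le> dist y z" "dist q z \<le> dist y z"
          using \<open>q \<in> closed_segment y z\<close> dist_in_closed_segment[of q y z] by (auto simp: dist_commute)
        have yh: "h (\<pi> y) < y \<bullet> d" "h (\<pi> z) < z \<bullet> d"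
        proof -
          have "ball x \<rho> \<subseteq> V" using r(2) subset_ball[of \<rho> r x] \<rho>\<eta> \<eta> \<rho>(1) by auto
          then show "h (\<pi> y) < y \<bullet> d" "h (\<pi> z) < z \<bullet> d"
            using graph[of y] graph[of z] y z unfolding \<pi>_def by blast+
        qed
        have "h (\<pi> q) \<le> h (\<pi> y) + M * dist y z" "h (\<pi> q) \<le> h (\<pi> z) + M * dist y z"
          using hl[of y] hl[of z] mult_left_mono[OF dq(1) M] mult_left_mono[OF dq(2) M] by linarith+
        then have a: "h (\<pi> q) < y \<bullet> d + M * dist y z" "h (\<pi> q) < z \<bullet> d + M * dist y z" using yh by auto
        \<comment> \<open>The bounds from the two end points are averaged with the weights defining
          \<open>q\<close>, so that the height of \<open>q\<close> itself appears.\<close>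
        have "(1 - u) * h (\<pi> q) + u * h (\<pi> q) < (1 - u) * (y \<bullet> d + M * dist y z) + u * (z \<bullet> d + M * dist y z)"
        proof (cases "u = 0")
          case False
          then show ?thesis using a u by (intro add_le_less_mono mult_left_mono mult_strict_left_mono) auto
        qed (use a in simp)
        then have "h (\<pi> q) < q \<bullet> d + M * dist y z"
          by (simp add: q_def inner_add_left algebra_simps)
        moreover have "M * dist y z \<le> (M + 1) * (2 * \<rho>)" using yz M by (intro mult_mono) auto
        ultimately have "h (\<pi> q) < q \<bullet> d + \<eta>" using \<rho>(2) by (simp add: mult.commute)
        moreover have "\<pi> p = \<pi> q" "p \<bullet> d = q \<bullet> d + \<eta>" by (auto simp: p \<pi>_def inner_add_left dd algebra_simps)
        moreover have "p \<in> V"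
        proof -
          have "dist x p \<le> dist x q + \<eta>"
            using norm_triangle_ineq4[of "x - q" "\<eta> *\<^sub>R d"] \<eta> d by (simp add: p dist_norm diff_diff_eq)
          then have "p \<in> ball x r" using q \<rho>\<eta> \<eta> \<rho> by auto
          then show ?thesis using r by auto
        qed
        ultimately show "p \<in> U" using graph[of p] by (simp add: \<pi>_def)
      qed
      have "\<bar>F y - F (y + \<eta> *\<^sub>R d)\<bar> \<le> L * \<eta>" "\<bar>F z - F (z + \<eta> *\<^sub>R d)\<bar> \<le> L * \<eta>"
        using seg[OF vert[of y]] seg[OF vert[of z]] y z ball \<eta> d by (auto simp: dist_norm)
      moreover have "\<bar>F (y + \<eta> *\<^sub>R d) - F (z + \<eta> *\<^sub>R d)\<bar> \<le> L * dist y z"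
        using seg[OF horiz] by simp
      moreover have "L * dist y z \<le> L * \<eta>" using yz \<rho>\<eta> L by (intro mult_left_mono) auto
      ultimately have "\<bar>F y - F z\<bar> \<le> 3 * (L * \<eta>)" by linarith
      also have "\<dots> < 4 * ((L + 1) * \<eta>)" using \<eta>(1) mult_nonneg_nonneg[OF L less_imp_le[OF \<eta>(1)]] by (simp add: algebra_simps)
      also have "\<dots> \<le> 4 * ((L + 1) * (e / (4 * (L + 1))))" using L \<eta> by (intro mult_left_mono) auto
      also have "\<dots> = e" using cancel(2)[of "L + 1" e] L by linarith
      finally show ?thesis .
    qed
    then show ?thesis using \<rho>(1) by blast
  qed
  have "uniformly_continuous_on U F"
    unfolding uniformly_continuous_on_def
  proof (intro allI impI)
    fix e :: real assume e: "e > 0"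
    \<comment> \<open>Balls of small oscillation cover the compact closure; a Lebesgue number of
      this cover serves as the modulus of continuity for \<open>e\<close>.\<close>
    define \<G> where "\<G> = {ball x \<rho> |x \<rho>. \<rho> > 0 \<and> (\<forall>y\<in>ball x \<rho> \<inter> U. \<forall>z\<in>ball x \<rho> \<inter> U. \<bar>F y - F z\<bar> < e)}"
    have comp: "compact (closure U)" using U(2) by simp
    have cover: "closure U \<subseteq> \<Union>\<G>"
    proof
      fix x assume "x \<in> closure U"
      then obtain \<rho> where "\<rho> > 0" "\<forall>y\<in>ball x \<rho> \<inter> U. \<forall>z\<in>ball x \<rho> \<inter> U. \<bar>F y - F z\<bar> < e" using osc e by blast
      then have "ball x \<rho> \<in> \<G>" "x \<in> ball x \<rho>" by (auto simp: \<G>_def)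
      then show "x \<in> \<Union>\<G>" by blast
    qed
    have opn: "open G" if "G \<in> \<G>" for G using that by (auto simp: \<G>_def)
    obtain d where d: "d > 0" "\<And>x. x \<in> closure U \<Longrightarrow> \<exists>G\<in>\<G>. ball x d \<subseteq> G"
      by (rule Heine_Borel_lemma[OF comp cover]) (erule opn, rule that)
    show "\<exists>d>0. \<forall>x\<in>U. \<forall>x'\<in>U. dist x' x < d \<longrightarrow> dist (F x') (F x) < e"
    proof (intro exI[of _ d] conjI d(1) ballI impI)
      fix x x' assume xx: "x \<in> U" "x' \<in> U" "dist x' x < d"
      obtain G where G: "G \<in> \<G>" "ball x d \<subseteq> G" using d(2)[of x] xx(1) closure_subset by blast
      have "x \<in> G" "x' \<in> G" using G(2) xx d(1) by (auto simp: subset_iff dist_commute)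
      then show "dist (F x') (F x) < e" using G(1) xx by (auto simp: \<G>_def dist_real_def)
    qed
  qed
  then obtain g where g: "uniformly_continuous_on (closure U) g" "\<And>x. x \<in> U \<Longrightarrow> F x = g x"
    by (rule uniformly_continuous_on_extension_on_closure) (rule that)
  have "AE x in lebesgue_on U. g x = f x"
    using AE g(2) U(1) by (subst (asm) AE_lebesgue_on_iff, simp, subst AE_lebesgue_on_iff, simp) (auto elim!: eventually_mono)
  then show ?thesis using g(1) uniformly_continuous_imp_continuous by blast
qed

subsection \<open>Energies and equilibria\<close>

text \<open>The constant state, cut off outside the closures of cells and faces as membership in
  \<open>hybrid_space\<close> requires.\<close>

definition const_hybrid :: "'n::finite mesh \<Rightarrow> real \<Rightarrow> 'n hybrid" where
  "const_hybrid D c = \<lparr>cell = (\<lambda>K x. if K \<in> cells D \<and> x \<in> closure K then c else 0),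
    face = (\<lambda>\<sigma> x. if \<sigma> \<in> faces D \<and> x \<in> closure \<sigma> then c else 0)\<rparr>"

lemma const_hybrid_in_hybrid_space: "const_hybrid D c \<in> hybrid_space k D"
proof -
  have "cell (const_hybrid D c) K \<in> poly_on (k + 1) K" if "K \<in> cells D" for K
    using poly_on_const[of K c "k + 1"] that by (simp add: const_hybrid_def)
  moreover have "face (const_hybrid D c) \<sigma> \<in> poly_on k \<sigma>" if "\<sigma> \<in> faces D" for \<sigma>
    using poly_on_const[of \<sigma> c k] that by (simp add: const_hybrid_def)
  ultimately show ?thesis by (simp add: hybrid_space_def) (simp add: const_hybrid_def)
qed

lemma hybrid_space_cell: "v \<in> hybrid_space k D \<Longrightarrow> K \<in> cells D \<Longrightarrow> cell v K \<in> poly_on (k + 1) K"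
  unfolding hybrid_space_def mem_Collect_eq by (elim conjE) (drule spec[of _ K], simp)

lemma hybrid_space_face: "v \<in> hybrid_space k D \<Longrightarrow> \<sigma> \<in> faces D \<Longrightarrow> face v \<sigma> \<in> poly_on k \<sigma>"
  unfolding hybrid_space_def mem_Collect_eq by (elim conjE, drule spec[of _ \<sigma>] , drule spec[of _ \<sigma>], simp)

lemma hybrid_space_eqI:
  assumes v: "v \<in> hybrid_space k D" and w: "w \<in> hybrid_space k' D"
    and c: "\<And>K x. K \<in> cells D \<Longrightarrow> cell v K x = cell w K x" and f: "\<And>\<sigma> x. \<sigma> \<in> faces D \<Longrightarrow> face v \<sigma> x = face w \<sigma> x"
  shows "v = w"
proof -
  have "cell v K = cell w K" for K
  proof (cases "K \<in> cells D")
    case True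
    then show ?thesis using c by auto
  next
    case False
    then have "cell v K = (\<lambda>_. 0)" "cell w K = (\<lambda>_. 0)" using v w unfolding hybrid_space_def by simp_all
    then show ?thesis by simp
  qed
  moreover have "face v \<sigma> = face w \<sigma>" for \<sigma>
  proof (cases "\<sigma> \<in> faces D")
    case True
    then show ?thesis using f by auto
  next
    case False
    then have "face v \<sigma> = (\<lambda>_. 0)" "face w \<sigma> = (\<lambda>_. 0)" using v w unfolding hybrid_space_def by simp_all
    then show ?thesis by simp
  qed
  ultimately show ?thesis by (cases v; cases w) auto
qed

lemma hybrid_space_add:
  assumes v: "v \<in> hybrid_space k D" and w: "w \<in> hybrid_space k D"
  shows "hybrid_add v w \<in> hybrid_space k D"
proof -
  have "cell (hybrid_add v w) K \<in> poly_on (k + 1) K" if "K \<in> cells D" for K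
    unfolding hybrid_add_def using poly_on_add[OF hybrid_space_cell[OF v that] hybrid_space_cell[OF w that]] by simp
  moreover have "face (hybrid_add v w) \<sigma> \<in> poly_on k \<sigma>" if "\<sigma> \<in> faces D" for \<sigma>
    unfolding hybrid_add_def using poly_on_add[OF hybrid_space_face[OF v that] hybrid_space_face[OF w that]] by simp
  moreover have "cell (hybrid_add v w) K = (\<lambda>_. 0)" if "K \<notin> cells D" for K
    using v w that unfolding hybrid_space_def hybrid_add_def by simp
  moreover have "face (hybrid_add v w) \<sigma> = (\<lambda>_. 0)" if "\<sigma> \<notin> faces D" for \<sigma>
    using v w that unfolding hybrid_space_def hybrid_add_def by simp
  ultimately show ?thesis unfolding hybrid_space_def by simp
qed

text \<open>Used to solve for a logarithm potential whose sum with the discrete potential is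
  prescribed.\<close>

definition hybrid_neg :: "'n::finite hybrid \<Rightarrow> 'n hybrid" where
  "hybrid_neg v = \<lparr>cell = (\<lambda>K x. - cell v K x), face = (\<lambda>\<sigma> x. - face v \<sigma> x)\<rparr>"

lemma hybrid_space_neg:
  assumes v: "v \<in> hybrid_space k D"
  shows "hybrid_neg v \<in> hybrid_space k D"
proof -
  have "cell (hybrid_neg v) K \<in> poly_on (k + 1) K" if "K \<in> cells D" for K
    unfolding hybrid_neg_def using poly_on_cmult[OF hybrid_space_cell[OF v that], of "-1"] by simp
  moreover have "face (hybrid_neg v) \<sigma> \<in> poly_on k \<sigma>" if "\<sigma> \<in> faces D" for \<sigma>
    unfolding hybrid_neg_def using poly_on_cmult[OF hybrid_space_face[OF v that], of "-1"] by simp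
  moreover have "cell (hybrid_neg v) K = (\<lambda>_. 0)" if "K \<notin> cells D" for K
    using v that unfolding hybrid_space_def hybrid_neg_def by simp
  moreover have "face (hybrid_neg v) \<sigma> = (\<lambda>_. 0)" if "\<sigma> \<notin> faces D" for \<sigma>
    using v that unfolding hybrid_space_def hybrid_neg_def by simp
  ultimately show ?thesis unfolding hybrid_space_def by simp
qed

section \<open>Traces and positive coefficients\<close>

lemma L_infty_mult_integrable:
  fixes f h :: "real^'n::finite \<Rightarrow> real"
  assumes \<Omega>: "open \<Omega>" and f: "L_infty \<Omega> f" and K: "open K" "bounded K" "K \<subseteq> \<Omega>" and h: "continuous_on (closure K) h"
  shows "set_integrable lebesgue K (\<lambda>x. f x * h x)"
proof -
  obtain M where M: "M \<ge> 0" "AE x in lebesgue_on \<Omega>. \<bar>f x\<bar> \<le> M" by (rule L_infty_AE_bounded[OF f])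
  have hint: "set_integrable lebesgue K h" by (rule faithful_integrable[OF faithful_lebesgue[OF K(1,2)] h])
  have [measurable]: "(\<lambda>x. indicator \<Omega> x * f x) \<in> borel_measurable lebesgue"
    using f \<Omega> unfolding L_infty_def by (simp add: borel_measurable_restrict_space_iff)
  have [measurable]: "(\<lambda>x. indicator K x * h x) \<in> borel_measurable lebesgue"
    using hint by (auto simp: set_integrable_def)
  have eq: "indicator K x *\<^sub>R (f x * h x) = (indicator \<Omega> x * f x) * (indicator K x * h x)" for x
    using K(3) by (auto simp: indicator_def)
  show ?thesis
    unfolding set_integrable_def
  proof (rule Bochner_Integration.integrable_bound)
    show "integrable lebesgue (\<lambda>x. M * (indicator K x * h x))"
      using hint by (intro integrable_mult_right) (simp add: set_integrable_def)
    show "(\<lambda>x. indicator K x *\<^sub>R (f x * h x)) \<in> borel_measurable lebesgue" unfolding eq by measurable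
    have "AE x in lebesgue. x \<in> \<Omega> \<longrightarrow> \<bar>f x\<bar> \<le> M" using M(2) \<Omega> by (subst (asm) AE_lebesgue_on_iff) auto
    then show "AE x in lebesgue. norm (indicator K x *\<^sub>R (f x * h x)) \<le> norm (M * (indicator K x * h x))"
    proof eventually_elim
      case (elim x)
      then show ?case using M(1) K(3) by (auto simp: indicator_def abs_mult intro!: mult_right_mono)
    qed
  qed
qed

locale diffusion_mesh = mesh_on \<Omega> D for \<Omega> :: "(real^'n::finite) set" and D :: "'n mesh" +
  fixes \<Lambda> :: "real^'n \<Rightarrow> real^'n^'n" and \<phi> :: "real^'n \<Rightarrow> real" and k :: nat
  assumes domain: "open \<Omega>" "bounded \<Omega>" "connected \<Omega>" "lipschitz_boundary \<Omega>"
    and Lambda_bounded: "\<And>i j. L_infty \<Omega> (\<lambda>x. \<Lambda> x $ i $ j)"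
    and Lambda_elliptic: "\<exists>c>0. AE x in lebesgue_on \<Omega>. \<forall>\<xi>. (\<Lambda> x *v \<xi>) \<bullet> \<xi> \<ge> c * (norm \<xi>)\<^sup>2"
    and phi: "W1_infty \<Omega> \<phi>"
    and Lambda_cells: "\<And>K i j. K \<in> cells D \<Longrightarrow> W1_infty K (\<lambda>x. \<Lambda> x $ i $ j)"
begin

abbreviation potential :: "'n hybrid" where "potential \<equiv> discrete_potential k \<Omega> D \<phi>"

text \<open>In cells, boundedness of \<open>\<phi>\<close> is enough for the projection. On faces,
  the choice in \<open>boundary_trace\<close> is meaningful because a continuous representative
  exists up to the boundary.\<close>

lemma potential_in_hybrid_space: "potential \<in> hybrid_space k D"
proof -
  have "L_infty \<Omega> \<phi>" using phi by (simp add: W1_infty_def)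
  have "cell_proj (k + 1) K \<phi> \<in> poly_on (k + 1) K" if "K \<in> cells D" for K
    by (rule L2_proj(1)[OF faithful_cell[OF that]])
      (intro L_infty_mult_integrable[OF domain(1) \<open>L_infty \<Omega> \<phi>\<close>] cell_props that poly_on_continuous)
  moreover have "face_proj k \<sigma> (boundary_trace \<Omega> \<phi>) \<in> poly_on k \<sigma>" if \<sigma>: "\<sigma> \<in> faces D" for \<sigma>
  proof -
    have "\<exists>g. continuous_on (closure \<Omega>) g \<and> (AE x in lebesgue_on \<Omega>. g x = \<phi> x)"
      by (rule W1_infty_continuous_representative[OF domain(1,2,4) phi])
    then have "continuous_on (closure \<Omega>) (boundary_trace \<Omega> \<phi>)"
      unfolding boundary_trace_def by (rule someI2_ex) blast
    moreover have "closure \<sigma> \<subseteq> closure \<Omega>" using face_props(1)[OF \<sigma>] by (simp add: closure_minimal)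
    ultimately have "continuous_on (closure \<sigma>) (boundary_trace \<Omega> \<phi>)" by (rule continuous_on_subset)
    then show ?thesis
      using L2_proj_continuous_integrable[OF faithful_face[OF \<sigma>]] by (intro L2_proj(1)[OF faithful_face[OF \<sigma>]])
  qed
  ultimately show ?thesis unfolding hybrid_space_def discrete_potential_def by simp
qed

text \<open>Ellipticity holds almost everywhere, and a violation by the continuous trace at a point
  of the cell would persist on an open set, which is not negligible. Continuity carries the bound to
  the closed cell and hence to the faces.\<close>

lemma normal_diffusion_lower_bound:
  obtains c where "c > 0" "AE x in lebesgue_on \<Omega>. \<forall>\<xi>. (\<Lambda> x *v \<xi>) \<bullet> \<xi> \<ge> c * (norm \<xi>)\<^sup>2"
    "\<And>K \<sigma>. K \<in> cells D \<Longrightarrow> \<sigma> \<in> cell_faces D K \<Longrightarrow> continuous_on (closure \<sigma>) (normal_diffusion \<Lambda> K \<sigma>)"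
    "\<And>K \<sigma> x. K \<in> cells D \<Longrightarrow> \<sigma> \<in> cell_faces D K \<Longrightarrow> x \<in> closure \<sigma> \<Longrightarrow> c \<le> normal_diffusion \<Lambda> K \<sigma> x"
proof -
  obtain c where c: "c > 0" "AE x in lebesgue_on \<Omega>. \<forall>\<xi>. (\<Lambda> x *v \<xi>) \<bullet> \<xi> \<ge> c * (norm \<xi>)\<^sup>2"
    using Lambda_elliptic by blast
  have trace: "continuous_on (closure K) (boundary_trace K \<Lambda>) \<and> (AE x in lebesgue_on K. boundary_trace K \<Lambda> x = \<Lambda> x)"
    if K: "K \<in> cells D" for K
  proof -
    have "\<exists>g. continuous_on (closure K) g \<and> (AE x in lebesgue_on K. g x = \<Lambda> x $ i $ j)" for i j
      by (rule W1_infty_continuous_representative[OF cell_props(1,3,2)[OF K] Lambda_cells[OF K]])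
    then have "\<forall>i. \<forall>j. \<exists>g. continuous_on (closure K) g \<and> (AE x in lebesgue_on K. g x = \<Lambda> x $ i $ j)" by blast
    then obtain g where "\<forall>i j. continuous_on (closure K) (g i j) \<and> (AE x in lebesgue_on K. g i j x = \<Lambda> x $ i $ j)"
      unfolding choice_iff by blast
    then have g: "\<And>i j. continuous_on (closure K) (g i j)" "\<And>i j. AE x in lebesgue_on K. g i j x = \<Lambda> x $ i $ j"
      by blast+
    define G where "G x = (\<chi> i j. g i j x)" for x
    have "continuous_on (closure K) G" unfolding G_def by (intro continuous_on_vec_lambda g)
    moreover have "AE x in lebesgue_on K. \<forall>i j. g i j x = \<Lambda> x $ i $ j"
      using g(2) by (simp add: AE_all_countable)
    then have "AE x in lebesgue_on K. G x = \<Lambda> x"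
      by eventually_elim (simp add: G_def vec_eq_iff)
    ultimately have "\<exists>g. continuous_on (closure K) g \<and> (AE x in lebesgue_on K. g x = \<Lambda> x)" by blast
    then show ?thesis unfolding boundary_trace_def by (rule someI_ex)
  qed
  have quad: "continuous_on (closure K) (\<lambda>x. (boundary_trace K \<Lambda> x *v \<xi>) \<bullet> \<xi>)" if K: "K \<in> cells D" for K \<xi>
    using trace[OF K] unfolding matrix_vector_mult_def inner_vec_def
    by (auto intro!: continuous_intros)
  have lower: "c * (norm \<xi>)\<^sup>2 \<le> (boundary_trace K \<Lambda> x *v \<xi>) \<bullet> \<xi>" if K: "K \<in> cells D" and x: "x \<in> closure K" for K x \<xi>
  proof (rule continuous_ge_on_closure[OF quad[OF K] x])
    fix y assume y: "y \<in> K"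
    let ?q = "\<lambda>x. (boundary_trace K \<Lambda> x *v \<xi>) \<bullet> \<xi>"
    show "c * (norm \<xi>)\<^sup>2 \<le> ?q y"
    proof (rule ccontr)
      assume "\<not> c * (norm \<xi>)\<^sup>2 \<le> ?q y"
      then have yW: "y \<in> K \<inter> ?q -` {..<c * (norm \<xi>)\<^sup>2}" using y by simp
      have "open (K \<inter> ?q -` {..<c * (norm \<xi>)\<^sup>2})"
        using cell_props(1)[OF K] continuous_on_subset[OF quad[OF K] closure_subset] by (intro continuous_open_preimage) auto
      then have "\<not> negligible (K \<inter> ?q -` {..<c * (norm \<xi>)\<^sup>2})" using yW open_not_negligible by blast
      moreover have "AE x in lebesgue. x \<in> \<Omega> \<longrightarrow> (\<forall>\<xi>. (\<Lambda> x *v \<xi>) \<bullet> \<xi> \<ge> c * (norm \<xi>)\<^sup>2)"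
        using c(2) domain(1) by (subst (asm) AE_lebesgue_on_iff) auto
      moreover have "AE x in lebesgue. x \<in> K \<longrightarrow> boundary_trace K \<Lambda> x = \<Lambda> x"
        using conjunct2[OF trace[OF K]] cell_props(1)[OF K] by (subst (asm) AE_lebesgue_on_iff) auto
      ultimately have "AE x in lebesgue. x \<in> K \<longrightarrow> c * (norm \<xi>)\<^sup>2 \<le> ?q x"
        using cell_props(5)[OF K] by (auto elim: eventually_elim2)
      then have "negligible {x. \<not> (x \<in> K \<longrightarrow> c * (norm \<xi>)\<^sup>2 \<le> ?q x)}" by (rule negligible_AE)
      moreover have "K \<inter> ?q -` {..<c * (norm \<xi>)\<^sup>2} \<subseteq> {x. \<not> (x \<in> K \<longrightarrow> c * (norm \<xi>)\<^sup>2 \<le> ?q x)}" by auto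
      ultimately show False using \<open>\<not> negligible (K \<inter> ?q -` {..<c * (norm \<xi>)\<^sup>2})\<close> negligible_subset by blast
    qed
  qed
  show thesis
  proof (rule that[OF c])
    show "continuous_on (closure \<sigma>) (normal_diffusion \<Lambda> K \<sigma>)" if "K \<in> cells D" "\<sigma> \<in> cell_faces D K" for K \<sigma>
      unfolding normal_diffusion_def[abs_def]
      using continuous_on_subset[OF quad[OF that(1)] cell_face(3)[OF that]] .
    show "c \<le> normal_diffusion \<Lambda> K \<sigma> x" if "K \<in> cells D" "\<sigma> \<in> cell_faces D K" "x \<in> closure \<sigma>" for K \<sigma> x
    proof -
      have "x \<in> closure K" using cell_face(3)[OF that(1,2)] that(3) by blast
      from lower[OF that(1) this, of "outward_normal K \<sigma>"]
      show ?thesis using cell_face(4)[OF that(1,2)] by (simp add: normal_diffusion_def)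
    qed
  qed
qed

text \<open>Positive surface measure of the face turns an almost everywhere bound into a bound on
  the essential supremum. An upper bound is needed as well, since \<open>real_of_ereal\<close> sends
  an infinite value to zero.\<close>

lemma face_linf_norm_pos:
  assumes \<sigma>: "\<sigma> \<in> faces D" and h: "continuous_on (closure \<sigma>) h" "c > 0" "\<And>x. x \<in> \<sigma> \<Longrightarrow> c \<le> h x"
  shows "face_linf_norm \<sigma> h > 0"
proof -
  let ?M = "restrict_space (surface_measure \<sigma>) \<sigma>"
  let ?h = "\<lambda>x. ereal \<bar>h x\<bar>"
  have "h \<in> borel_measurable (restrict_space borel \<sigma>)"
    using continuous_on_subset[OF h(1) closure_subset] by (rule borel_measurable_continuous_on_restrict)
  moreover have "sets ?M = sets (restrict_space borel \<sigma>)" by (intro sets_restrict_space_cong) simp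
  ultimately have "h \<in> borel_measurable ?M" using measurable_cong_sets by blast
  then have meas: "?h \<in> borel_measurable ?M" by measurable
  have "emeasure (surface_measure \<sigma>) \<sigma> > 0" using mesh_faces \<sigma> by blast
  moreover obtain V where "open V" "\<sigma> = affine hull \<sigma> \<inter> V"
    using face_props(3)[OF \<sigma>] by (auto simp: openin_open)
  then have "\<sigma> \<in> sets borel" using closed_affine_hull[of \<sigma>] by (metis borel_closed borel_open sets.Int)
  ultimately have "emeasure ?M (space ?M) \<noteq> 0" by (simp add: emeasure_restrict_space space_restrict_space)
  then have nbot: "ae_filter ?M \<noteq> bot" by (simp add: ae_filter_eq_bot_iff)
  have space: "space ?M = \<sigma>" by (simp add: space_restrict_space)
  have "compact (closure \<sigma>)" using face_props(4)[OF \<sigma>] by simp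
  then have "bounded (h ` closure \<sigma>)" using h(1) compact_continuous_image compact_imp_bounded by blast
  then obtain B where "\<forall>y\<in>h ` closure \<sigma>. norm y \<le> B" unfolding bounded_iff by blast
  then have "\<bar>h x\<bar> \<le> B" if "x \<in> \<sigma>" for x using that closure_subset[of \<sigma>] by auto
  then have up: "esssup ?M ?h \<le> ereal B" by (intro esssup_I meas AE_I2) (simp add: space)
  have "AE x in ?M. ?h x \<le> esssup ?M ?h" by (rule esssup_AE)
  moreover have "AE x in ?M. ereal c \<le> ?h x" using h(2,3) space by (intro AE_I2) fastforce
  ultimately have "AE x in ?M. ereal c \<le> esssup ?M ?h" by eventually_elim (rule order_trans)
  then have "ereal c \<le> esssup ?M ?h" using nbot by (simp add: eventually_const_iff)
  then show ?thesis unfolding linf_norm_def using up h(2) by (cases "esssup ?M ?h") auto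
qed

lemma face_diameter_pos:
  assumes "\<sigma> \<in> faces D"
  shows "diameter \<sigma> > 0"
proof -
  obtain x where x: "x \<in> \<sigma>" using face_props(5)[OF assms] by blast
  have "\<sigma> \<noteq> {x}" using face_props(7)[OF assms] dim by auto
  then obtain y where "y \<in> \<sigma>" "y \<noteq> x" using x by blast
  then show ?thesis using diameter_bounded_bound[OF face_props(4)[OF assms] x, of y] by (metis dist_pos_lt less_le_trans)
qed

text \<open>The integrand need not be continuous, because \<open>\<Lambda>\<close> enters as a
  bounded measurable function. Ellipticity compares it with \<open>c\<close> times a continuous
  non-negative integrand, whose vanishing is detected pointwise.\<close>

lemma volume_term:
  assumes K: "K \<in> cells D" and e: "continuous_on (closure K) e" "\<And>x. x \<in> K \<Longrightarrow> 0 < e x"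
    and G: "G \<in> vec_poly_on k K"
  shows "0 \<le> (LINT x:K|lebesgue. e x * ((\<Lambda> x *v G x) \<bullet> G x))"
    and "(LINT x:K|lebesgue. e x * ((\<Lambda> x *v G x) \<bullet> G x)) = 0 \<Longrightarrow> G = (\<lambda>x. 0)"
proof -
  obtain c where c: "c > 0" "AE x in lebesgue_on \<Omega>. \<forall>\<xi>. (\<Lambda> x *v \<xi>) \<bullet> \<xi> \<ge> c * (norm \<xi>)\<^sup>2"
    using Lambda_elliptic by blast
  have Gi: "(\<lambda>x. G x $ i) \<in> poly_on k K" for i using G by (simp add: vec_poly_on_def)
  have contG: "continuous_on (closure K) (\<lambda>x. G x $ i)" for i by (rule poly_on_continuous[OF Gi])
  have eq: "e x * ((\<Lambda> x *v G x) \<bullet> G x) = (\<Sum>i\<in>UNIV. \<Sum>j\<in>UNIV. \<Lambda> x $ i $ j * (e x * G x $ j * G x $ i))" for x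
    by (simp add: matrix_vector_mult_def inner_vec_def sum_distrib_left sum_distrib_right mult_ac)
  have int1: "set_integrable lebesgue K (\<lambda>x. e x * ((\<Lambda> x *v G x) \<bullet> G x))"
    unfolding eq set_integrable_def scaleR_sum_right
    by (intro Bochner_Integration.integrable_sum, fold set_integrable_def)
      (intro L_infty_mult_integrable[OF domain(1) Lambda_bounded] cell_props K continuous_on_mult e contG)
  have contn: "continuous_on (closure K) (\<lambda>x. e x * (\<Sum>i\<in>UNIV. G x $ i * G x $ i))"
    by (intro continuous_on_mult e continuous_on_sum contG)
  have n2: "(norm (G x))\<^sup>2 = (\<Sum>i\<in>UNIV. G x $ i * G x $ i)" for x
    by (simp add: power2_norm_eq_inner inner_vec_def)
  let ?n = "\<lambda>x. e x * (norm (G x))\<^sup>2"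
  have contn': "continuous_on (closure K) ?n" using contn by (simp add: n2)
  have int2: "set_integrable lebesgue K ?n" by (rule faithful_integrable[OF faithful_cell[OF K] contn'])
  have nn: "0 \<le> ?n x" if "x \<in> K" for x using e(2)[OF that] by simp
  have "(LINT x:K|lebesgue. c * ?n x) \<le> (LINT x:K|lebesgue. e x * ((\<Lambda> x *v G x) \<bullet> G x))"
  proof (rule set_integral_mono_AE)
    show "set_integrable lebesgue K (\<lambda>x. c * ?n x)" using int2 by simp
    have "AE x in lebesgue. x \<in> \<Omega> \<longrightarrow> (\<forall>\<xi>. (\<Lambda> x *v \<xi>) \<bullet> \<xi> \<ge> c * (norm \<xi>)\<^sup>2)"
      using c(2) domain(1) by (subst (asm) AE_lebesgue_on_iff) auto
    then show "AE x\<in>K in lebesgue. c * ?n x \<le> e x * ((\<Lambda> x *v G x) \<bullet> G x)"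
    proof eventually_elim
      case (elim x)
      show ?case
      proof
        assume x: "x \<in> K"
        then have "c * (norm (G x))\<^sup>2 \<le> (\<Lambda> x *v G x) \<bullet> G x" using elim cell_props(5)[OF K] by blast
        then have "e x * (c * (norm (G x))\<^sup>2) \<le> e x * ((\<Lambda> x *v G x) \<bullet> G x)" using e(2)[OF x] by (intro mult_left_mono) auto
        then show "c * ?n x \<le> e x * ((\<Lambda> x *v G x) \<bullet> G x)" by (simp add: mult.left_commute)
      qed
    qed
  qed (rule int1)
  then have le: "c * (LINT x:K|lebesgue. ?n x) \<le> (LINT x:K|lebesgue. e x * ((\<Lambda> x *v G x) \<bullet> G x))" by simp
  have n0: "0 \<le> (LINT x:K|lebesgue. ?n x)"
    unfolding set_lebesgue_integral_def using nn by (intro integral_nonneg_AE AE_I2) (auto simp: indicator_def)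
  then show "0 \<le> (LINT x:K|lebesgue. e x * ((\<Lambda> x *v G x) \<bullet> G x))"
    using le c(1) by (meson mult_nonneg_nonneg less_imp_le order_trans)
  assume "(LINT x:K|lebesgue. e x * ((\<Lambda> x *v G x) \<bullet> G x)) = 0"
  then have "c * (LINT x:K|lebesgue. ?n x) \<le> 0" using le by simp
  then have z: "(LINT x:K|lebesgue. ?n x) = 0" using n0 c(1) by (simp add: mult_le_0_iff)
  have "G x = 0" if "x \<in> K" for x
    using faithful_zero[OF faithful_cell[OF K] contn' nn z that] e(2)[OF that] by simp
  then have "(\<lambda>x. G x $ i) = (\<lambda>x. 0)" for i
    using poly_on_const[of K 0 k] by (intro poly_on_eqI[OF Gi, of _ k]) auto
  then show "G = (\<lambda>x. 0)" by (auto simp: fun_eq_iff vec_eq_iff)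
qed

lemma surface_term:
  assumes \<sigma>: "\<sigma> \<in> faces D" and e: "continuous_on (closure \<sigma>) e" "\<And>x. x \<in> \<sigma> \<Longrightarrow> 0 < e x"
    and J: "J \<in> poly_on k \<sigma>"
  shows "0 \<le> (LINT x:\<sigma>|surface_measure \<sigma>. e x * (J x * J x))"
    and "(LINT x:\<sigma>|surface_measure \<sigma>. e x * (J x * J x)) = 0 \<Longrightarrow> J = (\<lambda>x. 0)"
proof -
  have nn: "0 \<le> e x * (J x * J x)" if "x \<in> \<sigma>" for x using e(2)[OF that] by simp
  then show "0 \<le> (LINT x:\<sigma>|surface_measure \<sigma>. e x * (J x * J x))"
    unfolding set_lebesgue_integral_def by (intro integral_nonneg_AE AE_I2) (auto simp: indicator_def)
  assume z: "(LINT x:\<sigma>|surface_measure \<sigma>. e x * (J x * J x)) = 0"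
  have cont: "continuous_on (closure \<sigma>) (\<lambda>x. e x * (J x * J x))"
    by (intro continuous_on_mult e poly_on_continuous[OF J])
  have "J x = 0" if "x \<in> \<sigma>" for x
    using faithful_zero[OF faithful_face[OF \<sigma>] cont nn z that] e(2)[OF that] by simp
  then show "J = (\<lambda>x. 0)" using poly_on_const[of \<sigma> 0 k] by (intro poly_on_eqI[OF J, of _ k]) auto
qed

end

context diffusion_mesh
begin

section \<open>States of zero energy\<close>

lemma finite_cell_faces: "K \<in> cells D \<Longrightarrow> finite (cell_faces D K)"
  by (rule finite_subset[OF cell_props(6) finite_faces])

lemma cell_continuous: "v \<in> hybrid_space k D \<Longrightarrow> K \<in> cells D \<Longrightarrow> continuous_on (closure K) (cell v K)"
  by (rule poly_on_continuous[OF hybrid_space_cell])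

lemma face_proj_in_poly_on:
  assumes v: "v \<in> hybrid_space k D" and K: "K \<in> cells D" and \<sigma>: "\<sigma> \<in> cell_faces D K"
  shows "face_proj k \<sigma> (cell v K) \<in> poly_on k \<sigma>"
proof (rule L2_proj(1)[OF faithful_face[OF cell_face(1)[OF K \<sigma>]]])
  have "continuous_on (closure \<sigma>) (cell v K)"
    by (rule continuous_on_subset[OF cell_continuous[OF v K] cell_face(3)[OF K \<sigma>]])
  then show "set_integrable (surface_measure \<sigma>) \<sigma> (\<lambda>x. cell v K x * r x)" if "r \<in> poly_on k \<sigma>" for r
    by (rule L2_proj_continuous_integrable[OF faithful_face[OF cell_face(1)[OF K \<sigma>]] _ that])
qed

lemma jump_in_poly_on:
  assumes v: "v \<in> hybrid_space k D" and K: "K \<in> cells D" and \<sigma>: "\<sigma> \<in> cell_faces D K"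
  shows "jump k K \<sigma> v \<in> poly_on k \<sigma>"
  using poly_on_add[OF face_proj_in_poly_on[OF v K \<sigma>]
      poly_on_cmult[OF hybrid_space_face[OF v cell_face(1)[OF K \<sigma>]], of "-1"]]
  by (simp add: jump_def[abs_def])

lemma discrete_grad_in_vec_poly_on:
  assumes v: "v \<in> hybrid_space k D" and K: "K \<in> cells D"
  shows "discrete_grad k D K v \<in> vec_poly_on k K"
  by (rule discrete_grad(1)[OF K cell_continuous[OF v K]
        poly_on_continuous[OF hybrid_space_face[OF v cell_face(1)[OF K]]]])

lemma const_hybrid_of_zero_energy:
  assumes w: "w \<in> hybrid_space k D"
    and grad: "\<And>K. K \<in> cells D \<Longrightarrow> discrete_grad k D K w = (\<lambda>x. 0)"
    and jump: "\<And>K \<sigma>. K \<in> cells D \<Longrightarrow> \<sigma> \<in> cell_faces D K \<Longrightarrow> jump k K \<sigma> w = (\<lambda>x. 0)"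
  obtains c where "w = const_hybrid D c"
proof -
  have ex: "\<exists>c. (\<forall>x\<in>closure K. cell w K x = c) \<and> (\<forall>\<sigma>\<in>cell_faces D K. \<forall>x\<in>closure \<sigma>. face w \<sigma> x = c)"
    if K: "K \<in> cells D" for K
  proof -
    show ?thesis
    proof (rule constant_of_discrete_grad_zero[OF K hybrid_space_cell[OF w K] _ grad[OF K]])
      show "face w \<sigma> \<in> poly_on k \<sigma>" if "\<sigma> \<in> cell_faces D K" for \<sigma>
        by (rule hybrid_space_face[OF w cell_face(1)[OF K that]])
      show "face_proj k \<sigma> (cell w K) = face w \<sigma>" if "\<sigma> \<in> cell_faces D K" for \<sigma>
        using fun_cong[OF jump[OF K that]] by (simp add: jump_def fun_eq_iff)
      fix c assume c: "\<And>x. x \<in> closure K \<Longrightarrow> cell w K x = c"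
        "\<And>\<sigma> x. \<sigma> \<in> cell_faces D K \<Longrightarrow> x \<in> closure \<sigma> \<Longrightarrow> face w \<sigma> x = c"
      show ?thesis by (intro exI[of _ c] conjI ballI c)
    qed
  qed
  have "\<exists>c. \<forall>K\<in>cells D. (\<forall>x\<in>closure K. cell w K x = c K) \<and>
      (\<forall>\<sigma>\<in>cell_faces D K. \<forall>x\<in>closure \<sigma>. face w \<sigma> x = c K)"
    by (intro bchoice ballI ex)
  then obtain c where c: "\<forall>K\<in>cells D. (\<forall>x\<in>closure K. cell w K x = c K) \<and>
      (\<forall>\<sigma>\<in>cell_faces D K. \<forall>x\<in>closure \<sigma>. face w \<sigma> x = c K)"
    by (rule exE) (rule that)
  have agree: "c K = c K'" if K: "K \<in> cells D" and K': "K' \<in> cells D" for K K'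
  proof (rule cell_constants_agree[OF domain(1,3) _ K K'])
    fix L \<sigma> assume L: "L \<in> cells D" and \<sigma>: "\<sigma> \<in> cell_faces D L"
    \<comment> \<open>The value of the face unknown at an arbitrary point of the face serves as the
      constant attached to that face.\<close>
    have "(SOME x. x \<in> \<sigma>) \<in> \<sigma>" using face_props(5)[OF cell_face(1)[OF L \<sigma>]] some_in_eq by blast
    then show "c L = face w \<sigma> (SOME x. x \<in> \<sigma>)" using c L \<sigma> closure_subset[of \<sigma>] by (metis subsetD)
  qed
  obtain a where a: "\<And>K. K \<in> cells D \<Longrightarrow> c K = a"
  proof (cases "cells D = {}")
    case True
    then show ?thesis by (intro that[of 0]) simp
  next
    case False
    then obtain L where L: "L \<in> cells D" by blast
    show ?thesis by (rule that[of "c L"]) (rule agree[OF _ L])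
  qed
  have "w = const_hybrid D a"
  proof (rule hybrid_space_eqI[OF w const_hybrid_in_hybrid_space])
    fix K x assume K: "K \<in> cells D"
    show "cell w K x = cell (const_hybrid D a) K x"
      using c K a[OF K] poly_on_outside[OF hybrid_space_cell[OF w K]] by (auto simp: const_hybrid_def)
  next
    fix \<sigma> x assume \<sigma>: "\<sigma> \<in> faces D"
    \<comment> \<open>Every face unknown is reached because each face belongs to some cell.\<close>
    obtain K where K: "K \<in> cells D" "\<sigma> \<in> cell_faces D K" using face_has_cell[OF \<sigma>] by blast
    show "face w \<sigma> x = face (const_hybrid D a) \<sigma> x"
      using c K a[OF K(1)] \<sigma> poly_on_outside[OF hybrid_space_face[OF w \<sigma>]] by (auto simp: const_hybrid_def)
  qed
  then show thesis by (rule that)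
qed

text \<open>Common core of both schemes. The weights are the exponentials and the face coefficients
  of either form; \<open>b\<close> stands for the stabilisation of the nonlinear scheme, of which
  only the sign is used.\<close>

lemma const_hybrid_of_weighted_energy:
  assumes w: "w \<in> hybrid_space k D"
    and e: "\<And>K. K \<in> cells D \<Longrightarrow> continuous_on (closure K) (e K)" "\<And>K x. 0 < e K x"
    and a: "\<And>K \<sigma>. K \<in> cells D \<Longrightarrow> \<sigma> \<in> cell_faces D K \<Longrightarrow> 0 < a K \<sigma>"
    and g: "\<And>K \<sigma>. K \<in> cells D \<Longrightarrow> \<sigma> \<in> cell_faces D K \<Longrightarrow> continuous_on (closure \<sigma>) (g K \<sigma>)" "\<And>K \<sigma> x. 0 < g K \<sigma> x"
    and b: "\<And>K. K \<in> cells D \<Longrightarrow> 0 \<le> b K"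
    and zero: "(\<Sum>K\<in>cells D.
        (LINT x:K|lebesgue. e K x * ((\<Lambda> x *v discrete_grad k D K w x) \<bullet> discrete_grad k D K w x)) +
        (\<Sum>\<sigma>\<in>cell_faces D K. a K \<sigma> *
          (LINT x:\<sigma>|surface_measure \<sigma>. g K \<sigma> x * (jump k K \<sigma> w x * jump k K \<sigma> w x))) + b K) = (0 :: real)"
  obtains c where "w = const_hybrid D c"
proof -
  define V where "V K = (LINT x:K|lebesgue. e K x * ((\<Lambda> x *v discrete_grad k D K w x) \<bullet> discrete_grad k D K w x))" for K
  define S where "S K \<sigma> = (LINT x:\<sigma>|surface_measure \<sigma>. g K \<sigma> x * (jump k K \<sigma> w x * jump k K \<sigma> w x))" for K \<sigma>
  have V: "0 \<le> V K" "V K = 0 \<Longrightarrow> discrete_grad k D K w = (\<lambda>x. 0)" if K: "K \<in> cells D" for K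
    unfolding V_def by (rule volume_term[OF K e(1)[OF K] e(2) discrete_grad_in_vec_poly_on[OF w K]], assumption?)+
  have S: "0 \<le> S K \<sigma>" "S K \<sigma> = 0 \<Longrightarrow> jump k K \<sigma> w = (\<lambda>x. 0)" if K: "K \<in> cells D" and \<sigma>: "\<sigma> \<in> cell_faces D K" for K \<sigma>
    unfolding S_def
    by (rule surface_term[OF cell_face(1)[OF K \<sigma>] g(1)[OF K \<sigma>] g(2) jump_in_poly_on[OF w K \<sigma>]], assumption?)+
  have aS: "0 \<le> a K \<sigma> * S K \<sigma>" if "K \<in> cells D" "\<sigma> \<in> cell_faces D K" for K \<sigma>
    using a[OF that] S(1)[OF that] by simp
  have sS: "0 \<le> (\<Sum>\<sigma>\<in>cell_faces D K. a K \<sigma> * S K \<sigma>)" if "K \<in> cells D" for K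
    by (rule sum_nonneg) (rule aS[OF that])
  have tot: "(\<Sum>K\<in>cells D. V K + (\<Sum>\<sigma>\<in>cell_faces D K. a K \<sigma> * S K \<sigma>) + b K) = 0"
    using zero by (simp only: V_def S_def)
  have cellzero: "V K + (\<Sum>\<sigma>\<in>cell_faces D K. a K \<sigma> * S K \<sigma>) + b K = 0" if K: "K \<in> cells D" for K
  proof -
    have "0 \<le> V L + (\<Sum>\<sigma>\<in>cell_faces D L. a L \<sigma> * S L \<sigma>) + b L" if "L \<in> cells D" for L
      using V(1)[OF that] sS[OF that] b[OF that] by linarith
    then show ?thesis using tot sum_nonneg_eq_0_iff[OF finite_cells, of "\<lambda>K. V K + (\<Sum>\<sigma>\<in>cell_faces D K. a K \<sigma> * S K \<sigma>) + b K"] K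
      by blast
  qed
  show thesis
  proof (rule const_hybrid_of_zero_energy[OF w])
    fix K assume K: "K \<in> cells D"
    have "V K = 0" using cellzero[OF K] V(1)[OF K] sS[OF K] b[OF K] by linarith
    then show "discrete_grad k D K w = (\<lambda>x. 0)" by (rule V(2)[OF K])
  next
    fix K \<sigma> assume K: "K \<in> cells D" and \<sigma>: "\<sigma> \<in> cell_faces D K"
    have "(\<Sum>\<sigma>\<in>cell_faces D K. a K \<sigma> * S K \<sigma>) = 0"
      using cellzero[OF K] V(1)[OF K] sS[OF K] b[OF K] by linarith
    then have "a K \<sigma> * S K \<sigma> = 0"
      using sum_nonneg_eq_0_iff[OF finite_cell_faces[OF K], of "\<lambda>\<sigma>. a K \<sigma> * S K \<sigma>"] aS[OF K] \<sigma> by blast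
    then have "S K \<sigma> = 0" using a[OF K \<sigma>] by simp
    then show "jump k K \<sigma> w = (\<lambda>x. 0)" by (rule S(2)[OF K \<sigma>])
  qed (rule that)
qed

text \<open>A continuous positive weight has a positive minimum on the compact closed face. The
  weight one gives the coefficient of the nonlinear scheme.\<close>

lemma face_coefficient_pos:
  assumes K: "K \<in> cells D" and \<sigma>: "\<sigma> \<in> cell_faces D K" and e: "continuous_on (closure K) e" "\<And>x. 0 < e x"
  shows "0 < face_linf_norm \<sigma> (\<lambda>x. e x * normal_diffusion \<Lambda> K \<sigma> x) / diameter \<sigma>"
proof -
  obtain c where c: "c > 0"
    "\<And>K \<sigma>. K \<in> cells D \<Longrightarrow> \<sigma> \<in> cell_faces D K \<Longrightarrow> continuous_on (closure \<sigma>) (normal_diffusion \<Lambda> K \<sigma>)"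
    "\<And>K \<sigma> x. K \<in> cells D \<Longrightarrow> \<sigma> \<in> cell_faces D K \<Longrightarrow> x \<in> closure \<sigma> \<Longrightarrow> c \<le> normal_diffusion \<Lambda> K \<sigma> x"
    by (rule normal_diffusion_lower_bound) (rule that)
  note \<sigma>f = cell_face(1)[OF K \<sigma>]
  have ce: "continuous_on (closure \<sigma>) e" by (rule continuous_on_subset[OF e(1) cell_face(3)[OF K \<sigma>]])
  have "compact (closure \<sigma>)" "closure \<sigma> \<noteq> {}" using face_props(4,5)[OF \<sigma>f] by simp_all
  then obtain x0 where x0: "\<forall>x\<in>closure \<sigma>. e x0 \<le> e x" using continuous_attains_inf[OF _ _ ce] by blast
  have "0 < face_linf_norm \<sigma> (\<lambda>x. e x * normal_diffusion \<Lambda> K \<sigma> x)"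
  proof (rule face_linf_norm_pos[OF \<sigma>f])
    show "continuous_on (closure \<sigma>) (\<lambda>x. e x * normal_diffusion \<Lambda> K \<sigma> x)"
      by (intro continuous_on_mult ce c(2)[OF K \<sigma>])
    show "0 < e x0 * c" using e(2)[of x0] c(1) by simp
    show "e x0 * c \<le> e x * normal_diffusion \<Lambda> K \<sigma> x" if "x \<in> \<sigma>" for x
    proof -
      have x: "x \<in> closure \<sigma>" using that closure_subset by blast
      show ?thesis
        by (intro mult_mono bspec[OF x0 x] c(3)[OF K \<sigma> x] less_imp_le[OF e(2)] less_imp_le[OF c(1)])
    qed
  qed
  then show ?thesis using face_diameter_pos[OF \<sigma>f] by simp
qed

lemma local_form_nonneg:
  assumes w: "w \<in> hybrid_space k D" and K: "K \<in> cells D"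
  shows "0 \<le> local_form k D \<Lambda> K w w"
proof -
  have "0 \<le> (LINT x:K|lebesgue. 1 * ((\<Lambda> x *v discrete_grad k D K w x) \<bullet> discrete_grad k D K w x))"
    by (rule volume_term(1)[OF K _ _ discrete_grad_in_vec_poly_on[OF w K]]) simp_all
  moreover have "0 \<le> face_linf_norm \<sigma> (normal_diffusion \<Lambda> K \<sigma>) / diameter \<sigma> *
      (LINT x:\<sigma>|surface_measure \<sigma>. 1 * (jump k K \<sigma> w x * jump k K \<sigma> w x))" if \<sigma>: "\<sigma> \<in> cell_faces D K" for \<sigma>
  proof (rule mult_nonneg_nonneg)
    show "0 \<le> face_linf_norm \<sigma> (normal_diffusion \<Lambda> K \<sigma>) / diameter \<sigma>"
      using face_coefficient_pos[OF K \<sigma>, of "\<lambda>_. 1"] by simp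
    show "0 \<le> (LINT x:\<sigma>|surface_measure \<sigma>. 1 * (jump k K \<sigma> w x * jump k K \<sigma> w x))"
      by (rule surface_term(1)[OF cell_face(1)[OF K \<sigma>] _ _ jump_in_poly_on[OF w K \<sigma>]]) simp_all
  qed
  ultimately show ?thesis unfolding local_form_def by (simp add: sum_nonneg)
qed

lemma ef_form_zero:
  assumes \<rho>: "\<rho> \<in> hybrid_space k D" and \<Phi>: "\<Phi> \<in> hybrid_space k D" and z: "ef_form k D \<Lambda> \<Phi> \<rho> \<rho> = 0"
  obtains c where "\<rho> = const_hybrid D c"
proof (rule const_hybrid_of_weighted_energy[OF \<rho>, where e = "\<lambda>K x. exp (- cell \<Phi> K x)"
      and a = "\<lambda>K \<sigma>. face_linf_norm \<sigma> (\<lambda>x. exp (- cell \<Phi> K x) * normal_diffusion \<Lambda> K \<sigma> x) / diameter \<sigma>"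
      and g = "\<lambda>_ _ _. 1" and b = "\<lambda>_. 0"])
  show c: "continuous_on (closure K) (\<lambda>x. exp (- cell \<Phi> K x))" if "K \<in> cells D" for K
    by (intro continuous_on_exp continuous_on_minus cell_continuous[OF \<Phi> that])
  show "0 < face_linf_norm \<sigma> (\<lambda>x. exp (- cell \<Phi> K x) * normal_diffusion \<Lambda> K \<sigma> x) / diameter \<sigma>"
    if "K \<in> cells D" "\<sigma> \<in> cell_faces D K" for K \<sigma>
    by (rule face_coefficient_pos[OF that c[OF that(1)]]) simp
  show "(\<Sum>K\<in>cells D.
        (LINT x:K|lebesgue. exp (- cell \<Phi> K x) * ((\<Lambda> x *v discrete_grad k D K \<rho> x) \<bullet> discrete_grad k D K \<rho> x)) +
        (\<Sum>\<sigma>\<in>cell_faces D K.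
          face_linf_norm \<sigma> (\<lambda>x. exp (- cell \<Phi> K x) * normal_diffusion \<Lambda> K \<sigma> x) / diameter \<sigma> *
          (LINT x:\<sigma>|surface_measure \<sigma>. 1 * (jump k K \<sigma> \<rho> x * jump k K \<sigma> \<rho> x))) + 0) = 0"
    using z by (simp only: ef_form_def mult_1 add_0_right)
  show "continuous_on (closure \<sigma>) (\<lambda>_. 1 :: real)" for \<sigma> :: "(real^'n) set" by (rule continuous_on_const)
qed (rule exp_gt_zero zero_less_one order_refl that, assumption?)+

lemma nl_form_zero:
  assumes l: "l \<in> hybrid_space k D" and w: "w \<in> hybrid_space k D" and \<epsilon>: "\<epsilon> \<ge> 0"
    and z: "nl_form k D \<Lambda> \<epsilon> l w w = 0"
  obtains c where "w = const_hybrid D c"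
proof (rule const_hybrid_of_weighted_energy[OF w, where e = "\<lambda>K x. exp (cell l K x)"
      and a = "\<lambda>K \<sigma>. face_linf_norm \<sigma> (normal_diffusion \<Lambda> K \<sigma>) / diameter \<sigma>"
      and g = "\<lambda>K \<sigma> x. (exp (face_proj k \<sigma> (cell l K) x) + exp (face l \<sigma> x)) / 2"
      and b = "\<lambda>K. \<epsilon> * diameter K ^ (k + 2) * local_form k D \<Lambda> K w w"])
  show "continuous_on (closure K) (\<lambda>x. exp (cell l K x))" if "K \<in> cells D" for K
    by (intro continuous_on_exp cell_continuous[OF l that])
  show "0 < face_linf_norm \<sigma> (normal_diffusion \<Lambda> K \<sigma>) / diameter \<sigma>"
    if "K \<in> cells D" "\<sigma> \<in> cell_faces D K" for K \<sigma>
    using face_coefficient_pos[OF that, of "\<lambda>_. 1"] by simp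
  show "continuous_on (closure \<sigma>) (\<lambda>x. (exp (face_proj k \<sigma> (cell l K) x) + exp (face l \<sigma> x)) / 2)"
    if "K \<in> cells D" "\<sigma> \<in> cell_faces D K" for K \<sigma>
    using poly_on_continuous[OF face_proj_in_poly_on[OF l that]]
      poly_on_continuous[OF hybrid_space_face[OF l cell_face(1)[OF that]]]
    by (intro continuous_intros) auto
  show "0 \<le> \<epsilon> * diameter K ^ (k + 2) * local_form k D \<Lambda> K w w" if "K \<in> cells D" for K
    using \<epsilon> local_form_nonneg[OF w that] diameter_ge_0[OF cell_props(3)[OF that]] by simp
  show "(\<Sum>K\<in>cells D.
        (LINT x:K|lebesgue. exp (cell l K x) * ((\<Lambda> x *v discrete_grad k D K w x) \<bullet> discrete_grad k D K w x)) +
        (\<Sum>\<sigma>\<in>cell_faces D K. face_linf_norm \<sigma> (normal_diffusion \<Lambda> K \<sigma>) / diameter \<sigma> *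
          (LINT x:\<sigma>|surface_measure \<sigma>. (exp (face_proj k \<sigma> (cell l K) x) + exp (face l \<sigma> x)) / 2 *
            (jump k K \<sigma> w x * jump k K \<sigma> w x))) +
        \<epsilon> * diameter K ^ (k + 2) * local_form k D \<Lambda> K w w) = 0"
    using z unfolding nl_form_def .
  show "0 < (exp (face_proj k \<sigma> (cell l K) x) + exp (face l \<sigma> x)) / 2" for K \<sigma> x
    by (intro divide_pos_pos add_pos_pos exp_gt_zero) simp
qed (rule exp_gt_zero that, assumption?)+

lemma discrete_grad_const_hybrid: "K \<in> cells D \<Longrightarrow> discrete_grad k D K (const_hybrid D c) = (\<lambda>x. 0)"
  by (rule discrete_grad_constant[where c = c]) (simp_all add: const_hybrid_def cell_face(1))

lemma jump_const_hybrid: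
  assumes K: "K \<in> cells D" and \<sigma>: "\<sigma> \<in> cell_faces D K"
  shows "jump k K \<sigma> (const_hybrid D c) = (\<lambda>x. 0)"
proof -
  have "face_proj k \<sigma> (cell (const_hybrid D c) K) = (\<lambda>x. if x \<in> closure \<sigma> then c else 0)"
  proof (rule L2_proj_constant[OF faithful_face[OF cell_face(1)[OF K \<sigma>]]])
    fix x assume "x \<in> \<sigma>"
    then have "x \<in> closure K" using cell_face(3)[OF K \<sigma>] closure_subset[of \<sigma>] by blast
    then show "cell (const_hybrid D c) K x = c" using K by (simp add: const_hybrid_def)
  qed
  then show ?thesis using cell_face(1)[OF K \<sigma>] by (simp add: jump_def fun_eq_iff const_hybrid_def)
qed

lemma ef_form_const_hybrid: "ef_form k D \<Lambda> \<Phi> (const_hybrid D c) v = 0"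
  unfolding ef_form_def by (simp add: discrete_grad_const_hybrid jump_const_hybrid)

lemma nl_form_const_hybrid: "nl_form k D \<Lambda> \<epsilon> l (const_hybrid D c) v = 0"
  unfolding nl_form_def local_form_def by (simp add: discrete_grad_const_hybrid jump_const_hybrid)

section \<open>Total masses and equilibria\<close>

lemma cell_function_eq:
  assumes K: "K \<in> cells D" and x: "x \<in> K"
  shows "cell_function D v x = cell v K x"
proof -
  have "indicator L x * cell v L x = (if L = K then cell v K x else 0)" if "L \<in> cells D" for L
    using that K x cells_disjoint by (auto simp: indicator_def pairwise_def disjnt_def)
  then have "cell_function D v x = (\<Sum>L\<in>cells D. if L = K then cell v K x else 0)"
    unfolding cell_function_def by (rule sum.cong[OF refl])
  then show ?thesis using K finite_cells by simp
qed

lemma cell_function_measurable: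
  assumes v: "v \<in> hybrid_space k D"
  shows "cell_function D v \<in> borel_measurable lebesgue"
proof -
  have "(\<lambda>x. indicator K x * cell v K x) \<in> borel_measurable lebesgue" if K: "K \<in> cells D" for K
    using faithful_integrable[OF faithful_cell[OF K] cell_continuous[OF v K]] by (auto simp: set_integrable_def)
  then show ?thesis unfolding cell_function_def[abs_def] by (rule borel_measurable_sum)
qed

text \<open>Up to a null set the cells partition the domain, so only the description of
  \<open>f\<close> inside the cells matters.\<close>

lemma LINT_domain_cells:
  assumes f: "f \<in> borel_measurable lebesgue"
    and g: "\<And>K. K \<in> cells D \<Longrightarrow> continuous_on (closure K) (g K)" "\<And>K x. K \<in> cells D \<Longrightarrow> x \<in> K \<Longrightarrow> f x = (g K x :: real)"
  shows "(LINT x:\<Omega>|lebesgue. f x) = (\<Sum>K\<in>cells D. LINT x:K|lebesgue. g K x)"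
proof -
  have int: "integrable lebesgue (\<lambda>x. indicator K x *\<^sub>R g K x)" if K: "K \<in> cells D" for K
    using faithful_integrable[OF faithful_cell[OF K] g(1)[OF K]] by (simp add: set_integrable_def)
  have eq: "indicator \<Omega> x *\<^sub>R f x = (\<Sum>K\<in>cells D. indicator K x *\<^sub>R g K x)" if x: "x \<notin> \<Omega> - \<Union>(cells D)" for x
  proof (cases "x \<in> \<Omega>")
    case True
    then obtain K where K: "K \<in> cells D" "x \<in> K" using x by blast
    have "indicator L x *\<^sub>R g L x = (if L = K then g K x else 0)" if "L \<in> cells D" for L
      using that K cells_disjoint by (auto simp: indicator_def pairwise_def disjnt_def)
    then have "(\<Sum>L\<in>cells D. indicator L x *\<^sub>R g L x) = (\<Sum>L\<in>cells D. if L = K then g K x else 0)"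
      by (rule sum.cong[OF refl])
    then show ?thesis using K True finite_cells g(2)[OF K] by simp
  next
    case False
    then have "indicator K x *\<^sub>R g K x = 0" if "K \<in> cells D" for K
      using cell_props(5)[OF that] by (auto simp: indicator_def)
    then have "(\<Sum>K\<in>cells D. indicator K x *\<^sub>R g K x) = 0" by (intro sum.neutral ballI)
    then show ?thesis using False by simp
  qed
  have "(LINT x:\<Omega>|lebesgue. f x) = (LINT x|lebesgue. (\<Sum>K\<in>cells D. indicator K x *\<^sub>R g K x))"
    unfolding set_lebesgue_integral_def
  proof (rule integral_cong_AE)
    have "\<Omega> \<in> sets lebesgue" using domain(1) by simp
    then show "(\<lambda>x. indicator \<Omega> x *\<^sub>R f x) \<in> borel_measurable lebesgue" using f by measurable
    show "(\<lambda>x. \<Sum>K\<in>cells D. indicator K x *\<^sub>R g K x) \<in> borel_measurable lebesgue"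
      by (intro borel_measurable_sum borel_measurable_integrable int)
    have "AE x in lebesgue. x \<notin> \<Omega> - \<Union>(cells D)"
      using negligible_outside_cells by (intro AE_not_in) (simp add: negligible_iff_null_sets)
    then show "AE x in lebesgue. indicator \<Omega> x *\<^sub>R f x = (\<Sum>K\<in>cells D. indicator K x *\<^sub>R g K x)"
      by eventually_elim (rule eq)
  qed
  also have "\<dots> = (\<Sum>K\<in>cells D. LINT x:K|lebesgue. g K x)"
    unfolding set_lebesgue_integral_def by (intro Bochner_Integration.integral_sum int)
  finally show ?thesis .
qed

text \<open>Total mass of the discrete Gibbs density built from the projected potential; it is the
  normalisation constant of both equilibria.\<close>

definition partition_function :: real where
  "partition_function = (\<Sum>K\<in>cells D. LINT x:K|lebesgue. exp (- cell potential K x))"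

lemma weight_continuous: "K \<in> cells D \<Longrightarrow> continuous_on (closure K) (\<lambda>x. exp (- cell potential K x))"
  by (intro continuous_on_exp continuous_on_minus cell_continuous[OF potential_in_hybrid_space])

lemma partition_function_pos:
  assumes "\<Omega> \<noteq> {}"
  shows "partition_function > 0"
proof -
  have "cells D \<noteq> {}" using assms closure_domain by auto
  moreover have "0 < (LINT x:K|lebesgue. exp (- cell potential K x))" if K: "K \<in> cells D" for K
  proof -
    have "0 \<le> (LINT x:K|lebesgue. exp (- cell potential K x))"
      unfolding set_lebesgue_integral_def by (intro integral_nonneg_AE AE_I2) simp
    moreover have "(LINT x:K|lebesgue. exp (- cell potential K x)) \<noteq> 0"
    proof
      assume z: "(LINT x:K|lebesgue. exp (- cell potential K x)) = 0"
      obtain x where x: "x \<in> K" using cell_props(4)[OF K] by blast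
      have "exp (- cell potential K x) = 0"
        by (rule faithful_zero[OF faithful_cell[OF K] weight_continuous[OF K] _ z x]) simp
      then show False by simp
    qed
    ultimately show ?thesis by linarith
  qed
  ultimately show ?thesis unfolding partition_function_def by (intro sum_pos finite_cells)
qed

lemma ef_mass_const_hybrid:
  "(LINT x:\<Omega>|lebesgue. exp (- cell_function D potential x) * cell_function D (const_hybrid D c) x) = c * partition_function"
proof -
  have [measurable]: "cell_function D potential \<in> borel_measurable lebesgue" "cell_function D (const_hybrid D c) \<in> borel_measurable lebesgue"
    by (rule cell_function_measurable potential_in_hybrid_space const_hybrid_in_hybrid_space)+
  have "(LINT x:\<Omega>|lebesgue. exp (- cell_function D potential x) * cell_function D (const_hybrid D c) x)
      = (\<Sum>K\<in>cells D. LINT x:K|lebesgue. c * exp (- cell potential K x))"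
  proof (rule LINT_domain_cells)
    show "(\<lambda>x. exp (- cell_function D potential x) * cell_function D (const_hybrid D c) x) \<in> borel_measurable lebesgue"
      by measurable
    show "continuous_on (closure K) (\<lambda>x. c * exp (- cell potential K x))" if "K \<in> cells D" for K
      by (intro continuous_on_mult continuous_on_const weight_continuous that)
    show "exp (- cell_function D potential x) * cell_function D (const_hybrid D c) x = c * exp (- cell potential K x)"
      if "K \<in> cells D" "x \<in> K" for K x
    proof -
      have "x \<in> closure K" using that(2) closure_subset by blast
      then show ?thesis using cell_function_eq[OF that] that(1) by (simp add: const_hybrid_def)
    qed
  qed
  then show ?thesis by (simp add: partition_function_def sum_distrib_left)
qed

lemma nl_mass_const_hybrid:
  assumes l: "l \<in> hybrid_space k D" and c: "hybrid_add l potential = const_hybrid D c"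
  shows "(LINT x:\<Omega>|lebesgue. exp (cell_function D l x)) = exp c * partition_function"
proof -
  have [measurable]: "cell_function D l \<in> borel_measurable lebesgue" by (rule cell_function_measurable[OF l])
  have "(LINT x:\<Omega>|lebesgue. exp (cell_function D l x)) = (\<Sum>K\<in>cells D. LINT x:K|lebesgue. exp c * exp (- cell potential K x))"
  proof (rule LINT_domain_cells)
    show "(\<lambda>x. exp (cell_function D l x)) \<in> borel_measurable lebesgue" by measurable
    show "continuous_on (closure K) (\<lambda>x. exp c * exp (- cell potential K x))" if "K \<in> cells D" for K
      by (intro continuous_on_mult continuous_on_const weight_continuous that)
    show "exp (cell_function D l x) = exp c * exp (- cell potential K x)" if "K \<in> cells D" "x \<in> K" for K x
    proof -
      have "x \<in> closure K" using that(2) closure_subset by blast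
      moreover have "cell (hybrid_add l potential) K x = cell (const_hybrid D c) K x" using c by simp
      ultimately have "cell l K x = c - cell potential K x"
        using that(1) unfolding hybrid_add_def const_hybrid_def by simp
      then show ?thesis using cell_function_eq[OF that, of l] by (simp add: exp_diff exp_minus divide_inverse)
    qed
  qed
  then show ?thesis by (simp add: partition_function_def sum_distrib_left)
qed

text \<open>Testing a steady state with itself leaves only constants, and the mass
  \<open>c * partition_function\<close> fixes \<open>c\<close>. As an equivalence this yields
  existence and uniqueness at once.\<close>

lemma ef_equilibrium_iff:
  assumes m: "\<Omega> \<noteq> {}"
  shows "ef_equilibrium k \<Omega> D \<Lambda> potential m \<rho> \<longleftrightarrow> \<rho> = const_hybrid D (m / partition_function)"
proof
  assume *: "ef_equilibrium k \<Omega> D \<Lambda> potential m \<rho>"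
  then have \<rho>: "\<rho> \<in> hybrid_space k D" and z: "ef_form k D \<Lambda> potential \<rho> \<rho> = 0"
    and mass: "(LINT x:\<Omega>|lebesgue. exp (- cell_function D potential x) * cell_function D \<rho> x) = m"
    unfolding ef_equilibrium_def by blast+
  obtain c where c: "\<rho> = const_hybrid D c" by (rule ef_form_zero[OF \<rho> potential_in_hybrid_space z])
  then have "c * partition_function = m" using mass ef_mass_const_hybrid by simp
  then show "\<rho> = const_hybrid D (m / partition_function)" using c partition_function_pos[OF m] by auto
next
  assume "\<rho> = const_hybrid D (m / partition_function)"
  then show "ef_equilibrium k \<Omega> D \<Lambda> potential m \<rho>"
    unfolding ef_equilibrium_def using partition_function_pos[OF m]
    by (simp add: const_hybrid_in_hybrid_space ef_form_const_hybrid ef_mass_const_hybrid)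
qed

text \<open>Turns constancy of the sum into an explicit formula for \<open>l\<close>, from which
  both existence and uniqueness of the nonlinear equilibrium can be read off.\<close>

lemma hybrid_add_eq_iff: "hybrid_add l v = w \<longleftrightarrow> l = hybrid_add w (hybrid_neg v)"
  by (cases l; cases w) (auto simp: hybrid_add_def hybrid_neg_def)

text \<open>The test function is the quasi-Fermi potential itself; the dependence of the weights on
  \<open>l\<close> does no harm, because they are positive. A constant value \<open>c\<close> has
  mass \<open>exp c * partition_function\<close>, and positivity of \<open>m\<close> lets the
  logarithm solve for \<open>c\<close>.\<close>

lemma nl_equilibrium_iff:
  assumes \<epsilon>: "\<epsilon> \<ge> 0" and \<Omega>: "\<Omega> \<noteq> {}" and m: "m > 0"
  shows "nl_equilibrium k \<Omega> D \<Lambda> potential \<epsilon> m l \<longleftrightarrow> hybrid_add l potential = const_hybrid D (ln (m / partition_function))"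
proof
  assume *: "nl_equilibrium k \<Omega> D \<Lambda> potential \<epsilon> m l"
  then have l: "l \<in> hybrid_space k D" and mass: "(LINT x:\<Omega>|lebesgue. exp (cell_function D l x)) = m"
    unfolding nl_equilibrium_def by blast+
  have w: "hybrid_add l potential \<in> hybrid_space k D" by (rule hybrid_space_add[OF l potential_in_hybrid_space])
  then have z: "nl_form k D \<Lambda> \<epsilon> l (hybrid_add l potential) (hybrid_add l potential) = 0"
    using * unfolding nl_equilibrium_def by blast
  obtain c where c: "hybrid_add l potential = const_hybrid D c" by (rule nl_form_zero[OF l w \<epsilon> z])
  then have "exp c * partition_function = m" using nl_mass_const_hybrid[OF l c] mass by simp
  then have "exp c = m / partition_function" using partition_function_pos[OF \<Omega>] by (auto simp: field_simps)
  then have "c = ln (m / partition_function)" by (metis ln_exp)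
  then show "hybrid_add l potential = const_hybrid D (ln (m / partition_function))" using c by simp
next
  assume c: "hybrid_add l potential = const_hybrid D (ln (m / partition_function))"
  then have "l = hybrid_add (const_hybrid D (ln (m / partition_function))) (hybrid_neg potential)"
    by (rule iffD1[OF hybrid_add_eq_iff])
  then have l: "l \<in> hybrid_space k D"
    by (simp add: hybrid_space_add hybrid_space_neg const_hybrid_in_hybrid_space potential_in_hybrid_space)
  then show "nl_equilibrium k \<Omega> D \<Lambda> potential \<epsilon> m l"
    unfolding nl_equilibrium_def c using nl_mass_const_hybrid[OF l c] m partition_function_pos[OF \<Omega>]
    by (simp add: nl_form_const_hybrid)
qed

lemma proportional_to_one_const_hybrid: "proportional_to_one D (const_hybrid D c)"
  unfolding proportional_to_one_def const_hybrid_def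
  by (intro exI[of _ c]) (auto dest: subsetD[OF closure_subset])

text \<open>The logarithm turns the product of \<open>c\<close> and the exponential weight into
  \<open>ln c\<close> minus the potential, component by component; positivity of \<open>c\<close>
  makes this legitimate.\<close>

lemma ef_density_const_hybrid:
  assumes c: "c > 0"
  shows "hybrid_positive D (ef_density \<Phi> (const_hybrid D c))"
    and "proportional_to_one D (hybrid_add (hybrid_ln (ef_density \<Phi> (const_hybrid D c))) \<Phi>)"
proof -
  have cell: "cell (const_hybrid D c) K x = c" if "K \<in> cells D" "x \<in> K" for K x
    using that closure_subset[of K] by (auto simp: const_hybrid_def)
  have face: "face (const_hybrid D c) \<sigma> x = c" if "\<sigma> \<in> faces D" "x \<in> \<sigma>" for \<sigma> x
    using that closure_subset[of \<sigma>] by (auto simp: const_hybrid_def)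
  show "hybrid_positive D (ef_density \<Phi> (const_hybrid D c))"
    using c by (simp add: hybrid_positive_def ef_density_def cell face)
  show "proportional_to_one D (hybrid_add (hybrid_ln (ef_density \<Phi> (const_hybrid D c))) \<Phi>)"
    unfolding proportional_to_one_def using c
    by (intro exI[of _ "ln c"]) (simp add: hybrid_add_def hybrid_ln_def ef_density_def cell face ln_mult)
qed

end

theorem proposition1:
  fixes \<Omega> :: "(real^'n) set" and \<Lambda> :: "real^'n \<Rightarrow> real^'n^'n"
    and \<phi> u0 :: "real^'n \<Rightarrow> real" and D :: "'n mesh" and k :: nat and m \<epsilon> :: real
  defines "\<Phi> \<equiv> discrete_potential k \<Omega> D \<phi>"
  assumes dim: "CARD('n) \<in> {2, 3}"
    and domain: "open \<Omega>" "bounded \<Omega>" "connected \<Omega>" "polytopal (int CARD('n)) \<Omega>"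
      "lipschitz_boundary \<Omega>"
    and Lambda_bounded: "\<And>i j. L_infty \<Omega> (\<lambda>x. \<Lambda> x $ i $ j)"
    and Lambda_elliptic:
      "\<exists>c>0. AE x in lebesgue_on \<Omega>. \<forall>\<xi>. (\<Lambda> x *v \<xi>) \<bullet> \<xi> \<ge> c * (norm \<xi>)\<^sup>2"
    and phi: "W1_infty \<Omega> \<phi>"
    and u0_integrable: "set_integrable lebesgue \<Omega> u0"
    and u0_nonneg: "AE x in lebesgue_on \<Omega>. 0 \<le> u0 x"
    and u0_entropy: "set_integrable lebesgue \<Omega> (\<lambda>x. u0 x * ln (u0 x))"
    and mass: "m = (LINT x:\<Omega>|lebesgue. u0 x)" "m > 0"
    and mesh: "polytopal_mesh \<Omega> D"
    and Lambda_cells: "\<And>K i j. K \<in> cells D \<Longrightarrow> W1_infty K (\<lambda>x. \<Lambda> x $ i $ j)"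
    and eps: "\<epsilon> \<ge> 0"
  shows "(\<exists>!\<rho>. ef_equilibrium k \<Omega> D \<Lambda> \<Phi> m \<rho>) \<and>
      (\<forall>\<rho>. ef_equilibrium k \<Omega> D \<Lambda> \<Phi> m \<rho> \<longrightarrow>
        hybrid_positive D (ef_density \<Phi> \<rho>) \<and>
        proportional_to_one D (hybrid_add (hybrid_ln (ef_density \<Phi> \<rho>)) \<Phi>)) \<and>
      (\<exists>!l. nl_equilibrium k \<Omega> D \<Lambda> \<Phi> \<epsilon> m l) \<and>
      (\<forall>l. nl_equilibrium k \<Omega> D \<Lambda> \<Phi> \<epsilon> m l \<longrightarrow>
        proportional_to_one D (hybrid_add l \<Phi>))"
proof -
  interpret diffusion_mesh \<Omega> D \<Lambda> \<phi> k
    using dim mesh domain Lambda_bounded Lambda_elliptic phi Lambda_cells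
    by unfold_locales auto
  \<comment> \<open>An empty domain would have mass zero.\<close>
  have \<Omega>: "\<Omega> \<noteq> {}" using mass by (auto simp: set_lebesgue_integral_def)
  note ef = ef_equilibrium_iff[OF \<Omega>, of m]
  note nl = nl_equilibrium_iff[OF eps \<Omega> mass(2)]
  have "m / partition_function > 0" using mass(2) partition_function_pos[OF \<Omega>] by simp
  then have "hybrid_positive D (ef_density potential \<rho>) \<and>
      proportional_to_one D (hybrid_add (hybrid_ln (ef_density potential \<rho>)) potential)"
    if "ef_equilibrium k \<Omega> D \<Lambda> potential m \<rho>" for \<rho>
    using that ef_density_const_hybrid by (simp add: ef)
  moreover have "\<exists>!\<rho>. ef_equilibrium k \<Omega> D \<Lambda> potential m \<rho>" by (simp add: ef)
  moreover have "\<exists>!l. nl_equilibrium k \<Omega> D \<Lambda> potential \<epsilon> m l" by (simp add: nl hybrid_add_eq_iff)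
  moreover have "proportional_to_one D (hybrid_add l potential)"
    if "nl_equilibrium k \<Omega> D \<Lambda> potential \<epsilon> m l" for l
    using that proportional_to_one_const_hybrid by (simp add: nl)
  ultimately show ?thesis unfolding \<Phi>_def by blast
qed

end
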